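(* Let $\pi_{\eta_1,V}:\eta_1\to V$ and $\pi_{\eta_2,W}:\eta_2\to W$ be $C^\infty$ real vector bundles of the same rank $r\in\mathbb{N}$, and let $f:\mathcal{F}_c(\pi_{\eta_1,V})\to\tilde{\mathcal{F}}(\pi_{\eta_2,W})$ be a linear map. Then the following statements (a) and (b) are equivalent. (a) For any $w\in W$, $\mathcal{S}_{E_w\circ f}$ is a nonempty and compact subset of $V$. Moreover, the bundle $\pi_{\eta_1,V}$ is trivial on an open neighborhood of $\mathcal{S}_{E_w\circ f}$. Additionally, for any $x\in\mathcal{F}_c(\pi_{\eta_1,V})$ which does not vanish (at any point) on $\mathcal{S}_{E_w\circ f}$, we have $f(x)(w)\ne\mathbf{0}$. If $r=1$, it is further required that $\mathcal{S}_{E_w\circ f}$ consists of a single point for every $w\in W$. (b) There exist an $\tilde{\mathcal{F}}$ map $\phi:W\to V$ and an $\tilde{\mathcal{F}}$ isomorphism of vector bundles $\gamma:\phi^*\eta_1\to\eta_2$ covering the identity map on $W$ such that $$f(x)=\gamma\circ(\phi^*x),\qquad x\in\mathcal{F}_c(\pi_{\eta_1,V}).$$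
   Context: All manifolds are Hausdorff. $V$ and $W$ are finite dimensional $C^\infty$ manifolds, possibly with boundary, not necessarily paracompact or connected. $\mathbb{N}=\{1,2,\dots\}$. Smoothness classes: $\mathcal{F}$ is a fixed class among $C^k$, $k=0,1,\dots,\infty$ (in the Michal–Bastiani or the Fréchet sense), locally Hölder $C^{k,\alpha}$, $k=0,1,\dots$, $0\le\alpha\le1$ ($C^{k,0}=C^k$), or locally Sobolev $W^{k,p}$, $k=1,2,\dots$, $1\le p<\infty$, with $kp>\dim_{\mathbb{R}}V$, or $k=\dim_{\mathbb{R}}V$ and $p=1$. $\tilde{\mathcal{F}}$ is another (possibly different) class from the same list, with $V$ replaced by $W$. $\mathcal{F}_c(\pi_{\eta_1,V})$ is the space of compactly supported $\mathcal{F}$ sections of $\pi_{\eta_1,V}$; $\tilde{\mathcal{F}}(\pi_{\eta_2,W})$ is the space of $\tilde{\mathcal{F}}$ sections of $\pi_{\eta_2,W}$; $E_w$ is evaluation of sections at $w$. A point $v_0\in V$ is a support point of $E_w\circ f$ if for every open neighborhood $O$ of $v_0$ there is $\hat x\in\mathcal{F}_c(\pi_{\eta_1,V})$ with $\operatorname{supp}\hat x\subset O$ and $f(\hat x)(w)\ne\mathbf{0}$; $\mathcal{S}_{E_w\circ f}$ is the set of support points. A real vector bundle over $W$ of rank $r$ is an $\tilde{\mathcal{F}}$ bundle if its transition functions are $\tilde{\mathcal{F}}$ maps from open subsets of $W$ to $GL(r,\mathbb{R})$; a vector bundle morphism between $\tilde{\mathcal{F}}$ bundles over $W$ covering the identity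 is an $\tilde{\mathcal{F}}$ morphism if in local trivializations it is represented by $\tilde{\mathcal{F}}$ maps into the space of real matrices; an $\tilde{\mathcal{F}}$ isomorphism is such a morphism that is an isomorphism on each fiber. If $\phi$ is an $\tilde{\mathcal{F}}$ map, $\phi^*\eta_1$ (the total space of the pullback of $\pi_{\eta_1,V}$) is an $\tilde{\mathcal{F}}$ vector bundle over $W$; $\phi^*x$ is the pullback of the section $x$. *)

theory Defs
  imports "HOL-Analysis.Analysis"
begin

section \<open>Smoothness classes on subsets of a Euclidean space\<close>

text \<open>All domains used below are relatively open subsets of a closed half-space (or of a point, in
dimension zero).  Derivatives are taken within the domain, so that at boundary points they are
one-sided, and continuity and local conditions are understood up to the boundary.\<close>

text \<open>\<open>deriv_on S P k f\<close>: \<open>f\<close> is \<open>k\<close> times differentiable on \<open>S\<close>, and all iterated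
directional derivatives of order \<open>k\<close> satisfy \<open>P\<close>.\<close>

primrec deriv_on ::
  "'a::euclidean_space set \<Rightarrow> (('a \<Rightarrow> 'b::euclidean_space) \<Rightarrow> bool) \<Rightarrow> nat \<Rightarrow> ('a \<Rightarrow> 'b) \<Rightarrow> bool"
where
  "deriv_on S P 0 f \<longleftrightarrow> P f"
| "deriv_on S P (Suc k) f \<longleftrightarrow>
     (\<exists>f'. (\<forall>x\<in>S. (f has_derivative f' x) (at x within S)) \<and>
           (\<forall>v. deriv_on S P k (\<lambda>x. f' x v)))"

definition C_on :: "enat \<Rightarrow> 'a::euclidean_space set \<Rightarrow> ('a \<Rightarrow> 'b::euclidean_space) \<Rightarrow> bool" where
  "C_on k S f \<longleftrightarrow> (\<forall>j. enat j \<le> k \<longrightarrow> deriv_on S (continuous_on S) j f)"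

definition locally_Holder_on ::
  "real \<Rightarrow> 'a::euclidean_space set \<Rightarrow> ('a \<Rightarrow> 'b::euclidean_space) \<Rightarrow> bool" where
  "locally_Holder_on \<alpha> S f \<longleftrightarrow>
     continuous_on S f \<and>
     (\<forall>x\<in>S. \<exists>d>0. \<exists>C. \<forall>y\<in>S \<inter> ball x d. \<forall>z\<in>S \<inter> ball x d.
        norm (f y - f z) \<le> C * dist y z powr \<alpha>)"

definition Holder_on ::
  "nat \<Rightarrow> real \<Rightarrow> 'a::euclidean_space set \<Rightarrow> ('a \<Rightarrow> 'b::euclidean_space) \<Rightarrow> bool" where
  "Holder_on k \<alpha> S f \<longleftrightarrow> deriv_on S (locally_Holder_on \<alpha> S) k f"

definition test_function :: "'a::euclidean_space set \<Rightarrow> ('a \<Rightarrow> real) \<Rightarrow> bool" where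
  "test_function U \<psi> \<longleftrightarrow>
     C_on \<infinity> UNIV \<psi> \<and> (\<exists>K. compact K \<and> K \<subseteq> U \<and> (\<forall>x. x \<notin> K \<longrightarrow> \<psi> x = 0))"

definition weak_deriv_on ::
  "'a::euclidean_space set \<Rightarrow> 'a \<Rightarrow> ('a \<Rightarrow> 'b::euclidean_space) \<Rightarrow> ('a \<Rightarrow> 'b) \<Rightarrow> bool" where
  "weak_deriv_on S b f g \<longleftrightarrow>
     (\<forall>\<psi>. test_function (interior S) \<psi> \<longrightarrow>
        (LINT x|lborel. frechet_derivative \<psi> (at x) b *\<^sub>R f x) = - (LINT x|lborel. \<psi> x *\<^sub>R g x))"

definition locally_Lp_on ::
  "real \<Rightarrow> 'a::euclidean_space set \<Rightarrow> ('a \<Rightarrow> 'b::euclidean_space) \<Rightarrow> bool" where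
  "locally_Lp_on p S f \<longleftrightarrow>
     (\<forall>K. compact K \<and> K \<subseteq> S \<longrightarrow>
        set_borel_measurable lborel K f \<and> set_integrable lborel K (\<lambda>x. norm (f x) powr p))"

primrec weakly_deriv_on ::
  "real \<Rightarrow> 'a::euclidean_space set \<Rightarrow> nat \<Rightarrow> ('a \<Rightarrow> 'b::euclidean_space) \<Rightarrow> bool"
where
  "weakly_deriv_on p S 0 f \<longleftrightarrow> locally_Lp_on p S f"
| "weakly_deriv_on p S (Suc k) f \<longleftrightarrow>
     locally_Lp_on p S f \<and>
     (\<forall>b\<in>Basis. \<exists>g. weak_deriv_on S b f g \<and> weakly_deriv_on p S k g)"

text \<open>In the admissible range of \<open>(k, p)\<close> every element of the local Sobolev space has a unique
continuous representative; this is the one meant, so that functions have values at points.\<close>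

definition Sobolev_on ::
  "nat \<Rightarrow> real \<Rightarrow> 'a::euclidean_space set \<Rightarrow> ('a \<Rightarrow> 'b::euclidean_space) \<Rightarrow> bool" where
  "Sobolev_on k p S f \<longleftrightarrow> continuous_on S f \<and> weakly_deriv_on p S k f"

datatype smoothness = C_class enat | Holder_class nat real | Sobolev_class nat real

fun admissible :: "nat \<Rightarrow> smoothness \<Rightarrow> bool" where
  "admissible n (C_class k) \<longleftrightarrow> True"
| "admissible n (Holder_class k \<alpha>) \<longleftrightarrow> 0 \<le> \<alpha> \<and> \<alpha> \<le> 1"
| "admissible n (Sobolev_class k p) \<longleftrightarrow>
     1 \<le> k \<and> 1 \<le> p \<and> (real k * p > real n \<or> k = n \<and> p = 1)"

fun class_on ::
  "smoothness \<Rightarrow> 'a::euclidean_space set \<Rightarrow> ('a \<Rightarrow> 'b::euclidean_space) \<Rightarrow> bool" where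
  "class_on (C_class k) = C_on k"
| "class_on (Holder_class k \<alpha>) = Holder_on k \<alpha>"
| "class_on (Sobolev_class k p) = Sobolev_on k p"


section \<open>Manifolds with boundary\<close>

record ('v, 'm) manifold =
  mtop :: "'v topology"
  charts :: "('v set \<times> ('v \<Rightarrow> 'm)) set"

text \<open>A Euclidean type has positive dimension; zero-dimensional manifolds are therefore modelled on
the subset \<open>{0}\<close> of an arbitrary Euclidean type.  The choice \<open>a = 0\<close> gives the whole space.\<close>

definition model_spaces :: "nat \<Rightarrow> 'm::euclidean_space set set" where
  "model_spaces n = (if n = 0 then {{0}} else {{x. 0 \<le> a \<bullet> x} | a. True})"

definition manifold_chart ::
  "nat \<Rightarrow> 'v topology \<Rightarrow> 'v set \<Rightarrow> ('v \<Rightarrow> 'm::euclidean_space) \<Rightarrow> bool" where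
  "manifold_chart n X U c \<longleftrightarrow>
     openin X U \<and> (\<exists>H\<in>model_spaces n. openin (top_of_set H) (c ` U)) \<and>
     homeomorphic_map (subtopology X U) (top_of_set (c ` U)) c"

definition smooth_manifold :: "nat \<Rightarrow> ('v, 'm::euclidean_space) manifold \<Rightarrow> bool" where
  "smooth_manifold n M \<longleftrightarrow>
     (n = DIM('m) \<or> n = 0) \<and>
     Hausdorff_space (mtop M) \<and>
     topspace (mtop M) = (\<Union>(U, c)\<in>charts M. U) \<and>
     (\<forall>(U, c)\<in>charts M. manifold_chart n (mtop M) U c) \<and>
     (\<forall>(U, c)\<in>charts M. \<forall>(U', c')\<in>charts M. C_on \<infinity> (c ` (U \<inter> U')) (c' \<circ> inv_into U c))"

definition class_fun ::
  "smoothness \<Rightarrow> ('v, 'm::euclidean_space) manifold \<Rightarrow> 'v set \<Rightarrow> ('v \<Rightarrow> 'b::euclidean_space) \<Rightarrow> bool"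
where
  "class_fun F M O' g \<longleftrightarrow>
     (\<forall>(U, c)\<in>charts M. class_on F (c ` (U \<inter> O')) (g \<circ> inv_into U c))"

definition class_map ::
  "smoothness \<Rightarrow> ('w, 'n::euclidean_space) manifold \<Rightarrow> ('v, 'm::euclidean_space) manifold \<Rightarrow>
   ('w \<Rightarrow> 'v) \<Rightarrow> bool"
where
  "class_map F M N \<phi> \<longleftrightarrow>
     continuous_map (mtop M) (mtop N) \<phi> \<and>
     (\<forall>(U, c)\<in>charts N. class_fun F M {w \<in> topspace (mtop M). \<phi> w \<in> U} (c \<circ> \<phi>))"


section \<open>Real vector bundles\<close>

text \<open>The manifold structure of the total space is the one induced by the local trivializations.  A
local trivialization over \<open>U\<close> is given by its second component \<open>\<psi>\<close>, so the actual
trivialization is \<open>e \<mapsto> (bproj E e, \<psi> e)\<close>.\<close>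

record ('v, 'e, 'r::finite) vbundle =
  btotal :: "'e set"
  bproj :: "'e \<Rightarrow> 'v"
  fadd :: "'e \<Rightarrow> 'e \<Rightarrow> 'e"
  fscale :: "real \<Rightarrow> 'e \<Rightarrow> 'e"
  fzero :: "'v \<Rightarrow> 'e"
  trivs :: "('v set \<times> ('e \<Rightarrow> real ^ 'r)) set"

definition fiber :: "('v, 'e, 'r::finite) vbundle \<Rightarrow> 'v \<Rightarrow> 'e set" where
  "fiber E v = {e \<in> btotal E. bproj E e = v}"

text \<open>The following also forces each fiber over \<open>U\<close> to be a vector space under the given
operations, since these are transported to those of the standard fiber by a bijection.\<close>

definition trivialization ::
  "'v topology \<Rightarrow> ('v, 'e, 'r::finite) vbundle \<Rightarrow> 'v set \<Rightarrow> ('e \<Rightarrow> real ^ 'r) \<Rightarrow> bool" where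
  "trivialization X E U \<psi> \<longleftrightarrow>
     openin X U \<and>
     (\<forall>v\<in>U. bij_betw \<psi> (fiber E v) UNIV \<and>
        fzero E v \<in> fiber E v \<and> \<psi> (fzero E v) = 0 \<and>
        (\<forall>e\<in>fiber E v. \<forall>e'\<in>fiber E v.
           fadd E e e' \<in> fiber E v \<and> \<psi> (fadd E e e') = \<psi> e + \<psi> e') \<and>
        (\<forall>a. \<forall>e\<in>fiber E v. fscale E a e \<in> fiber E v \<and> \<psi> (fscale E a e) = a *\<^sub>R \<psi> e))"

definition transition ::
  "('v, 'e, 'r::finite) vbundle \<Rightarrow> ('e \<Rightarrow> real ^ 'r) \<Rightarrow> ('e \<Rightarrow> real ^ 'r) \<Rightarrow> 'v \<Rightarrow> real ^ 'r ^ 'r" where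
  "transition E \<psi> \<psi>' v = matrix (\<psi>' \<circ> inv_into (fiber E v) \<psi>)"

definition vector_bundle ::
  "smoothness \<Rightarrow> ('v, 'm::euclidean_space) manifold \<Rightarrow> ('v, 'e, 'r::finite) vbundle \<Rightarrow> bool" where
  "vector_bundle F M E \<longleftrightarrow>
     bproj E ` btotal E \<subseteq> topspace (mtop M) \<and>
     topspace (mtop M) = (\<Union>(U, \<psi>)\<in>trivs E. U) \<and>
     (\<forall>(U, \<psi>)\<in>trivs E. trivialization (mtop M) E U \<psi>) \<and>
     (\<forall>(U, \<psi>)\<in>trivs E. \<forall>(U', \<psi>')\<in>trivs E. class_fun F M (U \<inter> U') (transition E \<psi> \<psi>'))"

abbreviation smooth_vector_bundle ::
  "('v, 'm::euclidean_space) manifold \<Rightarrow> ('v, 'e, 'r::finite) vbundle \<Rightarrow> bool" where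
  "smooth_vector_bundle \<equiv> vector_bundle (C_class \<infinity>)"

text \<open>Triviality over \<open>U\<close>: there is a trivialization over \<open>U\<close> that is smoothly compatible with
the given bundle atlas.\<close>

definition trivial_bundle_on ::
  "('v, 'm::euclidean_space) manifold \<Rightarrow> ('v, 'e, 'r::finite) vbundle \<Rightarrow> 'v set \<Rightarrow> bool" where
  "trivial_bundle_on M E U \<longleftrightarrow>
     (\<exists>\<psi>. smooth_vector_bundle M (E\<lparr>trivs := insert (U, \<psi>) (trivs E)\<rparr>))"

definition bundle_morphism ::
  "smoothness \<Rightarrow> ('w, 'n::euclidean_space) manifold \<Rightarrow> ('w, 'e, 'r::finite) vbundle \<Rightarrow>
   ('w, 'e', 's::finite) vbundle \<Rightarrow> ('e \<Rightarrow> 'e') \<Rightarrow> bool"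
where
  "bundle_morphism F M A B \<gamma> \<longleftrightarrow>
     (\<forall>w\<in>topspace (mtop M).
        \<gamma> ` fiber A w \<subseteq> fiber B w \<and>
        (\<forall>e\<in>fiber A w. \<forall>e'\<in>fiber A w. \<gamma> (fadd A e e') = fadd B (\<gamma> e) (\<gamma> e')) \<and>
        (\<forall>a. \<forall>e\<in>fiber A w. \<gamma> (fscale A a e) = fscale B a (\<gamma> e))) \<and>
     (\<forall>(U, \<psi>)\<in>trivs A. \<forall>(U', \<psi>')\<in>trivs B.
        class_fun F M (U \<inter> U') (\<lambda>w. matrix (\<psi>' \<circ> \<gamma> \<circ> inv_into (fiber A w) \<psi>)))"

definition bundle_isomorphism ::
  "smoothness \<Rightarrow> ('w, 'n::euclidean_space) manifold \<Rightarrow> ('w, 'e, 'r::finite) vbundle \<Rightarrow>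
   ('w, 'e', 's::finite) vbundle \<Rightarrow> ('e \<Rightarrow> 'e') \<Rightarrow> bool"
where
  "bundle_isomorphism F M A B \<gamma> \<longleftrightarrow>
     bundle_morphism F M A B \<gamma> \<and>
     (\<forall>w\<in>topspace (mtop M). bij_betw \<gamma> (fiber A w) (fiber B w))"

definition pullback_bundle ::
  "'w topology \<Rightarrow> ('w \<Rightarrow> 'v) \<Rightarrow> ('v, 'e, 'r::finite) vbundle \<Rightarrow> ('w, 'w \<times> 'e, 'r::finite) vbundle" where
  "pullback_bundle X \<phi> E =
     \<lparr>btotal = {(w, e). w \<in> topspace X \<and> e \<in> fiber E (\<phi> w)},
      bproj = fst,
      fadd = (\<lambda>(w, e) (w', e'). (w, fadd E e e')),
      fscale = (\<lambda>a (w, e). (w, fscale E a e)),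
      fzero = (\<lambda>w. (w, fzero E (\<phi> w))),
      trivs = {({w \<in> topspace X. \<phi> w \<in> U}, \<psi> \<circ> snd) | U \<psi>. (U, \<psi>) \<in> trivs E}\<rparr>"


section \<open>Sections\<close>

text \<open>Sections are extensional functions, so that they are determined by their values on the
underlying manifold.\<close>

definition sections ::
  "smoothness \<Rightarrow> ('v, 'm::euclidean_space) manifold \<Rightarrow> ('v, 'e, 'r::finite) vbundle \<Rightarrow>
   ('v \<Rightarrow> 'e) set"
where
  "sections F M E =
     {x \<in> (\<Pi>\<^sub>E v\<in>topspace (mtop M). fiber E v). \<forall>(U, \<psi>)\<in>trivs E. class_fun F M U (\<psi> \<circ> x)}"

definition section_support ::
  "('v, 'm) manifold \<Rightarrow> ('v, 'e, 'r::finite) vbundle \<Rightarrow> ('v \<Rightarrow> 'e) \<Rightarrow> 'v set" where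
  "section_support M E x = mtop M closure_of {v \<in> topspace (mtop M). x v \<noteq> fzero E v}"

definition compact_sections ::
  "smoothness \<Rightarrow> ('v, 'm::euclidean_space) manifold \<Rightarrow> ('v, 'e, 'r::finite) vbundle \<Rightarrow>
   ('v \<Rightarrow> 'e) set"
where
  "compact_sections F M E = {x \<in> sections F M E. compactin (mtop M) (section_support M E x)}"

definition section_add ::
  "('v, 'm) manifold \<Rightarrow> ('v, 'e, 'r::finite) vbundle \<Rightarrow> ('v \<Rightarrow> 'e) \<Rightarrow> ('v \<Rightarrow> 'e) \<Rightarrow> 'v \<Rightarrow> 'e" where
  "section_add M E x y = (\<lambda>v\<in>topspace (mtop M). fadd E (x v) (y v))"

definition section_scale ::
  "('v, 'm) manifold \<Rightarrow> ('v, 'e, 'r::finite) vbundle \<Rightarrow> real \<Rightarrow> ('v \<Rightarrow> 'e) \<Rightarrow> 'v \<Rightarrow> 'e" where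
  "section_scale M E a x = (\<lambda>v\<in>topspace (mtop M). fscale E a (x v))"

definition linear_section_map ::
  "smoothness \<Rightarrow> ('v, 'm::euclidean_space) manifold \<Rightarrow> ('v, 'e1, 'r::finite) vbundle \<Rightarrow>
   smoothness \<Rightarrow> ('w, 'n::euclidean_space) manifold \<Rightarrow> ('w, 'e2, 's::finite) vbundle \<Rightarrow>
   (('v \<Rightarrow> 'e1) \<Rightarrow> 'w \<Rightarrow> 'e2) \<Rightarrow> bool"
where
  "linear_section_map F V E1 G W E2 f \<longleftrightarrow>
     f ` compact_sections F V E1 \<subseteq> sections G W E2 \<and>
     (\<forall>x\<in>compact_sections F V E1. \<forall>y\<in>compact_sections F V E1.
        f (section_add V E1 x y) = section_add W E2 (f x) (f y)) \<and>
     (\<forall>a. \<forall>x\<in>compact_sections F V E1. f (section_scale V E1 a x) = section_scale W E2 a (f x))"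

definition pullback_section ::
  "'w topology \<Rightarrow> ('w \<Rightarrow> 'v) \<Rightarrow> ('v \<Rightarrow> 'e) \<Rightarrow> 'w \<Rightarrow> 'w \<times> 'e" where
  "pullback_section X \<phi> x = (\<lambda>w\<in>topspace X. (w, x (\<phi> w)))"

text \<open>The set of support points of \<open>f\<close> followed by evaluation at \<open>w\<close>.\<close>

definition support_points ::
  "smoothness \<Rightarrow> ('v, 'm::euclidean_space) manifold \<Rightarrow> ('v, 'e1, 'r::finite) vbundle \<Rightarrow>
   ('w, 'e2, 's::finite) vbundle \<Rightarrow> (('v \<Rightarrow> 'e1) \<Rightarrow> 'w \<Rightarrow> 'e2) \<Rightarrow> 'w \<Rightarrow> 'v set"
where
  "support_points F V E1 E2 f w =
     {v \<in> topspace (mtop V). \<forall>U. openin (mtop V) U \<and> v \<in> U \<longrightarrow>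
        (\<exists>x\<in>compact_sections F V E1. section_support V E1 x \<subseteq> U \<and> f x w \<noteq> fzero E2 w)}"

end

(* Fix a point w. The linear map f(.)(w) takes values in a space of dimension r, so comparing it with the
   sections k*a (k > 0 on the support, a in R^r, in a trivialization) yields a linear L with
   f(x)(w) = f(k*L(x))(w), and by the nonvanishing hypothesis x - k*L(x) vanishes somewhere on the support.
   For r >= 2, testing on b*e_j gives L(b*a) = l(b)*a; by compactness some v satisfies l(b) > 0 whenever
   b >= 0 and b(v) > 0, and perturbing x by large multiples of b*e_j in a direction other than that of a nonzero
   component forces x(v) = k(v)*L(x). Hence f(x)(w) is the image of x(phi(w)) under a fibre isomorphism.
   Locally the components of phi and the entries of gamma are quotients of components of sections f(x), so
   regularity reduces to each class being local and closed under quotients. For Sobolev classes this rests on a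
   Gagliardo-Nirenberg estimate up to the boundary (i-th derivatives lie in L^(kp/i)), obtained from a
   one-dimensional inequality along inward segments and polarization. *)
theory Submission
  imports Defs
begin

section \<open>Differentiability classes\<close>

text \<open>Rank one is special because averages survive there: integration against a positive
  measure with connected compact support is nonzero on every nowhere vanishing function. In rank at
  least two a section can be pushed in a direction transverse to a nonzero component without
  creating zeros, and this is what rules averages out. Manifolds need not be paracompact, so
  sections are built from bumps in one chart and one trivialization, extended by zero; this is
  legitimate because compact sets are closed in a Hausdorff space. The analytic obstacle is the
  Leibniz rule: a product of derivatives of orders i and k - i must lie in L^p although only order k
  is known to. The exponents kp/i and kp/(k - i) are right since their reciprocals add up to 1/p;
  they come from the continuity of the function together with its k-th derivatives. Test functions
  see the interior only, while compact subsets of a chart image may touch the boundary. Kernels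
  displaced into the half-space make derivatives of mollifications equal to mollified weak
  derivatives there too, and all segments and polarizing directions are chosen inward for the same
  reason.\<close>

definition locally_convex :: "'a::euclidean_space set => bool" where
  "locally_convex S \<longleftrightarrow> (\<forall>x\<in>S. \<exists>d>0. convex (S \<inter> ball x d))"

lemma locally_convex_Int_open:
  assumes "locally_convex S" "open T" shows "locally_convex (S \<inter> T)" unfolding locally_convex_def
proof
  fix x assume x: "x \<in> S \<inter> T"
  obtain d where d: "d > 0" "convex (S \<inter> ball x d)" using assms(1) x by (auto simp: locally_convex_def)
  obtain e where e: "e > 0" "ball x e \<subseteq> T" using assms(2) x open_contains_ball by blast
  have "S \<inter> T \<inter> ball x (min d e) = (S \<inter> ball x d) \<inter> ball x (min d e)" using e(2) by auto
  then show "\<exists>d>0. convex (S \<inter> T \<inter> ball x d)" using d e by (metis convex_Int convex_ball min_less_iff_conj)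
qed

lemma locally_convex_convex_Int_open:
  assumes "convex H" "open T" shows "locally_convex (H \<inter> T)"
proof -
  have "locally_convex H" using assms(1) by (auto simp: locally_convex_def convex_Int intro: exI[of _ 1])
  then show ?thesis using assms(2) locally_convex_Int_open by blast
qed

lemma locally_convex_UNIV: "locally_convex UNIV" using locally_convex_convex_Int_open[of UNIV UNIV] by simp

lemma locally_Holder_on_imp_continuous: "locally_Holder_on alpha S f ==> continuous_on S f"
  by (simp add: locally_Holder_on_def)

text \<open>Sums, linear images, products and reciprocals all reduce to such a bound on increments.
  \<open>K\<close> may depend on the point, so it can absorb local bounds of the factors.\<close>

lemma locally_Holder_on_dominated:
  assumes f: "locally_Holder_on alpha S f" and g: "locally_Holder_on alpha S g" and h: "continuous_on S h"
    and dom: "\<And>x. x \<in> S ==> \<exists>d>0. \<exists>K\<ge>0. \<forall>y\<in>S \<inter> ball x d. \<forall>z\<in>S \<inter> ball x d.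
      norm (h y - h z) <= K * (norm (f y - f z) + norm (g y - g z))" shows "locally_Holder_on alpha S h"
  unfolding locally_Holder_on_def
proof (intro conjI h ballI)
  fix x assume x: "x \<in> S"
  obtain c C where c: "c > 0" "\<forall>y\<in>S \<inter> ball x c. \<forall>z\<in>S \<inter> ball x c. norm (f y - f z) <= C * dist y z powr alpha"
    using f x by (auto simp: locally_Holder_on_def)
  obtain d D where d: "d > 0" "\<forall>y\<in>S \<inter> ball x d. \<forall>z\<in>S \<inter> ball x d. norm (g y - g z) <= D * dist y z powr alpha"
    using g x by (auto simp: locally_Holder_on_def)
  obtain e K where e: "e > 0" "K >= 0" "\<forall>y\<in>S \<inter> ball x e. \<forall>z\<in>S \<inter> ball x e.
      norm (h y - h z) <= K * (norm (f y - f z) + norm (g y - g z))" using dom[OF x] by blast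
  have "norm (h y - h z) <= (K * (C + D)) * dist y z powr alpha"
    if "y \<in> S \<inter> ball x (min c (min d e))" "z \<in> S \<inter> ball x (min c (min d e))" for y z
  proof -
    have "norm (h y - h z) <= K * (norm (f y - f z) + norm (g y - g z))" using e(3) that by simp
    also have "... <= K * (C * dist y z powr alpha + D * dist y z powr alpha)"
      using c(2) d(2) that by (intro mult_left_mono add_mono e(2)) simp_all
    finally show ?thesis by (simp add: algebra_simps)
  qed
  then show "\<exists>d>0. \<exists>C. \<forall>y\<in>S \<inter> ball x d. \<forall>z\<in>S \<inter> ball x d. norm (h y - h z) <= C * dist y z powr alpha"
    using c(1) d(1) e(1) by (intro exI[of _ "min c (min d e)"] conjI exI[of _ "K * (C + D)"]) auto
qed

lemma continuous_on_bounded_near: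
  fixes f :: "'a::metric_space => 'b::real_normed_vector"
  assumes "continuous_on S f" "x \<in> S" shows "\<exists>d>0. \<forall>y\<in>S \<inter> ball x d. norm (f y) <= norm (f x) + 1"
proof -
  obtain d where d: "d > 0" "\<And>y. y \<in> S ==> dist y x < d ==> dist (f y) (f x) < 1"
    using assms by (meson continuous_on_iff zero_less_one)
  have "norm (f y) <= norm (f x) + 1" if "y \<in> S \<inter> ball x d" for y
    using d(2)[of y] that norm_triangle_sub[of "f y" "f x"] by (simp add: dist_norm dist_commute)
  then show ?thesis using d(1) by blast
qed

text \<open>For exponent 0 the increment condition is local boundedness, which continuity provides.
  Equal points are treated apart because \<open>0 powr 0 = 0\<close>.\<close>

lemma locally_Holder_on_0: "locally_Holder_on 0 S f \<longleftrightarrow> continuous_on S f"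
proof
  assume c: "continuous_on S f"
  show "locally_Holder_on 0 S f" unfolding locally_Holder_on_def
  proof (intro conjI c ballI)
    fix x assume "x \<in> S"
    then obtain d where d: "d > 0" "\<forall>y\<in>S \<inter> ball x d. norm (f y) <= norm (f x) + 1"
      using continuous_on_bounded_near[OF c] by blast
    have "norm (f y - f z) <= (2 * (norm (f x) + 1)) * dist y z powr 0" if "y \<in> S \<inter> ball x d" "z \<in> S \<inter> ball x d" for y z
    proof -
      have "norm (f y) <= norm (f x) + 1" "norm (f z) <= norm (f x) + 1" using d(2) that by blast+
      then show ?thesis using norm_triangle_ineq4[of "f y" "f z"] by (cases "y = z") auto
    qed
    then show "\<exists>d>0. \<exists>C. \<forall>y\<in>S \<inter> ball x d. \<forall>z\<in>S \<inter> ball x d. norm (f y - f z) <= C * dist y z powr 0"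
      using d(1) by blast
  qed
qed (simp add: locally_Holder_on_def)

text \<open>Lets the C^k classes inherit the closure properties proved for the Holder
  classes.\<close>

lemma C_on_iff_Holder_on: "C_on k S f \<longleftrightarrow> (\<forall>j. enat j <= k --> Holder_on j 0 S f)"
proof -
  have "locally_Holder_on 0 S = (continuous_on S :: ('a => 'b) => bool)"
    by (auto simp: fun_eq_iff locally_Holder_on_0)
  then show ?thesis by (simp add: C_on_def Holder_on_def)
qed

lemma Holder_on_0 [simp]: "Holder_on 0 alpha S f \<longleftrightarrow> locally_Holder_on alpha S f" by (simp add: Holder_on_def)

lemma Holder_on_Suc: "Holder_on (Suc k) alpha S f \<longleftrightarrow>
     (\<exists>f'. (\<forall>x\<in>S. (f has_derivative f' x) (at x within S)) \<and> (\<forall>v. Holder_on k alpha S (\<lambda>x. f' x v)))"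
  by (simp add: Holder_on_def)

lemma locally_Holder_on_cong:
  assumes "locally_Holder_on alpha S f" "\<And>x. x \<in> S ==> f x = g x" shows "locally_Holder_on alpha S g"
  using assms by (auto simp: locally_Holder_on_def cong: continuous_on_cong)

lemma Holder_on_cong:
  assumes "Holder_on k alpha S f" "\<And>x. x \<in> S ==> f x = g x" shows "Holder_on k alpha S g"
proof (cases k)
  case 0
  then show ?thesis using assms locally_Holder_on_cong by (metis Holder_on_0)
next
  case (Suc j)
  have "(g has_derivative f') (at x within S)" if "(f has_derivative f') (at x within S)" "x \<in> S" for f' x
    using that assms(2) by (metis has_derivative_transform)
  then show ?thesis using assms(1) by (auto simp: Holder_on_Suc Suc)
qed

lemma Holder_on_subset_open:
  "Holder_on k alpha S f ==> Holder_on k alpha (S \<inter> T) f"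
proof (induction k arbitrary: f)
  case 0
  then have h: "locally_Holder_on alpha S f" by simp
  have "\<exists>d>0. \<exists>C. \<forall>y\<in>S \<inter> T \<inter> ball x d. \<forall>z\<in>S \<inter> T \<inter> ball x d. norm (f y - f z) <= C * dist y z powr alpha" if x: "x \<in> S \<inter> T" for x
  proof -
    obtain d C where "d > 0" "\<forall>y\<in>S \<inter> ball x d. \<forall>z\<in>S \<inter> ball x d. norm (f y - f z) <= C * dist y z powr alpha"
      using h x unfolding locally_Holder_on_def by blast
    then show ?thesis by (intro exI[of _ d] conjI exI[of _ C]) auto
  qed
  then have "locally_Holder_on alpha (S \<inter> T) f"
    using h continuous_on_subset[of S f "S \<inter> T"] by (auto simp: locally_Holder_on_def)
  then show ?case by simp
next
  case (Suc k)
  then obtain f' where f': "\<forall>x\<in>S. (f has_derivative f' x) (at x within S)"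
     "\<forall>v. Holder_on k alpha S (\<lambda>x. f' x v)" by (auto simp: Holder_on_Suc)
  have "\<forall>x\<in>S \<inter> T. (f has_derivative f' x) (at x within S \<inter> T)"
    using f'(1) by (meson IntD1 Int_lower1 has_derivative_subset)
  then show ?case using f'(2) Suc.IH by (auto simp: Holder_on_Suc)
qed

lemma Holder_on_subset: "Holder_on k alpha S f ==> T \<subseteq> S ==> Holder_on k alpha T f"
  by (metis Holder_on_subset_open Int_absorb1 inf_commute)

section \<open>Images of charts\<close>

definition model_domain :: "nat => 'a::euclidean_space set => bool" where
  "model_domain n S \<longleftrightarrow> (\<exists>H\<in>model_spaces n. openin (top_of_set H) S)"

lemma model_domain_cases:
  assumes "model_domain n S"
  obtains "n = 0" "S \<subseteq> {0}" | a T where "n \<noteq> 0" "open T" "S = {x. 0 <= a \<bullet> x} \<inter> T"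
proof -
  obtain H where H: "H \<in> model_spaces n" "openin (top_of_set H) S" using assms by (auto simp: model_domain_def)
  show ?thesis
  proof (cases "n = 0")
    case True
    then show ?thesis using H that(1) openin_subset by (fastforce simp: model_spaces_def)
  next
    case False
    then obtain a where "H = {x. 0 <= a \<bullet> x}" using H by (auto simp: model_spaces_def)
    then show ?thesis using H(2) False that(2) by (auto simp: openin_open)
  qed
qed

lemma convex_halfspace: "convex {x::'a::euclidean_space. 0 <= a \<bullet> x}" using convex_halfspace_ge[of 0 a] by simp

lemma model_domain_locally_convex:
  assumes "model_domain n S" shows "locally_convex S" using assms
proof (cases rule: model_domain_cases)
  case 1
  then have "S = {} \<or> S = {0} \<inter> UNIV" by auto
  then show ?thesis using locally_convex_convex_Int_open[of "{0}" UNIV] by (auto simp: locally_convex_def)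
next
  case (2 a T)
  then show ?thesis using locally_convex_convex_Int_open[OF convex_halfspace] by auto
qed

text \<open>Even from a boundary point of a half-space, each basis direction can be followed a
  little way after a suitable change of sign. On a one-point domain every linear map is a derivative
  within the domain, hence the exclusion.\<close>

lemma model_domain_unique_derivative:
  fixes f :: "'a::euclidean_space => 'b::euclidean_space"
  assumes "model_domain n S" "\<not> S \<subseteq> {0}" "x \<in> S"
    and "(f has_derivative f') (at x within S)" "(f has_derivative f'') (at x within S)" shows "f' = f''"
  using assms(1)
proof (cases rule: model_domain_cases)
  case (2 a T)
  obtain r where r: "r > 0" "ball x r \<subseteq> T" using 2 assms(3) open_contains_ball by blast
  have "\<exists>d. 0 < \<bar>d\<bar> \<and> \<bar>d\<bar> < e \<and> x + d *\<^sub>R i \<in> S" if "i \<in> Basis" "e > 0" for i e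
  proof -
    define delta where "delta = min e r / 2"
    \<comment> \<open>The sign makes \<open>d * (a \<bullet> i)\<close> nonnegative, so that the
      step does not leave the half-space.\<close>
    define d where "d = (if 0 <= a \<bullet> i then delta else - delta)"
    have delta: "0 < delta" "delta < e" "delta < r" using that r by (auto simp: delta_def)
    have "dist x (x + d *\<^sub>R i) < r" using delta that(1) by (auto simp: d_def dist_norm)
    moreover have "0 <= d * (a \<bullet> i)" using delta by (auto simp: d_def mult_nonneg_nonpos)
    ultimately have "x + d *\<^sub>R i \<in> S" using r 2 assms(3) by (auto simp: inner_add_right)
    then show ?thesis using delta by (intro exI[of _ d]) (auto simp: d_def)
  qed
  then show ?thesis by (intro frechet_derivative_unique_within[OF assms(4,5)]) auto
qed (use assms in auto)

text \<open>The derivatives supplied near different points are different functions a priori.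
  Uniqueness makes them agree on overlaps, so the diagonal choice \<open>f' x x\<close> works near
  every point. If the domain lies in {0}, one neighbourhood already covers it.\<close>

lemma Holder_on_local:
  assumes "model_domain n S" and "\<And>x. x \<in> S ==> \<exists>T. open T \<and> x \<in> T \<and> Holder_on k alpha (S \<inter> T) f"
  shows "Holder_on k alpha S f" using assms(2)
proof (induction k arbitrary: f)
  case 0
  have "locally_Holder_on alpha S f" unfolding locally_Holder_on_def continuous_on_eq_continuous_within
  proof (intro conjI ballI)
    fix x assume x: "x \<in> S"
    obtain T where T: "open T" "x \<in> T" "locally_Holder_on alpha (S \<inter> T) f" using 0[OF x] by auto
    then have "continuous_on (S \<inter> T) f" using locally_Holder_on_imp_continuous by blast
    then have "continuous (at x within S \<inter> T) f" using x T continuous_on_eq_continuous_within by blast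
    then show "continuous (at x within S) f"
        using T(1,2) at_within_nhd[of x T "S \<inter> T" S] by (simp add: inf_commute inf_left_commute)
    obtain e where e: "e > 0" "ball x e \<subseteq> T" using T open_contains_ball by blast
    obtain d C where "d > 0" "\<forall>y\<in>S \<inter> T \<inter> ball x d. \<forall>z\<in>S \<inter> T \<inter> ball x d. norm (f y - f z) <= C * dist y z powr alpha"
      using T(2,3) x unfolding locally_Holder_on_def by blast
    then show "\<exists>d>0. \<exists>C. \<forall>y\<in>S \<inter> ball x d. \<forall>z\<in>S \<inter> ball x d. norm (f y - f z) <= C * dist y z powr alpha"
      using e by (intro exI[of _ "min d e"] conjI exI[of _ C]) (auto simp: subset_iff)
  qed
  then show ?case by simp
next
  case (Suc k)
  have "\<exists>T f'. open T \<and> x \<in> T \<and> (\<forall>y\<in>S\<inter>T. (f has_derivative f' y) (at y within S))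
            \<and> (\<forall>v. Holder_on k alpha (S \<inter> T) (\<lambda>y. f' y v))" if x: "x \<in> S" for x
  proof -
    obtain T f' where T: "open T" "x \<in> T" "\<forall>y\<in>S\<inter>T. (f has_derivative f' y) (at y within S \<inter> T)"
      "\<forall>v. Holder_on k alpha (S \<inter> T) (\<lambda>y. f' y v)" using Suc.prems[OF x] by (auto simp: Holder_on_Suc)
    have "at y within S \<inter> T = at y within S" if "y \<in> S \<inter> T" for y
      using that T(1) at_within_nhd[of y T "S \<inter> T" S] by auto
    then show ?thesis using T by metis
  qed
  then obtain T f' where T: "\<And>x. x \<in> S ==> open (T x)" "\<And>x. x \<in> S ==> x \<in> T x"
     "\<And>x y. x \<in> S ==> y\<in>S\<inter>T x ==> (f has_derivative f' x y) (at y within S)"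
      "\<And>x v. x \<in> S ==> Holder_on k alpha (S \<inter> T x) (\<lambda>y. f' x y v)" by metis
  show ?case
  proof (cases "S \<subseteq> {0}")
    case True
    then consider "S = {}" | "S = {0}" by blast
    then show ?thesis
    proof cases
      case 1
      have "Holder_on j alpha {} (f :: 'a => 'b)" for j f
        by (induction j arbitrary: f) (auto simp: Holder_on_Suc locally_Holder_on_def)
      then show ?thesis using 1 by blast
    next
      case 2
      then have "S \<inter> T 0 = S" using T(2) by auto
      then show ?thesis using T(3,4)[of 0] 2 by (auto simp: Holder_on_Suc)
    qed
  next
    case False
    define g where "g x = f' x x" for x
    have eq: "f' x y = g y" if "x \<in> S" "y \<in> S \<inter> T x" for x y
      unfolding g_def using model_domain_unique_derivative[OF assms(1) False, of y f] T that by blast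
    have "\<forall>x\<in>S. (f has_derivative g x) (at x within S)" using T(2,3) by (auto simp: g_def)
    moreover have "Holder_on k alpha S (\<lambda>x. g x v)" for v
    proof (rule Suc.IH)
      fix x assume x: "x \<in> S"
      have "Holder_on k alpha (S \<inter> T x) (\<lambda>y. g y v)" using Holder_on_cong[OF T(4)[OF x, of v]] eq[OF x] by simp
      then show "\<exists>T. open T \<and> x \<in> T \<and> Holder_on k alpha (S \<inter> T) (\<lambda>y. g y v)" using T(1,2) x by blast
    qed
    ultimately show ?thesis by (auto simp: Holder_on_Suc)
  qed
qed

lemma locally_Holder_on_add:
  assumes f: "locally_Holder_on alpha S f" and g: "locally_Holder_on alpha S g"
  shows "locally_Holder_on alpha S (\<lambda>x. f x + g x)"
proof (rule locally_Holder_on_dominated[OF f g])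
  have "norm (f y + g y - (f z + g z)) <= 1 * (norm (f y - f z) + norm (g y - g z))" for y z
    using norm_triangle_ineq[of "f y - f z" "g y - g z"] by (simp add: algebra_simps)
  then show "\<exists>d>0. \<exists>K\<ge>0. \<forall>y\<in>S \<inter> ball x d. \<forall>z\<in>S \<inter> ball x d.
      norm (f y + g y - (f z + g z)) <= K * (norm (f y - f z) + norm (g y - g z))" for x
    by (meson zero_less_one zero_le_one)
qed (use f g in \<open>intro continuous_intros locally_Holder_on_imp_continuous\<close>)

lemma Holder_on_add:
  "Holder_on k alpha S f ==> Holder_on k alpha S g ==> Holder_on k alpha S (\<lambda>x. f x + g x)"
proof (induction k arbitrary: f g)
  case (Suc k)
  obtain f' where f': "\<forall>x\<in>S. (f has_derivative f' x) (at x within S)"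
     "\<forall>v. Holder_on k alpha S (\<lambda>x. f' x v)" using Suc.prems(1) by (auto simp: Holder_on_Suc)
  obtain g' where g': "\<forall>x\<in>S. (g has_derivative g' x) (at x within S)"
     "\<forall>v. Holder_on k alpha S (\<lambda>x. g' x v)" using Suc.prems(2) by (auto simp: Holder_on_Suc)
  show ?case unfolding Holder_on_Suc
    using f' g' Suc.IH by (intro exI[of _ "\<lambda>x v. f' x v + g' x v"]) (auto intro!: has_derivative_add)
qed (simp add: locally_Holder_on_add)

lemma locally_Holder_on_linear:
  assumes L: "bounded_linear L" and f: "locally_Holder_on alpha S f" shows "locally_Holder_on alpha S (\<lambda>x. L (f x))"
proof (rule locally_Holder_on_dominated[OF f f])
  have "norm (L (f y) - L (f z)) <= onorm L * (norm (f y - f z) + norm (f y - f z))" for y z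
    using order_trans[OF onorm[OF L, of "f y - f z"] mult_left_mono[OF _ onorm_pos_le[OF L]]]
    by (simp add: linear_diff[OF bounded_linear.linear[OF L], symmetric])
  then show "\<exists>d>0. \<exists>K\<ge>0. \<forall>y\<in>S \<inter> ball x d. \<forall>z\<in>S \<inter> ball x d.
      norm (L (f y) - L (f z)) <= K * (norm (f y - f z) + norm (f y - f z))" for x
    using onorm_pos_le[OF L] by (meson zero_less_one)
qed (use f in \<open>intro bounded_linear.continuous_on[OF L] locally_Holder_on_imp_continuous\<close>)

lemma Holder_on_linear:
  assumes L: "bounded_linear L" shows "Holder_on k alpha S f ==> Holder_on k alpha S (\<lambda>x. L (f x))"
proof (induction k arbitrary: f)
  case 0
  then show ?case using L by (simp add: locally_Holder_on_linear)
next
  case (Suc k)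
  obtain f' where f': "\<forall>x\<in>S. (f has_derivative f' x) (at x within S)"
     "\<forall>v. Holder_on k alpha S (\<lambda>x. f' x v)" using Suc.prems(1) by (auto simp: Holder_on_Suc)
  show ?case unfolding Holder_on_Suc
    using f' Suc.IH by (intro exI[of _ "\<lambda>x v. L (f' x v)"]) (auto intro!: bounded_linear.has_derivative[OF L])
qed

lemma locally_Holder_on_const: "locally_Holder_on alpha S (\<lambda>x. c)"
  unfolding locally_Holder_on_def by (intro conjI ballI exI[of _ 1] exI[of _ 0]) auto

lemma Holder_on_const: "Holder_on k alpha S (\<lambda>x. c)"
proof (induction k arbitrary: c)
  case (Suc k)
  show ?case unfolding Holder_on_Suc by (intro exI[of _ "\<lambda>x v. 0"]) (auto intro: Suc.IH)
qed (simp add: locally_Holder_on_const)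

lemma Holder_on_sum:
  "finite I ==> (\<And>i. i \<in> I ==> Holder_on k alpha S (f i)) ==> Holder_on k alpha S (\<lambda>x. \<Sum>i\<in>I. f i x)"
  by (induction I rule: finite_induct) (auto intro: Holder_on_add Holder_on_const)

text \<open>Near a point the derivatives along \<open>Basis\<close> are bounded, hence so is the
  operator norm; on a convex neighbourhood the mean value inequality then gives a Lipschitz bound.
  This is the purpose of local convexity.\<close>

lemma locally_Holder_on_differentiable:
  fixes f :: "'a::euclidean_space => 'b::euclidean_space"
  assumes S: "locally_convex S" and alpha: "0 <= alpha" "alpha <= 1"
    and f': "\<And>x. x \<in> S ==> (f has_derivative f' x) (at x within S)" and cont: "\<And>v. continuous_on S (\<lambda>x. f' x v)"
  shows "locally_Holder_on alpha S f" unfolding locally_Holder_on_def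
proof (intro conjI ballI)
  show "continuous_on S f" using f' has_derivative_continuous continuous_on_eq_continuous_within by blast
  fix x assume x: "x \<in> S"
  define g where "g y = (\<Sum>b\<in>Basis. norm (f' y b))" for y
  have "continuous_on S g" unfolding g_def by (intro continuous_intros cont)
  then obtain d1 where d1: "d1 > 0" "\<And>y. y \<in> S ==> dist y x < d1 ==> dist (g y) (g x) < 1"
    using x by (meson continuous_on_iff zero_less_one)
  obtain d2 where d2: "d2 > 0" "convex (S \<inter> ball x d2)" using S x by (auto simp: locally_convex_def)
  \<comment> \<open>Radius at most 1/2 keeps two points of the ball at distance at most 1, where t
    is at most t powr alpha.\<close>
  define d where "d = min (1/2) (min d1 d2)"
  have d: "d > 0" "d <= 1/2" "d <= d1" "d <= d2" using d1 d2 by (auto simp: d_def)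
  define B where "B = g x + 1"
  have conv: "convex (S \<inter> ball x d)"
    using convex_Int[OF d2(2) convex_ball[of x d]] d(4) by (simp add: Int_assoc inf_absorb2 subset_ball)
  have on: "onorm (f' y) <= B" if y: "y \<in> S \<inter> ball x d" for y
  proof (rule onorm_le)
    fix v
    have lin: "bounded_linear (f' y)" using f' y has_derivative_bounded_linear by blast
    have "f' y v = f' y (\<Sum>b\<in>Basis. (v \<bullet> b) *\<^sub>R b)" by (simp add: euclidean_representation)
    also have "... = (\<Sum>b\<in>Basis. (v \<bullet> b) *\<^sub>R f' y b)"
      using bounded_linear.linear[OF lin] by (simp add: linear_sum linear_scale)
    finally have "norm (f' y v) = norm (\<Sum>b\<in>Basis. (v \<bullet> b) *\<^sub>R f' y b)" by simp
    also have "... <= (\<Sum>b\<in>Basis. norm v * norm (f' y b))"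
      by (intro sum_norm_le) (auto intro!: mult_right_mono Basis_le_norm)
    also have "... = g y * norm v" by (simp add: g_def sum_distrib_left[symmetric])
    also have "... <= B * norm v"
      using d1(2)[of y] y d by (intro mult_right_mono) (auto simp: B_def dist_real_def dist_commute)
    finally show "norm (f' y v) <= B * norm v" .
  qed
  have B: "B >= 0" by (auto simp: B_def g_def intro!: add_nonneg_nonneg sum_nonneg)
  have "norm (f y - f z) <= B * dist y z powr alpha"
    if yz: "y \<in> S \<inter> ball x d" "z \<in> S \<inter> ball x d" for y z
  proof (cases "y = z")
    case False
    have "norm (f y - f z) <= B * norm (y - z)"
      using yz by (intro differentiable_bound[OF conv, where f' = f'] on) (auto intro: has_derivative_subset f')
    also have "norm (y - z) <= norm (y - z) powr alpha"
    proof -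
      have "norm (y - z) <= 1" using yz d dist_triangle_half_r[of x y 1 z] by (simp add: dist_norm[symmetric])
      then show ?thesis using powr_mono'[of alpha 1 "norm (y - z)"] alpha False by simp
    qed
    finally show ?thesis using B by (simp add: dist_norm mult_left_mono)
  qed simp
  then show "\<exists>d>0. \<exists>C. \<forall>y\<in>S \<inter> ball x d. \<forall>z\<in>S \<inter> ball x d. norm (f y - f z) <= C * dist y z powr alpha"
    using d(1) by blast
qed

lemma Holder_on_decr:
  fixes f :: "'a::euclidean_space => 'b::euclidean_space"
  assumes S: "locally_convex S" and alpha: "0 <= alpha" "alpha <= 1"
  shows "Holder_on (Suc k) beta S f ==> Holder_on k alpha S f"
proof (induction k arbitrary: f)
  case 0
  then obtain f' where f': "\<forall>x\<in>S. (f has_derivative f' x) (at x within S)"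
     "\<forall>v. locally_Holder_on beta S (\<lambda>x. f' x v)" by (auto simp: Holder_on_Suc)
  have "continuous_on S (\<lambda>x. f' x v)" for v using f'(2) locally_Holder_on_imp_continuous by blast
  then show ?case using locally_Holder_on_differentiable[OF S alpha, of f f'] f'(1) by simp
next
  case (Suc k)
  then show ?case by (metis Holder_on_Suc)
qed

lemma locally_Holder_on_scaleR:
  fixes r :: "'a::euclidean_space => real" and f :: "'a => 'b::euclidean_space"
  assumes r: "locally_Holder_on alpha S r" and f: "locally_Holder_on alpha S f"
  shows "locally_Holder_on alpha S (\<lambda>x. r x *\<^sub>R f x)"
proof (rule locally_Holder_on_dominated[OF r f])
  note c = locally_Holder_on_imp_continuous[OF r] locally_Holder_on_imp_continuous[OF f]
  show "continuous_on S (\<lambda>x. r x *\<^sub>R f x)" using c by (intro continuous_intros)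
  fix x assume x: "x \<in> S"
  obtain d where d: "d > 0" "\<forall>y\<in>S \<inter> ball x d. norm (r y) <= norm (r x) + 1" using continuous_on_bounded_near[OF c(1) x] by blast
  obtain e where e: "e > 0" "\<forall>y\<in>S \<inter> ball x e. norm (f y) <= norm (f x) + 1" using continuous_on_bounded_near[OF c(2) x] by blast
  define K where "K = max (norm (r x) + 1) (norm (f x) + 1)"
  have "norm (r y *\<^sub>R f y - r z *\<^sub>R f z) <= K * (norm (r y - r z) + norm (f y - f z))"
    if "y \<in> S \<inter> ball x (min d e)" "z \<in> S \<inter> ball x (min d e)" for y z
  proof -
    have "r y *\<^sub>R f y - r z *\<^sub>R f z = (r y - r z) *\<^sub>R f z + r y *\<^sub>R (f y - f z)" by (simp add: algebra_simps)
    then have "norm (r y *\<^sub>R f y - r z *\<^sub>R f z) <= norm (f z) * norm (r y - r z) + norm (r y) * norm (f y - f z)"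
      by (metis mult.commute norm_scaleR norm_triangle_ineq real_norm_def)
    also have "... <= K * norm (r y - r z) + K * norm (f y - f z)"
      using d(2) e(2) that by (intro add_mono mult_right_mono) (auto simp: K_def intro: max.coboundedI1 max.coboundedI2)
    finally show ?thesis by (simp add: distrib_left)
  qed
  moreover have "K >= 0" by (simp add: K_def le_max_iff_disj)
  ultimately show "\<exists>d>0. \<exists>K\<ge>0. \<forall>y\<in>S \<inter> ball x d. \<forall>z\<in>S \<inter> ball x d.
      norm (r y *\<^sub>R f y - r z *\<^sub>R f z) <= K * (norm (r y - r z) + norm (f y - f z))"
    using d(1) e(1) by (intro exI[of _ "min d e"] conjI exI[of _ K]) auto
qed

lemma Holder_on_scaleR:
  fixes r :: "'a::euclidean_space => real" and f :: "'a => 'b::euclidean_space"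
  assumes S: "locally_convex S" and alpha: "0 <= alpha" "alpha <= 1"
  shows "Holder_on k alpha S r ==> Holder_on k alpha S f ==> Holder_on k alpha S (\<lambda>x. r x *\<^sub>R f x)"
proof (induction k arbitrary: r f)
  case (Suc k)
  obtain r' where r': "\<forall>x\<in>S. (r has_derivative r' x) (at x within S)"
     "\<forall>v. Holder_on k alpha S (\<lambda>x. r' x v)" using Suc.prems(1) by (auto simp: Holder_on_Suc)
  obtain f' where f': "\<forall>x\<in>S. (f has_derivative f' x) (at x within S)"
     "\<forall>v. Holder_on k alpha S (\<lambda>x. f' x v)" using Suc.prems(2) by (auto simp: Holder_on_Suc)
  have "\<forall>x\<in>S. ((\<lambda>x. r x *\<^sub>R f x) has_derivative (\<lambda>v. r x *\<^sub>R f' x v + r' x v *\<^sub>R f x)) (at x within S)"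
    using r' f' by (auto intro!: has_derivative_scaleR)
  moreover have "Holder_on k alpha S (\<lambda>x. r x *\<^sub>R f' x v + r' x v *\<^sub>R f x)" for v
    using r' f' Suc.prems by (intro Holder_on_add Suc.IH) (auto intro: Holder_on_decr[OF S alpha])
  ultimately show ?case unfolding Holder_on_Suc by (intro exI[of _ "\<lambda>x v. r x *\<^sub>R f' x v + r' x v *\<^sub>R f x"]) simp
qed (simp add: locally_Holder_on_scaleR)

lemma Holder_on_mult:
  fixes f g :: "'a::euclidean_space => real"
  assumes "locally_convex S" "0 <= alpha" "alpha <= 1" "Holder_on k alpha S f" "Holder_on k alpha S g"
  shows "Holder_on k alpha S (\<lambda>x. f x * g x)" using Holder_on_scaleR[OF assms] by simp

lemma locally_Holder_on_inverse:
  fixes f :: "'a::euclidean_space => real"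
  assumes f: "locally_Holder_on alpha S f" and nz: "\<And>x. x \<in> S ==> f x \<noteq> 0"
  shows "locally_Holder_on alpha S (\<lambda>x. inverse (f x))"
proof (rule locally_Holder_on_dominated[OF f f])
  show c: "continuous_on S (\<lambda>x. inverse (f x))"
    using nz by (intro continuous_intros locally_Holder_on_imp_continuous[OF f]) auto
  fix x assume x: "x \<in> S"
  define B where "B = norm (inverse (f x)) + 1"
  obtain d where d: "d > 0" "\<forall>y\<in>S \<inter> ball x d. norm (inverse (f y)) <= B"
    using continuous_on_bounded_near[OF c x] unfolding B_def by blast
  have B: "B >= 0" by (simp add: B_def)
  have "norm (inverse (f y) - inverse (f z)) <= (B * B) * (norm (f y - f z) + norm (f y - f z))"
    if "y \<in> S \<inter> ball x d" "z \<in> S \<inter> ball x d" for y z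
  proof -
    have "inverse (f y) - inverse (f z) = - (inverse (f y) * inverse (f z) * (f y - f z))"
      using nz that by (simp add: field_simps)
    then have "norm (inverse (f y) - inverse (f z)) = norm (inverse (f y)) * norm (inverse (f z)) * norm (f y - f z)"
      by (simp add: abs_mult)
    also have "... <= (B * B) * norm (f y - f z)" using d(2) that B by (intro mult_mono) auto
    also have "... <= (B * B) * (norm (f y - f z) + norm (f y - f z))" using B by (intro mult_left_mono) auto
    finally show ?thesis .
  qed
  then show "\<exists>d>0. \<exists>K\<ge>0. \<forall>y\<in>S \<inter> ball x d. \<forall>z\<in>S \<inter> ball x d.
      norm (inverse (f y) - inverse (f z)) <= K * (norm (f y - f z) + norm (f y - f z))"
    using d(1) B by (intro exI[of _ d] conjI exI[of _ "B * B"]) auto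
qed

lemma Holder_on_inverse:
  fixes f :: "'a::euclidean_space => real"
  assumes S: "locally_convex S" and alpha: "0 <= alpha" "alpha <= 1" and nz: "\<And>x. x \<in> S ==> f x \<noteq> 0"
  shows "Holder_on k alpha S f ==> Holder_on k alpha S (\<lambda>x. inverse (f x))"
proof (induction k)
  case (Suc k)
  obtain f' where f': "\<forall>x\<in>S. (f has_derivative f' x) (at x within S)"
     "\<forall>v. Holder_on k alpha S (\<lambda>x. f' x v)" using Suc.prems(1) by (auto simp: Holder_on_Suc)
  have IH: "Holder_on k alpha S (\<lambda>x. inverse (f x))" using Suc Holder_on_decr[OF S alpha] by blast
  have "\<forall>x\<in>S. ((\<lambda>x. inverse (f x)) has_derivative (\<lambda>v. - (inverse (f x) * f' x v * inverse (f x)))) (at x within S)"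
    using f' nz by (auto intro!: has_derivative_inverse)
  moreover have "Holder_on k alpha S (\<lambda>x. - (inverse (f x) * f' x v * inverse (f x)))" for v
    using f' IH by (intro Holder_on_linear[OF bounded_linear_minus[OF bounded_linear_ident]] Holder_on_mult[OF S alpha]) auto
  ultimately show ?case unfolding Holder_on_Suc
    by (intro exI[of _ "\<lambda>x v. - (inverse (f x) * f' x v * inverse (f x))"]) simp
qed (use nz in \<open>simp add: locally_Holder_on_inverse\<close>)

text \<open>The derivative of g in the varying direction \<open>T' x v\<close> is expanded in
  \<open>Basis\<close>; each term is a product of a derivative of T with a derivative of g composed
  with T, to which the induction applies.\<close>

lemma Holder_on_compose:
  fixes T :: "'a::euclidean_space => 'c::euclidean_space" and g :: "'c => 'b::euclidean_space"
  assumes S: "locally_convex S" and sub: "T ` S \<subseteq> S'" and S': "locally_convex S'"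
  shows "Holder_on k 0 S T ==> Holder_on k 0 S' g ==> Holder_on k 0 S (g \<circ> T)"
proof (induction k arbitrary: g)
  case 0
  then have "continuous_on S T" "continuous_on S' g" by (simp_all add: locally_Holder_on_0)
  then have "continuous_on S (g \<circ> T)" using sub continuous_on_compose continuous_on_subset by blast
  then show ?case by (simp add: locally_Holder_on_0)
next
  case (Suc k)
  obtain T' where T': "\<forall>x\<in>S. (T has_derivative T' x) (at x within S)"
     "\<forall>v. Holder_on k 0 S (\<lambda>x. T' x v)" using Suc.prems(1) by (auto simp: Holder_on_Suc)
  obtain g' where g': "\<forall>x\<in>S'. (g has_derivative g' x) (at x within S')"
     "\<forall>v. Holder_on k 0 S' (\<lambda>x. g' x v)" using Suc.prems(2) by (auto simp: Holder_on_Suc)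
  have 1: "(g \<circ> T has_derivative (g' (T x) \<circ> T' x)) (at x within S)" if "x \<in> S" for x
  proof (rule diff_chain_within)
    show "(T has_derivative T' x) (at x within S)" using T' that by blast
    show "(g has_derivative g' (T x)) (at (T x) within T ` S)"
      using g' sub that by (meson has_derivative_subset image_subset_iff)
  qed
  have "Holder_on k 0 S (\<lambda>x. (g' (T x) \<circ> T' x) v)" for v
  proof -
    have "Holder_on k 0 S (\<lambda>x. \<Sum>b\<in>Basis. (T' x v \<bullet> b) *\<^sub>R ((\<lambda>y. g' y b) \<circ> T) x)"
    proof (intro Holder_on_sum Holder_on_scaleR[OF S])
      fix b :: 'c
      show "Holder_on k 0 S (\<lambda>x. T' x v \<bullet> b)"
        using T'(2) by (intro Holder_on_linear[OF bounded_linear_inner_left]) auto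
      show "Holder_on k 0 S ((\<lambda>y. g' y b) \<circ> T)"
        using g'(2) Suc.prems(1) by (intro Suc.IH) (auto intro: Holder_on_decr[OF S])
    qed auto
    then show ?thesis
    proof (rule Holder_on_cong)
      fix x assume "x \<in> S"
      then have lin: "linear (g' (T x))" using g'(1) sub has_derivative_linear by blast
      have "g' (T x) (T' x v) = g' (T x) (\<Sum>b\<in>Basis. (T' x v \<bullet> b) *\<^sub>R b)" by (simp add: euclidean_representation)
      also have "... = (\<Sum>b\<in>Basis. (T' x v \<bullet> b) *\<^sub>R g' (T x) b)"
        by (simp add: linear_sum[OF lin] linear_scale[OF lin])
      finally show "(\<Sum>b\<in>Basis. (T' x v \<bullet> b) *\<^sub>R ((\<lambda>y. g' y b) \<circ> T) x) = (g' (T x) \<circ> T' x) v" by simp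
    qed
  qed
  then show ?case using 1 unfolding Holder_on_Suc by (intro exI[of _ "\<lambda>x. g' (T x) \<circ> T' x"]) simp
qed

lemma Holder_on_bounded_linear:
  assumes L: "bounded_linear L" shows "Holder_on k 0 S L"
proof (cases k)
  case 0
  then show ?thesis by (simp add: locally_Holder_on_0 linear_continuous_on[OF L])
next
  case (Suc j)
  have "(L has_derivative L) (at x within S)" for x
    by (rule bounded_linear.has_derivative[OF L has_derivative_ident])
  then show ?thesis unfolding Suc Holder_on_Suc using Holder_on_const by (intro exI[of _ "\<lambda>x. L"]) auto
qed

section \<open>Smooth functions\<close>

abbreviation smooth :: "('a::euclidean_space => 'b::euclidean_space) => bool" where
  "smooth \<equiv> C_on \<infinity> UNIV"

lemma C_on_infinity: "C_on \<infinity> S f \<longleftrightarrow> (\<forall>k. Holder_on k 0 S f)" by (simp add: C_on_iff_Holder_on)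

lemma C_on_infinity_imp_Holder_on:
  assumes "locally_convex S" "0 <= alpha" "alpha <= 1" "C_on \<infinity> S f" shows "Holder_on k alpha S f"
  using assms(4) by (intro Holder_on_decr[OF assms(1-3), of _ 0]) (simp add: C_on_infinity)

lemma smooth_on_cong: "C_on \<infinity> S f ==> (\<And>x. x \<in> S ==> f x = g x) ==> C_on \<infinity> S g"
  by (auto simp: C_on_infinity intro: Holder_on_cong)

lemma smooth_on_add: "C_on \<infinity> S f ==> C_on \<infinity> S g ==> C_on \<infinity> S (\<lambda>x. f x + g x)"
  by (auto simp: C_on_infinity intro: Holder_on_add)

lemma smooth_on_sum:
  "finite I ==> (\<And>i. i \<in> I ==> C_on \<infinity> S (f i)) ==> C_on \<infinity> S (\<lambda>x. \<Sum>i\<in>I. f i x)"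
  by (auto simp: C_on_infinity intro: Holder_on_sum)

lemma smooth_on_linear: "bounded_linear L ==> C_on \<infinity> S f ==> C_on \<infinity> S (\<lambda>x. L (f x))"
  by (auto simp: C_on_infinity intro: Holder_on_linear)

lemma smooth_on_bounded_linear: "bounded_linear L ==> C_on \<infinity> S L"
  by (auto simp: C_on_infinity intro: Holder_on_bounded_linear)

lemma smooth_on_const: "C_on \<infinity> S (\<lambda>x. c)" by (auto simp: C_on_infinity intro: Holder_on_const)

lemma smooth_on_scaleR:
  fixes r :: "'a::euclidean_space => real"
  shows "locally_convex S ==> C_on \<infinity> S r ==> C_on \<infinity> S f ==> C_on \<infinity> S (\<lambda>x. r x *\<^sub>R f x)"
  by (auto simp: C_on_infinity intro: Holder_on_scaleR)

lemma smooth_on_mult: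
  fixes f g :: "'a::euclidean_space => real"
  shows "locally_convex S ==> C_on \<infinity> S f ==> C_on \<infinity> S g ==> C_on \<infinity> S (\<lambda>x. f x * g x)"
  by (auto simp: C_on_infinity intro: Holder_on_mult)

lemma smooth_on_inverse:
  fixes f :: "'a::euclidean_space => real"
  shows "locally_convex S ==> C_on \<infinity> S f ==> (\<And>x. x \<in> S ==> f x \<noteq> 0) ==> C_on \<infinity> S (\<lambda>x. inverse (f x))"
  by (auto simp: C_on_infinity intro: Holder_on_inverse)

lemma smooth_on_compose:
  "locally_convex S ==> T ` S \<subseteq> S' ==> locally_convex S' ==> C_on \<infinity> S T ==> C_on \<infinity> S' g ==> C_on \<infinity> S (g \<circ> T)"
  unfolding C_on_infinity using Holder_on_compose by blast

lemma smooth_on_imp_continuous: "C_on \<infinity> S f ==> continuous_on S f"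
  unfolding C_on_infinity using Holder_on_0[of 0 S f] by (auto simp: locally_Holder_on_0 simp del: Holder_on_0)

section \<open>Bump functions\<close>

text \<open>The case m = 0 is the usual flat function exp(-1/t). Derivatives of members of the
  family are combinations of members, so a single induction over all m proves smoothness.\<close>

definition exp_flat :: "nat => real => real" where
  "exp_flat m t = (if t > 0 then exp (- inverse t) * inverse t ^ m else 0)"

text \<open>The term of degree m + 2 in the exponential series of 1/t beats the factor t^(-m) by
  t^2. The quadratic bound makes the derivative at 0 vanish.\<close>

lemma exp_flat_le:
  "\<bar>exp_flat m t\<bar> <= fact (m + 2) * t\<^sup>2"
proof (cases "t > 0")
  case True
  have "inverse t ^ (m + 2) / fact (m + 2) <= exp (inverse t)"
  proof -
    have "(\<Sum>i\<in>{m+2}. inverse t ^ i /\<^sub>R fact i) <= exp (inverse t)" unfolding exp_def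
      using summable_exp_generic[of "inverse t"] True by (intro sum_le_suminf) auto
    then show ?thesis by (simp add: divide_inverse mult.commute)
  qed
  then have "inverse t ^ (m + 2) <= fact (m + 2) * exp (inverse t)" by (simp add: divide_le_eq mult.commute)
  then have "inverse t ^ (m + 2) * t\<^sup>2 * exp (- inverse t) <= fact (m + 2) * exp (inverse t) * t\<^sup>2 * exp (- inverse t)"
    by (intro mult_right_mono) auto
  moreover have "inverse t ^ (m + 2) * t\<^sup>2 = inverse t ^ m"
  proof -
    have "(inverse t)\<^sup>2 * t\<^sup>2 = 1" using True by (simp add: power_mult_distrib[symmetric])
    moreover have "inverse t ^ (m + 2) = inverse t ^ m * (inverse t)\<^sup>2" by (rule power_add)
    ultimately show ?thesis by (metis mult.assoc mult.right_neutral)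
  qed
  moreover have "fact (m + 2) * exp (inverse t) * t\<^sup>2 * exp (- inverse t) = fact (m + 2) * t\<^sup>2"
    by (simp add: exp_minus)
  ultimately have "inverse t ^ m * exp (- inverse t) <= fact (m + 2) * t\<^sup>2" by metis
  then show ?thesis using True by (simp add: exp_flat_def abs_mult mult.commute)
qed (simp add: exp_flat_def)

lemma exp_flat_has_derivative:
  "(exp_flat m has_real_derivative (exp_flat (m + 2) t - real m * exp_flat (m + 1) t)) (at t)"
proof -
  consider "t > 0" | "t < 0" | "t = 0" by linarith
  then show ?thesis
  proof cases
    case 1
    have "((\<lambda>t. exp (- inverse t) * inverse t ^ m) has_real_derivative
        (exp (- inverse t) * inverse t ^ (m + 2) - real m * (exp (- inverse t) * inverse t ^ (m + 1)))) (at t)"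
    proof -
      have "((\<lambda>t. inverse t ^ m) has_real_derivative (- (real m * inverse t ^ (m + 1)))) (at t)"
        using DERIV_power[OF DERIV_inverse, of t m UNIV] 1 by (cases m) (simp_all add: algebra_simps)
      moreover have "((\<lambda>t. exp (- inverse t)) has_real_derivative (exp (- inverse t) * (inverse t)\<^sup>2)) (at t)"
        using 1 by (auto intro!: derivative_eq_intros simp: power2_eq_square)
      ultimately have "((\<lambda>t. exp (- inverse t) * inverse t ^ m) has_real_derivative
          exp (- inverse t) * (inverse t)\<^sup>2 * inverse t ^ m + - (real m * inverse t ^ (m + 1)) * exp (- inverse t)) (at t)"
        by (rule DERIV_mult[rotated])
      then show ?thesis by (rule DERIV_cong) (simp add: algebra_simps power2_eq_square)
    qed
    then show ?thesis using 1
      by (rule_tac has_field_derivative_transform_within_open[of "\<lambda>t. exp (- inverse t) * inverse t ^ m" _ _ "{0<..}"])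
         (auto simp: exp_flat_def)
  next
    case 2
    have "((\<lambda>t. 0) has_real_derivative 0) (at t)" by simp
    then show ?thesis using 2 by (rule_tac has_field_derivative_transform_within_open[of "\<lambda>t. 0" _ _ "{..<0}"])
         (auto simp: exp_flat_def)
  next
    case 3
    have "((\<lambda>h. (exp_flat m h - exp_flat m 0) / h) \<longlongrightarrow> 0) (at 0)"
    proof (rule Lim_null_comparison)
      have "norm ((exp_flat m h - exp_flat m 0) / h) <= fact (m + 2) * \<bar>h\<bar>" if "h \<noteq> 0" for h
        using exp_flat_le[of m h] that
        by (simp add: exp_flat_def[of _ 0] abs_divide divide_le_eq power2_eq_square mult.assoc)
      then show "\<forall>\<^sub>F h in at 0. norm ((exp_flat m h - exp_flat m 0) / h) <= fact (m + 2) * \<bar>h\<bar>"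
        by (auto simp: eventually_at intro: exI[of _ 1])
      show "((\<lambda>h. fact (m + 2) * \<bar>h\<bar>) \<longlongrightarrow> 0) (at (0::real))" by (auto intro!: tendsto_eq_intros)
    qed
    then show ?thesis by (simp add: 3 DERIV_def exp_flat_def)
  qed
qed

lemma smooth_exp_flat: "smooth (exp_flat m)"
proof -
  have "Holder_on k 0 UNIV (exp_flat m)" for k m
  proof (induction k arbitrary: m)
    case 0
    have "isCont (exp_flat m) x" for x using exp_flat_has_derivative DERIV_isCont by blast
    then show ?case by (simp add: locally_Holder_on_0 continuous_at_imp_continuous_on)
  next
    case (Suc k)
    have "(exp_flat m has_derivative (\<lambda>v. v * (exp_flat (m + 2) t - real m * exp_flat (m + 1) t))) (at t)" for t
      using exp_flat_has_derivative[of m t] by (simp add: has_field_derivative_def mult.commute[of _ "_ - _"])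
    moreover have "Holder_on k 0 UNIV (\<lambda>t. v * (exp_flat (m + 2) t - real m * exp_flat (m + 1) t))" for v
    proof -
      have "Holder_on k 0 UNIV (\<lambda>t. v * (exp_flat (m + 2) t + (- real m) * exp_flat (m + 1) t))"
        by (intro Holder_on_linear[OF bounded_linear_mult_right] Holder_on_add Suc.IH)
      then show ?thesis by simp
    qed
    ultimately show ?case unfolding Holder_on_Suc
      by (intro exI[of _ "\<lambda>t v. v * (exp_flat (m + 2) t - real m * exp_flat (m + 1) t)"]) auto
  qed
  then show ?thesis by (simp add: C_on_infinity)
qed

text \<open>The squared distance is a polynomial, which keeps the bump smooth at its centre.\<close>

definition bump :: "'a::euclidean_space => real => 'a => real" where
  "bump p r x = exp_flat 0 (r\<^sup>2 - (x - p) \<bullet> (x - p))"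

lemma bump_nonneg: "bump p r x >= 0" by (simp add: bump_def exp_flat_def)

lemma bump_pos_iff: "r > 0 ==> bump p r x > 0 \<longleftrightarrow> dist p x < r"
proof -
  assume "r > 0"
  then have "(norm (x - p))\<^sup>2 < r\<^sup>2 \<longleftrightarrow> norm (x - p) < r"
    by (meson less_imp_le norm_ge_zero power2_less_imp_less power_strict_mono zero_less_numeral)
  then show ?thesis
    by (simp add: bump_def exp_flat_def dist_norm norm_minus_commute[of p] power2_norm_eq_inner[symmetric])
qed

lemma bump_eq_0_iff: "r > 0 ==> bump p r x = 0 \<longleftrightarrow> r <= dist p x"
  using bump_pos_iff[of r p x] bump_nonneg[of p r x] by linarith

lemma smooth_bump: "smooth (bump (p::'a::euclidean_space) r)"
proof -
  have "smooth (\<lambda>x. r\<^sup>2 + - (\<Sum>b\<in>Basis. ((x \<bullet> b) + - (p \<bullet> b)) * ((x \<bullet> b) + - (p \<bullet> b))))"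
    by (intro smooth_on_add smooth_on_const smooth_on_linear[OF bounded_linear_minus[OF bounded_linear_ident]]
        smooth_on_sum smooth_on_mult locally_convex_UNIV smooth_on_bounded_linear bounded_linear_inner_left) auto
  then have "smooth (\<lambda>x. r\<^sup>2 - (x - p) \<bullet> (x - p))"
    by (rule smooth_on_cong) (subst euclidean_inner, simp add: inner_diff_left)
  then have "smooth (exp_flat 0 \<circ> (\<lambda>x. r\<^sup>2 - (x - p) \<bullet> (x - p)))"
    by (intro smooth_on_compose[where S' = UNIV] locally_convex_UNIV smooth_exp_flat) auto
  then show ?thesis by (rule smooth_on_cong) (simp add: bump_def)
qed

section \<open>Test functions and mollification\<close>

text \<open>The direction comes first, so that iterated derivatives are powers
  \<open>dd v ^^ n\<close> of an operator.\<close>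

definition dd :: "'a::euclidean_space => ('a => real) => 'a => real" where
  "dd v f x = frechet_derivative f (at x) v"

lemma dd_eq: "(f has_derivative f') (at x) ==> dd v f x = f' v"
  unfolding dd_def using frechet_derivative_at by metis

lemma smooth_has_derivative:
  assumes "smooth f" shows "(f has_derivative (\<lambda>v. dd v f x)) (at x)"
proof -
  have "Holder_on (Suc 0) 0 UNIV f" using assms by (simp add: C_on_infinity)
  then obtain f' where "(f has_derivative f') (at x)" by (auto simp: Holder_on_Suc)
  then show ?thesis using dd_eq by (metis (no_types, lifting) ext)
qed

lemma dd_linear: "smooth f ==> linear (\<lambda>v. dd v f x)" using smooth_has_derivative has_derivative_linear by blast

lemma dd_expand:
  assumes "smooth f" shows "dd v f x = (\<Sum>b\<in>Basis. (v \<bullet> b) * dd b f x)"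
proof -
  have "dd v f x = dd (\<Sum>b\<in>Basis. (v \<bullet> b) *\<^sub>R b) f x" by (simp add: euclidean_representation)
  also have "... = (\<Sum>b\<in>Basis. dd ((v \<bullet> b) *\<^sub>R b) f x)" by (rule linear_sum[OF dd_linear[OF assms]])
  also have "... = (\<Sum>b\<in>Basis. (v \<bullet> b) * dd b f x)" using linear_scale[OF dd_linear[OF assms]] by simp
  finally show ?thesis .
qed

lemma smooth_dd:
  assumes "smooth f" shows "smooth (dd v f)" unfolding C_on_infinity
proof
  fix k
  have "Holder_on (Suc k) 0 UNIV f" using assms by (simp add: C_on_infinity)
  then obtain f' where f': "\<And>x. (f has_derivative f' x) (at x)" "\<And>v. Holder_on k 0 UNIV (\<lambda>x. f' x v)"
    by (auto simp: Holder_on_Suc)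
  have "(\<lambda>x. f' x v) = dd v f" using dd_eq[OF f'(1)] by (auto simp: fun_eq_iff)
  then show "Holder_on k 0 UNIV (dd v f)" using f'(2) by metis
qed

lemma test_function_smooth: "test_function U psi ==> smooth psi" by (simp add: test_function_def)

lemma test_function_mono: "test_function U psi ==> U \<subseteq> U' ==> test_function U' psi"
  unfolding test_function_def by blast

lemma test_function_dd:
  assumes "test_function U psi" shows "test_function U (dd v psi)"
proof -
  obtain K where K: "compact K" "K \<subseteq> U" "\<And>x. x \<notin> K ==> psi x = 0" using assms by (auto simp: test_function_def)
  have "dd v psi x = 0" if "x \<notin> K" for x
  proof -
    have "((\<lambda>x. 0) has_derivative (\<lambda>v. 0)) (at x)" by simp
    then have "(psi has_derivative (\<lambda>v. 0)) (at x)" by (rule has_derivative_transform_within_open[of _ _ _ _ "- K"])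
         (use K that compact_imp_closed in auto)
    then show ?thesis using dd_eq by blast
  qed
  then show ?thesis using K smooth_dd[OF test_function_smooth[OF assms]] unfolding test_function_def by blast
qed

lemma test_function_bounded:
  assumes "test_function U psi"
  obtains B where "B > 0" "\<And>x. \<bar>psi x\<bar> <= B"
proof -
  obtain K where K: "compact K" "\<And>x. x \<notin> K ==> psi x = 0" using assms by (auto simp: test_function_def)
  have "continuous_on K psi"
    using test_function_smooth[OF assms] smooth_on_imp_continuous continuous_on_subset by blast
  then have "bounded (psi ` K)" using K(1) compact_continuous_image compact_imp_bounded by blast
  then obtain B where B: "B > 0" "\<And>x. x \<in> K ==> \<bar>psi x\<bar> <= B" by (auto simp: bounded_pos)
  then show ?thesis using K(2) that[of B] by (metis abs_zero less_imp_le)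
qed

lemma test_function_borel: "test_function U psi ==> psi \<in> borel_measurable borel"
  using test_function_smooth smooth_on_imp_continuous borel_measurable_continuous_onI by blast

text \<open>The second derivatives are bounded because of compact support, so the quadratic
  remainder is uniform in z. That uniformity allows differentiation under the integral in
  \<open>mol_has_derivative\<close>.\<close>

lemma test_function_taylor:
  assumes "test_function U psi"
  obtains C where "C > 0" "\<And>z h. \<bar>psi (z + h) - psi z - dd h psi z\<bar> <= C * (norm h)\<^sup>2"
    "\<And>x y. \<bar>psi x - psi y\<bar> <= C * norm (x - y)"
proof -
  have lip: "\<exists>L>0. \<forall>x y. \<bar>phi x - phi y\<bar> <= L * norm (x - y)" if phi: "test_function U phi" for phi :: "'a => real"
  proof -
    have "\<exists>B>0. \<forall>x. \<bar>dd b phi x\<bar> <= B" for b using test_function_bounded[OF test_function_dd[OF phi]] by metis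
    then obtain B where B: "\<And>b. B b > 0" "\<And>b x. \<bar>dd b phi x\<bar> <= B b" by metis
    define L where "L = (\<Sum>b\<in>Basis. B b)"
    have Lpos: "L > 0" unfolding L_def using B(1) by (intro sum_pos) auto
    have on: "onorm (\<lambda>v. dd v phi x) <= L" for x
    proof (rule onorm_le)
      fix v
      have "norm (dd v phi x) = norm (\<Sum>b\<in>Basis. (v \<bullet> b) *\<^sub>R dd b phi x)"
        using dd_expand[OF test_function_smooth[OF phi], of v x] by simp
      also have "... <= (\<Sum>b\<in>Basis. norm v * B b)"
      proof (rule sum_norm_le)
        fix b :: 'a assume b: "b \<in> Basis"
        have "norm ((v \<bullet> b) *\<^sub>R dd b phi x) = \<bar>v \<bullet> b\<bar> * \<bar>dd b phi x\<bar>" by (simp add: abs_mult)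
        also have "... <= norm v * B b" by (intro mult_mono Basis_le_norm b B) auto
        finally show "norm ((v \<bullet> b) *\<^sub>R dd b phi x) <= norm v * B b" .
      qed
      finally show "norm (dd v phi x) <= L * norm v" by (simp add: L_def sum_distrib_left[symmetric] mult.commute[of "sum B Basis"])
    qed
    have "\<bar>phi x - phi y\<bar> <= L * norm (x - y)" for x y
      using differentiable_bound[OF convex_UNIV, of phi "\<lambda>x v. dd v phi x" L x y]
        smooth_has_derivative[OF test_function_smooth[OF phi]] on by auto
    then show ?thesis using Lpos by blast
  qed
  have "\<exists>L>0. \<forall>x y. \<bar>dd b psi x - dd b psi y\<bar> <= L * norm (x - y)" for b using lip[OF test_function_dd[OF assms]] .
  then obtain L where L: "\<And>b. L b > 0" "\<And>b x y. \<bar>dd b psi x - dd b psi y\<bar> <= L b * norm (x - y)" by metis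
  obtain L0 where L0: "L0 > 0" "\<And>x y. \<bar>psi x - psi y\<bar> <= L0 * norm (x - y)" using lip[OF assms] by blast
  define M where "M = (\<Sum>b\<in>Basis. L b)"
  have Mpos: "M > 0" unfolding M_def using L(1) by (intro sum_pos) auto
  have tay: "\<bar>psi (z + h) - psi z - dd h psi z\<bar> <= M * (norm h)\<^sup>2" for z h
  proof -
    have "norm (psi (z + h) - psi z - dd (z + h - z) psi z) <= norm (z + h - z) * (M * norm h)"
    proof (rule differentiable_bound_linearization[where S = "cball z (norm h)" and f' = "\<lambda>x v. dd v psi x"])
      show "z + t *\<^sub>R (z + h - z) \<in> cball z (norm h)" if "t \<in> {0..1}" for t :: real
        using that by (auto simp: dist_norm intro!: mult_left_le_one_le)
      show "(psi has_derivative (\<lambda>v. dd v psi x)) (at x within cball z (norm h))" for x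
        using smooth_has_derivative[OF test_function_smooth[OF assms]] has_derivative_at_withinI by blast
      show "onorm ((\<lambda>v. dd v psi x) - (\<lambda>v. dd v psi z)) <= M * norm h" if x: "x \<in> cball z (norm h)" for x
      proof (rule onorm_le)
        fix v
        have sm: "smooth psi" using test_function_smooth assms by blast
        note rep = dd_expand[OF sm, of v]
        have "dd v psi x - dd v psi z = (\<Sum>b\<in>Basis. (v \<bullet> b) * (dd b psi x - dd b psi z))"
          by (simp add: rep[of x] rep[of z] sum_subtractf right_diff_distrib)
        then have "norm (((\<lambda>v. dd v psi x) - (\<lambda>v. dd v psi z)) v) = norm (\<Sum>b\<in>Basis. (v \<bullet> b) * (dd b psi x - dd b psi z))"
          by simp
        also have "... <= (\<Sum>b\<in>Basis. norm v * (L b * norm h))"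
        proof (rule sum_norm_le)
          fix b :: 'a assume b: "b \<in> Basis"
          have "norm ((v \<bullet> b) * (dd b psi x - dd b psi z)) = \<bar>v \<bullet> b\<bar> * \<bar>dd b psi x - dd b psi z\<bar>" by (simp add: abs_mult)
          also have "... <= norm v * (L b * norm (x - z))" by (intro mult_mono Basis_le_norm b L) auto
          also have "... <= norm v * (L b * norm h)"
            using x L(1)[of b] by (intro mult_left_mono) (auto simp: dist_norm norm_minus_commute)
          finally show "norm ((v \<bullet> b) * (dd b psi x - dd b psi z)) <= norm v * (L b * norm h)" .
        qed
        also have "... = M * norm h * norm v" by (simp add: M_def sum_distrib_left sum_distrib_right mult_ac)
        finally show "norm (((\<lambda>v. dd v psi x) - (\<lambda>v. dd v psi z)) v) <= M * norm h * norm v" .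
      qed
    qed simp
    then show ?thesis by (simp add: power2_eq_square mult_ac)
  qed
  show ?thesis
  proof (rule that[of "max M L0"])
    show "max M L0 > 0" using Mpos by simp
    show "\<bar>psi (z + h) - psi z - dd h psi z\<bar> <= max M L0 * (norm h)\<^sup>2" for z h
      using tay[of z h] mult_right_mono[of M "max M L0" "(norm h)\<^sup>2"] by auto
    show "\<bar>psi x - psi y\<bar> <= max M L0 * norm (x - y)" for x y
      using L0(2)[of x y] mult_right_mono[of L0 "max M L0" "norm (x - y)"] by auto
  qed
qed

text \<open>A correlation rather than a convolution: the value at x averages g over x plus the
  support of \<open>psi\<close>. A kernel supported on inward vectors thus samples g at points
  inward from x. The price is a minus sign in every derivative.\<close>

definition mol :: "('a::euclidean_space => real) => ('a => real) => 'a => real" where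
  "mol psi g x = (LINT y|lborel. psi (y - x) * g y)"

lemma integrable_bounded_mult:
  fixes g h :: "'a => real"
  assumes "integrable M g" "h \<in> borel_measurable M" "\<And>x. \<bar>h x\<bar> <= B" shows "integrable M (\<lambda>x. h x * g x)"
proof (rule Bochner_Integration.integrable_bound)
  show "integrable M (\<lambda>x. B * g x)" using assms(1) by simp
  show "(\<lambda>x. h x * g x) \<in> borel_measurable M" using assms by measurable
  have "norm (h x * g x) <= norm (B * g x)" for x
  proof -
    have "\<bar>h x\<bar> * \<bar>g x\<bar> <= \<bar>B\<bar> * \<bar>g x\<bar>" using assms(3)[of x] by (intro mult_right_mono) linarith+
    then show ?thesis by (simp add: abs_mult)
  qed
  then show "AE x in M. norm (h x * g x) <= norm (B * g x)" by simp
qed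

lemma mol_integrand_integrable:
  assumes "test_function U psi" "integrable lborel g" shows "integrable lborel (\<lambda>y. psi (y - x) * g y)"
proof -
  obtain B where B: "\<And>x. \<bar>psi x\<bar> <= B" using test_function_bounded assms(1) by metis
  have [measurable]: "psi \<in> borel_measurable borel" using test_function_borel assms(1) by blast
  show ?thesis by (rule integrable_bounded_mult[OF assms(2) _ B]) simp
qed

lemma mol_has_derivative:
  assumes psi: "test_function U psi" and g: "integrable lborel g"
  shows "(mol psi g has_derivative (\<lambda>v. - mol (dd v psi) g x)) (at x)"
proof -
  obtain C where C: "C > 0" "\<And>z h. \<bar>psi (z + h) - psi z - dd h psi z\<bar> <= C * (norm h)\<^sup>2"
    using test_function_taylor[OF psi] by metis
  have sm: "smooth psi" using psi test_function_smooth by blast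
  note int = mol_integrand_integrable[OF _ g]
  have dds: "dd (v + w) psi z = dd v psi z + dd w psi z" "dd (c *\<^sub>R v) psi z = c * dd v psi z" for v w z c
    using linear_add[OF dd_linear[OF sm]] linear_scale[OF dd_linear[OF sm]] by auto
  have lin: "linear (\<lambda>v. - mol (dd v psi) g x)"
  proof (rule linearI)
    fix v w :: 'a
    have "mol (dd (v + w) psi) g x = mol (dd v psi) g x + mol (dd w psi) g x" unfolding mol_def dds distrib_right
      by (intro Bochner_Integration.integral_add int[OF test_function_dd[OF psi]])
    then show "- mol (dd (v + w) psi) g x = - mol (dd v psi) g x + - mol (dd w psi) g x" by simp
    show "- mol (dd (c *\<^sub>R v) psi) g x = c *\<^sub>R (- mol (dd v psi) g x)" for c
      unfolding mol_def dds by (simp add: mult.assoc)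
  qed
  define A where "A = C * (LINT y|lborel. \<bar>g y\<bar>)"
  have bnd: "\<bar>mol psi g (x + h) - mol psi g x - (- mol (dd h psi) g x)\<bar> <= A * (norm h)\<^sup>2" for h
  proof -
    have eq: "psi (y - (x + h)) * g y - psi (y - x) * g y - dd (- h) psi (y - x) * g y
        = (psi ((y - x) + (- h)) - psi (y - x) - dd (- h) psi (y - x)) * g y" for y by (simp add: algebra_simps)
    have m: "dd (- h) psi z = - dd h psi z" for z using dds(2)[of "-1" h z] by simp
    have "mol psi g (x + h) - mol psi g x - (- mol (dd h psi) g x)
       = (LINT y|lborel. psi (y - (x + h)) * g y) - (LINT y|lborel. psi (y - x) * g y) - (LINT y|lborel. dd (- h) psi (y - x) * g y)"
      by (simp add: mol_def m)
    also have "... = (LINT y|lborel. psi (y - (x + h)) * g y - psi (y - x) * g y - dd (- h) psi (y - x) * g y)"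
      by (simp add: int[OF psi] int[OF test_function_dd[OF psi]])
    also have "\<bar>...\<bar> <= (LINT y|lborel. C * (norm h)\<^sup>2 * \<bar>g y\<bar>)"
    proof (rule order_trans[OF integral_abs_bound integral_mono])
      show "integrable lborel (\<lambda>y. \<bar>psi (y - (x + h)) * g y - psi (y - x) * g y - dd (- h) psi (y - x) * g y\<bar>)"
        by (intro integrable_abs Bochner_Integration.integrable_diff int[OF psi] int[OF test_function_dd[OF psi]])
      show "integrable lborel (\<lambda>y. C * (norm h)\<^sup>2 * \<bar>g y\<bar>)" using g by simp
      show "\<bar>psi (y - (x + h)) * g y - psi (y - x) * g y - dd (- h) psi (y - x) * g y\<bar> <= C * (norm h)\<^sup>2 * \<bar>g y\<bar>" for y
        unfolding eq abs_mult using C(2)[of "y - x" "- h"] by (intro mult_right_mono) auto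
    qed
    finally show ?thesis by (simp add: A_def mult_ac)
  qed
  show ?thesis unfolding has_derivative_at
  proof
    show "bounded_linear (\<lambda>v. - mol (dd v psi) g x)" using lin linear_conv_bounded_linear by blast
    show "(\<lambda>h. norm (mol psi g (x + h) - mol psi g x - (- mol (dd h psi) g x)) / norm h) \<midarrow>0\<rightarrow> 0"
    proof (rule Lim_null_comparison)
      have "norm (norm (mol psi g (x + h) - mol psi g x - (- mol (dd h psi) g x)) / norm h) <= A * norm h" for h
        using bnd[of h] by (cases "h = 0") (auto simp: divide_le_eq power2_eq_square mult_ac)
      then show "\<forall>\<^sub>F h in at 0. norm (norm (mol psi g (x + h) - mol psi g x - (- mol (dd h psi) g x)) / norm h) <= A * norm h"
        by simp
      show "((\<lambda>h. A * norm h) \<longlongrightarrow> 0) (at 0)" by (auto intro!: tendsto_eq_intros)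
    qed
  qed
qed

lemma dd_mol:
  "test_function U psi ==> integrable lborel g ==> dd v (mol psi g) x = - mol (dd v psi) g x"
  by (rule dd_eq[OF mol_has_derivative])

lemma smooth_mol:
  assumes g: "integrable lborel g" shows "test_function U psi ==> smooth (mol psi g)"
proof -
  have "test_function U psi ==> Holder_on k 0 UNIV (mol psi g)" for k
  proof (induction k arbitrary: psi)
    case 0
    have "isCont (mol psi g) x" for x using mol_has_derivative[OF 0 g] has_derivative_continuous by blast
    then show ?case by (simp add: locally_Holder_on_0 continuous_at_imp_continuous_on)
  next
    case (Suc k)
    have "Holder_on k 0 UNIV (\<lambda>x. - mol (dd v psi) g x)" for v
      by (intro Holder_on_linear[OF bounded_linear_minus[OF bounded_linear_ident]] Suc.IH test_function_dd Suc.prems)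
    then show ?case unfolding Holder_on_Suc using mol_has_derivative[OF Suc.prems g]
      by (intro exI[of _ "\<lambda>x v. - mol (dd v psi) g x"]) auto
  qed
  then show "test_function U psi ==> smooth (mol psi g)" by (simp add: C_on_infinity)
qed

definition mollifier :: "('a::euclidean_space => real) => bool" where
  "mollifier kappa \<longleftrightarrow> test_function UNIV kappa \<and> (\<forall>x. 0 <= kappa x) \<and> (LINT x|lborel. kappa x) = 1"

lemma nn_integral_lborel_reflect:
  fixes f :: "'a::euclidean_space => ennreal"
  assumes [measurable]: "f \<in> borel_measurable borel" shows "(\<integral>\<^sup>+x. f (y - x) \<partial>lborel) = (\<integral>\<^sup>+x. f x \<partial>lborel)"
proof -
  have "(\<integral>\<^sup>+x. f x \<partial>lborel) = (\<integral>\<^sup>+x. f x \<partial>(density (distr lborel borel (\<lambda>x. y + (-1) *\<^sub>R x)) (\<lambda>_. 1)))"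
    using lborel_affine[of "-1" y] by simp
  also have "... = (\<integral>\<^sup>+x. f (y - x) \<partial>lborel)" by (subst nn_integral_density) (auto simp: nn_integral_distr)
  finally show ?thesis by simp
qed

lemma nn_integral_lborel_shift:
  fixes f :: "'a::euclidean_space => ennreal"
  assumes [measurable]: "f \<in> borel_measurable borel" shows "(\<integral>\<^sup>+x. f (x + y) \<partial>lborel) = (\<integral>\<^sup>+x. f x \<partial>lborel)"
proof -
  have "(\<integral>\<^sup>+x. f x \<partial>lborel) = (\<integral>\<^sup>+x. f x \<partial>(density (distr lborel borel (\<lambda>x. y + 1 *\<^sub>R x)) (\<lambda>_. 1)))"
    using lborel_affine[of "1" y] by simp
  also have "... = (\<integral>\<^sup>+x. f (x + y) \<partial>lborel)"
    by (subst nn_integral_density) (auto simp: nn_integral_distr add.commute)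
  finally show ?thesis by simp
qed

lemma mollifier_test: "mollifier kappa ==> test_function UNIV kappa" by (simp add: mollifier_def)

lemma mollifier_nonneg: "mollifier kappa ==> 0 <= kappa x" by (simp add: mollifier_def)

lemma mollifier_borel: "mollifier kappa ==> kappa \<in> borel_measurable borel"
  using test_function_borel mollifier_test by blast

lemma mollifier_integrable: "mollifier kappa ==> integrable lborel kappa"
  unfolding mollifier_def using not_integrable_integral_eq by fastforce

lemma mollifier_nn_integral: "mollifier kappa ==> (\<integral>\<^sup>+x. ennreal (kappa x) \<partial>lborel) = 1"
  by (subst nn_integral_eq_integral) (auto simp: mollifier_integrable mollifier_nonneg, simp add: mollifier_def)

lemma mollifier_reflect_nn_integral:
  assumes "mollifier kappa" shows "(\<integral>\<^sup>+x. ennreal (kappa (y - x)) \<partial>lborel) = 1"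
  using nn_integral_lborel_reflect[of "\<lambda>x. ennreal (kappa x)" y] mollifier_borel[OF assms] mollifier_nn_integral[OF assms]
  by simp

lemma mollifier_shift_nn_integral:
  assumes "mollifier kappa" shows "(\<integral>\<^sup>+y. ennreal (kappa (y - x)) \<partial>lborel) = 1"
  using nn_integral_lborel_shift[of "\<lambda>x. ennreal (kappa x)" "- x"] mollifier_borel[OF assms] mollifier_nn_integral[OF assms]
  by simp

lemma mollifier_shift_integral:
  assumes "mollifier kappa" shows "integrable lborel (\<lambda>y. kappa (y - x))" "(LINT y|lborel. kappa (y - x)) = 1"
proof -
  have [measurable]: "kappa \<in> borel_measurable borel" by (rule mollifier_borel[OF assms])
  show "integrable lborel (\<lambda>y. kappa (y - x))"
    using mollifier_shift_nn_integral[OF assms, of x] mollifier_nonneg[OF assms] by (intro integrableI_nonneg) auto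
  show "(LINT y|lborel. kappa (y - x)) = 1"
    using mollifier_shift_nn_integral[OF assms, of x] mollifier_nonneg[OF assms]
    by (subst integral_eq_nn_integral) auto
qed

text \<open>Tonelli's theorem and the total mass 1 of the reflected kernel.\<close>

lemma nn_integral_mol:
  fixes g :: "'a::euclidean_space => real"
  assumes kappa: "mollifier kappa" and g: "integrable lborel g" "\<And>x. 0 <= g x"
  shows "(\<integral>\<^sup>+x. ennreal (mol kappa g x) \<partial>lborel) = (\<integral>\<^sup>+x. ennreal (g x) \<partial>lborel)"
proof -
  have [measurable]: "kappa \<in> borel_measurable borel" "g \<in> borel_measurable borel"
    using mollifier_borel[OF kappa] g(1) by auto
  have nn: "0 <= kappa x" for x by (rule mollifier_nonneg[OF kappa])
  have "(\<integral>\<^sup>+x. ennreal (mol kappa g x) \<partial>lborel) = (\<integral>\<^sup>+x. \<integral>\<^sup>+y. ennreal (kappa (y - x) * g y) \<partial>lborel \<partial>lborel)"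
    unfolding mol_def using nn g(2) mol_integrand_integrable[OF mollifier_test[OF kappa] g(1)]
    by (subst nn_integral_eq_integral[symmetric]) auto
  also have "... = (\<integral>\<^sup>+y. \<integral>\<^sup>+x. ennreal (kappa (y - x) * g y) \<partial>lborel \<partial>lborel)" by (rule lborel_pair.Fubini') simp
  also have "... = (\<integral>\<^sup>+y. \<integral>\<^sup>+x. ennreal (kappa (y - x)) * ennreal (g y) \<partial>lborel \<partial>lborel)"
    using nn g(2) by (simp add: ennreal_mult)
  also have "... = (\<integral>\<^sup>+y. ennreal (g y) \<partial>lborel)"
    by (subst nn_integral_multc) (auto simp: mollifier_reflect_nn_integral[OF kappa])
  finally show ?thesis .
qed

lemma mol_abs_le:
  assumes kappa: "mollifier kappa" and g: "integrable lborel g" shows "\<bar>mol kappa g x\<bar> <= mol kappa (\<lambda>y. \<bar>g y\<bar>) x"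
  unfolding mol_def
  using integral_abs_bound[of lborel "\<lambda>y. kappa (y - x) * g y"] mollifier_nonneg[OF kappa] by (simp add: abs_mult)

lemma mol_borel: "mollifier kappa ==> integrable lborel g ==> mol kappa g \<in> borel_measurable borel"
  using smooth_mol mollifier_test smooth_on_imp_continuous borel_measurable_continuous_onI by blast

lemma mol_nonneg: "mollifier kappa ==> (\<And>x. 0 <= g x) ==> 0 <= mol kappa g x"
  unfolding mol_def using mollifier_nonneg by (intro integral_nonneg_AE AE_I2 mult_nonneg_nonneg) auto

lemma mol_integrable_nonneg:
  assumes kappa: "mollifier kappa" and g: "integrable lborel g" "\<And>x. 0 <= g x"
  shows "integrable lborel (mol kappa g)" "(LINT x|lborel. mol kappa g x) = (LINT x|lborel. g x)"
proof -
  have [measurable]: "mol kappa g \<in> borel_measurable borel" by (rule mol_borel[OF kappa g(1)])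
  have nn: "0 <= mol kappa g x" for x using mol_nonneg kappa g(2) by blast
  have eq: "(\<integral>\<^sup>+x. ennreal (mol kappa g x) \<partial>lborel) = ennreal (LINT x|lborel. g x)"
    unfolding nn_integral_mol[OF kappa g] using g by (intro nn_integral_eq_integral) auto
  show "integrable lborel (mol kappa g)" using eq nn by (intro integrableI_nonneg) auto
  show "(LINT x|lborel. mol kappa g x) = (LINT x|lborel. g x)"
    using eq nn g(2) by (subst integral_eq_nn_integral) (auto intro!: integral_nonneg_AE)
qed

lemma mol_integrable:
  assumes kappa: "mollifier kappa" and g: "integrable lborel g"
  shows "integrable lborel (mol kappa g)" "(LINT x|lborel. \<bar>mol kappa g x\<bar>) <= (LINT x|lborel. \<bar>g x\<bar>)"
proof -
  have a: "integrable lborel (\<lambda>x. \<bar>g x\<bar>)" using g by simp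
  note b = mol_integrable_nonneg[OF kappa a]
  show i: "integrable lborel (mol kappa g)"
  proof (rule Bochner_Integration.integrable_bound[OF b(1)])
    show "mol kappa g \<in> borel_measurable lborel" using mol_borel[OF kappa g] by simp
    show "AE x in lborel. norm (mol kappa g x) <= norm (mol kappa (\<lambda>x. \<bar>g x\<bar>) x)"
      using mol_abs_le[OF kappa g] by (intro AE_I2) (auto intro: order_trans[OF _ abs_ge_self])
  qed auto
  have "(LINT x|lborel. \<bar>mol kappa g x\<bar>) <= (LINT x|lborel. mol kappa (\<lambda>x. \<bar>g x\<bar>) x)"
    using i b(1) mol_abs_le[OF kappa g] by (intro integral_mono) auto
  then show "(LINT x|lborel. \<bar>mol kappa g x\<bar>) <= (LINT x|lborel. \<bar>g x\<bar>)" using b(2) by simp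
qed

lemma mol_add:
  "test_function U psi ==> integrable lborel g ==> integrable lborel h ==> mol psi (\<lambda>y. g y + h y) x = mol psi g x + mol psi h x"
  unfolding mol_def distrib_left by (intro Bochner_Integration.integral_add mol_integrand_integrable)

lemma mol_diff:
  "test_function U psi ==> integrable lborel g ==> integrable lborel h ==> mol psi (\<lambda>y. g y - h y) x = mol psi g x - mol psi h x"
  unfolding mol_def right_diff_distrib by (intro Bochner_Integration.integral_diff mol_integrand_integrable)

lemma mol_scale: "mol psi (\<lambda>y. c * g y) x = c * mol psi g x" unfolding mol_def by (subst mult.left_commute) simp

text \<open>The tangent line to a convex function; integrated against a probability measure it is
  Jensen's inequality. It is used for averages by kernels and for averages over intervals. The point
  s = 0 is separate because the convexity result is applied on the open half-line.\<close>

lemma powr_tangent: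
  fixes q s z :: real
  assumes "q >= 1" "s >= 0" "z > 0" shows "s powr q >= z powr q + q * z powr (q - 1) * (s - z)"
proof (cases "s = 0")
  case True
  have "z powr q = z powr (q - 1) * z" using assms powr_mult_base[of z "q - 1"] by (simp add: mult.commute)
  moreover have "z powr (q - 1) * z * (1 - q) <= 0" using assms by (intro mult_nonneg_nonpos) auto
  ultimately show ?thesis using True assms by (simp add: algebra_simps)
next
  case False
  have "s powr q - z powr q >= (q * z powr (q - 1)) * (s - z)"
  proof (rule convex_on_imp_above_tangent[where A = "{0<..}"])
    show "convex_on {0<..} (\<lambda>x. x powr q)" using powr_convex assms by blast
    show "((\<lambda>x. x powr q) has_real_derivative q * z powr (q - 1)) (at z within {0<..})"
      using assms by (auto intro!: derivative_eq_intros)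
  qed (use assms False in \<open>auto simp: interior_open\<close>)
  then show ?thesis by simp
qed

text \<open>The tangent inequality at z, the kernel average of \<open>\<bar>g\<bar>\<close>, is
  multiplied by the kernel and integrated.\<close>

lemma mol_jensen:
  assumes kappa: "mollifier kappa" and g: "integrable lborel g" and gq: "integrable lborel (\<lambda>x. \<bar>g x\<bar> powr q)" and q: "q >= 1"
  shows "\<bar>mol kappa g x\<bar> powr q <= mol kappa (\<lambda>y. \<bar>g y\<bar> powr q) x"
proof -
  have a: "integrable lborel (\<lambda>x. \<bar>g x\<bar>)" using g by simp
  define z where "z = mol kappa (\<lambda>y. \<bar>g y\<bar>) x"
  have z0: "z >= 0" unfolding z_def by (rule mol_nonneg[OF kappa]) simp
  have nn: "0 <= mol kappa (\<lambda>y. \<bar>g y\<bar> powr q) x" by (rule mol_nonneg[OF kappa]) simp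
  have "\<bar>mol kappa g x\<bar> powr q <= z powr q"
    using mol_abs_le[OF kappa g, of x] q by (intro powr_mono2) (auto simp: z_def)
  also have "z powr q <= mol kappa (\<lambda>y. \<bar>g y\<bar> powr q) x"
  proof (cases "z = 0")
    case False
    then have z: "z > 0" using z0 by simp
    have i1: "integrable lborel (\<lambda>y. kappa (y - x) * (z powr q - q * z powr (q - 1) * z) + q * z powr (q - 1) * (kappa (y - x) * \<bar>g y\<bar>))"
      using mollifier_shift_integral(1)[OF kappa] mol_integrand_integrable[OF mollifier_test[OF kappa] a] by simp
    have "z powr q = (LINT y|lborel. kappa (y - x) * (z powr q - q * z powr (q - 1) * z) + q * z powr (q - 1) * (kappa (y - x) * \<bar>g y\<bar>))"
      using mollifier_shift_integral[OF kappa, of x] mol_integrand_integrable[OF mollifier_test[OF kappa] a, of x]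
      by (simp add: z_def[unfolded mol_def, symmetric])
    also have "... <= (LINT y|lborel. kappa (y - x) * \<bar>g y\<bar> powr q)"
    proof (rule integral_mono[OF i1 mol_integrand_integrable[OF mollifier_test[OF kappa] gq]])
      fix y
      have "kappa (y - x) * (z powr q + q * z powr (q - 1) * (\<bar>g y\<bar> - z)) <= kappa (y - x) * \<bar>g y\<bar> powr q"
        using mollifier_nonneg[OF kappa] powr_tangent[OF q _ z] by (intro mult_left_mono) auto
      then show "kappa (y - x) * (z powr q - q * z powr (q - 1) * z) + q * z powr (q - 1) * (kappa (y - x) * \<bar>g y\<bar>)
         <= kappa (y - x) * \<bar>g y\<bar> powr q" by (simp add: algebra_simps)
    qed
    finally show ?thesis by (simp add: mol_def)
  qed (use nn in simp)
  finally show ?thesis .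
qed

section \<open>A Gagliardo--Nirenberg inequality on intervals\<close>

text \<open>By induction both outer thirds of the interval contain a point where the m-th derivative
  is small. These points are at least a third of the length apart, and the mean value theorem
  between them gives a point where the next derivative is small.\<close>

lemma small_derivative_point:
  "\<exists>C\<ge>0. \<forall>F a b M. (\<forall>j t. (F j has_real_derivative F (Suc j) t) (at t)) --> a < b -->
     (\<forall>t\<in>{a..b}. \<bar>F 0 t\<bar> <= M) --> (\<exists>t\<in>{a..b}. \<bar>F m t\<bar> * (b - a) ^ m <= C * M)"
proof (induction m)
  case 0
  show ?case by (intro exI[of _ 1]) auto
next
  case (Suc m)
  then obtain C where C: "C >= 0" "\<And>F a b M. (\<forall>j t. (F j has_real_derivative F (Suc j) t) (at t)) ==> a < b ==>
     (\<forall>t\<in>{a..b}. \<bar>F 0 t\<bar> <= M) ==> \<exists>t\<in>{a..b}. \<bar>F m t\<bar> * (b - a) ^ m <= C * M" by blast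
  have "\<exists>t\<in>{a..b}. \<bar>F (Suc m) t\<bar> * (b - a) ^ Suc m <= 2 * C * 3 ^ Suc m * M"
    if D: "\<forall>j t. (F j has_real_derivative F (Suc j) t) (at t)" and ab: "a < b" and M: "\<forall>t\<in>{a..b}. \<bar>F 0 t\<bar> <= M"
    for F a b M
  proof -
    define h where "h = (b - a) / 3"
    have h: "h > 0" "b - a = 3 * h" using ab by (simp_all add: h_def)
    obtain s t where s: "s \<in> {a..a + h}" "\<bar>F m s\<bar> * h ^ m <= C * M" and t: "t \<in> {b - h..b}" "\<bar>F m t\<bar> * h ^ m <= C * M"
      using C(2)[OF D, of a "a + h" M] C(2)[OF D, of "b - h" b M] M h by auto
    have st: "s + h <= t" using s t h by auto
    then have "s < t" using h by linarith
    then obtain z where z: "s < z" "z < t" "F m t - F m s = (t - s) * F (Suc m) z"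
      using MVT2[of s t "F m" "F (Suc m)"] D by blast
    have "\<bar>F (Suc m) z\<bar> * h ^ Suc m = (h * \<bar>F (Suc m) z\<bar>) * h ^ m" by simp
    also have "... <= \<bar>F m t - F m s\<bar> * h ^ m" unfolding z(3) abs_mult using st h by (intro mult_right_mono) auto
    also have "... <= (\<bar>F m t\<bar> + \<bar>F m s\<bar>) * h ^ m" using h by (intro mult_right_mono) auto
    also have "... <= 2 * C * M" using s t by (simp add: distrib_right)
    finally have "\<bar>F (Suc m) z\<bar> * h ^ Suc m * 3 ^ Suc m <= 2 * C * M * 3 ^ Suc m" by (rule mult_right_mono) simp
    then show ?thesis using z s t by (intro bexI[of _ z]) (auto simp: h(2) power_mult_distrib mult_ac)
  qed
  then show ?case using C(1) by (intro exI[of _ "2 * C * 3 ^ Suc m"]) auto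
qed

text \<open>Descending induction on m. At some point the m-th derivative is small by
  \<open>small_derivative_point\<close>; its oscillation is controlled by the derivative of order m
  + 1, and for m = k - 1 by the integral of \<open>\<bar>F k\<bar>\<close>.\<close>

lemma intermediate_derivative_bound:
  fixes k :: nat
  assumes k: "k >= 1" shows "\<exists>C\<ge>1. \<forall>F a b M. (\<forall>j t. (F j has_real_derivative F (Suc j) t) (at t)) --> a < b -->
     (\<forall>t\<in>{a..b}. \<bar>F 0 t\<bar> <= M) -->
     (\<forall>x\<in>{a..b}. \<forall>m<k. \<bar>F m x\<bar> * (b - a) ^ m <= C * (M + (b - a) ^ (k - 1) * integral {a..b} (\<lambda>t. \<bar>F k t\<bar>)))"
proof -
  have "\<exists>C\<ge>1. \<forall>F a b M. (\<forall>j t. (F j has_real_derivative F (Suc j) t) (at t)) --> a < b --> (\<forall>t\<in>{a..b}. \<bar>F 0 t\<bar> <= M) -->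
     (\<forall>x\<in>{a..b}. \<forall>m<k. k <= m + n --> \<bar>F m x\<bar> * (b - a) ^ m <= C * (M + (b - a) ^ (k - 1) * integral {a..b} (\<lambda>t. \<bar>F k t\<bar>)))" for n
  proof (induction n)
    case (Suc n)
    then obtain C where C: "C >= 1" "\<And>F a b M x m. (\<forall>j t. (F j has_real_derivative F (Suc j) t) (at t)) ==> a < b ==>
       (\<forall>t\<in>{a..b}. \<bar>F 0 t\<bar> <= M) ==> x \<in> {a..b} ==> m < k ==> k <= m + n ==>
       \<bar>F m x\<bar> * (b - a) ^ m <= C * (M + (b - a) ^ (k - 1) * integral {a..b} (\<lambda>t. \<bar>F k t\<bar>))" by blast
    obtain C1 where C1: "C1 >= 0" "\<And>F a b M. (\<forall>j t. (F j has_real_derivative F (Suc j) t) (at t)) ==> a < b ==>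
       (\<forall>t\<in>{a..b}. \<bar>F 0 t\<bar> <= M) ==> \<exists>t\<in>{a..b}. \<bar>F (k - Suc n) t\<bar> * (b - a) ^ (k - Suc n) <= C1 * M"
      using small_derivative_point[of "k - Suc n"] by blast
    have "\<bar>F m x\<bar> * (b - a) ^ m <= (C1 + C) * (M + (b - a) ^ (k - 1) * integral {a..b} (\<lambda>t. \<bar>F k t\<bar>))"
      if D: "\<forall>j t. (F j has_real_derivative F (Suc j) t) (at t)" and ab: "a < b" and M: "\<forall>t\<in>{a..b}. \<bar>F 0 t\<bar> <= M"
        and x: "x \<in> {a..b}" and m: "m < k" "k <= m + Suc n" for F a b M x m
    proof -
      define T where "T = integral {a..b} (\<lambda>t. \<bar>F k t\<bar>)"
      define E where "E = M + (b - a) ^ (k - 1) * T"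
      have cont: "continuous_on S (F j)" for S j using D DERIV_isCont by (meson continuous_at_imp_continuous_on)
      have T0: "T >= 0" unfolding T_def
        by (intro Henstock_Kurzweil_Integration.integral_nonneg integrable_continuous_real continuous_intros cont) auto
      have M0: "M >= 0" using M ab by fastforce
      have E: "E >= M" using T0 ab by (simp add: E_def)
      show ?thesis
      proof (cases "k <= m + n")
        case True
        have "0 <= C1 * E" using C1(1) E M0 by simp
        then show ?thesis using C(2)[OF D ab M x m(1) True] by (simp add: E_def T_def distrib_right)
      next
        case False
        then have m': "k - Suc n = m" using m by simp
        obtain y where y: "y \<in> {a..b}" "\<bar>F m y\<bar> * (b - a) ^ m <= C1 * M" using C1(2)[OF D ab M] unfolding m' by blast
        have osc: "\<bar>F m v - F m u\<bar> * (b - a) ^ m <= C * E" if uv: "u \<in> {a..b}" "v \<in> {a..b}" "u < v" for u v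
        proof (cases "n = 0")
          case True
          then have km: "k = Suc m" using m by simp
          have "(F k has_integral F m v - F m u) {u..v}"
          proof (rule fundamental_theorem_of_calculus)
            show "(F m has_vector_derivative F k t) (at t within {u..v})" for t
              using D by (simp add: km has_real_derivative_iff_has_vector_derivative has_vector_derivative_at_within)
          qed (use uv in simp)
          then have "F m v - F m u = integral {u..v} (F k)" by (simp add: integral_unique)
          also have "\<bar>...\<bar> <= integral {u..v} (\<lambda>t. \<bar>F k t\<bar>)"
            using integral_norm_bound_integral[of "F k" "{u..v}" "\<lambda>t. \<bar>F k t\<bar>"]
            by (auto intro!: integrable_continuous_real continuous_intros cont)
          also have "... <= T" unfolding T_def
            using uv by (intro integral_subset_le integrable_continuous_real continuous_intros cont) auto
          finally have "\<bar>F m v - F m u\<bar> * (b - a) ^ m <= T * (b - a) ^ m" using ab by (intro mult_right_mono) auto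
          also have "... <= E" using M0 by (simp add: E_def km mult.commute)
          also have "... <= C * E" using mult_right_mono[OF C(1), of E] E M0 by simp
          finally show ?thesis .
        next
          case n: False
          obtain z where z: "u < z" "z < v" "F m v - F m u = (v - u) * F (Suc m) z"
            using MVT2[OF uv(3), of "F m" "F (Suc m)"] D by blast
          have "\<bar>F m v - F m u\<bar> = (v - u) * \<bar>F (Suc m) z\<bar>" using z(3) uv(3) by (simp add: abs_mult)
          also have "... <= (b - a) * \<bar>F (Suc m) z\<bar>" using uv by (intro mult_right_mono) auto
          finally have "\<bar>F m v - F m u\<bar> * (b - a) ^ m <= ((b - a) * \<bar>F (Suc m) z\<bar>) * (b - a) ^ m"
            using ab by (intro mult_right_mono) auto
          also have "... = \<bar>F (Suc m) z\<bar> * (b - a) ^ Suc m" by simp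
          also have "... <= C * E" unfolding E_def T_def by (rule C(2)[OF D ab M]) (use z uv n m False in auto)
          finally show ?thesis .
        qed
        have E0: "0 <= C * E" using C(1) E M0 by simp
        have "\<bar>F m x - F m y\<bar> * (b - a) ^ m <= C * E"
          using osc[of x y] osc[of y x] x y(1) E0 by (cases x y rule: linorder_cases) (simp_all add: abs_minus_commute)
        moreover have "\<bar>F m x\<bar> * (b - a) ^ m <= \<bar>F m x - F m y\<bar> * (b - a) ^ m + \<bar>F m y\<bar> * (b - a) ^ m"
          unfolding distrib_right[symmetric] using ab by (intro mult_right_mono) auto
        moreover have "C1 * M <= C1 * E" using C1(1) E by (rule mult_left_mono[rotated])
        ultimately show ?thesis using y(2) by (simp add: E_def T_def distrib_right)
      qed
    qed
    then show ?case using C(1) C1(1) by (intro exI[of _ "C1 + C"]) auto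
  qed (intro exI[of _ 1], auto)
  from this[of k] show ?thesis by auto
qed

text \<open>An interval is halved until its pieces are good. A good half of a bad interval has no
  lower bound on \<open>Psi\<close> to be charged to, so the claim for bad intervals carries the
  surplus \<open>D * (b - a) powr (- r)\<close>, which pays for a good sibling. With y = 2 powr r,
  the equation for D says \<open>(A - D) * y = - D\<close>, the case of one good and one bad half;
  the equation for B settles two good halves.\<close>

lemma bisection_bound:
  fixes Phi Psi :: "real => real => real" and good :: "real => real => bool"
  assumes r: "r >= 1" and A: "A >= 0" and m: "m > 0"
    and D: "D * (2 powr r - 1) = A * 2 powr r" and B: "B * m = 2 * A * 2 powr r + D"
    and addPhi: "\<And>a b c. alpha <= a ==> a <= c ==> c <= b ==> b <= beta ==> Phi a b = Phi a c + Phi c b"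
    and addPsi: "\<And>a b c. alpha <= a ==> a <= c ==> c <= b ==> b <= beta ==> Psi a b = Psi a c + Psi c b"
    and Psi0: "\<And>a b. alpha <= a ==> a <= b ==> b <= beta ==> 0 <= Psi a b"
    and good: "\<And>a b. alpha <= a ==> a < b ==> b <= beta ==> good a b ==> Phi a b <= A * (b - a) powr (- r)"
    and bad: "\<And>a b. alpha <= a ==> a < b ==> b <= beta ==> \<not> good a b ==> m * (b - a) powr (- r) <= Psi a b"
    and small: "delta > 0" "\<And>a b. alpha <= a ==> a < b ==> b <= beta ==> b - a <= delta ==> good a b"
    and ab: "alpha < beta" shows "Phi alpha beta <= A * (beta - alpha) powr (- r) + B * Psi alpha beta"
proof -
  define y where "y = 2 powr r"
  have y: "y >= 2" unfolding y_def using powr_mono[of 1 r 2] r by simp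
  have D0: "D >= 0"
  proof -
    have "D * (y - 1) >= 0" using D A y by (simp add: y_def)
    then show ?thesis using y by (simp add: zero_le_mult_iff)
  qed
  have B0: "B >= 0"
  proof -
    have "B * m >= 0" using B A D0 by simp
    then show ?thesis using m by (simp add: zero_le_mult_iff)
  qed
  have claim: "\<not> good a b --> Phi a b <= B * Psi a b - D * (b - a) powr (- r)"
    if "alpha <= a" "a < b" "b <= beta" "b - a <= 2 ^ n * delta" for a b n using that
  proof (induction n arbitrary: a b)
    case 0
    then show ?case using small(2) by simp
  next
    case (Suc n)
    define c where "c = (a + b) / 2"
    have c: "a < c" "c < b" "c - a = (b - a) / 2" "b - c = (b - a) / 2"
      using Suc.prems(2) by (auto simp: c_def field_simps)
    define L where "L = (b - a) powr (- r)"
    have half: "((b - a) / 2) powr (- r) = y * L"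
    proof -
      have "((b - a) / 2) powr (- r) = (b - a) powr (- r) / 2 powr (- r)" by (rule powr_divide)
      also have "2 powr (- r) = inverse y" unfolding y_def by (rule powr_minus)
      finally show ?thesis unfolding L_def by (simp only: divide_inverse inverse_inverse_eq mult.commute)
    qed
    have L0: "L >= 0" by (simp add: L_def)
    have IH1: "\<not> good a c --> Phi a c <= B * Psi a c - D * (y * L)"
    proof -
      have "\<not> good a c --> Phi a c <= B * Psi a c - D * (c - a) powr (- r)"
        by (rule Suc.IH) (use Suc.prems c in auto)
      then show ?thesis unfolding c(3) half .
    qed
    have IH2: "\<not> good c b --> Phi c b <= B * Psi c b - D * (y * L)"
    proof -
      have "\<not> good c b --> Phi c b <= B * Psi c b - D * (b - c) powr (- r)"
        by (rule Suc.IH) (use Suc.prems c in auto)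
      then show ?thesis unfolding c(4) half .
    qed
    have G1: "good a c --> Phi a c <= A * (y * L)"
      using good[of a c] Suc.prems(1-3) c(1,2) unfolding c(3) half by linarith
    have G2: "good c b --> Phi c b <= A * (y * L)"
      using good[of c b] Suc.prems(1-3) c(1,2) unfolding c(4) half by linarith
    have P: "Phi a b = Phi a c + Phi c b" "Psi a b = Psi a c + Psi c b"
      using addPhi[of a c b] addPsi[of a c b] Suc.prems(1-3) c(1,2) by auto
    have P0: "B * Psi a c >= 0" "B * Psi c b >= 0" using Psi0[of a c] Psi0[of c b] B0 Suc.prems(1-3) c(1,2) by auto
    have DA: "A * (y * L) - D * (y * L) = - D * L"
    proof -
      have "A * y - D * y = - D" using D by (simp add: y_def algebra_simps)
      then have "(A * y - D * y) * L = - D * L" by simp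
      then show ?thesis by (simp add: algebra_simps)
    qed
    have DL: "D * L <= D * (y * L)" using D0 L0 y by (intro mult_left_mono) (auto simp: mult_le_cancel_right1)
    have D0L: "D * L >= 0" using D0 L0 by simp
    show ?case
    proof
      assume nb: "\<not> good a b"
      have mB: "2 * (A * (y * L)) + D * L <= B * Psi a b"
      proof -
        have "B * (m * L) <= B * Psi a b" using bad[OF Suc.prems(1-3) nb] B0 by (intro mult_left_mono) (auto simp: L_def)
        moreover have "B * (m * L) = 2 * (A * (y * L)) + D * L"
        proof -
          have "B * (m * L) = (B * m) * L" by simp
          also have "... = (2 * A * y + D) * L" using B by (simp only: y_def)
          also have "... = 2 * (A * (y * L)) + D * L" by (simp add: distrib_right)
          finally show ?thesis .
        qed
        ultimately show ?thesis by simp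
      qed
      have "B * Psi a b = B * Psi a c + B * Psi c b" by (simp add: P distrib_left)
      then show "Phi a b <= B * Psi a b - D * (b - a) powr (- r)" unfolding L_def[symmetric] P(1)
        using IH1 IH2 G1 G2 P0 DA DL D0L mB by (cases "good a c"; cases "good c b"; simp; linarith)
    qed
  qed
  \<comment> \<open>The number of halvings after which the pieces have length at most
    \<open>delta\<close>.\<close>
  obtain n where n: "(beta - alpha) / delta < 2 ^ n" using real_arch_pow[of 2] by auto
  then have "beta - alpha <= 2 ^ n * delta" using small(1) by (simp add: divide_less_eq)
  then have "\<not> good alpha beta --> Phi alpha beta <= B * Psi alpha beta - D * (beta - alpha) powr (- r)" using claim ab by blast
  moreover have "good alpha beta --> Phi alpha beta <= A * (beta - alpha) powr (- r)" using good ab by blast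
  moreover have "A * (beta - alpha) powr (- r) >= 0" "D * (beta - alpha) powr (- r) >= 0" "B * Psi alpha beta >= 0"
    using A D0 B0 Psi0 ab by auto
  ultimately show ?thesis by linarith
qed

text \<open>The exponents are those for which the bound is invariant under rescaling: on an interval of
length \<open>l\<close> with \<open>l ^ (k - 1) * integral \<bar>F k\<bar> <= M\<close> the derivatives of \<open>F 0\<close> scale like powers of
\<open>l\<close>, and on any longer interval the integral of \<open>\<bar>F k\<bar> powr p\<close> is bounded below by a power of \<open>l\<close>.\<close>

lemma Gagliardo_Nirenberg_interval:
  fixes k i :: nat and p M :: real
  assumes k: "1 <= i" "i <= k" and p: "p >= 1" and M: "M > 0"
  shows "\<exists>C\<ge>0. \<forall>F alpha beta. (\<forall>j t. (F j has_real_derivative F (Suc j) t) (at t)) -->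
     1/2 <= beta - alpha --> (\<forall>t\<in>{alpha..beta}. \<bar>F 0 t\<bar> <= M) -->
     integral {alpha..beta} (\<lambda>t. \<bar>F i t\<bar> powr (k * p / i)) <= C * (integral {alpha..beta} (\<lambda>t. \<bar>F k t\<bar> powr p) + 1)"
proof (cases "i = k")
  case True
  then show ?thesis using k by (intro exI[of _ 1]) (auto simp: field_simps)
next
  case False
  then have ik: "i < k" "k >= 2" using k by auto
  obtain C0 where C0: "C0 >= 1" "\<And>F a b M x m. (\<And>j t. (F j has_real_derivative F (Suc j) t) (at t)) ==> a < b ==>
     (\<And>t. t\<in>{a..b} ==> \<bar>F 0 t\<bar> <= M) ==> x\<in>{a..b} ==> m < k ==>
     \<bar>F m x\<bar> * (b - a) ^ m <= C0 * (M + (b - a) ^ (k - 1) * integral {a..b} (\<lambda>t. \<bar>F k t\<bar>))"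
    using intermediate_derivative_bound[of k] ik by auto
  define q where "q = real k * p / real i"
  \<comment> \<open>On a good interval of length l the integrand is at most
    \<open>A * l powr (- (k * p))\<close>; integrating over length l leaves the exponent -r.\<close>
  define r where "r = real k * p - 1"
  have kp: "real k * p >= 2" using ik p mult_mono[of 2 "real k" 1 p] by simp
  have r: "r >= 1" using kp by (simp add: r_def)
  have q: "q > 0" "q * real i = real k * p" using k p kp by (auto simp: q_def)
  \<comment> \<open>On a good interval the two terms of the derivative bound add up to at most 2 *
    M.\<close>
  define A where "A = (2 * C0 * M) powr q"
  define D where "D = A * 2 powr r / (2 powr r - 1)"
  \<comment> \<open>For z = M / l^k, the quantity l * z powr p is M powr p * l powr (-r); this
    bounds \<open>Psi\<close> from below on a bad interval of length l.\<close>
  define m where "m = M powr p"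
  define B where "B = (2 * A * 2 powr r + D) / m"
  have A: "A >= 0" by (simp add: A_def)
  have m: "m > 0" using M by (simp add: m_def)
  have y: "2 powr r >= 2" using powr_mono[of 1 r 2] r by simp
  have y1: "2 powr r - 1 > 0" using y by linarith
  then have Deq: "D * (2 powr r - 1) = A * 2 powr r" 
    using nonzero_eq_divide_eq[of "2 powr r - 1" D "A * 2 powr r"] D_def by fastforce
  have D0: "D >= 0" unfolding D_def by (intro divide_nonneg_pos mult_nonneg_nonneg A y1) simp
  have Beq: "B * m = 2 * A * 2 powr r + D" using m nonzero_eq_divide_eq[of m B] B_def by fastforce
  have B0: "B >= 0" unfolding B_def by (intro divide_nonneg_pos add_nonneg_nonneg mult_nonneg_nonneg A D0 m) simp_all
  \<comment> \<open>The factor \<open>2 powr r\<close> bounds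
    \<open>(beta - alpha) powr (- r)\<close>, as the length is at least 1/2.\<close>
  define C where "C = max B (A * 2 powr r)"
  have "integral {alpha..beta} (\<lambda>t. \<bar>F i t\<bar> powr q) <= C * (integral {alpha..beta} (\<lambda>t. \<bar>F k t\<bar> powr p) + 1)"
    if D: "\<And>j t. (F j has_real_derivative F (Suc j) t) (at t)" and alphabeta: "1/2 <= beta - alpha"
      and M0: "\<And>t. t\<in>{alpha..beta} ==> \<bar>F 0 t\<bar> <= M" for F :: "nat => real => real" and alpha beta
  proof -
    have cont: "continuous_on S (F j)" for S j using D DERIV_isCont by (meson continuous_at_imp_continuous_on)
    have contp: "continuous_on S (\<lambda>t. \<bar>F j t\<bar> powr e)" if "e > 0" for S j e
      using that by (intro continuous_on_powr' continuous_intros cont) auto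
    define Phi where "Phi a b = integral {a..b} (\<lambda>t. \<bar>F i t\<bar> powr q)" for a b
    define Psi where "Psi a b = integral {a..b} (\<lambda>t. \<bar>F k t\<bar> powr p)" for a b
    define Theta where "Theta a b = integral {a..b} (\<lambda>t. \<bar>F k t\<bar>)" for a b
    define good where "good a b \<longleftrightarrow> (b - a) ^ (k - 1) * Theta a b <= M" for a b
    have intp: "(\<lambda>t. \<bar>F j t\<bar> powr e) integrable_on {a..b}" if "e > 0" for j e a b
      using that by (intro integrable_continuous_real contp)
    have inta: "(\<lambda>t. \<bar>F j t\<bar>) integrable_on {a..b}" for j a b
      by (intro integrable_continuous_real continuous_intros cont)
    have Theta0: "Theta a b >= 0" for a b
      unfolding Theta_def by (intro Henstock_Kurzweil_Integration.integral_nonneg inta) auto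
    have "Phi alpha beta <= A * (beta - alpha) powr (- r) + B * Psi alpha beta"
    proof (rule bisection_bound[OF r A m Deq Beq, where good = good])
      show "alpha < beta" using alphabeta by simp
      show "Phi a b = Phi a c + Phi c b" if "a <= c" "c <= b" for a b c
        unfolding Phi_def using that q by (intro Henstock_Kurzweil_Integration.integral_combine[symmetric] intp) auto
      show "Psi a b = Psi a c + Psi c b" if "a <= c" "c <= b" for a b c
        unfolding Psi_def using that p by (intro Henstock_Kurzweil_Integration.integral_combine[symmetric] intp) auto
      show "0 <= Psi a b" for a b
        unfolding Psi_def using p by (intro Henstock_Kurzweil_Integration.integral_nonneg intp) auto
    next
      fix a b assume ab: "alpha <= a" "a < b" "b <= beta" and g: "good a b"
      define l where "l = b - a"
      have l: "l > 0" using ab by (simp add: l_def)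
      have pt: "\<bar>F i x\<bar> powr q <= A * l powr (- (real k * p))" if x: "x \<in> {a..b}" for x
      proof -
        have "\<bar>F i x\<bar> * l ^ i <= C0 * (M + l ^ (k - 1) * Theta a b)" unfolding l_def Theta_def
          using C0(2)[of F a b M x i] D ab x ik(1) M0 by auto
        also have "... <= C0 * (M + M)" using g C0(1) by (intro mult_left_mono) (auto simp: good_def l_def)
        finally have "\<bar>F i x\<bar> * l ^ i <= C0 * (M + M)" .
        then have "\<bar>F i x\<bar> <= (2 * C0 * M) * l powr (- real i)"
        proof -
          have "l powr (- real i) = inverse (l ^ i)" using l by (simp only: powr_minus powr_realpow)
          then have "\<bar>F i x\<bar> = \<bar>F i x\<bar> * l ^ i * l powr (- real i)" using l by simp
          also have "... <= C0 * (M + M) * l powr (- real i)"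
            by (rule mult_right_mono[OF \<open>\<bar>F i x\<bar> * l ^ i <= C0 * (M + M)\<close>]) simp
          finally show ?thesis by (simp add: mult_ac)
        qed
        then have "\<bar>F i x\<bar> powr q <= ((2 * C0 * M) * l powr (- real i)) powr q" using q by (intro powr_mono2) auto
        also have "... = A * l powr (- real i * q)" using C0(1) M by (simp add: powr_mult powr_powr A_def)
        finally show ?thesis using q by (simp add: mult.commute)
      qed
      have "Phi a b <= integral {a..b} (\<lambda>t. A * l powr (- (real k * p)))"
        unfolding Phi_def using pt q by (intro integral_le intp) auto
      also have "... = A * (l powr (- (real k * p)) * l powr 1)" using ab l by (simp add: l_def)
      also have "... = A * l powr (- r)" unfolding powr_add[symmetric] by (simp add: r_def)
      finally show "Phi a b <= A * (b - a) powr (- r)" by (simp add: l_def)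
    next
      fix a b assume ab: "alpha <= a" "a < b" "b <= beta" and g: "\<not> good a b"
      define l where "l = b - a"
      have l: "l > 0" using ab by (simp add: l_def)
      \<comment> \<open>The mean of \<open>\<bar>F k\<bar>\<close> over a bad interval is at least
        z, so the tangent to s powr p at z yields a lower bound for \<open>Psi\<close>.\<close>
      define z where "z = M / l ^ k"
      have z: "z > 0" using M l by (simp add: z_def)
      have "l * l ^ (k - 1) = l ^ k" using ik by (cases k) auto
      then have "z * l * l ^ (k - 1) = M" using l by (simp add: z_def mult.assoc)
      then have "z * l * l ^ (k - 1) <= Theta a b * l ^ (k - 1)" using g by (simp add: good_def l_def mult.commute)
      then have zl: "z * l <= Theta a b" using l by (simp add: mult_le_cancel_right)
      have "m * l powr (- r) = l * z powr p"
      proof -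
        have "z powr p = M powr p * l powr (- (real k * p))"
        proof -
          have "z powr p = M powr p / (l ^ k) powr p" unfolding z_def by (rule powr_divide)
          also have "(l ^ k) powr p = l powr (real k * p)" using l
            by (subst powr_realpow[symmetric]) (simp_all only: powr_powr)
          also have "M powr p / l powr (real k * p) = M powr p * l powr (- (real k * p))"
            by (simp only: powr_minus divide_inverse)
          finally show ?thesis .
        qed
        then have "l * z powr p = M powr p * (l powr (- (real k * p)) * l powr 1)" using l by simp
        then show ?thesis unfolding powr_add[symmetric] by (simp add: m_def r_def)
      qed
      also have "... <= l * z powr p + p * z powr (p - 1) * (Theta a b - l * z)"
        using zl p by (simp add: mult.commute)
      also have "... = integral {a..b} (\<lambda>t. (z powr p - p * z powr (p - 1) * z) + p * z powr (p - 1) * \<bar>F k t\<bar>)"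
      proof -
        have "integral {a..b} (\<lambda>t. (z powr p - p * z powr (p - 1) * z) + p * z powr (p - 1) * \<bar>F k t\<bar>)
            = integral {a..b} (\<lambda>t. z powr p - p * z powr (p - 1) * z) + integral {a..b} (\<lambda>t. p * z powr (p - 1) * \<bar>F k t\<bar>)"
          by (intro Henstock_Kurzweil_Integration.integral_add integrable_continuous_real continuous_intros cont)
        also have "... = (z powr p - p * z powr (p - 1) * z) * l + p * z powr (p - 1) * Theta a b"
          using ab by (simp add: Theta_def l_def)
        finally show ?thesis by (simp add: algebra_simps)
      qed
      also have "... <= Psi a b" unfolding Psi_def
      proof (rule integral_le)
        show "(\<lambda>t. (z powr p - p * z powr (p - 1) * z) + p * z powr (p - 1) * \<bar>F k t\<bar>) integrable_on {a..b}"
          by (intro integrable_continuous_real continuous_intros cont)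
        show "(\<lambda>t. \<bar>F k t\<bar> powr p) integrable_on {a..b}" using p by (intro intp) auto
        show "(z powr p - p * z powr (p - 1) * z) + p * z powr (p - 1) * \<bar>F k t\<bar> <= \<bar>F k t\<bar> powr p" for t
          using powr_tangent[OF p _ z, of "\<bar>F k t\<bar>"] by (simp add: algebra_simps)
      qed
      finally show "m * (b - a) powr (- r) <= Psi a b" by (simp add: l_def)
    next
      \<comment> \<open>As k is at least 2, a power k - 1 of a length below 1 is at most that
        length; so below \<open>delta\<close> the defining product of \<open>good\<close> is at most
        M.\<close>
      define delta where "delta = min 1 (M / (Theta alpha beta + 1))"
      show "delta > 0" using M Theta0[of alpha beta] by (simp add: delta_def)
      fix a b assume ab: "alpha <= a" "a < b" "b <= beta" and small: "b - a <= delta"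
      have "Theta a b <= Theta alpha beta" unfolding Theta_def using ab by (intro integral_subset_le inta) auto
      moreover have "(b - a) ^ (k - 1) <= delta"
      proof -
        have "(b - a) ^ (k - 1) <= (b - a) ^ 1" using ab small ik by (intro power_decreasing) (auto simp: delta_def)
        then show ?thesis using small by simp
      qed
      ultimately have "(b - a) ^ (k - 1) * Theta a b <= delta * Theta alpha beta"
        using ab Theta0 \<open>delta > 0\<close> by (intro mult_mono) auto
      also have "... <= (M / (Theta alpha beta + 1)) * (Theta alpha beta + 1)"
        using Theta0[of alpha beta] M by (intro mult_mono) (auto simp: delta_def)
      also have "... = M" using Theta0[of alpha beta] by simp
      finally show "good a b" by (simp add: good_def)
    qed
    also have "A * (beta - alpha) powr (- r) + B * Psi alpha beta <= C * 1 + C * Psi alpha beta"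
    proof (rule add_mono)
      have "(beta - alpha) powr (- r) <= (1/2) powr (- r)" using alphabeta r by (intro powr_mono2') auto
      also have "(1/2::real) powr (- r) = 2 powr r"
      proof -
        have "(1/2::real) powr (- r) = 1 powr (- r) / 2 powr (- r)" by (rule powr_divide)
        also have "2 powr (- r) = inverse (2 powr r :: real)" by (rule powr_minus)
        finally show ?thesis by (simp only: powr_one_eq_one divide_inverse[of 1 "inverse _"] inverse_inverse_eq mult_1_left)
      qed
      finally have "A * (beta - alpha) powr (- r) <= A * 2 powr r" using A by (intro mult_left_mono)
      then show "A * (beta - alpha) powr (- r) <= C * 1" by (simp add: C_def)
      have "Psi alpha beta >= 0" unfolding Psi_def using p by (intro Henstock_Kurzweil_Integration.integral_nonneg intp) auto
      then show "B * Psi alpha beta <= C * Psi alpha beta" by (intro mult_right_mono) (simp_all add: C_def)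
    qed
    finally show ?thesis by (simp add: Phi_def Psi_def algebra_simps)
  qed
  moreover have "C >= 0" using B0 by (simp add: C_def)
  ultimately show ?thesis unfolding q_def by blast
qed

section \<open>Mollifiers with displaced support\<close>

text \<open>The centre nu / (m + 1) shrinks to the origin together with the radius, so the support
  always lies in the cone spanned by the ball of radius \<open>rho\<close> about \<open>nu\<close>.
  With \<open>nu\<close> pointing into a half-space and \<open>rho\<close> small, mollification at a
  boundary point uses interior values only.\<close>

definition kern :: "'a::euclidean_space => real => nat => 'a => real" where
  "kern nu rho m z = bump (nu /\<^sub>R real (Suc m)) (rho / real (Suc m)) z /
     (LINT x|lborel. bump (nu /\<^sub>R real (Suc m)) (rho / real (Suc m)) x)"

lemma test_function_integrable:
  assumes "test_function U psi" shows "integrable lborel psi"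
proof -
  obtain K where K: "compact K" "\<And>x. x \<notin> K ==> psi x = 0" using assms by (auto simp: test_function_def)
  have "continuous_on K psi"
    using test_function_smooth[OF assms] smooth_on_imp_continuous continuous_on_subset by blast
  then have "integrable lborel (\<lambda>x. indicator K x *\<^sub>R psi x)" using K(1) by (intro borel_integrable_compact)
  moreover have "(\<lambda>x. indicator K x *\<^sub>R psi x) = psi" using K(2) by (auto simp: fun_eq_iff indicator_def)
  ultimately show ?thesis by simp
qed

lemma test_function_bump:
  assumes "r > 0" shows "test_function UNIV (bump p r)" unfolding test_function_def
proof (intro conjI exI[of _ "cball p r"])
  show "\<forall>x. x \<notin> cball p r --> bump p r x = 0" by (auto simp: bump_eq_0_iff[OF assms])
qed (auto simp: smooth_bump)

lemma bump_integral_pos: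
  fixes p :: "'a::euclidean_space"
  assumes "r > 0" shows "(LINT x|lborel. bump p r x) > 0"
proof -
  have i: "integrable lborel (bump p r)" by (rule test_function_integrable[OF test_function_bump[OF assms]])
  have nn: "AE x in lborel. 0 <= bump p r x" by (simp add: bump_nonneg)
  have "(LINT x|lborel. bump p r x) \<noteq> 0"
  proof
    assume "(LINT x|lborel. bump p r x) = 0"
    then have "AE x in lborel. bump p r x = 0" using integral_nonneg_eq_0_iff_AE[OF i nn] by simp
    then have "AE x in lborel. x \<notin> ball p r"
    proof (rule AE_mp, intro AE_I2 impI)
      fix x assume "bump p r x = 0" then show "x \<notin> ball p r" by (auto simp: bump_eq_0_iff[OF assms])
    qed
    then have "emeasure lborel (ball p r) = 0" by (subst (asm) AE_iff_measurable[of "ball p r"]) auto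
    then show False using emeasure_lborel_ball_finite open_not_negligible[of "ball p r"] assms
      by (simp add: negligible_iff_null_sets null_sets_def)
  qed
  moreover have "(LINT x|lborel. bump p r x) >= 0" using nn by (intro integral_nonneg_AE)
  ultimately show ?thesis by simp
qed

lemma mollifier_kern:
  fixes nu :: "'a::euclidean_space"
  assumes "rho > 0" shows "mollifier (kern nu rho m)"
proof -
  define p where "p = nu /\<^sub>R real (Suc m)"
  define r where "r = rho / real (Suc m)"
  have r: "r > 0" using assms by (simp add: r_def)
  define I where "I = (LINT x|lborel. bump p r x)"
  have I: "I > 0" unfolding I_def by (rule bump_integral_pos[OF r])
  have k: "kern nu rho m = (\<lambda>z. bump p r z / I)" by (simp add: kern_def[abs_def] p_def r_def I_def)
  have "smooth (\<lambda>z. bump p r z / I)" using smooth_on_linear[OF bounded_linear_divide smooth_bump] .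
  moreover have "\<forall>x. x \<notin> cball p r --> bump p r x / I = 0" by (auto simp: bump_eq_0_iff[OF r])
  ultimately have "test_function UNIV (\<lambda>z. bump p r z / I)"
    unfolding test_function_def by (intro conjI exI[of _ "cball p r"]) auto
  then show ?thesis unfolding mollifier_def k using I bump_nonneg[of p r] by (simp add: I_def)
qed

lemma kern_support:
  assumes "rho > 0" "kern nu rho m z \<noteq> 0"
  obtains u where "dist nu u < rho" "z = u /\<^sub>R real (Suc m)"
proof -
  have "bump (nu /\<^sub>R real (Suc m)) (rho / real (Suc m)) z \<noteq> 0" using assms by (auto simp: kern_def)
  then have "dist (nu /\<^sub>R real (Suc m)) z < rho / real (Suc m)"
    using assms(1) bump_eq_0_iff[of "rho / real (Suc m)" "nu /\<^sub>R real (Suc m)" z] by auto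
  moreover define u where "u = real (Suc m) *\<^sub>R z"
  have z: "z = u /\<^sub>R real (Suc m)" by (simp add: u_def)
  have "dist (nu /\<^sub>R real (Suc m)) z = dist nu u / real (Suc m)"
    unfolding z by (simp add: dist_norm scaleR_diff_right[symmetric] divide_inverse mult.commute del: of_nat_Suc)
  ultimately have "dist nu u < rho" by (simp add: divide_less_cancel del: of_nat_Suc)
  then show ?thesis using that z by blast
qed

lemma kern_support_eventually:
  assumes "rho > 0" "d > 0" shows "\<forall>\<^sub>F m in sequentially. \<forall>z. kern nu rho m z \<noteq> 0 --> norm z < d"
proof -
  have "(\<lambda>m. (norm nu + rho) * inverse (real (Suc m))) \<longlonglongrightarrow> (norm nu + rho) * 0"
    by (intro tendsto_intros LIMSEQ_inverse_real_of_nat)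
  then have "\<forall>\<^sub>F m in sequentially. (norm nu + rho) * inverse (real (Suc m)) < d"
    using assms(2) order_tendstoD(2) by fastforce
  then show ?thesis
  proof (rule eventually_mono, intro allI impI)
    fix m z assume m: "(norm nu + rho) * inverse (real (Suc m)) < d" and "kern nu rho m z \<noteq> 0"
    then obtain u where u: "dist nu u < rho" "z = u /\<^sub>R real (Suc m)" using kern_support assms(1) by blast
    have "norm u <= norm nu + rho" using u(1) norm_triangle_sub[of u nu] by (simp add: dist_norm norm_minus_commute)
    then have "norm u * inverse (real (Suc m)) <= (norm nu + rho) * inverse (real (Suc m))"
      by (intro mult_right_mono) auto
    also note m
    finally show "norm z < d" using u(2) by (simp add: mult.commute)
  qed
qed

abbreviation mol_error :: "'a::euclidean_space => real => nat => ('a => real) => real" where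
  "mol_error nu rho m g \<equiv> LINT x|lborel. \<bar>mol (kern nu rho m) g x - g x\<bar>"

text \<open>Mollification preserves the integral, so the L^1 error is twice the integral of the
  positive part of g minus its mollification. That part is dominated by g; it is eventually zero at
  each point of the open set, and zero outside.\<close>

lemma mol_kern_L1_open:
  fixes U :: "'a::euclidean_space set"
  assumes rho: "rho > 0" and U: "open U" "emeasure lborel U < \<infinity>"
  shows "(\<lambda>m. LINT x|lborel. \<bar>mol (kern nu rho m) (indicator U) x - indicator U x\<bar>) \<longlonglongrightarrow> 0"
proof -
  define g where "g = (indicator U :: 'a => real)"
  have g: "integrable lborel g" unfolding g_def using U by (intro integrable_real_indicator) auto
  have g01: "0 <= g x" "g x <= 1" for x by (auto simp: g_def indicator_def)
  have [measurable]: "g \<in> borel_measurable borel" using g by simp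
  define M where "M m = mol (kern nu rho m) g" for m
  note mk = mollifier_kern[OF rho, of nu]
  have Mi: "integrable lborel (M m)" "(LINT x|lborel. M m x) = (LINT x|lborel. g x)" for m
    unfolding M_def using mol_integrable_nonneg[OF mk g g01(1)] by auto
  have M0: "0 <= M m x" for m x unfolding M_def by (intro mol_nonneg mk g01)
  have [measurable]: "M m \<in> borel_measurable borel" for m using Mi(1) by simp
  define pos where "pos m x = max 0 (g x - M m x)" for m x
  have eq: "\<bar>M m x - g x\<bar> = 2 * pos m x - (g x - M m x)" for m x by (simp add: pos_def max_def abs_if)
  have pos_i: "integrable lborel (pos m)" for m unfolding pos_def[abs_def] using g Mi(1) by simp
  have pos_le: "pos m x <= g x" for m x unfolding pos_def using M0 g01(1) by simp
  have "(\<lambda>m. LINT x|lborel. pos m x) \<longlonglongrightarrow> (LINT x::'a|lborel. (0::real))"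
  proof (rule integral_dominated_convergence[where w = g and f = "\<lambda>_. 0" and s = pos])
    show "integrable lborel g" by fact
    show "AE x in lborel. norm (pos m x) <= g x" for m using pos_le by (auto simp: pos_def)
    show "AE x in lborel. (\<lambda>m. pos m x) \<longlonglongrightarrow> 0"
    proof (intro AE_I2)
      fix x
      show "(\<lambda>m. pos m x) \<longlonglongrightarrow> 0"
      proof (cases "x \<in> U")
        case True
        then obtain d where d: "d > 0" "ball x d \<subseteq> U" using U open_contains_ball by blast
        have "\<forall>\<^sub>F m in sequentially. pos m x = 0" using kern_support_eventually[OF rho d(1), of nu]
        proof (rule eventually_mono)
          fix m assume m: "\<forall>z. kern nu rho m z \<noteq> 0 --> norm z < d"
          have *: "kern nu rho m (y - x) * g y = kern nu rho m (y - x)" for y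
          proof (cases "kern nu rho m (y - x) = 0")
            case False
            then have "y \<in> U" using m d(2) by (auto simp: dist_norm norm_minus_commute subset_iff)
            then show ?thesis by (simp add: g_def)
          qed simp
          have "M m x = 1" unfolding M_def mol_def * by (rule mollifier_shift_integral(2)[OF mk])
          then show "pos m x = 0" using g01(2)[of x] by (simp add: pos_def)
        qed
        then show ?thesis by (rule tendsto_eventually)
      next
        case False
        then have "pos m x = 0" for m using M0[of m x] by (simp add: pos_def g_def)
        then show ?thesis by simp
      qed
    qed
  qed (simp_all add: pos_def[abs_def])
  moreover have "(LINT x|lborel. \<bar>M m x - g x\<bar>) = 2 * (LINT x|lborel. pos m x)" for m
    unfolding eq using pos_i g Mi by simp
  ultimately have "(\<lambda>m. LINT x|lborel. \<bar>M m x - g x\<bar>) \<longlonglongrightarrow> 2 * 0" by (simp only:) (intro tendsto_intros, simp)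
  then show ?thesis by (simp add: M_def g_def)
qed

text \<open>Mollification does not increase the L^1 norm, so convergence passes to functions
  approximated in L^1.\<close>

lemma mol_kern_L1_approx:
  fixes g :: "'a::euclidean_space => real"
  assumes rho: "rho > 0" and g: "integrable lborel g"
    and approx: "\<And>e. e > 0 ==> \<exists>h. integrable lborel h \<and> (LINT x|lborel. \<bar>g x - h x\<bar>) <= e \<and>
       (\<lambda>m. mol_error nu rho m h) \<longlonglongrightarrow> 0" shows "(\<lambda>m. mol_error nu rho m g) \<longlonglongrightarrow> 0"
proof (rule LIMSEQ_I)
  fix e :: real assume e: "e > 0"
  obtain h where h: "integrable lborel h" "(LINT x|lborel. \<bar>g x - h x\<bar>) <= e / 4"
    "(\<lambda>m. mol_error nu rho m h) \<longlonglongrightarrow> 0" using approx[of "e / 4"] e by auto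
  note mk = mollifier_kern[OF rho, of nu]
  obtain N where N: "\<And>m. m >= N ==> norm ((mol_error nu rho m h) - 0) < e / 2"
    using LIMSEQ_D[OF h(3), of "e / 2"] e by auto
  have "norm ((mol_error nu rho m g) - 0) < e" if m: "m >= N" for m
  proof -
    let ?kappa = "kern nu rho m"
    have i: "integrable lborel (mol ?kappa (\<lambda>x. g x - h x))" "integrable lborel (mol ?kappa g)" "integrable lborel (mol ?kappa h)"
      using g h(1) by (auto intro!: mol_integrable mk)
    have "(LINT x|lborel. \<bar>mol ?kappa g x - g x\<bar>)
       <= (LINT x|lborel. \<bar>mol ?kappa (\<lambda>x. g x - h x) x\<bar> + \<bar>mol ?kappa h x - h x\<bar> + \<bar>g x - h x\<bar>)"
    proof (rule integral_mono)
      fix x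
      have "mol ?kappa (\<lambda>x. g x - h x) x = mol ?kappa g x - mol ?kappa h x"
        by (rule mol_diff[OF mollifier_test[OF mk] g h(1)])
      then show "\<bar>mol ?kappa g x - g x\<bar> <= \<bar>mol ?kappa (\<lambda>x. g x - h x) x\<bar> + \<bar>mol ?kappa h x - h x\<bar> + \<bar>g x - h x\<bar>"
        by linarith
    qed (use i g h(1) in auto)
    also have "... = (LINT x|lborel. \<bar>mol ?kappa (\<lambda>x. g x - h x) x\<bar>) + (LINT x|lborel. \<bar>mol ?kappa h x - h x\<bar>) + (LINT x|lborel. \<bar>g x - h x\<bar>)"
      using i g h(1) by simp
    also have "... <= e / 4 + (LINT x|lborel. \<bar>mol ?kappa h x - h x\<bar>) + e / 4"
      using h(1,2) g by (intro add_mono order_trans[OF mol_integrable(2)[OF mk]]) auto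
    also have "... < e" using N[OF m] by auto
    finally show ?thesis by (simp add: integral_nonneg_AE)
  qed
  then show "\<exists>N. \<forall>m\<ge>N. norm ((mol_error nu rho m g) - 0) < e" by blast
qed

text \<open>From open sets to Borel sets by outer regularity, and then through linear combinations
  and dominated limits.\<close>

lemma mol_kern_L1:
  fixes g :: "'a::euclidean_space => real"
  assumes rho: "rho > 0" and g: "integrable lborel g" shows "(\<lambda>m. mol_error nu rho m g) \<longlonglongrightarrow> 0" using g
proof (induction rule: integrable_induct)
  case (base A c)
  have A: "A \<in> sets borel" using base(1) by simp
  have "(\<lambda>m. LINT x|lborel. \<bar>mol (kern nu rho m) (indicator A) x - indicator A x\<bar>) \<longlonglongrightarrow> 0"
  proof (rule mol_kern_L1_approx[OF rho])
    show "integrable lborel (indicator A :: 'a => real)" using base by (intro integrable_real_indicator) auto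
    fix e :: real assume e: "e > 0"
    obtain U where U: "open U" "A \<subseteq> U" "emeasure lborel (U - A) < e" using outer_regular_lborel[OF A e] by blast
    have "emeasure lborel U <= emeasure lborel A + emeasure lborel (U - A)"
      using U A by (metis Un_Diff_cancel borel_open emeasure_subadditive sets.Diff sets_lborel subset_Un_eq)
    also have "... < \<infinity>" using base(2) order.strict_trans[OF U(3) ennreal_less_top[of e]] by (simp add: less_top)
    finally have Uf: "emeasure lborel U < \<infinity>" .
    have "(LINT x|lborel. \<bar>indicator A x - indicator U x :: real\<bar>) = (LINT x|lborel. indicator (U - A) x)"
      using U(2) by (intro Bochner_Integration.integral_cong) (auto simp: indicator_def)
    also have "... = measure lborel (U - A)" by simp
    also have "... <= e" using U(3) e unfolding measure_def by (intro enn2real_leI) auto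
    finally show "\<exists>h. integrable lborel h \<and> (LINT x|lborel. \<bar>indicator A x - h x\<bar>) <= e \<and>
       (\<lambda>m. mol_error nu rho m h) \<longlonglongrightarrow> 0" using mol_kern_L1_open[OF rho U(1) Uf] U(1) Uf
      by (intro exI[of _ "indicator U"]) (auto intro!: integrable_real_indicator)
  qed
  then have "(\<lambda>m. \<bar>c\<bar> * (LINT x|lborel. \<bar>mol (kern nu rho m) (indicator A) x - indicator A x\<bar>)) \<longlonglongrightarrow> \<bar>c\<bar> * 0"
    by (intro tendsto_intros)
  moreover have "\<bar>mol (kern nu rho m) (\<lambda>x. indicator A x *\<^sub>R c) x - indicator A x *\<^sub>R c\<bar>
      = \<bar>c\<bar> * \<bar>mol (kern nu rho m) (indicator A) x - indicator A x\<bar>" for m x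
    using mol_scale[of "kern nu rho m" c "indicator A" x]
    by (simp add: abs_mult[symmetric] right_diff_distrib mult.commute)
  ultimately show ?case by simp
next
  case (add f g)
  note mk = mollifier_kern[OF rho, of nu]
  show ?case
  proof (rule tendsto_sandwich[OF _ _ tendsto_const])
    show "(\<lambda>m. (mol_error nu rho m f) + (mol_error nu rho m g)) \<longlonglongrightarrow> 0" using tendsto_add[OF add(3,4)] by simp
    have "(LINT x|lborel. \<bar>mol (kern nu rho m) (\<lambda>x. f x + g x) x - (f x + g x)\<bar>)
      <= (mol_error nu rho m f) + (mol_error nu rho m g)" for m
    proof -
      let ?kappa = "kern nu rho m"
      have i: "integrable lborel (mol ?kappa (\<lambda>x. f x + g x))" "integrable lborel (mol ?kappa f)" "integrable lborel (mol ?kappa g)"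
        using add(1,2) by (auto intro!: mol_integrable mk)
      have "(LINT x|lborel. \<bar>mol ?kappa (\<lambda>x. f x + g x) x - (f x + g x)\<bar>)
        <= (LINT x|lborel. \<bar>mol ?kappa f x - f x\<bar> + \<bar>mol ?kappa g x - g x\<bar>)"
      proof (rule integral_mono)
        fix x
        have "mol ?kappa (\<lambda>x. f x + g x) x = mol ?kappa f x + mol ?kappa g x"
          by (rule mol_add[OF mollifier_test[OF mk] add(1,2)])
        then show "\<bar>mol ?kappa (\<lambda>x. f x + g x) x - (f x + g x)\<bar> <= \<bar>mol ?kappa f x - f x\<bar> + \<bar>mol ?kappa g x - g x\<bar>"
          by linarith
      qed (use i add(1,2) in auto)
      then show ?thesis using i add(1,2) by simp
    qed
    then show "\<forall>\<^sub>F m in sequentially. (LINT x|lborel. \<bar>mol (kern nu rho m) (\<lambda>x. f x + g x) x - (f x + g x)\<bar>)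
      <= (mol_error nu rho m f) + (mol_error nu rho m g)" by simp
    show "\<forall>\<^sub>F m in sequentially. 0 <= (LINT x|lborel. \<bar>mol (kern nu rho m) (\<lambda>x. f x + g x) x - (f x + g x)\<bar>)"
      by (intro always_eventually allI integral_nonneg_AE) auto
  qed
next
  case (lim f s)
  show ?case
  proof (rule mol_kern_L1_approx[OF rho lim(4)])
    fix e :: real assume e: "e > 0"
    have "(\<lambda>i. LINT x|lborel. \<bar>f x - s i x\<bar>) \<longlonglongrightarrow> (LINT x::'a|lborel. (0::real))"
    proof (rule integral_dominated_convergence[where w = "\<lambda>x. 3 * \<bar>f x\<bar>" and f = "\<lambda>_. 0" and s = "\<lambda>i x. \<bar>f x - s i x\<bar>"])
      show "integrable lborel (\<lambda>x. 3 * \<bar>f x\<bar>)" using lim(4) by simp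
      show "AE x in lborel. (\<lambda>i. \<bar>f x - s i x\<bar>) \<longlonglongrightarrow> 0"
      proof (intro AE_I2)
        fix x
        have "(\<lambda>i. \<bar>f x - s i x\<bar>) \<longlonglongrightarrow> \<bar>f x - f x\<bar>" using lim(2)[of x] by (intro tendsto_intros) auto
        then show "(\<lambda>i. \<bar>f x - s i x\<bar>) \<longlonglongrightarrow> 0" by simp
      qed
      show "AE x in lborel. norm \<bar>f x - s i x\<bar> <= 3 * \<bar>f x\<bar>" for i
      proof (intro AE_I2)
        fix x show "norm \<bar>f x - s i x\<bar> <= 3 * \<bar>f x\<bar>" using lim(3)[of x i] by (simp; linarith)
      qed
    qed (use lim(1,4) in auto)
    then have "\<forall>\<^sub>F i in sequentially. (LINT x|lborel. \<bar>f x - s i x\<bar>) < e" using e order_tendstoD(2) by fastforce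
    then obtain i where "(LINT x|lborel. \<bar>f x - s i x\<bar>) < e" using eventually_happens'[OF sequentially_bot] by blast
    then show "\<exists>h. integrable lborel h \<and> (LINT x|lborel. \<bar>f x - h x\<bar>) <= e \<and> (\<lambda>m. mol_error nu rho m h) \<longlonglongrightarrow> 0"
      using lim(1,5) by (intro exI[of _ "s i"]) auto
  qed
qed

text \<open>Along a subsequence with summable errors the mollifications are dominated, which replaces
convergence in the various Lebesgue spaces by dominated convergence.\<close>

lemma mol_kern_dominated:
  fixes G :: "'j => 'a::euclidean_space => real"
  assumes rho: "rho > 0" and J: "finite J" and G: "\<And>j. j \<in> J ==> integrable lborel (G j)"
  obtains r where "\<And>m. m <= r m"
    "\<And>j. j \<in> J ==> AE x in lborel. (\<lambda>m. mol (kern nu rho (r m)) (G j) x) \<longlonglongrightarrow> G j x"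
    "\<And>j. j \<in> J ==> \<exists>H. integrable lborel H \<and> (\<forall>x. 0 <= H x) \<and>
        (AE x in lborel. \<forall>m. \<bar>mol (kern nu rho (r m)) (G j) x\<bar> <= H x)"
proof -
  note mk = mollifier_kern[OF rho, of nu]
  have "\<exists>r\<ge>m. \<forall>j\<in>J. (LINT x|lborel. \<bar>mol (kern nu rho r) (G j) x - G j x\<bar>) < (1/2) ^ m" for m :: nat
  proof -
    have "\<forall>\<^sub>F r in sequentially. \<forall>j\<in>J. (LINT x|lborel. \<bar>mol (kern nu rho r) (G j) x - G j x\<bar>) < (1/2) ^ m"
      using J mol_kern_L1[OF rho G] by (intro eventually_ball_finite ballI order_tendstoD(2)) auto
    then have "\<forall>\<^sub>F r in sequentially. m <= r \<and> (\<forall>j\<in>J. (LINT x|lborel. \<bar>mol (kern nu rho r) (G j) x - G j x\<bar>) < (1/2) ^ m)"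
      using eventually_ge_at_top[of m] eventually_conj by blast
    then show ?thesis using eventually_happens'[OF sequentially_bot] by blast
  qed
  then obtain r where r: "\<And>m. m <= r m"
    "\<And>m j. j \<in> J ==> (LINT x|lborel. \<bar>mol (kern nu rho (r m)) (G j) x - G j x\<bar>) < (1/2) ^ m" by metis
  have main: "(AE x in lborel. (\<lambda>m. mol (kern nu rho (r m)) (G j) x) \<longlonglongrightarrow> G j x) \<and>
      (\<exists>H. integrable lborel H \<and> (\<forall>x. 0 <= H x) \<and> (AE x in lborel. \<forall>m. \<bar>mol (kern nu rho (r m)) (G j) x\<bar> <= H x))"
    if j: "j \<in> J" for j
  proof -
    define d where "d m x = \<bar>mol (kern nu rho (r m)) (G j) x - G j x\<bar>" for m x
    have di: "integrable lborel (d m)" for m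
      unfolding d_def[abs_def] using G[OF j] mol_integrable(1)[OF mk G[OF j]] by simp
    have [measurable]: "d m \<in> borel_measurable borel" for m using di by simp
    \<comment> \<open>The sum of all errors has finite integral. Hence
      \<open>\<bar>G j\<bar>\<close> plus this sum dominates the whole sequence, and the errors tend
      to 0 wherever the sum is finite.\<close>
    define S where "S x = (\<Sum>m. ennreal (d m x))" for x
    have [measurable]: "S \<in> borel_measurable borel" unfolding S_def[abs_def] by measurable
    have "(\<integral>\<^sup>+x. S x \<partial>lborel) = (\<Sum>m. \<integral>\<^sup>+x. ennreal (d m x) \<partial>lborel)"
      unfolding S_def by (intro nn_integral_suminf) measurable
    also have "... <= (\<Sum>m. ennreal ((1/2) ^ m))"
    proof (intro suminf_le)
      fix m
      have "(\<integral>\<^sup>+x. ennreal (d m x) \<partial>lborel) = ennreal (LINT x|lborel. d m x)"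
        proof (intro nn_integral_eq_integral AE_I2)
        show "integrable lborel (d m)" by (rule di)
        show "0 <= d m x" for x by (simp add: d_def)
      qed
      also have "... <= ennreal ((1/2) ^ m)" using r(2)[OF j, of m] by (intro ennreal_leI) (simp add: d_def)
      finally show "(\<integral>\<^sup>+x. ennreal (d m x) \<partial>lborel) <= ennreal ((1/2) ^ m)" .
    qed (rule summableI)+
    also have "... < \<infinity>"
    proof -
      have "summable (\<lambda>m. (1/2::real) ^ m)" by (rule summable_geometric) simp
      then have "(\<Sum>m. ennreal ((1/2) ^ m)) = ennreal (\<Sum>m. (1/2) ^ m)" by (intro suminf_ennreal2) auto
      then show ?thesis by (metis ennreal_less_top infinity_ennreal_def)
    qed
    finally have S_fin: "(\<integral>\<^sup>+x. S x \<partial>lborel) < \<infinity>" .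
    have AES: "AE x in lborel. S x \<noteq> \<infinity>" using S_fin by (intro nn_integral_noteq_infinite) auto
    have le: "d m x <= enn2real (S x)" if "S x \<noteq> \<infinity>" for m x
    proof -
      have "ennreal (d m x) <= S x" unfolding S_def using sum_le_suminf[of "\<lambda>m. ennreal (d m x)" "{m}"] by simp
      then have "enn2real (ennreal (d m x)) <= enn2real (S x)"
        using that by (intro enn2real_mono) (auto simp: less_top)
      then show ?thesis by (simp add: d_def)
    qed
    have lim: "(\<lambda>m. mol (kern nu rho (r m)) (G j) x) \<longlonglongrightarrow> G j x" if "S x \<noteq> \<infinity>" for x
    proof -
      have "summable (\<lambda>m. d m x)" using that unfolding S_def by (intro summable_suminf_not_top) (auto simp: d_def)
      then have "(\<lambda>m. d m x) \<longlonglongrightarrow> 0" by (rule summable_LIMSEQ_zero)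
      then have "(\<lambda>m. mol (kern nu rho (r m)) (G j) x - G j x) \<longlonglongrightarrow> 0"
        unfolding d_def by (rule tendsto_rabs_zero_cancel)
      then show ?thesis by (rule LIM_zero_cancel)
    qed
    define H where "H x = \<bar>G j x\<bar> + enn2real (S x)" for x
    have "integrable lborel (\<lambda>x. enn2real (S x))"
    proof (rule integrableI_nonneg)
      have "(\<integral>\<^sup>+x. ennreal (enn2real (S x)) \<partial>lborel) <= (\<integral>\<^sup>+x. S x \<partial>lborel)"
        by (intro nn_integral_mono) (metis ennreal_enn2real_if order_refl top_greatest zero_le)
      then show "(\<integral>\<^sup>+x. ennreal (enn2real (S x)) \<partial>lborel) < \<infinity>" using S_fin by simp
    qed auto
    then have Hi: "integrable lborel H" unfolding H_def[abs_def] using G[OF j] by simp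
    have "AE x in lborel. \<forall>m. \<bar>mol (kern nu rho (r m)) (G j) x\<bar> <= H x" using AES
    proof eventually_elim
      case (elim x)
      show ?case
      proof
        fix m show "\<bar>mol (kern nu rho (r m)) (G j) x\<bar> <= H x" using le[OF elim, of m] unfolding H_def d_def by linarith
      qed
    qed
    moreover have "AE x in lborel. (\<lambda>m. mol (kern nu rho (r m)) (G j) x) \<longlonglongrightarrow> G j x"
      using AES by eventually_elim (rule lim)
    ultimately show ?thesis using Hi by (intro conjI exI[of _ H]) (auto simp: H_def)
  qed
  then show ?thesis using that[of r] r(1) by blast
qed

section \<open>Local Lebesgue and Sobolev spaces\<close>

lemma locally_Lp_on_set_integrable:
  fixes f :: "'a::euclidean_space => 'b::euclidean_space"
  assumes "locally_Lp_on p S f" "p >= 1" "compact K" "K \<subseteq> S" shows "integrable lborel (\<lambda>x. indicator K x *\<^sub>R f x)"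
proof (rule Bochner_Integration.integrable_bound)
  have m: "set_borel_measurable lborel K f" and i: "set_integrable lborel K (\<lambda>x. norm (f x) powr p)"
    using assms by (auto simp: locally_Lp_on_def)
  show "(\<lambda>x. indicator K x *\<^sub>R f x) \<in> borel_measurable lborel" using m by (simp add: set_borel_measurable_def)
  have "integrable lborel (indicator K :: 'a => real)"
    using assms(3) emeasure_compact_finite[of K] by (intro integrable_real_indicator) (auto simp: compact_imp_closed)
  then show "integrable lborel (\<lambda>x. indicator K x + indicator K x *\<^sub>R norm (f x) powr p)"
    using i by (simp add: set_integrable_def)
  show "AE x in lborel. norm (indicator K x *\<^sub>R f x) <= norm (indicator K x + indicator K x *\<^sub>R norm (f x) powr p)"
  proof (intro AE_I2)
    fix x
    have "norm (f x) <= 1 + norm (f x) powr p"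
    proof (cases "norm (f x) <= 1")
      case False
      then have "norm (f x) powr 1 <= norm (f x) powr p" using assms(2) by (intro powr_mono) auto
      then show ?thesis using False by simp
    qed (simp add: add_increasing2)
    then show "norm (indicator K x *\<^sub>R f x) <= norm (indicator K x + indicator K x *\<^sub>R norm (f x) powr p)"
      by (auto simp: indicator_def)
  qed
qed

lemma continuous_on_imp_locally_Lp_on:
  fixes f :: "'a::euclidean_space => 'b::euclidean_space"
  assumes "continuous_on S f" "p >= 1" shows "locally_Lp_on p S f" unfolding locally_Lp_on_def
proof (intro allI impI)
  fix K assume K: "compact K \<and> K \<subseteq> S"
  then have c: "continuous_on K f" using assms(1) continuous_on_subset by blast
  have "integrable lborel (\<lambda>x. indicator K x *\<^sub>R f x)" using K c by (intro borel_integrable_compact) auto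
  moreover have "integrable lborel (\<lambda>x. indicator K x *\<^sub>R (norm (f x) powr p))"
    using K assms(2) by (intro borel_integrable_compact continuous_on_powr' continuous_intros c) auto
  ultimately show "set_borel_measurable lborel K f \<and> set_integrable lborel K (\<lambda>x. norm (f x) powr p)"
    by (simp add: set_borel_measurable_def set_integrable_def borel_measurable_integrable)
qed

lemma powr_add_le:
  fixes a b p :: real
  assumes "a >= 0" "b >= 0" "p >= 0" shows "(a + b) powr p <= 2 powr p * (a powr p + b powr p)"
proof -
  have "(a + b) powr p <= (2 * max a b) powr p" using assms by (intro powr_mono2) auto
  also have "... = 2 powr p * max a b powr p" using assms by (simp add: powr_mult)
  also have "max a b powr p <= a powr p + b powr p" by (auto simp: max_def)
  finally show ?thesis by simp
qed

lemma locally_Lp_on_add: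
  fixes f g :: "'a::euclidean_space => 'b::euclidean_space"
  assumes f: "locally_Lp_on p S f" and g: "locally_Lp_on p S g" and p: "p >= 0"
  shows "locally_Lp_on p S (\<lambda>x. f x + g x)" unfolding locally_Lp_on_def
proof (intro allI impI)
  fix K assume K: "compact K \<and> K \<subseteq> S"
  have f': "(\<lambda>x. indicator K x *\<^sub>R f x) \<in> borel_measurable lborel"
     "integrable lborel (\<lambda>x. indicator K x *\<^sub>R norm (f x) powr p)"
   and g': "(\<lambda>x. indicator K x *\<^sub>R g x) \<in> borel_measurable lborel"
     "integrable lborel (\<lambda>x. indicator K x *\<^sub>R norm (g x) powr p)"
    using f g K by (auto simp: locally_Lp_on_def set_borel_measurable_def set_integrable_def)
  have m: "(\<lambda>x. indicator K x *\<^sub>R (f x + g x)) \<in> borel_measurable lborel"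
    using borel_measurable_add[OF f'(1) g'(1)] by (simp add: scaleR_add_right)
  have "(\<lambda>x. indicator K x * norm (indicator K x *\<^sub>R (f x + g x)) powr p) \<in> borel_measurable lborel"
  proof -
    note [measurable] = m
    have [measurable]: "K \<in> sets borel" using K by (simp add: borel_compact)
    show ?thesis by measurable
  qed
  moreover have "indicator K x * norm (indicator K x *\<^sub>R (f x + g x)) powr p = indicator K x *\<^sub>R norm (f x + g x) powr p" for x
    by (simp add: indicator_def)
  ultimately have m2: "(\<lambda>x. indicator K x *\<^sub>R norm (f x + g x) powr p) \<in> borel_measurable lborel" by (simp only:)
  have "integrable lborel (\<lambda>x. indicator K x *\<^sub>R norm (f x + g x) powr p)"
  proof (rule Bochner_Integration.integrable_bound[OF _ m2])
    show "integrable lborel (\<lambda>x. 2 powr p * (indicator K x *\<^sub>R norm (f x) powr p + indicator K x *\<^sub>R norm (g x) powr p))"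
      using f'(2) g'(2) by simp
    have "norm (f x + g x) powr p <= 2 powr p * (norm (f x) powr p + norm (g x) powr p)" for x
      using p by (intro order_trans[OF powr_mono2 powr_add_le] norm_triangle_ineq) auto
    then show "AE x in lborel. norm (indicator K x *\<^sub>R norm (f x + g x) powr p)
       <= norm (2 powr p * (indicator K x *\<^sub>R norm (f x) powr p + indicator K x *\<^sub>R norm (g x) powr p))"
      by (intro AE_I2) (simp add: indicator_def)
  qed
  then show "set_borel_measurable lborel K (\<lambda>x. f x + g x) \<and> set_integrable lborel K (\<lambda>x. norm (f x + g x) powr p)"
    using m by (simp add: set_borel_measurable_def set_integrable_def)
qed

lemma locally_Lp_on_bound:
  fixes f :: "'a::euclidean_space => 'b::euclidean_space" and g :: "'a => 'c::euclidean_space"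
  assumes f: "locally_Lp_on p S f" and p: "p >= 0"
    and m: "\<And>K. compact K ==> K \<subseteq> S ==> (\<lambda>x. indicator K x *\<^sub>R g x) \<in> borel_measurable borel"
    and le: "\<And>x. x \<in> S ==> norm (g x) <= C * norm (f x)" and C: "C >= 0" shows "locally_Lp_on p S g"
  unfolding locally_Lp_on_def
proof (intro allI impI)
  fix K assume K: "compact K \<and> K \<subseteq> S"
  have f': "integrable lborel (\<lambda>x. indicator K x *\<^sub>R norm (f x) powr p)"
    using f K by (auto simp: locally_Lp_on_def set_integrable_def)
  have m: "(\<lambda>x. indicator K x *\<^sub>R g x) \<in> borel_measurable lborel" using m K by simp
  have "(\<lambda>x. indicator K x * norm (indicator K x *\<^sub>R g x) powr p) \<in> borel_measurable lborel"
  proof -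
    note [measurable] = m
    have [measurable]: "K \<in> sets borel" using K by (simp add: borel_compact)
    show ?thesis by measurable
  qed
  moreover have "indicator K x * norm (indicator K x *\<^sub>R g x) powr p = indicator K x *\<^sub>R norm (g x) powr p" for x
    by (simp add: indicator_def)
  ultimately have m2: "(\<lambda>x. indicator K x *\<^sub>R norm (g x) powr p) \<in> borel_measurable lborel" by (simp only:)
  have "integrable lborel (\<lambda>x. indicator K x *\<^sub>R norm (g x) powr p)"
  proof (rule Bochner_Integration.integrable_bound[OF _ m2])
    show "integrable lborel (\<lambda>x. C powr p * (indicator K x *\<^sub>R norm (f x) powr p))" using f' by simp
    have "norm (g x) powr p <= C powr p * norm (f x) powr p" if "x \<in> S" for x
    proof -
      have "norm (g x) powr p <= (C * norm (f x)) powr p" using le[OF that] p by (intro powr_mono2) auto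
      then show ?thesis using C by (simp add: powr_mult)
    qed
    then show "AE x in lborel. norm (indicator K x *\<^sub>R norm (g x) powr p)
       <= norm (C powr p * (indicator K x *\<^sub>R norm (f x) powr p))"
      using K by (intro AE_I2) (auto simp: indicator_def)
  qed
  then show "set_borel_measurable lborel K g \<and> set_integrable lborel K (\<lambda>x. norm (g x) powr p)"
    using m by (simp add: set_borel_measurable_def set_integrable_def)
qed

lemma locally_Lp_on_borel:
  "locally_Lp_on p S f ==> compact K ==> K \<subseteq> S ==> (\<lambda>x. indicator K x *\<^sub>R f x) \<in> borel_measurable borel"
  by (auto simp: locally_Lp_on_def set_borel_measurable_def)

lemma locally_Lp_on_linear:
  fixes f :: "'a::euclidean_space => 'b::euclidean_space" and L :: "'b => 'c::euclidean_space"
  assumes L: "bounded_linear L" and f: "locally_Lp_on p S f" and p: "p >= 0" shows "locally_Lp_on p S (\<lambda>x. L (f x))"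
proof (rule locally_Lp_on_bound[OF f p])
  show "norm (L (f x)) <= onorm L * norm (f x)" for x by (rule onorm[OF L])
  show "onorm L >= 0" by (rule onorm_pos_le[OF L])
  fix K assume K: "compact K" "K \<subseteq> S"
  have "L \<in> borel_measurable borel" using linear_continuous_on[OF L] by (rule borel_measurable_continuous_onI)
  then have "(\<lambda>x. L (indicator K x *\<^sub>R f x)) \<in> borel_measurable borel"
    using locally_Lp_on_borel[OF f K] by measurable
  then show "(\<lambda>x. indicator K x *\<^sub>R L (f x)) \<in> borel_measurable borel"
    by (simp add: linear_scale[OF bounded_linear.linear[OF L]])
qed

lemma locally_Lp_on_cong:
  assumes "locally_Lp_on p S f" "\<And>x. x \<in> S ==> f x = g x" shows "locally_Lp_on p S g"
  unfolding locally_Lp_on_def set_borel_measurable_def set_integrable_def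
proof (intro allI impI)
  fix K assume K: "compact K \<and> K \<subseteq> S"
  then have "(\<lambda>x. indicator K x *\<^sub>R g x) = (\<lambda>x. indicator K x *\<^sub>R f x)"
    "(\<lambda>x. indicator K x *\<^sub>R norm (g x) powr p) = (\<lambda>x. indicator K x *\<^sub>R norm (f x) powr p)"
    using assms(2) by (auto simp: fun_eq_iff indicator_def)
  then show "(\<lambda>x. indicator K x *\<^sub>R g x) \<in> borel_measurable lborel \<and>
       integrable lborel (\<lambda>x. indicator K x *\<^sub>R norm (g x) powr p)"
    using assms(1) K by (auto simp: locally_Lp_on_def set_borel_measurable_def set_integrable_def)
qed

lemma locally_Lp_on_subset: "locally_Lp_on p S f ==> T \<subseteq> S ==> locally_Lp_on p T f"
  by (auto simp: locally_Lp_on_def)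

section \<open>Weak derivatives\<close>

lemma test_function_mult_integrable:
  fixes f :: "'a::euclidean_space => 'b::euclidean_space"
  assumes psi: "test_function (interior S) psi" and f: "locally_Lp_on p S f" and p: "p >= 1"
  shows "integrable lborel (\<lambda>x. psi x *\<^sub>R f x)"
proof -
  obtain K where K: "compact K" "K \<subseteq> interior S" "\<And>x. x \<notin> K ==> psi x = 0"
    using psi by (auto simp: test_function_def)
  have KS: "K \<subseteq> S" using K(2) interior_subset by blast
  obtain B where B: "B > 0" "\<And>x. \<bar>psi x\<bar> <= B" using test_function_bounded[OF psi] by metis
  have [measurable]: "psi \<in> borel_measurable borel" by (rule test_function_borel[OF psi])
  have fi: "integrable lborel (\<lambda>x. indicator K x *\<^sub>R f x)" by (rule locally_Lp_on_set_integrable[OF f p K(1) KS])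
  have "integrable lborel (\<lambda>x. psi x *\<^sub>R (indicator K x *\<^sub>R f x))"
  proof (rule Bochner_Integration.integrable_bound)
    show "integrable lborel (\<lambda>x. B *\<^sub>R (indicator K x *\<^sub>R f x))" by (rule integrable_scaleR_right[OF fi])
    show "(\<lambda>x. psi x *\<^sub>R (indicator K x *\<^sub>R f x)) \<in> borel_measurable lborel" using fi by measurable
    show "AE x in lborel. norm (psi x *\<^sub>R (indicator K x *\<^sub>R f x)) <= norm (B *\<^sub>R (indicator K x *\<^sub>R f x))"
    proof (intro AE_I2)
      fix x
      have "\<bar>psi x\<bar> * norm (f x) <= B * norm (f x)" by (intro mult_right_mono B) simp
      then show "norm (psi x *\<^sub>R (indicator K x *\<^sub>R f x)) <= norm (B *\<^sub>R (indicator K x *\<^sub>R f x))"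
        using B(1) by (simp add: indicator_def)
    qed
  qed
  moreover have "(\<lambda>x. psi x *\<^sub>R (indicator K x *\<^sub>R f x)) = (\<lambda>x. psi x *\<^sub>R f x)"
    using K(3) by (auto simp: fun_eq_iff indicator_def)
  ultimately show ?thesis by simp
qed

lemma weak_deriv_on_alt:
  "weak_deriv_on S b f g \<longleftrightarrow>
     (\<forall>psi. test_function (interior S) psi --> (LINT x|lborel. dd b psi x *\<^sub>R f x) = - (LINT x|lborel. psi x *\<^sub>R g x))"
  by (simp add: weak_deriv_on_def dd_def)

lemma weak_deriv_onD:
  "weak_deriv_on S b f g ==> test_function (interior S) psi ==>
     (LINT x|lborel. dd b psi x *\<^sub>R f x) = - (LINT x|lborel. psi x *\<^sub>R g x)" by (simp add: weak_deriv_on_alt)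

lemma weak_deriv_on_add:
  assumes "weak_deriv_on S b f g" "weak_deriv_on S b f' g'" and p: "p >= 1"
    and Lp: "locally_Lp_on p S f" "locally_Lp_on p S g" "locally_Lp_on p S f'" "locally_Lp_on p S g'"
  shows "weak_deriv_on S b (\<lambda>x. f x + f' x) (\<lambda>x. g x + g' x)" unfolding weak_deriv_on_alt
proof (intro allI impI)
  fix psi assume psi: "test_function (interior S) psi"
  note int = test_function_mult_integrable[OF psi _ p] test_function_mult_integrable[OF test_function_dd[OF psi] _ p]
  show "(LINT x|lborel. dd b psi x *\<^sub>R (f x + f' x)) = - (LINT x|lborel. psi x *\<^sub>R (g x + g' x))"
    using weak_deriv_onD[OF assms(1) psi] weak_deriv_onD[OF assms(2) psi] by (simp add: scaleR_add_right int Lp)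
qed

lemma weak_deriv_on_linear:
  assumes L: "bounded_linear L" and "weak_deriv_on S b f g" and p: "p >= 1"
    and Lp: "locally_Lp_on p S f" "locally_Lp_on p S g" shows "weak_deriv_on S b (\<lambda>x. L (f x)) (\<lambda>x. L (g x))"
  unfolding weak_deriv_on_alt
proof (intro allI impI)
  fix psi assume psi: "test_function (interior S) psi"
  note lin = bounded_linear.linear[OF L]
  have "(LINT x|lborel. dd b psi x *\<^sub>R L (f x)) = L (LINT x|lborel. dd b psi x *\<^sub>R f x)"
    using integral_bounded_linear[OF L test_function_mult_integrable[OF test_function_dd[OF psi] Lp(1) p]]
    by (simp add: linear_scale[OF lin])
  also have "... = - L (LINT x|lborel. psi x *\<^sub>R g x)"
    using weak_deriv_onD[OF assms(2) psi] by (simp add: linear_neg[OF lin])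
  also have "L (LINT x|lborel. psi x *\<^sub>R g x) = (LINT x|lborel. psi x *\<^sub>R L (g x))"
    using integral_bounded_linear[OF L test_function_mult_integrable[OF psi Lp(2) p]]
    by (simp add: linear_scale[OF lin])
  finally show "(LINT x|lborel. dd b psi x *\<^sub>R L (f x)) = - (LINT x|lborel. psi x *\<^sub>R L (g x))" .
qed

lemma weak_deriv_on_subset:
  "weak_deriv_on S b f g ==> T \<subseteq> S ==> weak_deriv_on T b f g"
  unfolding weak_deriv_on_alt using test_function_mono interior_mono by blast

lemma test_function_zero_outside: "test_function U psi ==> x \<notin> U ==> psi x = 0" by (auto simp: test_function_def)

lemma weak_deriv_on_cong:
  assumes "weak_deriv_on S b f g" "\<And>x. x \<in> S ==> f x = f' x" "\<And>x. x \<in> S ==> g x = g' x"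
  shows "weak_deriv_on S b f' g'" unfolding weak_deriv_on_alt
proof (intro allI impI)
  fix psi assume psi: "test_function (interior S) psi"
  have 1: "(\<lambda>x. dd b psi x *\<^sub>R f' x) = (\<lambda>x. dd b psi x *\<^sub>R f x)"
    using test_function_zero_outside[OF test_function_dd[OF psi]] assms(2) interior_subset by fastforce
  have 2: "(\<lambda>x. psi x *\<^sub>R g' x) = (\<lambda>x. psi x *\<^sub>R g x)"
    using test_function_zero_outside[OF psi] assms(3) interior_subset by fastforce
  show "(LINT x|lborel. dd b psi x *\<^sub>R f' x) = - (LINT x|lborel. psi x *\<^sub>R g' x)"
    unfolding 1 2 by (rule weak_deriv_onD[OF assms(1) psi])
qed

lemma weakly_deriv_on_Lp: "weakly_deriv_on p S k f ==> locally_Lp_on p S f" by (cases k) auto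

lemma weakly_deriv_on_add:
  assumes p: "p >= 1"
  shows "weakly_deriv_on p S k f ==> weakly_deriv_on p S k g ==> weakly_deriv_on p S k (\<lambda>x. f x + g x)"
proof (induction k arbitrary: f g)
  case 0
  then show ?case using locally_Lp_on_add[of p S f g] p by simp
next
  case (Suc k)
  have "\<exists>h. weak_deriv_on S b (\<lambda>x. f x + g x) h \<and> weakly_deriv_on p S k h" if b: "b \<in> Basis" for b
  proof -
    obtain f' where f': "weak_deriv_on S b f f'" "weakly_deriv_on p S k f'" using Suc.prems(1) b by auto
    obtain g' where g': "weak_deriv_on S b g g'" "weakly_deriv_on p S k g'" using Suc.prems(2) b by auto
    show ?thesis
      using weak_deriv_on_add[OF f'(1) g'(1) p] Suc.IH[OF f'(2) g'(2)] Suc.prems f' g' weakly_deriv_on_Lp by blast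
  qed
  then show ?case using locally_Lp_on_add[of p S f g] p Suc.prems by auto
qed

lemma weakly_deriv_on_linear:
  assumes p: "p >= 1" and L: "bounded_linear L"
  shows "weakly_deriv_on p S k f ==> weakly_deriv_on p S k (\<lambda>x. L (f x))"
proof (induction k arbitrary: f)
  case 0
  then show ?case using locally_Lp_on_linear[OF L, of p S f] p by simp
next
  case (Suc k)
  have "\<exists>h. weak_deriv_on S b (\<lambda>x. L (f x)) h \<and> weakly_deriv_on p S k h" if b: "b \<in> Basis" for b
  proof -
    obtain f' where f': "weak_deriv_on S b f f'" "weakly_deriv_on p S k f'" using Suc.prems(1) b by auto
    show ?thesis using weak_deriv_on_linear[OF L f'(1) p] Suc.IH[OF f'(2)] Suc.prems f' weakly_deriv_on_Lp by blast
  qed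
  then show ?case using locally_Lp_on_linear[OF L, of p S f] p Suc.prems by auto
qed

lemma weakly_deriv_on_subset:
  "weakly_deriv_on p S k f ==> T \<subseteq> S ==> weakly_deriv_on p T k f"
proof (induction k arbitrary: f)
  case (Suc k)
  have "\<exists>h. weak_deriv_on T b f h \<and> weakly_deriv_on p T k h" if b: "b \<in> Basis" for b
  proof -
    obtain f' where f': "weak_deriv_on S b f f'" "weakly_deriv_on p S k f'" using Suc.prems(1) b by auto
    show ?thesis using weak_deriv_on_subset[OF f'(1) Suc.prems(2)] Suc.IH[OF f'(2) Suc.prems(2)] by blast
  qed
  moreover have "locally_Lp_on p T f" using Suc.prems locally_Lp_on_subset by auto
  ultimately show ?case by simp
qed (auto intro: locally_Lp_on_subset)

lemma weakly_deriv_on_cong: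
  assumes "weakly_deriv_on p S k f" "\<And>x. x \<in> S ==> f x = g x" shows "weakly_deriv_on p S k g"
proof (cases k)
  case 0
  then show ?thesis using assms(1) by (auto intro: locally_Lp_on_cong[OF _ assms(2)])
next
  case (Suc j)
  have w: "weak_deriv_on S b g h" if "weak_deriv_on S b f h" for b h
    by (rule weak_deriv_on_cong[OF that assms(2)]) auto
  have "locally_Lp_on p S g" using assms(1) Suc by (intro locally_Lp_on_cong[OF _ assms(2)]) auto
  moreover have "\<forall>b\<in>Basis. \<exists>h. weak_deriv_on S b g h \<and> weakly_deriv_on p S j h"
    using assms(1) w unfolding Suc weakly_deriv_on.simps by blast
  ultimately show ?thesis by (simp add: Suc)
qed

lemma integral_lborel_shift:
  fixes f :: "'a::euclidean_space => 'b::euclidean_space"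
  assumes "f \<in> borel_measurable borel" shows "(LINT x|lborel. f (x + y)) = (LINT x|lborel. f x)"
proof -
  have "(LINT x|lborel. f x) = (LINT x|distr lborel borel ((+) y). f x)" by (simp add: lborel_distr_plus)
  also have "... = (LINT x|lborel. f (y + x))" using assms by (intro integral_distr) auto
  finally show ?thesis by (simp add: add.commute)
qed

text \<open>By translation invariance each difference quotient has integral 0. The quotients are
  bounded and supported in one compact set, so dominated convergence passes to the
  derivative.\<close>

lemma integral_directional_derivative:
  fixes h :: "'a::euclidean_space => 'b::euclidean_space"
  assumes h': "\<And>x. (h has_derivative h' x) (at x)" and cont: "continuous_on UNIV (\<lambda>x. h' x b)"
    and K: "compact K" "\<And>x. x \<notin> K ==> h x = 0" shows "(LINT x|lborel. h' x b) = 0"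
proof -
  have hc: "continuous_on UNIV h" using h' has_derivative_continuous continuous_at_imp_continuous_on by blast
  have [measurable]: "h \<in> borel_measurable borel" "(\<lambda>x. h' x b) \<in> borel_measurable borel"
    using hc cont by (auto intro: borel_measurable_continuous_onI)
  have hi: "integrable lborel h"
  proof -
    have "integrable lborel (\<lambda>x. indicator K x *\<^sub>R h x)"
      using K(1) hc by (intro borel_integrable_compact continuous_on_subset[OF hc]) auto
    moreover have "(\<lambda>x. indicator K x *\<^sub>R h x) = h" using K(2) by (auto simp: fun_eq_iff indicator_def)
    ultimately show ?thesis by simp
  qed
  have h0: "h' x b = 0" if "x \<notin> K" for x
  proof -
    have "((\<lambda>x. 0) has_derivative (\<lambda>v. 0)) (at x)" by simp
    then have "(h has_derivative (\<lambda>v. 0)) (at x)"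
      by (rule has_derivative_transform_within_open[of _ _ _ _ "- K"]) (use K that compact_imp_closed in auto)
    then show ?thesis using has_derivative_unique[OF h'] by metis
  qed
  have "bounded ((\<lambda>x. h' x b) ` K)"
    using K(1) cont by (intro compact_imp_bounded compact_continuous_image continuous_on_subset[OF cont]) auto
  then obtain B where B: "B > 0" "\<And>x. x \<in> K ==> norm (h' x b) <= B" by (auto simp: bounded_pos)
  have B': "norm (h' x b) <= B" for x using B h0[of x] by (cases "x \<in> K") auto
  define epsilon where "epsilon m = inverse (real (Suc m))" for m
  have epsilon: "epsilon m > 0" "epsilon m <= 1" for m by (auto simp: epsilon_def inverse_le_1_iff)
  have epsilon0: "epsilon \<longlonglongrightarrow> 0" unfolding epsilon_def by (rule LIMSEQ_inverse_real_of_nat)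
  define q where "q m x = (1 / epsilon m) *\<^sub>R (h (x + epsilon m *\<^sub>R b) - h x)" for m x
  have hs: "integrable lborel (\<lambda>x. h (x + y))" for y
  proof -
    have "integrable (distr lborel borel ((+) y)) h" using hi by (simp add: lborel_distr_plus)
    then have "integrable lborel (\<lambda>x. h (y + x))" by (subst (asm) integrable_distr_eq) auto
    then show ?thesis by (simp add: add.commute)
  qed
  have q0: "(LINT x|lborel. q m x) = 0" for m
    unfolding q_def using hs hi integral_lborel_shift[of h "epsilon m *\<^sub>R b"] by simp
  define K2 where "K2 = {x + y | x y. x \<in> K \<and> y \<in> cball 0 (norm b)}"
  have K2: "compact K2" unfolding K2_def by (rule compact_sums[OF K(1) compact_cball])
  have qb: "norm (q m x) <= indicator K2 x * B" for m x
  proof (cases "x \<in> K2")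
    case True
    have "norm (h (x + epsilon m *\<^sub>R b) - h x) <= epsilon m * B"
    proof -
      define g where "g t = h (x + t *\<^sub>R b)" for t :: real
      have g': "(g has_derivative (\<lambda>s. h' (x + t *\<^sub>R b) (s *\<^sub>R b))) (at t within {0..epsilon m})" for t
        unfolding g_def by (rule has_derivative_compose[OF _ h']) (auto intro!: derivative_eq_intros)
      have "norm (g (epsilon m) - g 0) <= B * norm (epsilon m - 0)"
      proof (rule differentiable_bound[OF _ g'])
        show "onorm (\<lambda>s. h' (x + t *\<^sub>R b) (s *\<^sub>R b)) <= B" for t
        proof (rule onorm_le)
          fix s :: real
          have "h' (x + t *\<^sub>R b) (s *\<^sub>R b) = s *\<^sub>R h' (x + t *\<^sub>R b) b"
            using linear_scale[OF has_derivative_linear[OF h']] by blast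
          then show "norm (h' (x + t *\<^sub>R b) (s *\<^sub>R b)) <= B * norm s"
            using mult_left_mono[OF B'[of "x + t *\<^sub>R b"], of "\<bar>s\<bar>"] by (simp add: mult.commute)
        qed
      qed (use epsilon(1)[of m] in auto)
      then show ?thesis using epsilon(1)[of m] by (simp add: g_def mult.commute)
    qed
    then have "norm (q m x) <= B" using epsilon(1)[of m] by (simp add: q_def divide_le_eq mult.commute)
    then show ?thesis using True by simp
  next
    case False
    have "x \<notin> K"
    proof
      assume "x \<in> K"
      then have "x + 0 \<in> K2" unfolding K2_def by (intro CollectI exI[of _ x] exI[of _ 0]) auto
      then show False using False by simp
    qed
    moreover have "x + epsilon m *\<^sub>R b \<notin> K"
    proof
      assume a: "x + epsilon m *\<^sub>R b \<in> K"
      have "norm (epsilon m *\<^sub>R b) <= norm b" using epsilon[of m] by (simp add: mult_left_le_one_le)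
      then have "(x + epsilon m *\<^sub>R b) + (- (epsilon m *\<^sub>R b)) \<in> K2"
        using a unfolding K2_def by (intro CollectI exI[of _ "x + epsilon m *\<^sub>R b"] exI[of _ "- (epsilon m *\<^sub>R b)"]) auto
      then show False using False by simp
    qed
    ultimately show ?thesis using K(2) by (simp add: q_def False)
  qed
  have "(\<lambda>m. LINT x|lborel. q m x) \<longlonglongrightarrow> (LINT x|lborel. h' x b)"
  proof (rule integral_dominated_convergence)
    show "integrable lborel (\<lambda>x. indicator K2 x * B)"
      using K2 emeasure_compact_finite[of K2] by (intro integrable_mult_left integrable_real_indicator) (auto simp: compact_imp_closed)
    show "AE x in lborel. norm (q m x) <= indicator K2 x * B" for m using qb by simp
    show "AE x in lborel. (\<lambda>m. q m x) \<longlonglongrightarrow> h' x b"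
    proof (intro AE_I2)
      fix x
      have "((\<lambda>t. h (x + t *\<^sub>R b)) has_derivative (\<lambda>s. h' x (s *\<^sub>R b))) (at 0)"
      proof (rule has_derivative_compose[of "\<lambda>t. x + t *\<^sub>R b", where g = h])
        show "((\<lambda>t. x + t *\<^sub>R b) has_derivative (\<lambda>s. s *\<^sub>R b)) (at 0)" by (auto intro!: derivative_eq_intros)
      qed (use h'[of x] in simp)
      then have "((\<lambda>t. h (x + t *\<^sub>R b)) has_vector_derivative h' x b) (at 0)"
        unfolding has_vector_derivative_def using linear_scale[OF has_derivative_linear[OF h']] by simp
      then have "((\<lambda>t. (1 / norm (t - 0)) *\<^sub>R (h (x + t *\<^sub>R b) - (h (x + 0 *\<^sub>R b) + (t - 0) *\<^sub>R h' x b))) \<longlongrightarrow> 0) (at 0)"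
        unfolding has_vector_derivative_def has_derivative_within by blast
      moreover have "filterlim epsilon (at 0) sequentially"
        using epsilon0 epsilon(1) by (auto simp: filterlim_at less_imp_neq[symmetric])
      ultimately have "(\<lambda>m. (1 / norm (epsilon m - 0)) *\<^sub>R (h (x + epsilon m *\<^sub>R b) - (h (x + 0 *\<^sub>R b) + (epsilon m - 0) *\<^sub>R h' x b))) \<longlonglongrightarrow> 0"
        by (rule filterlim_compose)
      moreover have "(1 / norm (epsilon m - 0)) *\<^sub>R (h (x + epsilon m *\<^sub>R b) - (h (x + 0 *\<^sub>R b) + (epsilon m - 0) *\<^sub>R h' x b)) = q m x - h' x b" for m
        using epsilon(1)[of m] by (simp add: q_def algebra_simps)
      ultimately have "(\<lambda>m. q m x - h' x b) \<longlonglongrightarrow> 0" by simp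
      then show "(\<lambda>m. q m x) \<longlonglongrightarrow> h' x b" by (rule LIM_zero_cancel)
    qed
  qed (auto simp: q_def[abs_def])
  then have "(\<lambda>m::nat. 0 :: 'b) \<longlonglongrightarrow> (LINT x|lborel. h' x b)" by (simp only: q0)
  then show ?thesis by (simp only: LIMSEQ_const_iff)
qed

text \<open>The product of f with a test function extends by 0 to a function on the whole space
  whose derivative along b is continuous and has integral zero; the product rule then gives
  integration by parts.\<close>

lemma differentiable_weak_deriv_on:
  fixes f :: "'a::euclidean_space => 'b::euclidean_space"
  assumes f': "\<And>x. x \<in> S ==> (f has_derivative f' x) (at x within S)" and cont: "continuous_on S (\<lambda>x. f' x b)"
  shows "weak_deriv_on S b f (\<lambda>x. f' x b)" unfolding weak_deriv_on_alt
proof (intro allI impI)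
  fix psi assume psi: "test_function (interior S) psi"
  obtain K where K: "compact K" "K \<subseteq> interior S" "\<And>x. x \<notin> K ==> psi x = 0"
    using psi by (auto simp: test_function_def)
  have sm: "smooth psi" by (rule test_function_smooth[OF psi])
  have ddK: "dd v psi x = 0" if "x \<notin> K" for v x
  proof -
    have "((\<lambda>x. 0) has_derivative (\<lambda>v. 0)) (at x)" by simp
    then have "(psi has_derivative (\<lambda>v. 0)) (at x)"
      by (rule has_derivative_transform_within_open[of _ _ _ _ "- K"]) (use K that compact_imp_closed in auto)
    then show ?thesis using dd_eq by blast
  qed
  have fc: "continuous_on S f" using f' has_derivative_continuous continuous_on_eq_continuous_within by blast
  define h where "h x = psi x *\<^sub>R f x" for x
  define h' where "h' x v = psi x *\<^sub>R f' x v + dd v psi x *\<^sub>R f x" for x v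
  have "(h has_derivative h' x) (at x)" for x
  proof (cases "x \<in> K")
    case True
    then have x: "x \<in> interior S" using K by blast
    then have "(f has_derivative f' x) (at x)" using f'[of x] interior_subset by (metis at_within_interior subsetD)
    then show ?thesis unfolding h_def[abs_def] h'_def[abs_def]
      by (intro has_derivative_scaleR smooth_has_derivative[OF sm])
  next
    case False
    have "((\<lambda>x. 0) has_derivative (\<lambda>v. 0)) (at x)" by simp
    then have "(h has_derivative (\<lambda>v. 0)) (at x)" by (rule has_derivative_transform_within_open[of _ _ _ _ "- K"])
        (use K False compact_imp_closed in \<open>auto simp: h_def\<close>)
    moreover have "h' x = (\<lambda>v. 0)" using K(3)[OF False] ddK[OF False] by (simp add: h'_def[abs_def])
    ultimately show ?thesis by simp
  qed
  moreover have "continuous_on UNIV (\<lambda>x. h' x b)"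
  proof -
    have "continuous_on (interior S) (\<lambda>x. h' x b)" unfolding h'_def using interior_subset
      by (intro continuous_intros continuous_on_subset[OF cont] continuous_on_subset[OF fc]
          continuous_on_subset[OF smooth_on_imp_continuous[OF sm]]
          continuous_on_subset[OF smooth_on_imp_continuous[OF smooth_dd[OF sm]]]) auto
    moreover have "continuous_on (- K) (\<lambda>x. h' x b)"
      using K(3) ddK by (subst continuous_on_cong[OF refl, of _ _ "\<lambda>x. 0"]) (auto simp: h'_def)
    ultimately have "continuous_on (interior S \<union> - K) (\<lambda>x. h' x b)"
      using K(1) by (intro continuous_on_open_Un) (auto simp: compact_imp_closed open_Compl)
    moreover have "interior S \<union> - K = UNIV" using K(2) by auto
    ultimately show ?thesis by simp
  qed
  ultimately have "(LINT x|lborel. h' x b) = 0"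
    using K(1,3) by (intro integral_directional_derivative[of h h' b K]) (auto simp: h_def)
  moreover have "integrable lborel (\<lambda>x. psi x *\<^sub>R f' x b)"
    by (rule test_function_mult_integrable[OF psi continuous_on_imp_locally_Lp_on[OF cont, of 1]]) auto
  moreover have "integrable lborel (\<lambda>x. dd b psi x *\<^sub>R f x)"
    by (rule test_function_mult_integrable[OF test_function_dd[OF psi] continuous_on_imp_locally_Lp_on[OF fc, of 1]]) auto
  ultimately show "(LINT x|lborel. dd b psi x *\<^sub>R f x) = - (LINT x|lborel. psi x *\<^sub>R f' x b)"
    unfolding h'_def by (simp add: eq_neg_iff_add_eq_0 add.commute)
qed

lemma Holder_on_imp_continuous:
  "Holder_on k alpha S f ==> continuous_on S f"
proof (cases k)
  case (Suc j)
  assume "Holder_on k alpha S f"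
  then show ?thesis unfolding Suc Holder_on_Suc
    using has_derivative_continuous continuous_on_eq_continuous_within by blast
qed (auto simp: locally_Holder_on_def)

lemma Holder_on_imp_weakly_deriv_on:
  assumes p: "p >= 1" shows "Holder_on k 0 S f ==> weakly_deriv_on p S k f"
proof (induction k arbitrary: f)
  case 0
  then show ?case using continuous_on_imp_locally_Lp_on[OF Holder_on_imp_continuous p, of 0 0 S f] by simp
next
  case (Suc k)
  obtain f' where f': "\<And>x. x \<in> S ==> (f has_derivative f' x) (at x within S)"
     "\<And>v. Holder_on k 0 S (\<lambda>x. f' x v)" using Suc.prems by (auto simp: Holder_on_Suc)
  have "locally_Lp_on p S f" by (rule continuous_on_imp_locally_Lp_on[OF Holder_on_imp_continuous[OF Suc.prems] p])
  moreover have "weak_deriv_on S b f (\<lambda>x. f' x b)" for b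
    by (rule differentiable_weak_deriv_on[OF f'(1) Holder_on_imp_continuous[OF f'(2)]])
  ultimately show ?case using Suc.IH[OF f'(2)] by auto
qed

lemma C_on_infinity_imp_Sobolev_on:
  assumes "p >= 1" "C_on \<infinity> S f" shows "Sobolev_on k p S f" unfolding Sobolev_on_def
proof
  show "continuous_on S f" by (rule smooth_on_imp_continuous[OF assms(2)])
  show "weakly_deriv_on p S k f"
    using assms(2) by (intro Holder_on_imp_weakly_deriv_on[OF assms(1)]) (simp add: C_on_infinity)
qed

section \<open>Mollified weak derivatives up to the boundary\<close>

fun ddl :: "'a::euclidean_space list => ('a => real) => 'a => real" where
  "ddl [] f = f"
| "ddl (b # w) f = dd b (ddl w f)"

lemma smooth_ddl: "smooth f ==> smooth (ddl w f)" by (induction w) (auto intro: smooth_dd)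

lemma test_function_ddl: "test_function U psi ==> test_function U (ddl w psi)"
  by (induction w) (auto intro: test_function_dd)

lemma dd_cmult: "smooth f ==> dd b (\<lambda>x. c * f x) x = c * dd b f x"
  by (intro dd_eq[where f' = "\<lambda>v. c * dd v f x"] has_derivative_mult_right smooth_has_derivative)

lemma ddl_mol:
  assumes psi: "test_function U psi" and g: "integrable lborel g"
  shows "ddl w (mol psi g) = (\<lambda>x. (-1) ^ length w * mol (ddl w psi) g x)"
proof (induction w)
  case (Cons b w)
  show ?case
  proof
    fix x
    have "ddl (b # w) (mol psi g) x = dd b (\<lambda>x. (-1) ^ length w * mol (ddl w psi) g x) x" by (simp add: Cons)
    also have "... = (-1) ^ length w * dd b (mol (ddl w psi) g) x"
      by (rule dd_cmult[OF smooth_mol[OF g test_function_ddl[OF psi]]])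
    also have "dd b (mol (ddl w psi) g) x = - mol (dd b (ddl w psi)) g x"
      by (rule dd_mol[OF test_function_ddl[OF psi] g])
    finally show "ddl (b # w) (mol psi g) x = (-1) ^ length (b # w) * mol (ddl (b # w) psi) g x" by simp
  qed
qed simp

definition cutoff :: "'a set => ('a => real) => 'a => real" where
  "cutoff K f x = indicator K x * f x"

lemma cutoff_integrable:
  "locally_Lp_on p S f ==> p >= 1 ==> compact K ==> K \<subseteq> S ==> integrable lborel (cutoff K f)"
  using locally_Lp_on_set_integrable[of p S f K] by (simp add: cutoff_def[abs_def])

lemma cutoff_powr_integrable:
  assumes "locally_Lp_on p S f" "compact K" "K \<subseteq> S" shows "integrable lborel (\<lambda>x. \<bar>cutoff K f x\<bar> powr p)"
proof -
  have "integrable lborel (\<lambda>x. indicator K x *\<^sub>R \<bar>f x\<bar> powr p)"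
    using assms by (auto simp: locally_Lp_on_def set_integrable_def)
  moreover have "(\<lambda>x. \<bar>cutoff K f x\<bar> powr p) = (\<lambda>x. indicator K x *\<^sub>R \<bar>f x\<bar> powr p)"
    by (auto simp: cutoff_def indicator_def fun_eq_iff)
  ultimately show ?thesis by simp
qed

lemma smooth_shift:
  fixes psi :: "'a::euclidean_space => real"
  assumes "smooth psi" shows "smooth (\<lambda>y. psi (y - x))"
proof -
  have "smooth (\<lambda>y::'a. y + (- x))"
    by (intro smooth_on_add smooth_on_const smooth_on_bounded_linear bounded_linear_ident)
  then have "smooth (psi \<circ> (\<lambda>y::'a. y + (- x)))"
    by (intro smooth_on_compose[where S' = UNIV] locally_convex_UNIV assms) auto
  then show ?thesis by (rule smooth_on_cong) simp
qed

lemma dd_shift: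
  assumes "smooth psi" shows "dd b (\<lambda>y. psi (y - x)) y = dd b psi (y - x)"
proof (rule dd_eq)
  show "((\<lambda>y. psi (y - x)) has_derivative (\<lambda>v. dd v psi (y - x))) (at y)"
    by (rule has_derivative_compose[OF _ smooth_has_derivative[OF assms]]) (auto intro!: derivative_eq_intros)
qed

text \<open>Says that the translated kernel \<open>\<lambda>y. psi (y - x)\<close> is a test
  function for the interior of S and that its support lies in K, so truncation to K is invisible at
  x. The point x itself may lie on the boundary.\<close>

definition admits :: "'a::euclidean_space set => 'a set => ('a => real) => 'a => bool" where
  "admits S K psi x \<longleftrightarrow> test_function UNIV psi \<and>
     (\<exists>C. compact C \<and> (\<forall>z. z \<notin> C --> psi z = 0) \<and> (\<forall>z\<in>C. x + z \<in> interior S \<and> x + z \<in> K))"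

lemma admits_dd: "admits S K psi x ==> admits S K (dd b psi) x"
proof -
  assume "admits S K psi x"
  then obtain C where C: "test_function UNIV psi" "compact C" "\<forall>z. z \<notin> C --> psi z = 0" "\<forall>z\<in>C. x + z \<in> interior S \<and> x + z \<in> K"
    unfolding admits_def by blast
  then have "test_function C psi" unfolding test_function_def by blast
  then have "dd b psi z = 0" if "z \<notin> C" for z using test_function_zero_outside[OF test_function_dd] that by blast
  then show ?thesis using C test_function_dd[OF C(1)] unfolding admits_def by blast
qed

text \<open>The definition of the weak derivative, tested against the kernel translated to
  x.\<close>

lemma mol_weak_deriv:
  assumes ad: "admits S K psi x" and w: "weak_deriv_on S b f g"
  shows "mol (dd b psi) (cutoff K f) x = - mol psi (cutoff K g) x"
proof -
  obtain C where C: "test_function UNIV psi" "compact C" "\<And>z. z \<notin> C ==> psi z = 0" "\<And>z. z \<in> C ==> x + z \<in> interior S \<and> x + z \<in> K"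
    using ad unfolding admits_def by blast
  have sm: "smooth psi" by (rule test_function_smooth[OF C(1)])
  define phi where "phi y = psi (y - x)" for y
  have phi0: "phi y = 0" if "y \<notin> (\<lambda>z. x + z) ` C" for y
  proof -
    have "y - x \<notin> C" using that by (metis add_diff_cancel_left' diff_add_cancel add.commute image_eqI)
    then show ?thesis using C(3) by (simp add: phi_def)
  qed
  have "test_function (interior S) phi" unfolding test_function_def
  proof (intro conjI exI[of _ "(\<lambda>z. x + z) ` C"])
    show "smooth phi" unfolding phi_def[abs_def] by (rule smooth_shift[OF sm])
    show "compact ((\<lambda>z. x + z) ` C)" by (rule compact_translation[OF C(2)])
  qed (use phi0 C(4) in auto)
  then have eq: "(LINT y|lborel. dd b phi y *\<^sub>R f y) = - (LINT y|lborel. phi y *\<^sub>R g y)" by (rule weak_deriv_onD[OF w])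
  have 1: "psi (y - x) * cutoff K g y = phi y *\<^sub>R g y" for y
    using phi0[of y] C(4) by (cases "y \<in> (\<lambda>z. x + z) ` C") (auto simp: phi_def cutoff_def)
  have 2: "dd b psi (y - x) * cutoff K f y = dd b phi y *\<^sub>R f y" for y
  proof (cases "y \<in> (\<lambda>z. x + z) ` C")
    case True
    then show ?thesis using C(4) dd_shift[OF sm, of b x y] by (auto simp: phi_def[abs_def] cutoff_def)
  next
    case False
    have "test_function ((\<lambda>z. x + z) ` C) phi" unfolding test_function_def
      using phi0 smooth_shift[OF sm] compact_translation[OF C(2), of x] by (auto simp: phi_def[abs_def])
    then have "dd b phi y = 0" using test_function_zero_outside[OF test_function_dd] False by blast
    moreover have "dd b phi y = dd b psi (y - x)" using dd_shift[OF sm, of b x y] by (simp add: phi_def[abs_def])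
    ultimately show ?thesis by simp
  qed
  show ?thesis unfolding mol_def 1 2 by (rule eq)
qed

text \<open>A weak derivative is determined only up to null sets, so one is fixed for every word of
  basis vectors, without identifying words that differ by a permutation. The head of a word is the
  derivative taken last.\<close>

definition deriv_tree :: "real => 'a::euclidean_space set => nat => ('a list => 'a => real) => bool" where
  "deriv_tree p S k G \<longleftrightarrow> (\<forall>w. set w \<subseteq> Basis --> length w <= k --> locally_Lp_on p S (G w)) \<and>
     (\<forall>w. \<forall>b\<in>Basis. set w \<subseteq> Basis --> length w < k --> weak_deriv_on S b (G w) (G (b # w)))"

lemma weakly_deriv_on_tree:
  "weakly_deriv_on p S k f ==> \<exists>G. deriv_tree p S k G \<and> G [] = f"
proof (induction k arbitrary: f)
  case 0
  then show ?case by (intro exI[of _ "\<lambda>w. f"]) (auto simp: deriv_tree_def)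
next
  case (Suc k)
  have "\<exists>G. deriv_tree p S k G \<and> weak_deriv_on S b f (G [])" if "b \<in> Basis" for b
    using Suc that by (metis weakly_deriv_on.simps(2))
  then obtain G where G: "\<And>b. b \<in> Basis ==> deriv_tree p S k (G b)" "\<And>b. b \<in> Basis ==> weak_deriv_on S b f (G b [])"
    by metis
  \<comment> \<open>The last letter is the first derivative taken; it selects the tree in which the
    rest of the word is looked up.\<close>
  define T where "T w = (if w = [] then f else G (last w) (butlast w))" for w
  have "locally_Lp_on p S (T w)" if w: "set w \<subseteq> Basis" "length w <= Suc k" for w
  proof (cases "w = []")
    case True
    then show ?thesis using Suc.prems by (simp add: T_def)
  next
    case False
    then have "set (butlast w) \<subseteq> Basis" "last w \<in> Basis" using w(1) by (auto dest: in_set_butlastD)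
    then show ?thesis using G(1)[of "last w"] w False by (auto simp: T_def deriv_tree_def)
  qed
  moreover have "weak_deriv_on S b (T w) (T (b # w))" if w: "set w \<subseteq> Basis" "length w < Suc k" "b \<in> Basis" for w b
  proof (cases "w = []")
    case True
    then show ?thesis using G(2) w by (simp add: T_def)
  next
    case False
    then have "set (butlast w) \<subseteq> Basis" "last w \<in> Basis" using w(1) by (auto dest: in_set_butlastD)
    moreover have "length (butlast w) < k" using w(2) False by (cases w) auto
    ultimately show ?thesis using G(1)[of "last w"] w False by (auto simp: T_def deriv_tree_def)
  qed
  ultimately have "deriv_tree p S (Suc k) T" by (auto simp: deriv_tree_def)
  moreover have "T [] = f" by (simp add: T_def)
  ultimately show ?case by blast
qed

text \<open>The outermost derivative on the kernel is the first to be moved onto the function, which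
  reverses the word. Differentiating \<open>mol\<close> and moving a derivative off the kernel each
  contribute a sign, and these cancel.\<close>

lemma ddl_mol_tree:
  assumes G: "deriv_tree p S k G" and p: "p >= 1" and K: "compact K" "K \<subseteq> S"
    and ad: "admits S K psi x" and w: "set w \<subseteq> Basis" "length w <= k"
  shows "ddl w (mol psi (cutoff K (G []))) x = mol psi (cutoff K (G (rev w))) x"
proof -
  have tf: "test_function UNIV psi" using ad by (simp add: admits_def)
  have ad': "admits S K (ddl w psi) x" for w by (induction w) (auto intro: ad admits_dd)
  have "(-1) ^ length w * mol (ddl w psi) (cutoff K (G v)) x = mol psi (cutoff K (G (rev w @ v))) x"
    if "set w \<subseteq> Basis" "set v \<subseteq> Basis" "length w + length v <= k" for w v using that
  proof (induction w arbitrary: v)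
    case (Cons b w)
    have "mol (ddl (b # w) psi) (cutoff K (G v)) x = - mol (ddl w psi) (cutoff K (G (b # v))) x"
      using G Cons.prems by (auto intro!: mol_weak_deriv[OF ad'] simp: deriv_tree_def)
    then show ?case using Cons.IH[of "b # v"] Cons.prems by simp
  qed simp
  note * = this[of w "[]"]
  show ?thesis
  proof -
    have "locally_Lp_on p S (G [])" using G by (simp add: deriv_tree_def)
    then have "integrable lborel (cutoff K (G []))" by (intro cutoff_integrable[OF _ p K])
    then show ?thesis using * w by (subst ddl_mol[OF tf]) auto
  qed
qed

text \<open>Take \<open>nu\<close> to be the inward normal a. Vectors close to it have positive
  inner product with a, so small displacements in their directions lead from K into the interior,
  and they remain in a compact neighbourhood \<open>K3\<close> of K within S.\<close>

lemma model_domain_inward: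
  assumes S: "model_domain n S" "n \<noteq> 0" and K: "compact K" "K \<subseteq> S"
  obtains nu rho K3 where "rho > 0" "compact K3" "K \<subseteq> K3" "K3 \<subseteq> S"
    "\<forall>\<^sub>F m in sequentially. \<forall>x\<in>K. admits S K3 (kern nu rho m) x"
proof -
  obtain a T where aT: "open T" "S = {x. 0 <= a \<bullet> x} \<inter> T"
    using S(1) by (cases rule: model_domain_cases) (use S(2) in auto)
  define H where "H = {x. 0 <= a \<bullet> x}"
  \<comment> \<open>With radius \<open>norm a / 2\<close> the closed ball about a lies in the open
    half-space. For a = 0 there is no boundary and any positive radius serves.\<close>
  define rho where "rho = (if a = 0 then 1 else norm a / 2)"
  have rho: "rho > 0" by (simp add: rho_def)
  have inw: "a = 0 \<or> 0 < a \<bullet> u" if "dist a u <= rho" for u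
  proof (cases "a = 0")
    case False
    have "a \<bullet> (a - u) <= norm a * norm (a - u)" by (rule norm_cauchy_schwarz)
    also have "... <= norm a * (norm a / 2)" using that False by (intro mult_left_mono) (auto simp: rho_def dist_norm)
    also have "... < norm a * norm a" using False by simp
    finally have "a \<bullet> (a - u) < a \<bullet> a" by (simp add: power2_norm_eq_inner[symmetric] power2_eq_square)
    then show ?thesis by (simp add: inner_diff_right)
  qed simp
  obtain delta where delta: "delta > 0" "(\<Union>x\<in>K. cball x delta) \<subseteq> T"
    using compact_subset_open_imp_cball_epsilon_subset[OF K(1) aT(1)] K(2) aT(2) by auto
  define K3 where "K3 = H \<inter> {x + y | x y. x \<in> K \<and> y \<in> cball 0 delta}"
  have "closed H" unfolding H_def by (rule closed_halfspace_ge)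
  then have K3: "compact K3" unfolding K3_def by (intro closed_Int_compact compact_sums K(1) compact_cball)
  have K3S: "K3 \<subseteq> S"
  proof
    fix z assume "z \<in> K3"
    then obtain x y where z: "z = x + y" "x \<in> K" "norm y <= delta" "z \<in> H" by (auto simp: K3_def)
    then have "z \<in> cball x delta" by (simp add: dist_norm)
    then have "z \<in> T" using delta(2) z(2) by blast
    then show "z \<in> S" using z(4) aT(2) by (simp add: H_def)
  qed
  have KK3: "K \<subseteq> K3"
  proof
    fix x assume x: "x \<in> K"
    then have "\<exists>x' y. x = x' + y \<and> x' \<in> K \<and> y \<in> cball 0 delta"
      using delta(1) by (intro exI[of _ x] exI[of _ 0]) simp
    then show "x \<in> K3" using x K(2) aT(2) unfolding K3_def H_def by blast
  qed
  have "(\<lambda>m. (norm a + rho) * inverse (real (Suc m))) \<longlonglongrightarrow> (norm a + rho) * 0"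
    by (intro tendsto_intros LIMSEQ_inverse_real_of_nat)
  then have "\<forall>\<^sub>F m in sequentially. (norm a + rho) * inverse (real (Suc m)) < delta"
    using delta(1) order_tendstoD(2) by fastforce
  then have "\<forall>\<^sub>F m in sequentially. \<forall>x\<in>K. admits S K3 (kern a rho m) x"
  proof (rule eventually_mono, intro ballI)
    fix m x assume m: "(norm a + rho) * inverse (real (Suc m)) < delta" and x: "x \<in> K"
    define C where "C = (\<lambda>u. u /\<^sub>R real (Suc m)) ` cball a rho"
    have "compact C" unfolding C_def by (rule compact_scaling[OF compact_cball])
    moreover have "kern a rho m z = 0" if "z \<notin> C" for z
      using that kern_support[OF rho, of a m z] unfolding C_def by (metis image_eqI less_imp_le mem_cball)
    moreover have "x + z \<in> interior S \<and> x + z \<in> K3" if z: "z \<in> C" for z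
    proof -
      obtain u where u: "dist a u <= rho" "z = u /\<^sub>R real (Suc m)" using z by (auto simp: C_def)
      have "norm u <= norm a + rho" using u(1) norm_triangle_sub[of u a] by (simp add: dist_norm norm_minus_commute)
      then have "norm u * inverse (real (Suc m)) <= (norm a + rho) * inverse (real (Suc m))"
        by (intro mult_right_mono) auto
      also note m
      finally have nz: "norm z < delta" using u(2) by (simp add: mult.commute)
      have pos: "a = 0 \<or> 0 < a \<bullet> z" using inw[OF u(1)] u(2) by (auto simp: zero_less_mult_iff)
      have ax: "0 <= a \<bullet> x" using x K(2) aT(2) by auto
      have "x + z \<in> cball x delta" using nz by (simp add: dist_norm)
      then have xz: "x + z \<in> T" using delta(2) x by blast
      have "\<exists>x' y. x + z = x' + y \<and> x' \<in> K \<and> y \<in> cball 0 delta" using x nz by (intro exI[of _ x] exI[of _ z]) simp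
      moreover have "x + z \<in> H" using pos ax by (auto simp: H_def inner_add_right)
      ultimately have "x + z \<in> K3" unfolding K3_def by blast
      moreover have "x + z \<in> interior S"
      proof (cases "a = 0")
        case True
        then show ?thesis using aT xz by (simp add: interior_open)
      next
        case False
        have "open ({x. 0 < a \<bullet> x} \<inter> T)" by (intro open_Int open_halfspace_gt aT(1))
        moreover have "x + z \<in> {x. 0 < a \<bullet> x} \<inter> T" using pos ax xz False by (auto simp: inner_add_right)
        moreover have "{x. 0 < a \<bullet> x} \<inter> T \<subseteq> S" using aT(2) by auto
        ultimately show ?thesis using interiorI by blast
      qed
      ultimately show ?thesis by blast
    qed
    ultimately show "admits S K3 (kern a rho m) x"
      unfolding admits_def using mollifier_test[OF mollifier_kern[OF rho]] by blast
  qed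
  then show ?thesis using that[OF rho K3 KK3 K3S] by blast
qed

section \<open>Intermediate derivatives of smooth functions\<close>

lemma smooth_line_derivative:
  assumes "smooth f" shows "((\<lambda>s. f (x + s *\<^sub>R v)) has_real_derivative dd v f (x + s *\<^sub>R v)) (at s)"
proof -
  have "((\<lambda>s. f (x + s *\<^sub>R v)) has_derivative (\<lambda>h. dd (h *\<^sub>R v) f (x + s *\<^sub>R v))) (at s)"
    by (rule has_derivative_compose[OF _ smooth_has_derivative[OF assms]]) (auto intro!: derivative_eq_intros)
  moreover have "(\<lambda>h. dd (h *\<^sub>R v) f (x + s *\<^sub>R v)) = (*) (dd v f (x + s *\<^sub>R v))"
    using linear_scale[OF dd_linear[OF assms]] by (auto simp: fun_eq_iff)
  ultimately show ?thesis by (simp add: has_field_derivative_def)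
qed

lemma smooth_second_difference:
  assumes f: "smooth f" and t: "t > 0"
  obtains xi eta where "0 < xi" "xi < t" "0 < eta" "eta < t"
    "f (x + t *\<^sub>R v + t *\<^sub>R w) - f (x + t *\<^sub>R v) - f (x + t *\<^sub>R w) + f x = t * t * dd w (dd v f) (x + xi *\<^sub>R v + eta *\<^sub>R w)"
proof -
  define g where "g s = f (x + t *\<^sub>R w + s *\<^sub>R v) - f (x + s *\<^sub>R v)" for s
  have g': "(g has_real_derivative (dd v f (x + t *\<^sub>R w + s *\<^sub>R v) - dd v f (x + s *\<^sub>R v))) (at s)" for s
    unfolding g_def[abs_def] by (intro DERIV_diff smooth_line_derivative f)
  obtain xi where xi: "0 < xi" "xi < t" "g t - g 0 = (t - 0) * (dd v f (x + t *\<^sub>R w + xi *\<^sub>R v) - dd v f (x + xi *\<^sub>R v))"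
    using MVT2[OF t, of g "\<lambda>s. dd v f (x + t *\<^sub>R w + s *\<^sub>R v) - dd v f (x + s *\<^sub>R v)"] g' by blast
  define k where "k r = dd v f (x + xi *\<^sub>R v + r *\<^sub>R w)" for r
  have k': "(k has_real_derivative dd w (dd v f) (x + xi *\<^sub>R v + r *\<^sub>R w)) (at r)" for r
    unfolding k_def[abs_def] by (rule smooth_line_derivative[OF smooth_dd[OF f]])
  obtain eta where eta: "0 < eta" "eta < t" "k t - k 0 = (t - 0) * dd w (dd v f) (x + xi *\<^sub>R v + eta *\<^sub>R w)"
    using MVT2[OF t, of k "\<lambda>r. dd w (dd v f) (x + xi *\<^sub>R v + r *\<^sub>R w)"] k' by blast
  have "dd v f (x + t *\<^sub>R w + xi *\<^sub>R v) - dd v f (x + xi *\<^sub>R v) = k t - k 0" by (simp add: k_def add_ac)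
  then have "g t - g 0 = t * t * dd w (dd v f) (x + xi *\<^sub>R v + eta *\<^sub>R w)" using xi(3) eta(3) by simp
  then show ?thesis using that[OF xi(1,2) eta(1,2)] by (simp add: g_def algebra_simps)
qed

text \<open>The second difference is symmetric in v and w; expressed by the mean value theorem in
  both orders, it gives equal values of the two mixed derivatives at points arbitrarily near
  x.\<close>

lemma dd_commute:
  assumes f: "smooth f" shows "dd v (dd w f) = dd w (dd v f)"
proof
  fix x
  define A where "A = dd w (dd v f)"
  define B where "B = dd v (dd w f)"
  have cont: "isCont A x" "isCont B x" using smooth_on_imp_continuous[OF smooth_dd[OF smooth_dd[OF f]]]
    by (auto simp: A_def B_def continuous_on_eq_continuous_at)
  have "\<bar>A x - B x\<bar> < e" if e: "e > 0" for e
  proof -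
    obtain d1 where d1: "d1 > 0" "\<And>y. dist y x < d1 ==> dist (A y) (A x) < e / 2"
      using cont(1) e unfolding continuous_at_eps_delta by (meson half_gt_zero)
    obtain d2 where d2: "d2 > 0" "\<And>y. dist y x < d2 ==> dist (B y) (B x) < e / 2"
      using cont(2) e unfolding continuous_at_eps_delta by (meson half_gt_zero)
    define t where "t = min d1 d2 / (norm v + norm w + 1)"
    have nn: "norm v + norm w + 1 > 0" by (simp add: add_nonneg_pos)
    have t: "t > 0" using d1(1) d2(1) nn by (simp add: t_def)
    have near: "dist (x + xi *\<^sub>R a + eta *\<^sub>R b) x < min d1 d2"
      if "0 < xi" "xi < t" "0 < eta" "eta < t" "norm a + norm b = norm v + norm w" for xi eta a b
    proof -
      have "dist (x + xi *\<^sub>R a + eta *\<^sub>R b) x <= norm (xi *\<^sub>R a) + norm (eta *\<^sub>R b)"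
        using norm_triangle_ineq[of "xi *\<^sub>R a" "eta *\<^sub>R b"] by (simp add: dist_norm add.assoc)
      also have "... <= t * norm a + t * norm b" using that by (intro add_mono) (auto intro: mult_right_mono)
      also have "... = t * (norm v + norm w)" using that(5) by (simp add: distrib_left[symmetric])
      also have "... < t * (norm v + norm w + 1)" using t by (intro mult_strict_left_mono) auto
      also have "... = min d1 d2" using nn by (simp add: t_def)
      finally show ?thesis .
    qed
    obtain xi eta where 1: "0 < xi" "xi < t" "0 < eta" "eta < t"
      "f (x + t *\<^sub>R v + t *\<^sub>R w) - f (x + t *\<^sub>R v) - f (x + t *\<^sub>R w) + f x = t * t * A (x + xi *\<^sub>R v + eta *\<^sub>R w)"
      using smooth_second_difference[OF f t, of x v w] unfolding A_def by metis
    obtain xi' eta' where 2: "0 < xi'" "xi' < t" "0 < eta'" "eta' < t"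
      "f (x + t *\<^sub>R w + t *\<^sub>R v) - f (x + t *\<^sub>R w) - f (x + t *\<^sub>R v) + f x = t * t * B (x + xi' *\<^sub>R w + eta' *\<^sub>R v)"
      using smooth_second_difference[OF f t, of x w v] unfolding B_def by metis
    have "x + t *\<^sub>R w + t *\<^sub>R v = x + t *\<^sub>R v + t *\<^sub>R w" by simp
    then have "t * t * A (x + xi *\<^sub>R v + eta *\<^sub>R w) = t * t * B (x + xi' *\<^sub>R w + eta' *\<^sub>R v)"
      unfolding 1(5)[symmetric] 2(5)[symmetric] by (simp only:)
    then have eq: "A (x + xi *\<^sub>R v + eta *\<^sub>R w) = B (x + xi' *\<^sub>R w + eta' *\<^sub>R v)" using t by simp
    have "dist (A (x + xi *\<^sub>R v + eta *\<^sub>R w)) (A x) < e / 2" using near[OF 1(1-4)] by (intro d1(2)) auto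
    moreover have "dist (B (x + xi' *\<^sub>R w + eta' *\<^sub>R v)) (B x) < e / 2" using near[OF 2(1-4), of w v] by (intro d2(2)) auto
    ultimately show ?thesis using eq unfolding dist_real_def by linarith
  qed
  then have "\<bar>A x - B x\<bar> <= 0" by (meson linorder_not_less order_less_irrefl)
  then show "dd v (dd w f) x = dd w (dd v f) x" by (simp add: A_def B_def)
qed

lemma smooth_funpow_dd: "smooth f ==> smooth ((dd v ^^ n) f)" by (induction n) (auto intro: smooth_dd)

lemma ddl_dd_commute: "smooth f ==> ddl w (dd b f) = dd b (ddl w f)"
proof (induction w)
  case (Cons c w)
  then show ?case using dd_commute[OF smooth_ddl[of f w], of c b] by simp
qed simp

lemma ddl_funpow_commute: "smooth f ==> ddl w ((dd v ^^ n) f) = (dd v ^^ n) (ddl w f)"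
  by (induction n) (auto simp: ddl_dd_commute smooth_funpow_dd)

lemma dd_funpow_commute: "smooth f ==> (dd v ^^ n) (dd b f) = dd b ((dd v ^^ n) f)"
  using ddl_funpow_commute[of f "[b]"] by simp

lemma ddl_append: "ddl (u @ w) f = ddl u (ddl w f)" by (induction u) auto

lemma ddl_replicate: "ddl (replicate n v) f = (dd v ^^ n) f" by (induction n) auto

lemma dd_sum: "finite I ==> (\<And>i. i \<in> I ==> smooth (f i)) ==> dd b (\<lambda>x. \<Sum>i\<in>I. f i x) x = (\<Sum>i\<in>I. dd b (f i) x)"
  by (intro dd_eq[where f' = "\<lambda>v. \<Sum>i\<in>I. dd v (f i) x"] has_derivative_sum smooth_has_derivative)

lemma dd_zero: "dd b (\<lambda>x. 0) = (\<lambda>x. 0)" using dd_eq[of "\<lambda>x. 0" "\<lambda>v. 0"] by auto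

text \<open>The coefficient of s^l in the n-th power of the operator \<open>dd v + s dd b\<close>,
  obtained by multiplying out one factor at a time.\<close>

primrec binomial_dd :: "'a::euclidean_space => 'a => ('a => real) => nat => nat => 'a => real" where
  "binomial_dd v b h 0 = (\<lambda>l. if l = 0 then h else (\<lambda>x. 0))"
| "binomial_dd v b h (Suc n) = (\<lambda>l x. dd v (binomial_dd v b h n l) x + (if l = 0 then (\<lambda>x. 0) else dd b (binomial_dd v b h n (l - 1))) x)"

lemma smooth_binomial_dd: "smooth h ==> smooth (binomial_dd v b h n l)"
proof (induction n arbitrary: l)
  case (Suc n)
  then show ?case by (cases "l = 0") (auto intro!: smooth_on_add smooth_dd smooth_on_const)
qed (auto intro: smooth_on_const)

lemma binomial_dd_above: "n < l ==> binomial_dd v b h n l = (\<lambda>x. 0)"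
  by (induction n arbitrary: l) (auto simp: dd_zero)

lemma binomial_dd_0: "binomial_dd v b h n 0 = (dd v ^^ n) h" by (induction n) simp_all

lemma binomial_dd_1:
  assumes h: "smooth h" shows "binomial_dd v b h (Suc n) 1 = (\<lambda>x. real (Suc n) * dd b ((dd v ^^ n) h) x)"
proof (induction n)
  case 0
  show ?case by (simp add: dd_zero)
next
  case (Suc n)
  have "binomial_dd v b h (Suc (Suc n)) 1 = (\<lambda>x. dd v (binomial_dd v b h (Suc n) 1) x + dd b (binomial_dd v b h (Suc n) 0) x)"
    by simp
  also have "... = (\<lambda>x. real (Suc n) * dd v (dd b ((dd v ^^ n) h)) x + dd b ((dd v ^^ Suc n) h) x)"
    unfolding Suc binomial_dd_0 using dd_cmult[OF smooth_dd[OF smooth_funpow_dd[OF h]]] by simp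
  also have "dd v (dd b ((dd v ^^ n) h)) = dd b ((dd v ^^ Suc n) h)"
    using dd_commute[OF smooth_funpow_dd[OF h], of v b] by simp
  finally show ?case by (simp add: distrib_right)
qed

lemma binomial_dd_expand:
  assumes h: "smooth h" shows "(dd (v + s *\<^sub>R b) ^^ n) h = (\<lambda>x. \<Sum>l\<le>n. s ^ l * binomial_dd v b h n l x)"
proof (induction n)
  case (Suc n)
  let ?B = "binomial_dd v b h"
  note sm = smooth_binomial_dd[OF h, of v b]
  show ?case
  proof
    fix x
    have "(dd (v + s *\<^sub>R b) ^^ Suc n) h x = dd (v + s *\<^sub>R b) (\<lambda>x. \<Sum>l\<le>n. s ^ l * ?B n l x) x" by (simp add: Suc)
    also have "... = (\<Sum>l\<le>n. s ^ l * dd (v + s *\<^sub>R b) (?B n l) x)"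
      using sm by (subst dd_sum) (auto intro!: smooth_on_linear[OF bounded_linear_mult_right] simp: dd_cmult)
    also have "... = (\<Sum>l\<le>n. s ^ l * dd v (?B n l) x + s ^ Suc l * dd b (?B n l) x)"
      using linear_add[OF dd_linear[OF sm]] linear_scale[OF dd_linear[OF sm]] by (intro sum.cong) (auto simp: algebra_simps)
    also have "... = (\<Sum>l\<le>n. s ^ l * dd v (?B n l) x) + (\<Sum>l\<le>n. s ^ Suc l * dd b (?B n l) x)" by (rule sum.distrib)
    also have "(\<Sum>l\<le>n. s ^ l * dd v (?B n l) x) = (\<Sum>l\<le>Suc n. s ^ l * dd v (?B n l) x)"
      by (simp add: binomial_dd_above dd_zero)
    also have "(\<Sum>l\<le>n. s ^ Suc l * dd b (?B n l) x) = (\<Sum>l\<le>Suc n. s ^ l * (if l = 0 then (\<lambda>x. 0) else dd b (?B n (l - 1))) x)"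
      by (subst sum.atMost_Suc_shift) simp
    also have "(\<Sum>l\<le>Suc n. s ^ l * dd v (?B n l) x) + ... = (\<Sum>l\<le>Suc n. s ^ l * ?B (Suc n) l x)"
      by (simp only: sum.distrib[symmetric] distrib_left[symmetric] binomial_dd.simps)
    finally show "(dd (v + s *\<^sub>R b) ^^ Suc n) h x = (\<Sum>l\<le>Suc n. s ^ l * ?B (Suc n) l x)" .
  qed
qed simp

text \<open>A linear coefficient is recovered from the values of the polynomial at the powers of 2.
  The combination p(2s) - 2^N p(s) removes the top coefficient, which drives the induction on the
  degree.\<close>

lemma linear_coeff_bound:
  "\<exists>C\<ge>0. \<forall>c. \<bar>c 1 :: real\<bar> <= C * (\<Sum>j\<le>Suc n. \<bar>\<Sum>m\<le>Suc n. c m * (2 ^ j) ^ m\<bar>)"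
proof (induction n)
  case 0
  show ?case by (intro exI[of _ 1]) auto
next
  case (Suc n)
  then obtain C where C: "C >= 0" "\<And>c. \<bar>c 1 :: real\<bar> <= C * (\<Sum>j\<le>Suc n. \<bar>\<Sum>m\<le>Suc n. c m * (2 ^ j) ^ m\<bar>)" by blast
  define N where "N = Suc (Suc n)"
  define p where "p c s = (\<Sum>m\<le>N. c m * s ^ m)" for c :: "nat => real" and s
  have "\<bar>c 1\<bar> <= (C * (1 + 2 ^ N)) * (\<Sum>j\<le>N. \<bar>p c (2 ^ j)\<bar>)" for c
  proof -
    \<comment> \<open>The coefficients of p(2s) - 2^N p(s): the N-th one vanishes, and the linear
      one is multiplied by 2 - 2^N, of absolute value at least 1.\<close>
    define d where "d m = (2 ^ m - 2 ^ N) * c m" for m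
    have d: "(\<Sum>m\<le>Suc n. d m * s ^ m) = p c (2 * s) - 2 ^ N * p c s" for s
    proof -
      have "p c (2 * s) - 2 ^ N * p c s = (\<Sum>m\<le>N. d m * s ^ m)"
        unfolding p_def d_def sum_distrib_left sum_subtractf[symmetric] by (intro sum.cong) (auto simp: power_mult_distrib algebra_simps)
      then show ?thesis by (simp add: N_def d_def)
    qed
    have "(2::real) ^ N >= 2 ^ 2" by (intro power_increasing) (auto simp: N_def)
    then have "1 * \<bar>c 1\<bar> <= \<bar>2 - 2 ^ N\<bar> * \<bar>c 1\<bar>" by (intro mult_right_mono) auto
    then have "\<bar>c 1\<bar> <= \<bar>d 1\<bar>" by (simp add: d_def abs_mult)
    also have "... <= C * (\<Sum>j\<le>Suc n. \<bar>p c (2 ^ Suc j) - 2 ^ N * p c (2 ^ j)\<bar>)" using C(2)[of d] by (simp only: d power_Suc)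
    also have "... <= C * (\<Sum>j\<le>Suc n. \<bar>p c (2 ^ Suc j)\<bar> + 2 ^ N * \<bar>p c (2 ^ j)\<bar>)"
      by (intro mult_left_mono sum_mono order_trans[OF abs_triangle_ineq4] C(1)) (simp add: abs_mult)
    also have "... = C * ((\<Sum>j\<le>Suc n. \<bar>p c (2 ^ Suc j)\<bar>) + 2 ^ N * (\<Sum>j\<le>Suc n. \<bar>p c (2 ^ j)\<bar>))"
      by (simp only: sum.distrib sum_distrib_left)
    also have "... <= C * ((\<Sum>j\<le>N. \<bar>p c (2 ^ j)\<bar>) + 2 ^ N * (\<Sum>j\<le>N. \<bar>p c (2 ^ j)\<bar>))"
    proof (intro mult_left_mono add_mono C(1))
      show "(\<Sum>j\<le>Suc n. \<bar>p c (2 ^ Suc j)\<bar>) <= (\<Sum>j\<le>N. \<bar>p c (2 ^ j)\<bar>)"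
        unfolding N_def sum.atMost_Suc_shift[of _ "Suc n"] by simp
    qed (auto simp: N_def)
    finally show ?thesis by (simp add: algebra_simps)
  qed
  then show ?case unfolding p_def N_def using C(1) by (intro exI[of _ "C * (1 + 2 ^ N)"]) (auto simp: N_def)
qed

text \<open>In the expansion of the power n + 1 of the derivative along v + s b, the coefficient of
  s is n + 1 times the mixed derivative; it is extracted from s = 2^j.\<close>

lemma polarization_step:
  "\<exists>C\<ge>0. \<forall>h x. smooth h --> \<bar>dd b ((dd v ^^ n) h) x\<bar> <= C * (\<Sum>j\<le>Suc n. \<bar>(dd (v + 2 ^ j *\<^sub>R b) ^^ Suc n) h x\<bar>)"
proof -
  obtain C where C: "C >= 0" "\<And>c. \<bar>c 1 :: real\<bar> <= C * (\<Sum>j\<le>Suc n. \<bar>\<Sum>m\<le>Suc n. c m * (2 ^ j) ^ m\<bar>)"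
    using linear_coeff_bound[of n] by blast
  have "\<bar>dd b ((dd v ^^ n) h) x\<bar> <= C * (\<Sum>j\<le>Suc n. \<bar>(dd (v + 2 ^ j *\<^sub>R b) ^^ Suc n) h x\<bar>)" if h: "smooth h" for h x
  proof -
    have "\<bar>dd b ((dd v ^^ n) h) x\<bar> <= \<bar>binomial_dd v b h (Suc n) 1 x\<bar>"
      unfolding binomial_dd_1[OF h] abs_mult by (simp add: mult_le_cancel_right1)
    also have "... <= C * (\<Sum>j\<le>Suc n. \<bar>(dd (v + 2 ^ j *\<^sub>R b) ^^ Suc n) h x\<bar>)"
      using C(2)[of "\<lambda>m. binomial_dd v b h (Suc n) m x"] unfolding binomial_dd_expand[OF h] by (simp only: mult.commute)
    finally show ?thesis .
  qed
  then show ?thesis using C(1) by blast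
qed

text \<open>The letters of the word are absorbed one by one into a pure power in a new direction.
  New directions are nonnegative combinations of old ones, so they stay in the convex cone P; the
  cone of inward vectors is the one needed later.\<close>

lemma polarization_aux:
  assumes P: "\<And>v w. v \<in> P ==> w \<in> P ==> v + w \<in> P" "\<And>c v. v \<in> P ==> 0 <= c ==> c *\<^sub>R v \<in> P"
  shows "set bs \<subseteq> P ==> v \<in> P ==> \<exists>A C. finite A \<and> A \<subseteq> P \<and> C >= 0 \<and> (\<forall>u x. smooth u -->
       \<bar>ddl bs ((dd v ^^ n) u) x\<bar> <= C * (\<Sum>a\<in>A. \<bar>(dd a ^^ (length bs + n)) u x\<bar>))"
proof (induction bs arbitrary: v n)
  case Nil
  then show ?case by (intro exI[of _ "{v}"] exI[of _ 1]) auto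
next
  case (Cons b bs)
  obtain C where C: "C >= 0" "\<And>h x. smooth h ==>
     \<bar>dd b ((dd v ^^ n) h) x\<bar> <= C * (\<Sum>j\<le>Suc n. \<bar>(dd (v + 2 ^ j *\<^sub>R b) ^^ Suc n) h x\<bar>)"
    using polarization_step[where b = b and v = v and n = n] by blast
  have "\<exists>A D. finite A \<and> A \<subseteq> P \<and> D >= 0 \<and> (\<forall>u x. smooth u -->
       \<bar>ddl bs ((dd (v + 2 ^ j *\<^sub>R b) ^^ Suc n) u) x\<bar> <= D * (\<Sum>a\<in>A. \<bar>(dd a ^^ (length bs + Suc n)) u x\<bar>))" for j :: nat
    using Cons.prems by (intro Cons.IH P) auto
  then obtain A D where AD: "\<And>j. finite (A j)" "\<And>j. A j \<subseteq> P" "\<And>j::nat. D j >= 0"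
    "\<And>j u x. smooth u ==>
       \<bar>ddl bs ((dd (v + 2 ^ j *\<^sub>R b) ^^ Suc n) u) x\<bar> <= D j * (\<Sum>a\<in>A j. \<bar>(dd a ^^ (length bs + Suc n)) u x\<bar>)" by metis
  define AA where "AA = (\<Union>j\<le>Suc n. A j)"
  define DD where "DD = (\<Sum>j\<le>Suc n. D j)"
  have fin: "finite AA" using AD(1) by (auto simp: AA_def)
  have "\<bar>ddl (b # bs) ((dd v ^^ n) u) x\<bar> <= (C * DD) * (\<Sum>a\<in>AA. \<bar>(dd a ^^ (length (b # bs) + n)) u x\<bar>)"
    if u: "smooth u" for u x
  proof -
    let ?S = "\<Sum>a\<in>AA. \<bar>(dd a ^^ (length (b # bs) + n)) u x\<bar>"
    have "ddl (b # bs) ((dd v ^^ n) u) x = dd b ((dd v ^^ n) (ddl bs u)) x"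
      by (simp add: ddl_funpow_commute[OF u] dd_funpow_commute[OF smooth_ddl[OF u]])
    also have "\<bar>...\<bar> <= C * (\<Sum>j\<le>Suc n. \<bar>(dd (v + 2 ^ j *\<^sub>R b) ^^ Suc n) (ddl bs u) x\<bar>)"
      by (rule C(2)[OF smooth_ddl[OF u]])
    also have "... = C * (\<Sum>j\<le>Suc n. \<bar>ddl bs ((dd (v + 2 ^ j *\<^sub>R b) ^^ Suc n) u) x\<bar>)"
      by (simp only: ddl_funpow_commute[OF u])
    also have "... <= C * (\<Sum>j\<le>Suc n. D j * ?S)"
    proof (intro mult_left_mono sum_mono C(1))
      fix j assume j: "j \<in> {..Suc n}"
      have "\<bar>ddl bs ((dd (v + 2 ^ j *\<^sub>R b) ^^ Suc n) u) x\<bar> <= D j * (\<Sum>a\<in>A j. \<bar>(dd a ^^ (length bs + Suc n)) u x\<bar>)"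
        by (rule AD(4)[OF u])
      also have "... <= D j * (\<Sum>a\<in>AA. \<bar>(dd a ^^ (length bs + Suc n)) u x\<bar>)"
        using j fin AD(3) by (intro mult_left_mono sum_mono2) (auto simp: AA_def)
      finally show "\<bar>ddl bs ((dd (v + 2 ^ j *\<^sub>R b) ^^ Suc n) u) x\<bar> <= D j * ?S" by simp
    qed
    also have "... = (C * DD) * ?S" by (simp add: DD_def sum_distrib_right mult.assoc del: sum.atMost_Suc)
    finally show ?thesis .
  qed
  moreover have "C * DD >= 0" unfolding DD_def using C(1) AD(3) by (intro mult_nonneg_nonneg sum_nonneg) auto
  moreover have "AA \<subseteq> P" using AD(2) by (auto simp: AA_def)
  ultimately show ?case using fin by (intro exI[of _ AA] exI[of _ "C * DD"]) simp
qed

lemma polarization: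
  assumes P: "\<And>v w. v \<in> P ==> w \<in> P ==> v + w \<in> P" "\<And>c v. v \<in> P ==> 0 <= c ==> c *\<^sub>R v \<in> P"
    and bs: "set bs \<subseteq> P" "bs \<noteq> []"
  obtains A C where "finite A" "A \<subseteq> P" "C >= 0"
    "\<And>u x. smooth u ==> \<bar>ddl bs u x\<bar> <= C * (\<Sum>a\<in>A. \<bar>(dd a ^^ length bs) u x\<bar>)"
proof -
  obtain b where "b \<in> P" using bs by (cases bs) auto
  then show ?thesis using polarization_aux[where P = P and bs = bs and v = b and n = 0, OF P bs(1)] that by auto
qed

definition words :: "nat => 'a::euclidean_space list set" where
  "words n = {w. set w \<subseteq> Basis \<and> length w = n}"

lemma finite_words: "finite (words n)" unfolding words_def by (rule finite_lists_length_eq[OF finite_Basis])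

text \<open>At top order the estimate goes the opposite way: a pure power in a polarizing direction
  is bounded by derivatives along words in \<open>Basis\<close>, the only ones for which weak
  derivatives are given.\<close>

lemma ddl_expand_words:
  fixes bs :: "'a::euclidean_space list"
  shows "\<exists>C\<ge>0. \<forall>u x. smooth u --> \<bar>ddl bs u x\<bar> <= C * (\<Sum>w\<in>words (length bs). \<bar>ddl w u x\<bar>)"
proof (induction bs)
  case Nil
  have w0: "words (length []) = {[] :: 'a list}" by (auto simp: words_def)
  show ?case unfolding w0 by (intro exI[of _ "1::real"] conjI allI impI) simp_all
next
  case (Cons b bs)
  from Cons.IH obtain C where C: "C >= 0 \<and> (\<forall>u x. smooth u --> \<bar>ddl bs u x\<bar> <= C * (\<Sum>w\<in>words (length bs). \<bar>ddl w u x\<bar>))" ..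
  define D where "D = (\<Sum>c\<in>Basis. \<bar>b \<bullet> c\<bar> * C)"
  have "\<bar>ddl (b # bs) u x\<bar> <= D * (\<Sum>w\<in>words (length (b # bs)). \<bar>ddl w u x\<bar>)" if u: "smooth u" for u x
  proof -
    let ?S = "\<Sum>w\<in>words (length (b # bs)). \<bar>ddl w u x\<bar>"
    have "ddl (b # bs) u x = (\<Sum>c\<in>Basis. (b \<bullet> c) * dd c (ddl bs u) x)"
      unfolding ddl.simps by (rule dd_expand[OF smooth_ddl[OF u]])
    also have "\<bar>...\<bar> <= (\<Sum>c\<in>Basis. \<bar>(b \<bullet> c) * dd c (ddl bs u) x\<bar>)" by (rule sum_abs)
    also have "... <= (\<Sum>c\<in>Basis. \<bar>b \<bullet> c\<bar> * C * ?S)"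
    proof (rule sum_mono)
      fix c :: 'a assume c: "c \<in> Basis"
      have "dd c (ddl bs u) x = ddl bs (dd c u) x" by (simp add: ddl_dd_commute[OF u])
      also have "\<bar>...\<bar> <= C * (\<Sum>w\<in>words (length bs). \<bar>ddl w (dd c u) x\<bar>)" using C smooth_dd[OF u] by simp
      also have "(\<Sum>w\<in>words (length bs). \<bar>ddl w (dd c u) x\<bar>) = (\<Sum>w\<in>(\<lambda>w. w @ [c]) ` words (length bs). \<bar>ddl w u x\<bar>)"
        by (subst sum.reindex) (auto simp: inj_on_def ddl_append)
      also have "C * ... <= C * ?S"
        using c by (intro mult_left_mono sum_mono2 finite_words) (use C c in \<open>auto simp: words_def\<close>)
      finally have "\<bar>dd c (ddl bs u) x\<bar> <= C * ?S" .
      then have "\<bar>b \<bullet> c\<bar> * \<bar>dd c (ddl bs u) x\<bar> <= \<bar>b \<bullet> c\<bar> * (C * ?S)" by (intro mult_left_mono) auto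
      then show "\<bar>(b \<bullet> c) * dd c (ddl bs u) x\<bar> <= \<bar>b \<bullet> c\<bar> * C * ?S" by (simp add: abs_mult mult.assoc)
    qed
    also have "... = D * ?S" by (simp add: D_def sum_distrib_right)
    finally show ?thesis .
  qed
  moreover have "D >= 0" unfolding D_def using C by (intro sum_nonneg) auto
  ultimately show ?case by (intro exI[of _ D] conjI allI impI)
qed

lemma dd_scale: "smooth f ==> dd (c *\<^sub>R v) f = (\<lambda>x. c * dd v f x)" using linear_scale[OF dd_linear] by fastforce

lemma funpow_dd_scale:
  assumes "smooth f" shows "(dd (c *\<^sub>R v) ^^ n) f = (\<lambda>x. c ^ n * (dd v ^^ n) f x)"
proof (induction n)
  case (Suc n)
  have "(dd (c *\<^sub>R v) ^^ Suc n) f = dd (c *\<^sub>R v) (\<lambda>x. c ^ n * (dd v ^^ n) f x)" by (simp add: Suc)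
  also have "... = (\<lambda>x. c * dd v (\<lambda>x. c ^ n * (dd v ^^ n) f x) x)"
    by (rule dd_scale) (intro smooth_on_linear[OF bounded_linear_mult_right] smooth_funpow_dd assms)
  also have "... = (\<lambda>x. c ^ Suc n * (dd v ^^ Suc n) f x)"
    by (simp add: dd_cmult[OF smooth_funpow_dd[OF assms]] mult.assoc)
  finally show ?case .
qed simp

section \<open>A Gagliardo--Nirenberg inequality up to the boundary\<close>

lemma sum_powr_le:
  fixes f :: "'b => real"
  assumes A: "finite A" and f: "\<And>a. a \<in> A ==> 0 <= f a" and q: "q > 0"
  shows "(\<Sum>a\<in>A. f a) powr q <= real (card A) powr q * (\<Sum>a\<in>A. f a powr q)"
proof (cases "A = {}")
  case False
  define m where "m = Max (f ` A)"
  have "m \<in> f ` A" unfolding m_def using A False by (intro Max_in) auto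
  then obtain a where a: "a \<in> A" "m = f a" by auto
  have le: "f x <= m" if "x \<in> A" for x unfolding m_def using A that by auto
  have m0: "m >= 0" using a f by auto
  have "(\<Sum>a\<in>A. f a) <= real (card A) * m" using sum_bounded_above[of A f m] le by simp
  then have "(\<Sum>a\<in>A. f a) powr q <= (real (card A) * m) powr q"
    using q by (intro powr_mono2) (auto intro!: sum_nonneg f)
  also have "... = real (card A) powr q * f a powr q" using m0 a by (simp add: powr_mult)
  also have "... <= real (card A) powr q * (\<Sum>a\<in>A. f a powr q)"
    using A a by (intro mult_left_mono member_le_sum) auto
  finally show ?thesis .
qed (use q in simp)

abbreviation powr_integral :: "real => 'a::euclidean_space set => ('a => real) => ennreal" where
  "powr_integral q K f \<equiv> \<integral>\<^sup>+x. indicator K x * ennreal (\<bar>f x\<bar> powr q) \<partial>lborel"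

text \<open>The one-dimensional inequality is applied to t |-> u(x + t v) and integrated over the
  starting points x with Fubini. Since v points into H, the times in [0, 1] at which such a line
  lies in H form an interval ending at 1; the starting points are chosen so that its length is at
  least 1/2.\<close>

lemma segment_bound:
  fixes v :: "'a::euclidean_space" and i k :: nat and p M :: real
  assumes H: "closed H" "\<And>y s. y \<in> H ==> 0 <= s ==> y + s *\<^sub>R v \<in> H"
    and K': "compact K'" "K' \<subseteq> H" and k: "1 <= i" "i <= k" and p: "p >= 1" and M: "M > 0"
    and K'': "K'' = {y + t *\<^sub>R v | y t. y \<in> K' \<and> t \<in> {-1..1}} \<inter> H"
  shows "\<exists>C\<ge>0. \<forall>u. smooth u --> (\<forall>x\<in>K''. \<bar>u x\<bar> <= M) --> (powr_integral (k * p / i) K' ((dd v ^^ i) u))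
     <= ennreal C * ((powr_integral p K'' ((dd v ^^ k) u)) + 1)"
proof -
  define q where "q = real k * p / real i"
  have q: "q > 0" using k p by (simp add: q_def)
  obtain C1 where C1: "C1 >= 0" "\<And>F alpha beta. (\<And>j t. (F j has_real_derivative F (Suc j) t) (at t)) ==>
     1/2 <= beta - alpha ==> (\<And>t. t\<in>{alpha..beta} ==> \<bar>F 0 t\<bar> <= M) ==>
     integral {alpha..beta} (\<lambda>t. \<bar>F i t\<bar> powr q) <= C1 * (integral {alpha..beta} (\<lambda>t. \<bar>F k t\<bar> powr p) + 1)"
    using Gagliardo_Nirenberg_interval[OF k p M] unfolding q_def by blast
  \<comment> \<open>Starting points: K' moved back along v by at most 1/2. They may lie outside H,
    but their lines return to H no later than time 1/2.\<close>
  define K where "K = (\<lambda>(y, s). y + (- s) *\<^sub>R v) ` (K' \<times> {0..1/2})"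
  have "compact K" unfolding K_def
    by (intro compact_continuous_image compact_Times K' compact_Icc) (auto intro!: continuous_intros simp: split_beta)
  then have [measurable]: "K \<in> sets borel" and Kfin: "emeasure lborel K < \<infinity>"
    using borel_compact emeasure_compact_finite by auto
  have [measurable]: "H \<in> sets borel" using H(1) by simp
  have [measurable]: "K' \<in> sets borel" using K'(1) by (rule borel_compact)
  have "compact ((\<lambda>(y, t). y + t *\<^sub>R v) ` (K' \<times> {-1..1}))"
    by (intro compact_continuous_image compact_Times K' compact_Icc) (auto intro!: continuous_intros simp: split_beta)
  moreover have "K'' = (\<lambda>(y, t). y + t *\<^sub>R v) ` (K' \<times> {-1..1}) \<inter> H" unfolding K'' by force
  ultimately have "compact K''" using compact_Int_closed[OF _ H(1)] by simp
  then have [measurable]: "K'' \<in> sets borel" by (rule borel_compact)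
  define c where "c = measure lborel K"
  have c: "emeasure lborel K = ennreal c" "c >= 0" using Kfin by (auto simp: c_def emeasure_eq_ennreal_measure)
  define C where "C = 2 * C1 * (1 + c)"
  have "(powr_integral q K' ((dd v ^^ i) u)) <= ennreal C * ((powr_integral p K'' ((dd v ^^ k) u)) + 1)"
    if u: "smooth u" and uM: "\<And>x. x\<in>K'' ==> \<bar>u x\<bar> <= M" for u
  proof -
    have cont: "continuous_on UNIV ((dd v ^^ j) u)" for j
      by (rule smooth_on_imp_continuous[OF smooth_funpow_dd[OF u]])
    have [measurable]: "(dd v ^^ j) u \<in> borel_measurable borel" for j
      using cont by (rule borel_measurable_continuous_onI)
    define A where "A x = ennreal (\<bar>(dd v ^^ i) u x\<bar> powr q)" for x
    define B where "B x = ennreal (\<bar>(dd v ^^ k) u x\<bar> powr p)" for x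
    have [measurable]: "A \<in> borel_measurable borel" "B \<in> borel_measurable borel"
      unfolding A_def[abs_def] B_def[abs_def] by measurable
    define X where "X = (\<integral>\<^sup>+x. indicator K' x * A x \<partial>lborel)"
    define Y where "Y = (\<integral>\<^sup>+x. indicator K'' x * B x \<partial>lborel)"
    let ?I = "\<lambda>(Z :: 'a => ennreal) (t :: real) y. indicator K (y - t *\<^sub>R v) * (indicator {0..1} t * (indicator H y * Z y))"
    let ?J = "\<lambda>(Z :: 'a => ennreal) x (t :: real). indicator {0..1} t * (indicator H (x + t *\<^sub>R v) * Z (x + t *\<^sub>R v))"
    define a where "a x = (\<integral>\<^sup>+t. ?J A x t \<partial>lborel)" for x
    define b where "b x = (\<integral>\<^sup>+t. ?J B x t \<partial>lborel)" for x
    have pt: "a x <= ennreal C1 * (b x + 1)" if x: "x \<in> K" for x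
    proof -
      obtain y s where ys: "y \<in> K'" "0 <= s" "s <= 1/2" "x = y - s *\<^sub>R v" using x by (auto simp: K_def)
      define T where "T = {t \<in> {0..1}. x + t *\<^sub>R v \<in> H}"
      have sT: "s \<in> T" using ys K'(2) by (auto simp: T_def)
      have "closed ((\<lambda>t. x + t *\<^sub>R v) -` H)" by (intro continuous_closed_vimage H(1) continuous_intros)
      then have "closed ({0..1} \<inter> (\<lambda>t. x + t *\<^sub>R v) -` H)" by (intro closed_Int) auto
      moreover have "T = {0..1} \<inter> (\<lambda>t. x + t *\<^sub>R v) -` H" by (auto simp: T_def)
      ultimately have Tc: "closed T" by simp
      have bdd: "bdd_below T" unfolding T_def by (intro bdd_belowI[of _ 0]) auto
      \<comment> \<open>The time of entry into H; because v points inward, the line stays in H from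
        then on.\<close>
      define alpha where "alpha = Inf T"
      have alphaT: "alpha \<in> T" unfolding alpha_def using sT bdd Tc by (intro closed_contains_Inf) auto
      have alphas: "alpha <= s" unfolding alpha_def by (rule cInf_lower[OF sT bdd])
      have Teq: "T = {alpha..1}"
      proof
        show "T \<subseteq> {alpha..1}" using cInf_lower[OF _ bdd] by (auto simp: alpha_def T_def)
        show "{alpha..1} \<subseteq> T"
        proof
          fix t assume t: "t \<in> {alpha..1}"
          have "(x + alpha *\<^sub>R v) + (t - alpha) *\<^sub>R v \<in> H"
            using alphaT t H(2)[of "x + alpha *\<^sub>R v" "t - alpha"] by (simp add: T_def)
          moreover have "(x + alpha *\<^sub>R v) + (t - alpha) *\<^sub>R v = x + t *\<^sub>R v" by (simp add: algebra_simps)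
          ultimately show "t \<in> T" using t alphaT by (simp add: T_def)
        qed
      qed
      have ind: "indicator {0..1} t * (indicator H (x + t *\<^sub>R v) * z) = indicator {alpha..1} t * (z::ennreal)" for t z
      proof -
        have "t \<in> {alpha..1} \<longleftrightarrow> t \<in> {0..1} \<and> x + t *\<^sub>R v \<in> H" unfolding Teq[symmetric] T_def by blast
        then show ?thesis by (cases "t \<in> {alpha..1}") (auto simp: indicator_def)
      qed
      define F where "F j t = (dd v ^^ j) u (x + t *\<^sub>R v)" for j t
      have DF: "(F j has_real_derivative F (Suc j) t) (at t)" for j t
        unfolding F_def using smooth_line_derivative[OF smooth_funpow_dd[OF u]] by simp
      have contF: "continuous_on S (F j)" for j S using DF DERIV_isCont by (meson continuous_at_imp_continuous_on)
      have nn: "(\<integral>\<^sup>+t. indicator {alpha..1} t * ennreal (\<bar>F j t\<bar> powr e) \<partial>lborel) = ennreal (integral {alpha..1} (\<lambda>t. \<bar>F j t\<bar> powr e))"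
        if "e > 0" for e j
      proof -
        have cp: "continuous_on S (\<lambda>t. \<bar>F j t\<bar> powr e)" for S
          using that by (intro continuous_on_powr' continuous_intros contF) auto
        let ?f = "\<lambda>t. if t \<in> {alpha..1} then \<bar>F j t\<bar> powr e else 0"
        have [measurable]: "(\<lambda>t. \<bar>F j t\<bar> powr e) \<in> borel_measurable borel" by (rule borel_measurable_continuous_onI[OF cp])
        have "(?f has_integral integral {alpha..1} (\<lambda>t. \<bar>F j t\<bar> powr e)) UNIV"
          unfolding has_integral_restrict_UNIV by (intro integrable_integral integrable_continuous_real cp)
        then have "(\<integral>\<^sup>+t. ennreal (?f t) \<partial>lborel) = ennreal (integral {alpha..1} (\<lambda>t. \<bar>F j t\<bar> powr e))"
          by (intro nn_integral_has_integral_lborel) auto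
        moreover have "ennreal (?f t) = indicator {alpha..1} t * ennreal (\<bar>F j t\<bar> powr e)" for t by simp
        ultimately show ?thesis by simp
      qed
      have "\<bar>F 0 t\<bar> <= M" if t: "t \<in> {alpha..1}" for t
      proof -
        have "x + t *\<^sub>R v \<in> H" "t >= 0" using t unfolding Teq[symmetric] T_def by auto
        moreover have "x + t *\<^sub>R v = y + (t - s) *\<^sub>R v" by (simp add: ys algebra_simps)
        moreover have "t - s \<in> {-1..1}" using t ys \<open>t >= 0\<close> by auto
        ultimately have "x + t *\<^sub>R v \<in> K''" unfolding K'' using ys(1) by blast
        then show ?thesis using uM by (simp add: F_def)
      qed
      then have "integral {alpha..1} (\<lambda>t. \<bar>F i t\<bar> powr q) <= C1 * (integral {alpha..1} (\<lambda>t. \<bar>F k t\<bar> powr p) + 1)"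
        using alphas ys by (intro C1(2)[of F] DF) auto
      then have "ennreal (integral {alpha..1} (\<lambda>t. \<bar>F i t\<bar> powr q)) <= ennreal (C1 * (integral {alpha..1} (\<lambda>t. \<bar>F k t\<bar> powr p) + 1))"
        by (rule ennreal_leI)
      also have "... = ennreal C1 * (ennreal (integral {alpha..1} (\<lambda>t. \<bar>F k t\<bar> powr p)) + 1)"
      proof -
        have "integral {alpha..1} (\<lambda>t. \<bar>F k t\<bar> powr p) >= 0"
          using p by (intro Henstock_Kurzweil_Integration.integral_nonneg integrable_continuous_real continuous_on_powr' continuous_intros contF) auto
        then show ?thesis using C1(1) by (simp add: ennreal_mult)
      qed
      finally show ?thesis
        unfolding a_def b_def ind A_def B_def F_def[symmetric] using nn[OF q, of i] nn[of p k] p by simp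
    qed
    have shift: "(\<integral>\<^sup>+x. indicator K x * (?J Z x t) \<partial>lborel) = (\<integral>\<^sup>+y. ?I Z t y \<partial>lborel)"
      if [measurable]: "Z \<in> borel_measurable borel" for t :: real and Z :: "'a => ennreal"
      using nn_integral_lborel_shift[of "\<lambda>y. ?I Z t y" "t *\<^sub>R v"] by simp
    have fub: "(\<integral>\<^sup>+x. indicator K x * (\<integral>\<^sup>+t. ?J Z x t \<partial>lborel) \<partial>lborel) = (\<integral>\<^sup>+t. \<integral>\<^sup>+y. ?I Z t y \<partial>lborel \<partial>lborel)"
      if [measurable]: "Z \<in> borel_measurable borel" for Z :: "'a => ennreal"
    proof -
      have "(\<integral>\<^sup>+x. indicator K x * (\<integral>\<^sup>+t. ?J Z x t \<partial>lborel) \<partial>lborel)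
        = (\<integral>\<^sup>+x. \<integral>\<^sup>+t. indicator K x * (?J Z x t) \<partial>lborel \<partial>lborel)"
        by (intro nn_integral_cong nn_integral_cmult[symmetric]) measurable
      also have "... = (\<integral>\<^sup>+t. \<integral>\<^sup>+x. indicator K x * (?J Z x t) \<partial>lborel \<partial>lborel)"
        by (rule lborel_pair.Fubini') measurable
      finally show ?thesis unfolding shift[OF that] .
    qed
    \<comment> \<open>Each point of K' is reached from K at every time in [0, 1/2], which produces
      the factor 1/2.\<close>
    have "ennreal (1/2) * X = (\<integral>\<^sup>+t. indicator {0..1/2::real} t * X \<partial>lborel)" by (subst nn_integral_multc) auto
    also have "... <= (\<integral>\<^sup>+t. \<integral>\<^sup>+y. ?I A t y \<partial>lborel \<partial>lborel)"
    proof (rule nn_integral_mono)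
      fix t :: real
      show "indicator {0..1/2} t * X <= (\<integral>\<^sup>+y. ?I A t y \<partial>lborel)"
      proof (cases "t \<in> {0..1/2}")
        case True
        have "indicator K' y * A y <= ?I A t y" for y
        proof (cases "y \<in> K'")
          case yK: True
          then have "y - t *\<^sub>R v \<in> K" unfolding K_def using True by (intro image_eqI[of _ _ "(y, t)"]) auto
          then show ?thesis using yK K'(2) True by auto
        qed simp
        then have "X <= (\<integral>\<^sup>+y. ?I A t y \<partial>lborel)" unfolding X_def by (intro nn_integral_mono)
        then show ?thesis using True by simp
      qed simp
    qed
    also have "... = (\<integral>\<^sup>+x. indicator K x * a x \<partial>lborel)" unfolding a_def by (rule fub[symmetric]) measurable
    also have "... <= (\<integral>\<^sup>+x. ennreal C1 * (indicator K x * b x + indicator K x) \<partial>lborel)"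
      using pt by (intro nn_integral_mono) (auto simp: indicator_def)
    also have "... = ennreal C1 * ((\<integral>\<^sup>+x. indicator K x * b x \<partial>lborel) + ennreal c)"
      unfolding b_def c(1)[symmetric] by (subst nn_integral_cmult, measurable) (subst nn_integral_add, auto)
    finally have half: "ennreal (1/2) * X <= ennreal C1 * ((\<integral>\<^sup>+x. indicator K x * b x \<partial>lborel) + ennreal c)" .
    have bY: "(\<integral>\<^sup>+x. indicator K x * b x \<partial>lborel) <= Y"
    proof -
      have "(\<integral>\<^sup>+x. indicator K x * b x \<partial>lborel) = (\<integral>\<^sup>+t. \<integral>\<^sup>+y. ?I B t y \<partial>lborel \<partial>lborel)"
        unfolding b_def by (rule fub) measurable
      also have "... <= (\<integral>\<^sup>+t. indicator {0..1::real} t * Y \<partial>lborel)"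
      proof (rule nn_integral_mono)
        fix t :: real
        show "(\<integral>\<^sup>+y. ?I B t y \<partial>lborel) <= indicator {0..1} t * Y"
        proof (cases "t \<in> {0..1}")
          case True
          have "?I B t y <= indicator K'' y * B y" for y
          proof (cases "y - t *\<^sub>R v \<in> K \<and> y \<in> H")
            case yK: True
            then obtain z s where zs: "z \<in> K'" "0 <= s" "s <= 1/2" "y - t *\<^sub>R v = z - s *\<^sub>R v" by (auto simp: K_def)
            then have "y = z + (t - s) *\<^sub>R v" by (simp add: algebra_simps)
            moreover have "t - s \<in> {-1..1}" using True zs by auto
            ultimately have "y \<in> K''" unfolding K'' using yK zs(1) by blast
            then show ?thesis by (auto simp: indicator_def)
          qed (auto simp: indicator_def)
          then show ?thesis using True unfolding Y_def by (auto intro!: nn_integral_mono)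
        qed simp
      qed
      also have "... = Y" by (subst nn_integral_multc) auto
      finally show ?thesis .
    qed
    have "ennreal (1/2) * X <= ennreal C1 * (Y + ennreal c)"
      by (rule order_trans[OF half mult_left_mono[OF add_right_mono[OF bY]]]) simp
    then have "ennreal 2 * (ennreal (1/2) * X) <= ennreal 2 * (ennreal C1 * (Y + ennreal c))" by (rule mult_left_mono) simp
    moreover have "ennreal 2 * (ennreal (1/2) * X) = X"
    proof -
      have "ennreal 2 * (ennreal (1/2) * X) = ennreal (2 * (1/2)) * X"
        by (simp only: mult.assoc[symmetric] ennreal_mult)
      then show ?thesis by simp
    qed
    ultimately have "X <= ennreal 2 * (ennreal C1 * (Y + ennreal c))" by simp
    also have "... <= ennreal 2 * (ennreal C1 * (ennreal (1 + c) * (Y + 1)))"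
    proof (intro mult_left_mono)
      have "Y + ennreal c <= ennreal (1 + c) * Y + ennreal (1 + c) * 1"
      proof (rule add_mono)
        show "Y <= ennreal (1 + c) * Y" using c(2) mult_right_mono[of 1 "ennreal (1 + c)" Y] by simp
        show "ennreal c <= ennreal (1 + c) * 1" by (simp add: ennreal_leI)
      qed
      then show "Y + ennreal c <= ennreal (1 + c) * (Y + 1)" by (simp only: distrib_left)
    qed auto
    also have "... = ennreal C * (Y + 1)"
      unfolding C_def using C1(1) c(2) by (simp add: ennreal_mult mult.assoc del: ennreal_plus)
    finally show ?thesis by (simp add: X_def Y_def A_def B_def)
  qed
  moreover have "C >= 0" using C1(1) c(2) by (simp add: C_def)
  ultimately show ?thesis unfolding q_def by blast
qed

lemma locally_Lp_on_point:
  fixes f :: "'a::euclidean_space => 'b::euclidean_space"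
  assumes "S \<subseteq> {0}" shows "locally_Lp_on p S f" unfolding locally_Lp_on_def
proof (intro allI impI)
  fix K assume K: "compact K \<and> K \<subseteq> S"
  then have [measurable]: "K \<in> sets borel" by (simp add: borel_compact)
  have Kf: "emeasure lborel K < \<infinity>" using K emeasure_compact_finite by blast
  have 1: "(\<lambda>x. indicator K x *\<^sub>R f x) = (\<lambda>x. indicator K x *\<^sub>R f 0)"
    "(\<lambda>x. indicator K x *\<^sub>R norm (f x) powr p) = (\<lambda>x. indicator K x *\<^sub>R norm (f 0) powr p)"
    using K assms by (auto simp: indicator_def fun_eq_iff)
  show "set_borel_measurable lborel K f \<and> set_integrable lborel K (\<lambda>x. norm (f x) powr p)"
    unfolding set_borel_measurable_def set_integrable_def 1
    using Kf by (auto intro!: integrable_mult_left integrable_real_indicator)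
qed

lemma weak_deriv_on_point:
  fixes f :: "'a::euclidean_space => 'b::euclidean_space"
  assumes "S \<subseteq> {0}" shows "weak_deriv_on S b f g"
proof -
  have "interior S \<subseteq> interior {0}" by (rule interior_mono[OF assms])
  then have "interior S = {}" by (simp add: interior_singleton)
  then show ?thesis unfolding weak_deriv_on_alt
    using test_function_zero_outside test_function_dd by (metis (no_types, lifting) Bochner_Integration.integral_cong empty_iff
        integral_zero neg_equal_0_iff_equal scaleR_zero_left)
qed

text \<open>Allows each basis vector to be turned to the inward side of the half-space at the cost
  of a global sign.\<close>

lemma ddl_signs:
  assumes "smooth u" and \<sigma>: "\<And>b. b \<in> set w ==> \<sigma> b = b \<or> \<sigma> b = - b"
  shows "\<exists>s. \<bar>s\<bar> = 1 \<and> ddl (map \<sigma> w) u = (\<lambda>x. s * ddl w u x)" using \<sigma>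
proof (induction w)
  case Nil
  show ?case by (rule exI[of _ 1]) simp
next
  case (Cons b w)
  then obtain s where s: "\<bar>s\<bar> = 1" "ddl (map \<sigma> w) u = (\<lambda>x. s * ddl w u x)" by auto
  obtain c where c: "\<bar>c\<bar> = 1" "\<sigma> b = c *\<^sub>R b"
    using Cons.prems[of b] by (metis abs_1 abs_minus_cancel list.set_intros(1) scaleR_minus1_left scaleR_one)
  have "ddl (map \<sigma> (b # w)) u = dd (c *\<^sub>R b) (\<lambda>x. s * ddl w u x)" by (simp add: s c)
  also have "... = (\<lambda>x. c * dd b (\<lambda>x. s * ddl w u x) x)"
    by (rule dd_scale) (intro smooth_on_linear[OF bounded_linear_mult_right] smooth_ddl assms)
  also have "... = (\<lambda>x. (c * s) * ddl (b # w) u x)" by (simp add: dd_cmult[OF smooth_ddl[OF assms(1)]] mult.assoc)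
  finally show ?case using s(1) c(1) by (intro exI[of _ "c * s"]) (simp add: abs_mult)
qed

lemma mol_bound:
  assumes kappa: "mollifier kappa" and g: "integrable lborel g" and M: "\<And>x. \<bar>g x\<bar> <= M" shows "\<bar>mol kappa g x\<bar> <= M"
proof -
  have "\<bar>mol kappa g x\<bar> <= mol kappa (\<lambda>y. \<bar>g y\<bar>) x" by (rule mol_abs_le[OF kappa g])
  also have "... <= (LINT y|lborel. kappa (y - x) * M)" unfolding mol_def
    using mol_integrand_integrable[OF mollifier_test[OF kappa], of "\<lambda>y. \<bar>g y\<bar>" x] g mollifier_shift_integral(1)[OF kappa] M mollifier_nonneg[OF kappa]
    by (intro integral_mono) (auto intro: mult_left_mono)
  also have "... = M" using mollifier_shift_integral[OF kappa, of x] by simp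
  finally show ?thesis .
qed

lemma compact_segments:
  fixes v :: "'a::euclidean_space"
  assumes "compact K'" "closed H" shows "compact ({y + t *\<^sub>R v | y t. y \<in> K' \<and> t \<in> {-1..1::real}} \<inter> H)"
proof -
  have "compact ((\<lambda>(y, t). y + t *\<^sub>R v) ` (K' \<times> {-1..1}))"
    by (intro compact_continuous_image compact_Times assms compact_Icc) (auto intro!: continuous_intros simp: split_beta)
  moreover have "{y + t *\<^sub>R v | y t. y \<in> K' \<and> t \<in> {-1..1}} = (\<lambda>(y, t). y + t *\<^sub>R v) ` (K' \<times> {-1..1})" by force
  ultimately show ?thesis using compact_Int_closed assms(2) by metis
qed

lemma nn_integral_sum_powr_le:
  fixes f :: "'b => 'a::euclidean_space => real"
  assumes A: "finite A" and [measurable]: "\<And>a. a \<in> A ==> f a \<in> borel_measurable borel" "K \<in> sets borel"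
    and q: "q > 0" and D: "D >= 0" and le: "\<And>x. x \<in> K ==> \<bar>g x\<bar> <= D * (\<Sum>a\<in>A. \<bar>f a x\<bar>)" shows "(powr_integral q K g)
    <= ennreal ((D * real (card A)) powr q) * (\<Sum>a\<in>A. \<integral>\<^sup>+x. indicator K x * ennreal (\<bar>f a x\<bar> powr q) \<partial>lborel)"
proof -
  have "indicator K x * ennreal (\<bar>g x\<bar> powr q)
     <= ennreal ((D * real (card A)) powr q) * (\<Sum>a\<in>A. indicator K x * ennreal (\<bar>f a x\<bar> powr q))" for x
  proof (cases "x \<in> K")
    case True
    have "\<bar>g x\<bar> powr q <= (D * (\<Sum>a\<in>A. \<bar>f a x\<bar>)) powr q" using le[OF True] q by (intro powr_mono2) auto
    also have "... = D powr q * (\<Sum>a\<in>A. \<bar>f a x\<bar>) powr q" using D by (simp add: powr_mult sum_nonneg)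
    also have "... <= D powr q * (real (card A) powr q * (\<Sum>a\<in>A. \<bar>f a x\<bar> powr q))"
      by (intro mult_left_mono sum_powr_le A q) auto
    also have "... = (D * real (card A)) powr q * (\<Sum>a\<in>A. \<bar>f a x\<bar> powr q)" using D by (simp add: powr_mult)
    finally have "ennreal (\<bar>g x\<bar> powr q) <= ennreal ((D * real (card A)) powr q * (\<Sum>a\<in>A. \<bar>f a x\<bar> powr q))"
      by (rule ennreal_leI)
    also have "... = ennreal ((D * real (card A)) powr q) * (\<Sum>a\<in>A. ennreal (\<bar>f a x\<bar> powr q))"
      by (simp add: ennreal_mult sum_nonneg)
    finally show ?thesis using True by simp
  qed simp
  then have "(powr_integral q K g)
    <= (\<integral>\<^sup>+x. ennreal ((D * real (card A)) powr q) * (\<Sum>a\<in>A. indicator K x * ennreal (\<bar>f a x\<bar> powr q)) \<partial>lborel)"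
    by (intro nn_integral_mono)
  also have "... = ennreal ((D * real (card A)) powr q) * (\<Sum>a\<in>A. \<integral>\<^sup>+x. indicator K x * ennreal (\<bar>f a x\<bar> powr q) \<partial>lborel)"
    by (subst nn_integral_cmult, measurable) (subst nn_integral_sum, auto)
  finally show ?thesis .
qed

text \<open>The function is mollified with inward kernels. The mollifications are bounded uniformly,
  since the function is bounded on compact sets; their k-th derivatives are bounded in L^p by
  Jensen's inequality; polarization and the segment bound then control the derivative along w in the
  required Lebesgue space, uniformly in m. Fatou's lemma transfers this to the weak
  derivative.\<close>

theorem deriv_tree_Gagliardo_Nirenberg:
  fixes G :: "'a::euclidean_space list => 'a => real"
  assumes S: "model_domain n S" and G: "deriv_tree p S k G" and c0: "continuous_on S (G [])"
    and p: "p >= 1" and w: "set w \<subseteq> Basis" "1 <= length w" "length w <= k"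
  shows "locally_Lp_on (real k * p / real (length w)) S (G w)"
proof (cases "n = 0")
  case True
  have "S \<subseteq> {0}" using S by (rule model_domain_cases) (use True in auto)
  then show ?thesis by (rule locally_Lp_on_point)
next
  case n0: False
  obtain a T where aT: "open T" "S = {x. 0 <= a \<bullet> x} \<inter> T" using S by (rule model_domain_cases) (use n0 in auto)
  define H where "H = {x. 0 <= a \<bullet> x}"
  have Hc: "closed H" unfolding H_def by (rule closed_halfspace_ge)
  define i where "i = length w"
  define q where "q = real k * p / real i"
  have i: "1 <= i" "i <= k" using w by (auto simp: i_def)
  have q: "q > 0" using i p by (simp add: q_def)
  show ?thesis unfolding locally_Lp_on_def i_def[symmetric] q_def[symmetric]
  proof (intro allI impI)
    fix K' assume K': "compact K' \<and> K' \<subseteq> S"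
    have K'H: "K' \<subseteq> H" "K' \<subseteq> T" using K' aT(2) by (auto simp: H_def)
    define P where "P = {v. 0 <= a \<bullet> v}"
    \<comment> \<open>Flips the outward basis vectors, so that polarization takes place in the cone
      of inward directions.\<close>
    define \<sigma> where "\<sigma> b = (if 0 <= a \<bullet> b then b else - b)" for b
    define bs where "bs = map \<sigma> (rev w)"
    have bsP: "set bs \<subseteq> P" by (auto simp: bs_def P_def \<sigma>_def)
    have lbs: "length bs = i" by (simp add: bs_def i_def)
    have bs0: "bs \<noteq> []" using i lbs by auto
    obtain A C where AC: "finite A" "A \<subseteq> P" "C >= 0"
      "\<And>u x. smooth u ==> \<bar>ddl bs u x\<bar> <= C * (\<Sum>a\<in>A. \<bar>(dd a ^^ i) u x\<bar>)"
      using polarization[of P bs, OF _ _ bsP bs0] unfolding lbs by (auto simp: P_def inner_add_right)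
    obtain delta where delta: "delta > 0" "(\<Union>x\<in>K'. cball x delta) \<subseteq> T"
      using compact_subset_open_imp_cball_epsilon_subset[of K' T] K' K'H aT(1) by auto
    \<comment> \<open>Shortens v so that segments of parameter length 1 in either direction from K'
      stay in the open set T.\<close>
    define tau where "tau v = delta / (norm v + 1)" for v :: 'a
    have tau: "tau v > 0" "norm (tau v *\<^sub>R v) <= delta" for v
    proof -
      show "tau v > 0" using delta(1) unfolding tau_def by (intro divide_pos_pos add_nonneg_pos) auto
      have "delta * norm v <= delta * (norm v + 1)" using delta(1) by simp
      then show "norm (tau v *\<^sub>R v) <= delta" using delta(1) by (simp add: tau_def abs_of_nonneg add_nonneg_pos divide_le_eq)
    qed
    define K2 where "K2 v = {y + t *\<^sub>R (tau v *\<^sub>R v) | y t. y \<in> K' \<and> t \<in> {-1..1::real}} \<inter> H" for v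
    have K2c: "compact (K2 v)" for v unfolding K2_def using K' Hc by (intro compact_segments) auto
    have K2S: "K2 v \<subseteq> S" for v
    proof
      fix z assume "z \<in> K2 v"
      then obtain y t where yt: "z = y + t *\<^sub>R (tau v *\<^sub>R v)" "y \<in> K'" "t \<in> {-1..1::real}" "z \<in> H" by (auto simp: K2_def)
      have "norm (t *\<^sub>R (tau v *\<^sub>R v)) <= 1 * norm (tau v *\<^sub>R v)"
        unfolding norm_scaleR[of t] using yt(3) by (intro mult_right_mono) auto
      then have "dist y z <= delta" using tau(2)[of v] by (simp add: yt(1) dist_norm)
      then have "z \<in> cball y delta" by simp
      then have "z \<in> T" using delta(2) yt(2) by blast
      then show "z \<in> S" using yt(4) aT(2) by (simp add: H_def)
    qed
    \<comment> \<open>All points at which derivatives of the mollifications are evaluated: K' and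
      the segments through it in the polarizing directions.\<close>
    define K where "K = K' \<union> (\<Union>v\<in>A. K2 v)"
    have Kc: "compact K" unfolding K_def using K' K2c AC(1) by (intro compact_Un compact_UN) auto
    have KS: "K \<subseteq> S" unfolding K_def using K' K2S by auto
    obtain nu rho K3 where K3: "rho > 0" "compact K3" "K \<subseteq> K3" "K3 \<subseteq> S"
      "\<forall>\<^sub>F m in sequentially. \<forall>x\<in>K. admits S K3 (kern nu rho m) x" using model_domain_inward[OF S n0 Kc KS] by metis
    note mk = mollifier_kern[OF K3(1), of nu]
    let ?U = "\<lambda>m w. mol (kern nu rho m) (cutoff K3 (G w))"
    have Lp: "locally_Lp_on p S (G u)" if "set u \<subseteq> Basis" "length u <= k" for u
      using G that by (simp add: deriv_tree_def)
    have Gi: "integrable lborel (cutoff K3 (G u))" if "set u \<subseteq> Basis" "length u <= k" for u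
      by (rule cutoff_integrable[OF Lp[OF that] p K3(2,4)])
    have "bounded (G [] ` K3)"
      by (intro compact_imp_bounded compact_continuous_image continuous_on_subset[OF c0] K3)
    then obtain M where M: "M > 0" "\<And>x. x \<in> K3 ==> \<bar>G [] x\<bar> <= M" by (auto simp: bounded_pos)
    have MG: "\<bar>cutoff K3 (G []) x\<bar> <= M" for x using M by (auto simp: cutoff_def indicator_def)
    define u where "u m = ?U m []" for m
    have us: "smooth (u m)" for m unfolding u_def by (rule smooth_mol[OF Gi mollifier_test[OF mk]]) auto
    have uM: "\<bar>u m x\<bar> <= M" for m x unfolding u_def by (rule mol_bound[OF mk Gi MG]) auto
    define R where "R = (\<Sum>v\<in>words k. \<integral>\<^sup>+x. ennreal (\<bar>cutoff K3 (G (rev v)) x\<bar> powr p) \<partial>lborel)"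
    have Rfin: "R < \<infinity>"
    proof -
      have "(\<integral>\<^sup>+x. ennreal (\<bar>cutoff K3 (G (rev v)) x\<bar> powr p) \<partial>lborel) < \<infinity>" if "v \<in> words k" for v
      proof -
        have "integrable lborel (\<lambda>x. \<bar>cutoff K3 (G (rev v)) x\<bar> powr p)"
          using that by (intro cutoff_powr_integrable[OF Lp K3(2,4)]) (auto simp: words_def)
        then show ?thesis by (subst nn_integral_eq_integral) auto
      qed
      then show ?thesis unfolding R_def by (simp add: finite_words less_top)
    qed
    \<comment> \<open>Jensen's inequality bounds each mollified k-th derivative in L^p by the norm
      of the weak derivative, independently of m.\<close>
    have top_k: "\<exists>B<\<infinity>. \<forall>\<^sub>F m in sequentially.
        (powr_integral p (K2 v) ((dd (tau v *\<^sub>R v) ^^ k) (u m))) <= B" if v: "v \<in> A" for v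
    proof -
      obtain D where D: "D >= 0" "\<And>u x. smooth u ==> \<bar>(dd (tau v *\<^sub>R v) ^^ k) u x\<bar> <= D * (\<Sum>b\<in>words k. \<bar>ddl b u x\<bar>)"
        using ddl_expand_words[of "replicate k (tau v *\<^sub>R v)"] unfolding ddl_replicate length_replicate by blast
      let ?D = "ennreal ((D * real (card (words k :: 'a list set))) powr p)"
      have [measurable]: "K2 v \<in> sets borel" using K2c by (rule borel_compact)
      have "\<forall>\<^sub>F m in sequentially. (powr_integral p (K2 v) ((dd (tau v *\<^sub>R v) ^^ k) (u m))) <= ?D * R" using K3(5)
      proof (rule eventually_mono)
        fix m assume ad: "\<forall>x\<in>K. admits S K3 (kern nu rho m) x"
        have meas: "?U m (rev b) \<in> borel_measurable borel" if "b \<in> words k" for b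
          using that by (intro mol_borel[OF mk] Gi) (auto simp: words_def)
        have "(powr_integral p (K2 v) ((dd (tau v *\<^sub>R v) ^^ k) (u m))) <= ?D *
             (\<Sum>b\<in>words k. \<integral>\<^sup>+x. indicator (K2 v) x * ennreal (\<bar>?U m (rev b) x\<bar> powr p) \<partial>lborel)"
        proof (rule nn_integral_sum_powr_le)
          fix x assume "x \<in> K2 v"
          then have x: "x \<in> K" using v by (auto simp: K_def)
          have "(\<Sum>b\<in>words k. \<bar>ddl b (u m) x\<bar>) = (\<Sum>b\<in>words k. \<bar>?U m (rev b) x\<bar>)"
          proof (intro sum.cong refl arg_cong[where f = abs])
            fix b :: "'a list" assume "b \<in> words k"
            then show "ddl b (u m) x = ?U m (rev b) x"
              unfolding u_def using ad x by (intro ddl_mol_tree[OF G p K3(2,4)]) (auto simp: words_def)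
          qed
          then show "\<bar>(dd (tau v *\<^sub>R v) ^^ k) (u m) x\<bar> <= D * (\<Sum>b\<in>words k. \<bar>?U m (rev b) x\<bar>)"
            using D(2)[OF us[of m], of x] by simp
        qed (use p D(1) meas in \<open>auto simp: finite_words\<close>)
        also have "... <= ?D * R" unfolding R_def
        proof (intro mult_left_mono sum_mono)
          fix b :: "'a list" assume b: "b \<in> words k"
          have gi: "integrable lborel (cutoff K3 (G (rev b)))" using b by (intro Gi) (auto simp: words_def)
          have gp: "integrable lborel (\<lambda>x. \<bar>cutoff K3 (G (rev b)) x\<bar> powr p)"
            using b by (intro cutoff_powr_integrable[OF Lp K3(2,4)]) (auto simp: words_def)
          have "(powr_integral p (K2 v) (?U m (rev b)))
             <= (\<integral>\<^sup>+x. ennreal (mol (kern nu rho m) (\<lambda>x. \<bar>cutoff K3 (G (rev b)) x\<bar> powr p) x) \<partial>lborel)"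
            using mol_jensen[OF mk gi gp p] by (intro nn_integral_mono) (auto simp: indicator_def intro!: ennreal_leI)
          also have "... = (\<integral>\<^sup>+x. ennreal (\<bar>cutoff K3 (G (rev b)) x\<bar> powr p) \<partial>lborel)"
            by (rule nn_integral_mol[OF mk gp]) simp
          finally show "(powr_integral p (K2 v) (?U m (rev b)))
             <= (\<integral>\<^sup>+x. ennreal (\<bar>cutoff K3 (G (rev b)) x\<bar> powr p) \<partial>lborel)" .
        qed auto
        finally show "(powr_integral p (K2 v) ((dd (tau v *\<^sub>R v) ^^ k) (u m))) <= ?D * R" .
      qed
      moreover have "?D * R < \<infinity>" using Rfin by (simp add: ennreal_mult_less_top)
      ultimately show ?thesis by blast
    qed
    have [measurable]: "K' \<in> sets borel" using K' by (simp add: borel_compact)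
    \<comment> \<open>The segment bound in the direction \<open>tau v *\<^sub>R v\<close>, followed
      by undoing the scaling with the factor \<open>tau v ^ i\<close>.\<close>
    have mid: "\<exists>B<\<infinity>. \<forall>\<^sub>F m in sequentially. (powr_integral q K' ((dd v ^^ i) (u m))) <= B" if v: "v \<in> A" for v
    proof -
      obtain B where B: "B < \<infinity>" "\<forall>\<^sub>F m in sequentially.
        (powr_integral p (K2 v) ((dd (tau v *\<^sub>R v) ^^ k) (u m))) <= B" using top_k[OF v] by blast
      have inw: "y + s *\<^sub>R (tau v *\<^sub>R v) \<in> H" if "y \<in> H" "0 <= s" for y s
        using that v AC(2) tau(1)[of v] by (auto simp: H_def P_def inner_add_right intro!: add_nonneg_nonneg mult_nonneg_nonneg)
      obtain C' where C': "C' >= 0" "\<And>u. smooth u ==> (\<And>x. x\<in>K2 v ==> \<bar>u x\<bar> <= M) ==>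
         (powr_integral q K' ((dd (tau v *\<^sub>R v) ^^ i) u))
         <= ennreal C' * ((powr_integral p (K2 v) ((dd (tau v *\<^sub>R v) ^^ k) u)) + 1)"
        using segment_bound[OF Hc inw _ K'H(1) i p M(1) K2_def[of v]] K' unfolding q_def by blast
      define t where "t = tau v ^ i"
      have t: "t > 0" unfolding t_def using tau(1) by simp
      have "\<forall>\<^sub>F m in sequentially. (powr_integral q K' ((dd v ^^ i) (u m)))
          <= ennreal ((1 / t) powr q) * (ennreal C' * (B + 1))" using B(2)
      proof (rule eventually_mono)
        fix m assume m: "(powr_integral p (K2 v) ((dd (tau v *\<^sub>R v) ^^ k) (u m))) <= B"
        have [measurable]: "(dd (tau v *\<^sub>R v) ^^ i) (u m) \<in> borel_measurable borel"
          using smooth_on_imp_continuous[OF smooth_funpow_dd[OF us]] by (rule borel_measurable_continuous_onI)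
        have "indicator K' x * ennreal (\<bar>(dd v ^^ i) (u m) x\<bar> powr q)
          = ennreal ((1 / t) powr q) * (indicator K' x * ennreal (\<bar>(dd (tau v *\<^sub>R v) ^^ i) (u m) x\<bar> powr q))" for x
        proof -
          have "\<bar>(dd v ^^ i) (u m) x\<bar> = (1 / t) * \<bar>(dd (tau v *\<^sub>R v) ^^ i) (u m) x\<bar>"
            unfolding funpow_dd_scale[OF us] t_def[symmetric] using t by (simp add: abs_mult)
          then have "\<bar>(dd v ^^ i) (u m) x\<bar> powr q = (1 / t) powr q * \<bar>(dd (tau v *\<^sub>R v) ^^ i) (u m) x\<bar> powr q"
            using t by (simp add: powr_mult[symmetric])
          then show ?thesis by (simp add: ennreal_mult mult_ac)
        qed
        then have "(powr_integral q K' ((dd v ^^ i) (u m)))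
          = ennreal ((1 / t) powr q) * (powr_integral q K' ((dd (tau v *\<^sub>R v) ^^ i) (u m)))"
          by (simp only:) (rule nn_integral_cmult, measurable)
        also have "... <= ennreal ((1 / t) powr q) * (ennreal C' * (B + 1))"
          by (intro mult_left_mono order_trans[OF C'(2)[OF us uM] mult_left_mono[OF add_right_mono[OF m]]]) auto
        finally show "(powr_integral q K' ((dd v ^^ i) (u m)))
          <= ennreal ((1 / t) powr q) * (ennreal C' * (B + 1))" .
      qed
      moreover have "ennreal ((1 / t) powr q) * (ennreal C' * (B + 1)) < \<infinity>"
        using B(1) by (simp add: ennreal_mult_less_top)
      ultimately show ?thesis by blast
    qed
    have "\<forall>v\<in>A. \<exists>B. B < \<infinity> \<and> (\<forall>\<^sub>F m in sequentially.
        (powr_integral q K' ((dd v ^^ i) (u m))) <= B)" using mid by blast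
    from bchoice[OF this] obtain B where B0: "\<forall>v\<in>A. B v < \<infinity> \<and> (\<forall>\<^sub>F m in sequentially.
        (powr_integral q K' ((dd v ^^ i) (u m))) <= B v)" ..
    then have B: "\<And>v. v \<in> A ==> B v < \<infinity>" "\<And>v. v \<in> A ==> \<forall>\<^sub>F m in sequentially.
        (powr_integral q K' ((dd v ^^ i) (u m))) <= B v" by blast+
    define Z where "Z = ennreal ((C * real (card A)) powr q) * (\<Sum>v\<in>A. B v)"
    have Zfin: "Z < \<infinity>" unfolding Z_def using B(1) AC(1) by (simp add: ennreal_mult_less_top less_top)
    have ev: "\<forall>\<^sub>F m in sequentially. (powr_integral q K' (?U m w)) <= Z"
    proof -
      have "\<forall>\<^sub>F m in sequentially. \<forall>v\<in>A. (powr_integral q K' ((dd v ^^ i) (u m))) <= B v"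
        using B(2) AC(1) by (intro eventually_ball_finite) auto
      with K3(5) show ?thesis
      proof eventually_elim
        case (elim m)
        have "(powr_integral q K' (?U m w))
          <= ennreal ((C * real (card A)) powr q) * (\<Sum>v\<in>A. \<integral>\<^sup>+x. indicator K' x * ennreal (\<bar>(dd v ^^ i) (u m) x\<bar> powr q) \<partial>lborel)"
        proof (rule nn_integral_sum_powr_le[OF AC(1) _ _ q AC(3)])
          show "(dd v ^^ i) (u m) \<in> borel_measurable borel" for v
            using smooth_on_imp_continuous[OF smooth_funpow_dd[OF us]] by (rule borel_measurable_continuous_onI)
          fix x assume "x \<in> K'"
          then have x: "x \<in> K" by (simp add: K_def)
          have "ddl (rev w) (u m) x = ?U m (rev (rev w)) x"
            unfolding u_def using elim(1) x w by (intro ddl_mol_tree[OF G p K3(2,4)]) auto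
          moreover have "\<exists>s. \<bar>s\<bar> = 1 \<and> ddl bs (u m) = (\<lambda>x. s * ddl (rev w) (u m) x)"
            unfolding bs_def by (rule ddl_signs[OF us]) (simp add: \<sigma>_def)
          then obtain s where "\<bar>s\<bar> = 1" "ddl bs (u m) = (\<lambda>x. s * ddl (rev w) (u m) x)" by blast
          ultimately have "\<bar>?U m w x\<bar> = \<bar>ddl bs (u m) x\<bar>" by (simp add: abs_mult)
          then show "\<bar>?U m w x\<bar> <= C * (\<Sum>v\<in>A. \<bar>(dd v ^^ i) (u m) x\<bar>)" using AC(4)[OF us[of m], of x] by simp
        qed measurable
        also have "... <= Z" unfolding Z_def using elim(2) by (intro mult_left_mono sum_mono) auto
        finally show ?case .
      qed
    qed
    have Gwi: "integrable lborel (cutoff K3 (G w))" using w by (intro Gi) auto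
    \<comment> \<open>A single function is followed, so the index set is the one-element set of
      units.\<close>
    obtain r where r: "\<And>m. m <= r m" "AE x in lborel. (\<lambda>m. ?U (r m) w x) \<longlonglongrightarrow> cutoff K3 (G w) x"
    proof (rule mol_kern_dominated[OF K3(1), of "{()}" "\<lambda>_. cutoff K3 (G w)" nu])
      show "integrable lborel (cutoff K3 (G w))" by (rule Gwi)
      fix r assume r: "\<And>m. m <= r m"
        "\<And>j. j \<in> {()} ==> AE x in lborel. (\<lambda>m. ?U (r m) w x) \<longlonglongrightarrow> cutoff K3 (G w) x"
      show thesis by (rule that[OF r(1) r(2)]) simp_all
    qed simp
    have rlim: "filterlim r at_top sequentially"
      by (rule filterlim_at_top_mono[OF filterlim_ident]) (auto simp: r(1))
    have [measurable]: "?U m w \<in> borel_measurable borel" for m by (rule mol_borel[OF mk Gwi])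
    have [measurable]: "cutoff K3 (G w) \<in> borel_measurable borel" using Gwi by simp
    define g where "g m x = indicator K' x * ennreal (\<bar>?U (r m) w x\<bar> powr q)" for m x
    \<comment> \<open>Almost everywhere convergence identifies the integrand with a lower limit, to
      which Fatou's lemma applies.\<close>
    have "(powr_integral q K' (cutoff K3 (G w))) = (\<integral>\<^sup>+x. liminf (\<lambda>m. g m x) \<partial>lborel)"
    proof (rule nn_integral_cong_AE)
      show "AE x in lborel. indicator K' x * ennreal (\<bar>cutoff K3 (G w) x\<bar> powr q) = liminf (\<lambda>m. g m x)" using r(2)
      proof eventually_elim
        case (elim x)
        have "(\<lambda>m. \<bar>?U (r m) w x\<bar> powr q) \<longlonglongrightarrow> \<bar>cutoff K3 (G w) x\<bar> powr q"
          using elim q by (intro tendsto_powr' tendsto_rabs tendsto_const) auto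
        then have "(\<lambda>m. g m x) \<longlonglongrightarrow> indicator K' x * ennreal (\<bar>cutoff K3 (G w) x\<bar> powr q)"
          unfolding g_def by (auto simp: indicator_def intro!: tendsto_ennrealI)
        then show ?case by (rule lim_imp_Liminf[OF sequentially_bot, symmetric])
      qed
    qed
    also have "... <= liminf (\<lambda>m. \<integral>\<^sup>+x. g m x \<partial>lborel)" by (rule nn_integral_liminf) (simp add: g_def[abs_def])
    also have "... <= liminf (\<lambda>m. Z)"
    proof (rule Liminf_mono)
      show "\<forall>\<^sub>F m in sequentially. (\<integral>\<^sup>+x. g m x \<partial>lborel) <= Z"
        unfolding g_def by (rule eventually_compose_filterlim[OF ev rlim])
    qed
    also have "... = Z" by (rule Liminf_const) simp
    finally have fin: "(powr_integral q K' (cutoff K3 (G w))) < \<infinity>" using Zfin by simp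
    have KK3: "K' \<subseteq> K3" using K3(3) by (auto simp: K_def)
    have "integrable lborel (\<lambda>x. indicator K' x * \<bar>cutoff K3 (G w) x\<bar> powr q)"
    proof (rule integrableI_nonneg)
      have "(\<integral>\<^sup>+x. ennreal (indicator K' x * \<bar>cutoff K3 (G w) x\<bar> powr q) \<partial>lborel) = (powr_integral q K' (cutoff K3 (G w)))"
        by (intro nn_integral_cong) (auto simp: indicator_def)
      then show "(\<integral>\<^sup>+x. ennreal (indicator K' x * \<bar>cutoff K3 (G w) x\<bar> powr q) \<partial>lborel) < \<infinity>" using fin by simp
    qed auto
    moreover have "(\<lambda>x. indicator K' x * \<bar>cutoff K3 (G w) x\<bar> powr q) = (\<lambda>x. indicator K' x *\<^sub>R norm (G w x) powr q)"
      using KK3 by (auto simp: cutoff_def indicator_def fun_eq_iff)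
    moreover have "set_borel_measurable lborel K' (G w)" using Lp[of w] w K' by (auto simp: locally_Lp_on_def)
    ultimately show "set_borel_measurable lborel K' (G w) \<and> set_integrable lborel K' (\<lambda>x. norm (G w x) powr q)"
      by (simp add: set_integrable_def)
  qed
qed

section \<open>Products and reciprocals of Sobolev functions\<close>

text \<open>In the applications Q is k * p. At order 0 the exponent Q / 0 would stand for infinity,
  and continuity takes its place.\<close>

definition level :: "real => 'a::euclidean_space set => nat => ('a => real) => bool" where
  "level Q S i u \<longleftrightarrow> (if i = 0 then continuous_on S u else locally_Lp_on (Q / real i) S u)"

text \<open>A derivative of order \<open>i\<close> counts as a function of homogeneity \<open>i\<close> and lies in the space with
exponent \<open>Q / i\<close>; these exponents are compatible with products.\<close>

primrec graded_Sobolev :: "real => 'a::euclidean_space set => nat => nat => ('a => real) => bool" where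
  "graded_Sobolev Q S 0 i u \<longleftrightarrow> level Q S i u"
| "graded_Sobolev Q S (Suc j) i u \<longleftrightarrow> level Q S i u \<and>
     (\<forall>b\<in>Basis. \<exists>g. weak_deriv_on S b u g \<and> graded_Sobolev Q S j (Suc i) g)"

lemma graded_Sobolev_level: "graded_Sobolev Q S j i u ==> level Q S i u" by (cases j) auto

lemma graded_Sobolev_decr: "graded_Sobolev Q S (Suc j) i u ==> graded_Sobolev Q S j i u"
proof (induction j arbitrary: i u)
  case 0
  then show ?case by (auto dest: graded_Sobolev_level)
next
  case (Suc j)
  have "\<exists>g. weak_deriv_on S b u g \<and> graded_Sobolev Q S j (Suc i) g" if b: "b \<in> Basis" for b
  proof -
    obtain g where "weak_deriv_on S b u g" "graded_Sobolev Q S (Suc j) (Suc i) g"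
      using Suc.prems b graded_Sobolev.simps(2)[of Q S "Suc j" i u] by blast
    then show ?thesis using Suc.IH by blast
  qed
  then show ?case using graded_Sobolev_level[OF Suc.prems] by simp
qed

lemma locally_Lp_on_mono:
  fixes f :: "'a::euclidean_space => real"
  assumes f: "locally_Lp_on q S f" and pq: "0 <= p" "p <= q" shows "locally_Lp_on p S f" unfolding locally_Lp_on_def
proof (intro allI impI)
  fix K assume K: "compact K \<and> K \<subseteq> S"
  then have [measurable]: "K \<in> sets borel" by (simp add: borel_compact)
  have m: "(\<lambda>x. indicator K x *\<^sub>R f x) \<in> borel_measurable borel" using locally_Lp_on_borel[OF f] K by blast
  have i: "integrable lborel (\<lambda>x. indicator K x *\<^sub>R norm (f x) powr q)"
    using f K by (auto simp: locally_Lp_on_def set_integrable_def)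
  have i1: "integrable lborel (indicator K :: 'a => real)"
    using K emeasure_compact_finite[of K] by (intro integrable_real_indicator) auto
  have "integrable lborel (\<lambda>x. indicator K x *\<^sub>R norm (f x) powr p)"
  proof (rule Bochner_Integration.integrable_bound)
    show "integrable lborel (\<lambda>x. indicator K x + indicator K x *\<^sub>R norm (f x) powr q)" using i i1 by simp
    note [measurable] = m
    have "(\<lambda>x. indicator K x * norm (indicator K x *\<^sub>R f x) powr p) \<in> borel_measurable lborel" by measurable
    moreover have "indicator K x * norm (indicator K x *\<^sub>R f x) powr p = indicator K x *\<^sub>R norm (f x) powr p" for x
      by (simp add: indicator_def)
    ultimately show "(\<lambda>x. indicator K x *\<^sub>R norm (f x) powr p) \<in> borel_measurable lborel" by (simp only:)
    have "norm (f x) powr p <= 1 + norm (f x) powr q" for x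
    proof (cases "norm (f x) <= 1")
      case True
      then have "norm (f x) powr p <= 1" using powr_mono2[of p "norm (f x)" 1] pq by simp
      then show ?thesis by (simp add: add_increasing2)
    next
      case False
      then have "norm (f x) powr p <= norm (f x) powr q" using pq by (intro powr_mono) auto
      then show ?thesis by simp
    qed
    then show "AE x in lborel. norm (indicator K x *\<^sub>R norm (f x) powr p) <= norm (indicator K x + indicator K x *\<^sub>R norm (f x) powr q)"
      by (intro AE_I2) (auto simp: indicator_def)
  qed
  then show "set_borel_measurable lborel K f \<and> set_integrable lborel K (\<lambda>x. norm (f x) powr p)"
    using m by (simp add: set_borel_measurable_def set_integrable_def)
qed

lemma level_imp_Lp:
  assumes "level Q S i u" "real i * p <= Q" "p >= 1" shows "locally_Lp_on p S u"
proof (cases "i = 0")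
  case True
  then show ?thesis using assms continuous_on_imp_locally_Lp_on by (auto simp: level_def)
next
  case False
  then have "p <= Q / real i" using assms(2) by (simp add: field_simps)
  then show ?thesis using assms False locally_Lp_on_mono[of "Q / real i" S u p] by (auto simp: level_def)
qed

text \<open>The place where interpolation enters: the higher integrability of the intermediate
  derivatives is the content, the tree structure being already there.\<close>

lemma weakly_deriv_on_imp_graded:
  assumes S: "model_domain n S" and p: "p >= 1" and u: "Sobolev_on k p S u"
  shows "graded_Sobolev (real k * p) S k 0 u"
proof -
  obtain G where G: "deriv_tree p S k G" "G [] = u" using u weakly_deriv_on_tree unfolding Sobolev_on_def by blast
  have c0: "continuous_on S (G [])" using u G(2) by (simp add: Sobolev_on_def)
  have lev: "level (real k * p) S (length w) (G w)" if "set w \<subseteq> Basis" "length w <= k" for w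
  proof (cases "length w = 0")
    case False
    then have "1 <= length w" by linarith
    from deriv_tree_Gagliardo_Nirenberg[OF S G(1) c0 p that(1) this that(2)] False show ?thesis by (simp add: level_def)
  qed (use c0 in \<open>simp add: level_def\<close>)
  have "graded_Sobolev (real k * p) S j (length w) (G w)" if "set w \<subseteq> Basis" "length w + j = k" for w j using that
  proof (induction j arbitrary: w)
    case 0
    then show ?case using lev[of w] by simp
  next
    case (Suc j)
    have "\<exists>g. weak_deriv_on S b (G w) g \<and> graded_Sobolev (real k * p) S j (Suc (length w)) g" if b: "b \<in> Basis" for b
    proof (intro exI conjI)
      show "weak_deriv_on S b (G w) (G (b # w))" using G(1) Suc.prems b by (simp add: deriv_tree_def)
      show "graded_Sobolev (real k * p) S j (Suc (length w)) (G (b # w))" using Suc.IH[of "b # w"] Suc.prems b by simp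
    qed
    then show ?case using lev[of w] Suc.prems by simp
  qed
  from this[of "[]" k] show ?thesis using G(2) by simp
qed

text \<open>For orders up to k the exponent k * p / i is at least p, so local integrability can be
  lowered to p.\<close>

lemma graded_imp_weakly_deriv_on:
  assumes p: "p >= 1" shows "graded_Sobolev (real k * p) S j i u ==> i + j <= k ==> weakly_deriv_on p S j u"
proof (induction j arbitrary: i u)
  case 0
  have "real i * p <= real k * p" using 0 p by (intro mult_right_mono) auto
  then show ?case using level_imp_Lp[OF graded_Sobolev_level[OF 0(1)] _ p] by simp
next
  case (Suc j)
  have "real i * p <= real k * p" using Suc p by (intro mult_right_mono) auto
  then have "locally_Lp_on p S u" using level_imp_Lp[OF graded_Sobolev_level[OF Suc.prems(1)] _ p] by simp
  moreover have "\<exists>g. weak_deriv_on S b u g \<and> weakly_deriv_on p S j g" if "b \<in> Basis" for b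
    using Suc that by (metis add_Suc_shift graded_Sobolev.simps(2))
  ultimately show ?case by simp
qed

lemma level_add: "level Q S i u ==> level Q S i v ==> Q >= 0 ==> level Q S i (\<lambda>x. u x + v x)"
  by (auto simp: level_def intro: continuous_on_add locally_Lp_on_add)

lemma level_cmult: "level Q S i u ==> Q >= 0 ==> level Q S i (\<lambda>x. c * u x)"
  by (auto simp: level_def intro: continuous_intros locally_Lp_on_linear[OF bounded_linear_mult_right])

lemma level_imp_L1:
  assumes "level Q S i u" "real i <= Q" shows "locally_Lp_on 1 S u" using level_imp_Lp[of Q S i u 1] assms by simp

lemma graded_imp_L1: "graded_Sobolev Q S j i u ==> real i <= Q ==> locally_Lp_on 1 S u"
  by (rule level_imp_L1[OF graded_Sobolev_level])

lemma graded_Sobolev_add: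
  "graded_Sobolev Q S j i u ==> graded_Sobolev Q S j i v ==> real (i + j) <= Q ==> graded_Sobolev Q S j i (\<lambda>x. u x + v x)"
proof (induction j arbitrary: i u v)
  case 0
  then show ?case by (auto intro: level_add)
next
  case (Suc j)
  have "\<exists>g. weak_deriv_on S b (\<lambda>x. u x + v x) g \<and> graded_Sobolev Q S j (Suc i) g" if b: "b \<in> Basis" for b
  proof -
    obtain u' where u': "weak_deriv_on S b u u'" "graded_Sobolev Q S j (Suc i) u'" using Suc.prems(1) b by auto
    obtain v' where v': "weak_deriv_on S b v v'" "graded_Sobolev Q S j (Suc i) v'" using Suc.prems(2) b by auto
    have "locally_Lp_on 1 S u" "locally_Lp_on 1 S v"
      using graded_imp_L1[OF Suc.prems(1)] graded_imp_L1[OF Suc.prems(2)] Suc.prems(3) by simp_all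
    moreover have "locally_Lp_on 1 S u'" "locally_Lp_on 1 S v'"
      using graded_imp_L1[OF u'(2)] graded_imp_L1[OF v'(2)] Suc.prems(3) by simp_all
    ultimately have "weak_deriv_on S b (\<lambda>x. u x + v x) (\<lambda>x. u' x + v' x)"
      using u'(1) v'(1) by (intro weak_deriv_on_add[where p = 1]) auto
    moreover have "graded_Sobolev Q S j (Suc i) (\<lambda>x. u' x + v' x)"
      using u'(2) v'(2) Suc.prems(3) by (intro Suc.IH) auto
    ultimately show ?thesis by blast
  qed
  then show ?case using Suc.prems by (auto intro: level_add)
qed

lemma graded_Sobolev_cmult:
  "graded_Sobolev Q S j i u ==> real (i + j) <= Q ==> graded_Sobolev Q S j i (\<lambda>x. c * u x)"
proof (induction j arbitrary: i u)
  case 0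
  then show ?case by (auto intro: level_cmult)
next
  case (Suc j)
  have "\<exists>g. weak_deriv_on S b (\<lambda>x. c * u x) g \<and> graded_Sobolev Q S j (Suc i) g" if b: "b \<in> Basis" for b
  proof -
    obtain u' where u': "weak_deriv_on S b u u'" "graded_Sobolev Q S j (Suc i) u'" using Suc.prems(1) b by auto
    have "locally_Lp_on 1 S u" "locally_Lp_on 1 S u'"
      using graded_imp_L1[OF Suc.prems(1)] graded_imp_L1[OF u'(2)] Suc.prems(2) by simp_all
    then have "weak_deriv_on S b (\<lambda>x. c * u x) (\<lambda>x. c * u' x)"
      using u'(1) by (intro weak_deriv_on_linear[OF bounded_linear_mult_right, where p = 1]) auto
    moreover have "graded_Sobolev Q S j (Suc i) (\<lambda>x. c * u' x)" using u'(2) Suc.prems(2) by (intro Suc.IH) auto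
    ultimately show ?thesis by blast
  qed
  then show ?case using Suc.prems by (auto intro: level_cmult)
qed

text \<open>Holder's inequality in pointwise form: exponents are added, and a base of at least 1
  allows them to be raised to 1, where h itself is integrable.\<close>

lemma mult_le_graded:
  fixes a b x y h :: real
  assumes "\<bar>x\<bar> <= C * h powr a" "\<bar>y\<bar> <= D * h powr b" "h >= 1" "a + b <= 1" "C >= 0" shows "\<bar>x * y\<bar> <= (C * D) * h"
proof -
  have "0 <= D * h powr b" using assms(2) by linarith
  then have D: "D >= 0" using assms(3) by (simp add: zero_le_mult_iff)
  have "\<bar>x * y\<bar> <= (C * h powr a) * (D * h powr b)" unfolding abs_mult using assms by (intro mult_mono) auto
  also have "... = (C * D) * h powr (a + b)" by (simp add: powr_add)
  also have "... <= (C * D) * h powr 1" using assms D by (intro mult_left_mono powr_mono) auto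
  finally show ?thesis using assms(3) by simp
qed

text \<open>Expresses membership at degree i as a pointwise bound by the power i / Q of an
  integrable function. Products are then handled by adding exponents, uniformly including degree
  0.\<close>

lemma level_dominated:
  fixes u :: "'a::euclidean_space => real"
  assumes u: "level Q S i u" and K: "compact K" "K \<subseteq> S" and Q: "Q > 0"
  obtains C H where "0 <= C" "integrable lborel H" "\<And>x. 0 <= H x" "\<And>x. x \<in> K ==> \<bar>u x\<bar> <= C * H x powr (real i / Q)"
proof (cases "i = 0")
  case True
  then have "bounded (u ` K)" using u K by (intro compact_imp_bounded compact_continuous_image) (auto simp: level_def intro: continuous_on_subset)
  then obtain M where M: "M > 0" "\<And>x. x \<in> K ==> \<bar>u x\<bar> <= M" by (auto simp: bounded_pos)
  have "integrable lborel (indicator K :: 'a => real)"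
    using K emeasure_compact_finite[of K] by (intro integrable_real_indicator) (auto simp: borel_compact)
  then show ?thesis using M True that[of M "indicator K"] by auto
next
  case False
  then have "integrable lborel (\<lambda>x. indicator K x *\<^sub>R norm (u x) powr (Q / real i))"
    using u K by (auto simp: level_def locally_Lp_on_def set_integrable_def)
  moreover have "\<bar>u x\<bar> <= 1 * (indicator K x *\<^sub>R norm (u x) powr (Q / real i)) powr (real i / Q)" if "x \<in> K" for x
    using that False Q by (simp add: powr_powr)
  ultimately show ?thesis using that[of 1 "\<lambda>x. indicator K x *\<^sub>R norm (u x) powr (Q / real i)"] by auto
qed

lemma level_mult:
  assumes u: "level Q S i u" and v: "level Q S j v" and ij: "real (i + j) <= Q"
  shows "level Q S (i + j) (\<lambda>x. u x * v x)"
proof (cases "i + j = 0")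
  case True
  then show ?thesis using u v by (auto simp: level_def intro: continuous_on_mult)
next
  case ij0: False
  have Q: "Q > 0" using ij ij0 by linarith
  have m: "(\<lambda>x. indicator K x *\<^sub>R u x) \<in> borel_measurable borel" if "level Q S i u" "compact K" "K \<subseteq> S" for i u K
  proof (cases "i = 0")
    case True
    then have "locally_Lp_on 1 S u" using that(1) continuous_on_imp_locally_Lp_on by (auto simp: level_def)
    then show ?thesis using locally_Lp_on_borel that by blast
  next
    case False
    then have "locally_Lp_on (Q / real i) S u" using that(1) by (simp add: level_def)
    then show ?thesis using locally_Lp_on_borel that by blast
  qed
  define e where "e = Q / real (i + j)"
  have e: "e > 0" unfolding e_def using Q ij0 by (intro divide_pos_pos) (auto simp del: of_nat_add)
  have "locally_Lp_on e S (\<lambda>x. u x * v x)" unfolding locally_Lp_on_def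
  proof (intro allI impI)
    fix K assume K: "compact K \<and> K \<subseteq> S"
    then have [measurable]: "K \<in> sets borel" by (simp add: borel_compact)
    obtain C H where H: "0 <= C" "integrable lborel H" "\<And>x. 0 <= H x" "\<And>x. x\<in>K ==> \<bar>u x\<bar> <= C * H x powr (real i / Q)"
      using level_dominated[OF u _ _ Q, of K] K by metis
    obtain D I where I: "0 <= D" "integrable lborel I" "\<And>x. 0 <= I x" "\<And>x. x\<in>K ==> \<bar>v x\<bar> <= D * I x powr (real j / Q)"
      using level_dominated[OF v _ _ Q, of K] K by metis
    have "(\<lambda>x. (indicator K x *\<^sub>R u x) * (indicator K x *\<^sub>R v x)) \<in> borel_measurable borel"
      using K by (intro borel_measurable_times m[OF u] m[OF v]) auto
    moreover have "(indicator K x *\<^sub>R u x) * (indicator K x *\<^sub>R v x) = indicator K x *\<^sub>R (u x * v x)" for x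
      by (simp add: indicator_def)
    ultimately have m2: "(\<lambda>x. indicator K x *\<^sub>R (u x * v x)) \<in> borel_measurable borel" by (simp only:)
    note [measurable] = m2
    have "(\<lambda>x. indicator K x * norm (indicator K x *\<^sub>R (u x * v x)) powr e) \<in> borel_measurable lborel" by measurable
    moreover have "indicator K x * norm (indicator K x *\<^sub>R (u x * v x)) powr e = indicator K x *\<^sub>R norm (u x * v x) powr e" for x
      by (simp add: indicator_def)
    ultimately have m3: "(\<lambda>x. indicator K x *\<^sub>R norm (u x * v x) powr e) \<in> borel_measurable lborel" by (simp only:)
    have "integrable lborel (\<lambda>x. indicator K x *\<^sub>R norm (u x * v x) powr e)"
    proof (rule Bochner_Integration.integrable_bound[OF _ m3])
      show "integrable lborel (\<lambda>x. (C * D) powr e * (H x + I x))" using H I by simp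
      have "norm (u x * v x) powr e <= (C * D) powr e * (H x + I x)" if x: "x \<in> K" for x
      proof -
        define h where "h = H x + I x"
        have h: "h >= 0" "H x <= h" "I x <= h" using H(3)[of x] I(3)[of x] by (auto simp: h_def)
        have "\<bar>u x\<bar> <= C * h powr (real i / Q)"
          by (rule order_trans[OF H(4)[OF x]]) (use H Q h in \<open>intro mult_left_mono powr_mono2, auto\<close>)
        moreover have "\<bar>v x\<bar> <= D * h powr (real j / Q)"
          by (rule order_trans[OF I(4)[OF x]]) (use I Q h in \<open>intro mult_left_mono powr_mono2, auto\<close>)
        ultimately have "\<bar>u x * v x\<bar> <= (C * h powr (real i / Q)) * (D * h powr (real j / Q))"
          unfolding abs_mult using H(1) by (intro mult_mono) auto
        also have "... = (C * D) * h powr (real (i + j) / Q)" by (simp add: powr_add[symmetric] add_divide_distrib)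
        finally have "\<bar>u x * v x\<bar> powr e <= ((C * D) * h powr (real (i + j) / Q)) powr e" using e by (intro powr_mono2) auto
        also have "... = (C * D) powr e * h powr (real (i + j) / Q * e)" using H(1) I(1) by (simp add: powr_mult powr_powr)
        also have "real (i + j) / Q * e = 1" using ij0 Q unfolding e_def by (simp del: of_nat_add)
        finally show ?thesis using h(1) by (simp add: h_def)
      qed
      then show "AE x in lborel. norm (indicator K x *\<^sub>R norm (u x * v x) powr e) <= norm ((C * D) powr e * (H x + I x))"
        using H(3) I(3) by (intro AE_I2) (auto simp: indicator_def abs_mult)
    qed
    then show "set_borel_measurable lborel K (\<lambda>x. u x * v x) \<and> set_integrable lborel K (\<lambda>x. norm (u x * v x) powr e)"
      using m2 by (simp add: set_borel_measurable_def set_integrable_def)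
  qed
  then show ?thesis unfolding level_def e_def if_not_P[OF ij0] .
qed

text \<open>Supplies smooth approximations whose values and derivatives converge almost everywhere
  and are dominated by powers of one integrable function, with the exponents of degrees i and i + 1.
  The domination is obtained by mollifying the integrable powers of u and u' and applying Jensen's
  inequality.\<close>

lemma weak_deriv_mollify:
  fixes u u' :: "'a::euclidean_space => real"
  assumes S: "model_domain n S" "n \<noteq> 0" and K: "compact K" "K \<subseteq> S"
    and w: "weak_deriv_on S b u u'" and u: "level Q S i u" and u': "level Q S (Suc i) u'" and iQ: "real (Suc i) <= Q"
  obtains f C H where "\<And>m. smooth (f m)" "0 <= C" "integrable lborel H" "\<And>x. 0 <= H x"
    "AE x in lborel. x \<in> K --> (\<lambda>m::nat. f m x) \<longlonglongrightarrow> u x \<and> (\<lambda>m. dd b (f m) x) \<longlonglongrightarrow> u' x"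
    "AE x in lborel. x \<in> K --> (\<forall>m. \<bar>f m x\<bar> <= C * H x powr (real i / Q) \<and> \<bar>dd b (f m) x\<bar> <= C * H x powr (real (Suc i) / Q))"
proof -
  have Q: "Q > 0" using iQ by simp
  have Lpu: "locally_Lp_on 1 S u" using iQ by (intro level_imp_L1[OF u]) auto
  have Lpu': "locally_Lp_on 1 S u'" using iQ by (intro level_imp_L1[OF u']) auto
  obtain nu rho K3 where K3: "rho > 0" "compact K3" "K \<subseteq> K3" "K3 \<subseteq> S"
    "\<forall>\<^sub>F m in sequentially. \<forall>x\<in>K. admits S K3 (kern nu rho m) x" using model_domain_inward[OF S K] by metis
  note mk = mollifier_kern[OF K3(1), of nu]
  have gi: "integrable lborel (cutoff K3 u)" "integrable lborel (cutoff K3 u')"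
    by (intro cutoff_integrable[OF _ _ K3(2,4), of 1] Lpu Lpu', simp)+
  have powi: "integrable lborel (\<lambda>x. \<bar>cutoff K3 v x\<bar> powr (Q / real j))" if "level Q S j v" "j \<noteq> 0" for v j
    using that by (intro cutoff_powr_integrable[OF _ K3(2,4)]) (simp add: level_def)
  \<comment> \<open>Four functions share one subsequence: u and u' for the limits, and their powers
    Q / i and Q / (i + 1) for the dominating functions. At degree 0 the power is replaced by 0,
    since a constant bound serves there.\<close>
  define G where "G j = (if j = (0::nat) then cutoff K3 u else if j = 1 then cutoff K3 u'
     else if j = 2 then (if i = 0 then (\<lambda>x. 0) else (\<lambda>x. \<bar>cutoff K3 u x\<bar> powr (Q / real i)))
     else (\<lambda>x. \<bar>cutoff K3 u' x\<bar> powr (Q / real (Suc i))))" for j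
  have Gi: "integrable lborel (G j)" for j
    unfolding G_def using gi powi[OF u] powi[OF u'] by (auto simp del: of_nat_Suc)
  obtain r where r: "\<And>m. m <= r m"
    "\<And>j. j \<in> {..3::nat} ==> AE x in lborel. (\<lambda>m. mol (kern nu rho (r m)) (G j) x) \<longlonglongrightarrow> G j x"
    "\<And>j. j \<in> {..3} ==> \<exists>H. integrable lborel H \<and> (\<forall>x. 0 <= H x) \<and>
        (AE x in lborel. \<forall>m. \<bar>mol (kern nu rho (r m)) (G j) x\<bar> <= H x)"
  proof (rule mol_kern_dominated[OF K3(1), of "{..3}" G nu])
    fix r assume "\<And>m. m <= r m"
      "\<And>j. j \<in> {..3} ==> AE x in lborel. (\<lambda>m. mol (kern nu rho (r m)) (G j) x) \<longlonglongrightarrow> G j x"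
      "\<And>j. j \<in> {..3} ==> \<exists>H. integrable lborel H \<and> (\<forall>x. 0 <= H x) \<and> (AE x in lborel. \<forall>m. \<bar>mol (kern nu rho (r m)) (G j) x\<bar> <= H x)"
    then show thesis by (rule that)
  qed (use Gi in auto)
  have rlim: "filterlim r at_top sequentially" by (rule filterlim_at_top_mono[OF filterlim_ident]) (auto simp: r(1))
  \<comment> \<open>From index N on, the kernels are admissible at every point of K; the sequence is
    shifted by N.\<close>
  obtain N where N: "\<And>m x. m >= N ==> x \<in> K ==> admits S K3 (kern nu rho (r m)) x"
    using eventually_compose_filterlim[OF K3(5) rlim] unfolding eventually_sequentially by blast
  define kappa where "kappa m = kern nu rho (r (m + N))" for m
  have mkappa: "mollifier (kappa m)" for m unfolding kappa_def by (rule mk)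
  define f where "f m = mol (kappa m) (cutoff K3 u)" for m
  have fd: "dd b (f m) x = mol (kappa m) (cutoff K3 u') x" if "x \<in> K" for m x
  proof -
    have "dd b (f m) x = - mol (dd b (kappa m)) (cutoff K3 u) x"
      unfolding f_def by (rule dd_mol[OF mollifier_test[OF mkappa] gi(1)])
    then show ?thesis using mol_weak_deriv[OF N w, of "m + N" x] that by (simp add: kappa_def)
  qed
  have limG: "AE x in lborel. (\<lambda>m. mol (kappa m) (G j) x) \<longlonglongrightarrow> G j x" if "j \<in> {..3}" for j using r(2)[OF that]
  proof eventually_elim
    case (elim x)
    show ?case unfolding kappa_def using LIMSEQ_ignore_initial_segment[OF elim, of N] by (simp add: add.commute)
  qed
  obtain H2 where H2: "integrable lborel H2" "\<And>x. 0 <= H2 x" "AE x in lborel. \<forall>m. \<bar>mol (kern nu rho (r m)) (G 2) x\<bar> <= H2 x"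
    using r(3)[of 2] by auto
  obtain H3 where H3: "integrable lborel H3" "\<And>x. 0 <= H3 x" "AE x in lborel. \<forall>m. \<bar>mol (kern nu rho (r m)) (G 3) x\<bar> <= H3 x"
    using r(3)[of 3] by auto
  \<comment> \<open>The indicator makes H at least 1 on K, so that \<open>H x powr 0\<close> is 1
    there and the degree 0 bound keeps the same form.\<close>
  define H where "H x = H2 x + H3 x + indicator K x" for x
  have Hi: "integrable lborel H"
  proof -
    have "integrable lborel (indicator K :: 'a => real)"
      using K emeasure_compact_finite[of K] by (intro integrable_real_indicator) (auto simp: borel_compact)
    then show ?thesis unfolding H_def[abs_def] using H2(1) H3(1) by simp
  qed
  have H0: "0 <= H x" for x using H2(2)[of x] H3(2)[of x] by (simp add: H_def)
  have HH: "H2 x <= H x" "H3 x <= H x" for x using H2(2)[of x] H3(2)[of x] by (auto simp: H_def indicator_def)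
  have pw: "\<bar>mol (kappa m) (cutoff K3 v) x\<bar> <= H x powr (real j / Q)"
    if v: "level Q S j v" "j \<noteq> 0" "real j <= Q" "integrable lborel (cutoff K3 v)"
      and le: "mol (kappa m) (\<lambda>x. \<bar>cutoff K3 v x\<bar> powr (Q / real j)) x <= H x" for v j m x
  proof -
    have q: "Q / real j >= 1" using v(2,3) by simp
    have "\<bar>mol (kappa m) (cutoff K3 v) x\<bar> powr (Q / real j) <= mol (kappa m) (\<lambda>x. \<bar>cutoff K3 v x\<bar> powr (Q / real j)) x"
      by (rule mol_jensen[OF mkappa v(4) powi[OF v(1,2)] q])
    also have "... <= H x" by (rule le)
    finally have "(\<bar>mol (kappa m) (cutoff K3 v) x\<bar> powr (Q / real j)) powr (real j / Q) <= H x powr (real j / Q)"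
      using Q by (intro powr_mono2) auto
    then show ?thesis using v(2) Q by (simp add: powr_powr)
  qed
  obtain M where M: "M >= 0" "\<And>x. i = 0 ==> \<bar>cutoff K3 u x\<bar> <= M"
  proof (cases "i = 0")
    case True
    then have "bounded (u ` K3)" using u K3 by (intro compact_imp_bounded compact_continuous_image) (auto simp: level_def intro: continuous_on_subset)
    then obtain B where "B > 0" "\<And>x. x \<in> K3 ==> \<bar>u x\<bar> <= B" by (auto simp: bounded_pos)
    then show ?thesis using that[of B] by (auto simp: cutoff_def indicator_def)
  qed (use that[of 0] in auto)
  define C where "C = M + 1"
  have dom: "AE x in lborel. x \<in> K --> (\<forall>m. \<bar>f m x\<bar> <= C * H x powr (real i / Q) \<and> \<bar>dd b (f m) x\<bar> <= C * H x powr (real (Suc i) / Q))"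
    using H2(3) H3(3)
  proof eventually_elim
    case (elim x)
    show ?case
    proof (intro impI allI conjI)
      fix m assume x: "x \<in> K"
      have H1: "H x >= 1" using x H2(2)[of x] H3(2)[of x] by (simp add: H_def)
      have pge: "1 <= H x powr e" if "e >= 0" for e using H1 that ge_one_powr_ge_zero by blast
      show "\<bar>f m x\<bar> <= C * H x powr (real i / Q)"
      proof (cases "i = 0")
        case True
        have "\<bar>f m x\<bar> <= M" unfolding f_def by (rule mol_bound[OF mkappa gi(1) M(2)[OF True]])
        then show ?thesis using True H1 by (simp add: C_def)
      next
        case False
        have "mol (kappa m) (G 2) x <= H2 x" using elim(1) unfolding kappa_def by (meson abs_le_D1)
        then have "mol (kappa m) (\<lambda>x. \<bar>cutoff K3 u x\<bar> powr (Q / real i)) x <= H x"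
          using False order_trans[OF _ HH(1)] by (simp add: G_def)
        then have "\<bar>f m x\<bar> <= 1 * H x powr (real i / Q)" unfolding f_def using pw[OF u False _ gi(1)] iQ by simp
        also have "... <= C * H x powr (real i / Q)" using M(1) by (intro mult_right_mono) (auto simp: C_def)
        finally show ?thesis .
      qed
      have "mol (kappa m) (G 3) x <= H3 x" using elim(2) unfolding kappa_def by (meson abs_le_D1)
      then have "mol (kappa m) (\<lambda>x. \<bar>cutoff K3 u' x\<bar> powr (Q / real (Suc i))) x <= H x"
        using order_trans[OF _ HH(2)] by (simp add: G_def)
      then have "\<bar>dd b (f m) x\<bar> <= 1 * H x powr (real (Suc i) / Q)"
        unfolding fd[OF x] using pw[OF u' _ iQ gi(2)] by simp
      also have "... <= C * H x powr (real (Suc i) / Q)" using M(1) by (intro mult_right_mono) (auto simp: C_def)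
      finally show "\<bar>dd b (f m) x\<bar> <= C * H x powr (real (Suc i) / Q)" .
    qed
  qed
  have "AE x in lborel. (\<lambda>m. mol (kappa m) (G 0) x) \<longlonglongrightarrow> G 0 x" "AE x in lborel. (\<lambda>m. mol (kappa m) (G 1) x) \<longlonglongrightarrow> G 1 x"
    by (intro limG; simp)+
  then have lims: "AE x in lborel. x \<in> K --> (\<lambda>m. f m x) \<longlonglongrightarrow> u x \<and> (\<lambda>m. dd b (f m) x) \<longlonglongrightarrow> u' x"
  proof eventually_elim
    case (elim x)
    show ?case
    proof
      assume x: "x \<in> K"
      then have "x \<in> K3" using K3(3) by blast
      then show "(\<lambda>m. f m x) \<longlonglongrightarrow> u x \<and> (\<lambda>m. dd b (f m) x) \<longlonglongrightarrow> u' x"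
        using elim unfolding fd[OF x] by (simp add: f_def G_def cutoff_def)
    qed
  qed
  show ?thesis
  proof (rule that[OF _ _ Hi H0 lims dom])
    show "smooth (f m)" for m unfolding f_def by (rule smooth_mol[OF gi(1) mollifier_test[OF mkappa]])
    show "0 <= C" using M(1) by (simp add: C_def)
  qed
qed

lemma dd_mult:
  assumes "smooth f" "smooth g" shows "dd b (\<lambda>x. f x * g x) x = f x * dd b g x + dd b f x * g x"
  by (rule dd_eq[where f' = "\<lambda>v. f x * dd v g x + dd v f x * g x"])
    (intro has_derivative_mult smooth_has_derivative assms)

text \<open>For each approximation the derivative of its product with the test function has integral
  0; dominated convergence carries the integration by parts to the limit.\<close>

lemma weak_deriv_limit:
  fixes w w' :: "'a::euclidean_space => real"
  assumes L: "locally_Lp_on 1 S w" "locally_Lp_on 1 S w'"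
    and lim: "\<And>K. compact K ==> K \<subseteq> interior S ==> \<exists>g H. (\<forall>m::nat. smooth (g m)) \<and> integrable lborel H \<and>
      (AE x in lborel. x \<in> K --> (\<lambda>m. g m x) \<longlonglongrightarrow> w x \<and> (\<lambda>m. dd b (g m) x) \<longlonglongrightarrow> w' x) \<and>
      (AE x in lborel. x \<in> K --> (\<forall>m. \<bar>g m x\<bar> <= H x \<and> \<bar>dd b (g m) x\<bar> <= H x))" shows "weak_deriv_on S b w w'"
  unfolding weak_deriv_on_alt
proof (intro allI impI)
  fix psi assume psi: "test_function (interior S) psi"
  obtain K where K: "compact K" "K \<subseteq> interior S" "\<And>x. x \<notin> K ==> psi x = 0"
    using psi by (auto simp: test_function_def)
  have sm: "smooth psi" by (rule test_function_smooth[OF psi])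
  have "test_function K psi" unfolding test_function_def using K sm by blast
  then have ddK: "dd b psi x = 0" if "x \<notin> K" for x
    using test_function_zero_outside[OF test_function_dd] that by blast
  obtain B1 where B1: "B1 > 0" "\<And>x. \<bar>psi x\<bar> <= B1" using test_function_bounded[OF psi] by metis
  obtain B2 where B2: "B2 > 0" "\<And>x. \<bar>dd b psi x\<bar> <= B2" using test_function_bounded[OF test_function_dd[OF psi]] by metis
  obtain g H where g: "\<And>m::nat. smooth (g m)" and H: "integrable lborel H"
    and gl: "AE x in lborel. x \<in> K --> (\<lambda>m. g m x) \<longlonglongrightarrow> w x \<and> (\<lambda>m. dd b (g m) x) \<longlonglongrightarrow> w' x"
    and gb: "AE x in lborel. x \<in> K --> (\<forall>m. \<bar>g m x\<bar> <= H x \<and> \<bar>dd b (g m) x\<bar> <= H x)" using lim[OF K(1,2)] by blast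
  define A where "A m x = psi x * dd b (g m) x + dd b psi x * g m x" for m x
  define L where "L x = dd b psi x * w x + psi x * w' x" for x
  have t: "test_function UNIV (\<lambda>x. psi x * g m x)" for m
    unfolding test_function_def using K(1,3) by (intro conjI smooth_on_mult locally_convex_UNIV g sm exI[of _ K]) auto
  have Ad: "A m = dd b (\<lambda>x. psi x * g m x)" for m by (simp add: A_def dd_mult[OF sm g] fun_eq_iff)
  have A0: "(LINT x|lborel. A m x) = 0" for m
    unfolding Ad using test_function_smooth[OF t] smooth_has_derivative K(1,3)
    by (intro integral_directional_derivative[where K = K and h = "\<lambda>x. psi x * g m x"] smooth_on_imp_continuous smooth_dd) auto
  have i: "integrable lborel (\<lambda>x. dd b psi x * w x)" "integrable lborel (\<lambda>x. psi x * w' x)"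
    using test_function_mult_integrable[OF test_function_dd[OF psi] L(1)] test_function_mult_integrable[OF psi L(2)] by simp_all
  have "(\<lambda>m. LINT x|lborel. A m x) \<longlonglongrightarrow> (LINT x|lborel. L x)"
  proof (rule integral_dominated_convergence)
    show "integrable lborel (\<lambda>x. (B1 + B2) * \<bar>H x\<bar>)" using H by simp
    show "AE x in lborel. (\<lambda>m. A m x) \<longlonglongrightarrow> L x" using gl
    proof eventually_elim
      case (elim x)
      have "(\<lambda>m. A m x) \<longlonglongrightarrow> psi x * w' x + dd b psi x * w x" if "x \<in> K"
        unfolding A_def using elim that by (intro tendsto_intros) auto
      then show ?case by (cases "x \<in> K") (simp_all add: A_def L_def K(3) ddK add.commute)
    qed
    show "AE x in lborel. norm (A m x) <= (B1 + B2) * \<bar>H x\<bar>" for m using gb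
    proof eventually_elim
      case (elim x)
      have "norm (A m x) <= \<bar>psi x\<bar> * \<bar>dd b (g m) x\<bar> + \<bar>dd b psi x\<bar> * \<bar>g m x\<bar>"
        unfolding A_def abs_mult[symmetric] real_norm_def by (rule abs_triangle_ineq)
      also have "... <= B1 * \<bar>H x\<bar> + B2 * \<bar>H x\<bar>" if "x \<in> K"
        using elim that B1 B2 by (intro add_mono mult_mono) (auto intro: order_trans[OF _ abs_ge_self])
      finally show ?case using B1(1) B2(1) by (cases "x \<in> K") (simp_all add: A_def K(3) ddK distrib_right)
    qed
    show "L \<in> borel_measurable lborel" unfolding L_def[abs_def] using i by simp
    show "A m \<in> borel_measurable lborel" for m
      unfolding Ad using test_function_integrable[OF test_function_dd[OF t]] by simp
  qed
  then have "(\<lambda>m::nat. 0::real) \<longlonglongrightarrow> (LINT x|lborel. L x)" by (simp only: A0)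
  then have "0 = (LINT x|lborel. L x)" by (simp only: LIMSEQ_const_iff)
  also have "... = (LINT x|lborel. dd b psi x * w x) + (LINT x|lborel. psi x * w' x)"
    unfolding L_def by (rule Bochner_Integration.integral_add[OF i])
  finally show "(LINT x|lborel. dd b psi x *\<^sub>R w x) = - (LINT x|lborel. psi x *\<^sub>R w' x)" by simp
qed

text \<open>The product rule holds for the products of the approximations. The degrees add up to at
  most Q, so all terms are dominated by an integrable function and \<open>weak_deriv_limit\<close>
  applies.\<close>

lemma weak_deriv_mult:
  fixes u v u' v' :: "'a::euclidean_space => real"
  assumes S: "model_domain n S" and wu: "weak_deriv_on S b u u'" and wv: "weak_deriv_on S b v v'"
    and u: "level Q S i u" "level Q S (Suc i) u'" and v: "level Q S j v" "level Q S (Suc j) v'"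
    and ij: "real (Suc (i + j)) <= Q" shows "weak_deriv_on S b (\<lambda>x. u x * v x) (\<lambda>x. u' x * v x + u x * v' x)"
proof (cases "n = 0")
  case True
  then have "S \<subseteq> {0}" using S by (rule_tac model_domain_cases[OF S]) auto
  then show ?thesis by (rule weak_deriv_on_point)
next
  case n0: False
  have Q: "Q > 0" using ij by simp
  show ?thesis
  proof (rule weak_deriv_limit)
    show "locally_Lp_on 1 S (\<lambda>x. u x * v x)" by (rule level_imp_L1[OF level_mult[OF u(1) v(1)]]) (use ij in auto)
    have "locally_Lp_on 1 S (\<lambda>x. u' x * v x)" "locally_Lp_on 1 S (\<lambda>x. u x * v' x)"
      by (rule level_imp_L1[OF level_mult[OF u(2) v(1)]], use ij in simp_all)
        (rule level_imp_L1[OF level_mult[OF u(1) v(2)]], use ij in simp_all)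
    then show "locally_Lp_on 1 S (\<lambda>x. u' x * v x + u x * v' x)" by (rule locally_Lp_on_add) simp
  next
    fix K assume K: "compact K" "K \<subseteq> interior S"
    have KS: "K \<subseteq> S" using K(2) interior_subset by blast
    have iQ: "real (Suc i) <= Q" "real (Suc j) <= Q" using ij by simp_all
    obtain f C H where f: "\<And>m. smooth (f m)" "0 <= C" "integrable lborel H" "\<And>x. 0 <= H x"
      "AE x in lborel. x \<in> K --> (\<lambda>m::nat. f m x) \<longlonglongrightarrow> u x \<and> (\<lambda>m. dd b (f m) x) \<longlonglongrightarrow> u' x"
      "AE x in lborel. x \<in> K --> (\<forall>m. \<bar>f m x\<bar> <= C * H x powr (real i / Q) \<and> \<bar>dd b (f m) x\<bar> <= C * H x powr (real (Suc i) / Q))"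
      by (rule weak_deriv_mollify[OF S n0 K(1) KS wu u iQ(1)]) blast
    obtain g D I where g: "\<And>m. smooth (g m)" "0 <= D" "integrable lborel I" "\<And>x. 0 <= I x"
      "AE x in lborel. x \<in> K --> (\<lambda>m::nat. g m x) \<longlonglongrightarrow> v x \<and> (\<lambda>m. dd b (g m) x) \<longlonglongrightarrow> v' x"
      "AE x in lborel. x \<in> K --> (\<forall>m. \<bar>g m x\<bar> <= D * I x powr (real j / Q) \<and> \<bar>dd b (g m) x\<bar> <= D * I x powr (real (Suc j) / Q))"
      by (rule weak_deriv_mollify[OF S n0 K(1) KS wv v iQ(2)]) blast
    \<comment> \<open>The indicator makes h at least 1 on K, so a power with exponent at most 1 is
      bounded by h.\<close>
    define h where "h x = H x + I x + indicator K x" for x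
    have "integrable lborel (indicator K :: 'a => real)"
      using K emeasure_compact_finite[of K] by (intro integrable_real_indicator) (auto simp: borel_compact)
    then have hi: "integrable lborel (\<lambda>x. 2 * (C * D) * h x)" unfolding h_def[abs_def] using f(3) g(3) by simp
    have hp: "c * y powr e <= c * h x powr e" if "x \<in> K" "y = H x \<or> y = I x" "0 <= c" "0 <= e" for x y e c
      using that f(4)[of x] g(4)[of x] by (intro mult_left_mono powr_mono2) (auto simp: h_def)
    have ds: "dd b (\<lambda>x. f m x * g m x) x = f m x * dd b (g m) x + dd b (f m) x * g m x" for m x
      by (rule dd_mult[OF f(1) g(1)])
    have 1: "AE x in lborel. x \<in> K --> (\<lambda>m. f m x * g m x) \<longlonglongrightarrow> u x * v x \<and>
        (\<lambda>m. dd b (\<lambda>x. f m x * g m x) x) \<longlonglongrightarrow> u' x * v x + u x * v' x"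
      using f(5) g(5) unfolding ds by eventually_elim (auto intro!: tendsto_eq_intros)
    have 2: "AE x in lborel. x \<in> K --> (\<forall>m. \<bar>f m x * g m x\<bar> <= 2 * (C * D) * h x \<and>
        \<bar>dd b (\<lambda>x. f m x * g m x) x\<bar> <= 2 * (C * D) * h x)" using f(6) g(6)
    proof eventually_elim
      case (elim x)
      show ?case
      proof (intro impI allI)
        fix m assume x: "x \<in> K"
        have h1: "1 <= h x" using f(4)[of x] g(4)[of x] x by (simp add: h_def)
        have fm: "\<bar>f m x\<bar> <= C * h x powr (real i / Q)" "\<bar>dd b (f m) x\<bar> <= C * h x powr (real (Suc i) / Q)"
          using elim(1) x f(2) Q by (auto intro: order_trans[OF _ hp[of x "H x"]] simp del: of_nat_Suc)
        have gm: "\<bar>g m x\<bar> <= D * h x powr (real j / Q)" "\<bar>dd b (g m) x\<bar> <= D * h x powr (real (Suc j) / Q)"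
          using elim(2) x g(2) Q by (auto intro: order_trans[OF _ hp[of x "I x"]] simp del: of_nat_Suc)
        have ex: "real i / Q + real j / Q <= 1" "real (Suc i) / Q + real j / Q <= 1" "real i / Q + real (Suc j) / Q <= 1"
          using ij Q by (simp_all add: add_divide_distrib[symmetric] divide_le_eq)
        have "\<bar>f m x * g m x\<bar> <= (C * D) * h x" "\<bar>f m x * dd b (g m) x\<bar> <= (C * D) * h x" "\<bar>dd b (f m) x * g m x\<bar> <= (C * D) * h x"
          by (rule mult_le_graded[OF fm(1) gm(1) h1 ex(1) f(2)] mult_le_graded[OF fm(1) gm(2) h1 ex(3) f(2)]
              mult_le_graded[OF fm(2) gm(1) h1 ex(2) f(2)])+
        then show "\<bar>f m x * g m x\<bar> <= 2 * (C * D) * h x \<and> \<bar>dd b (\<lambda>x. f m x * g m x) x\<bar> <= 2 * (C * D) * h x"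
          unfolding ds by linarith
      qed
    qed
    show "\<exists>g H. (\<forall>m::nat. smooth (g m)) \<and> integrable lborel H \<and>
      (AE x in lborel. x \<in> K --> (\<lambda>m. g m x) \<longlonglongrightarrow> u x * v x \<and> (\<lambda>m. dd b (g m) x) \<longlonglongrightarrow> u' x * v x + u x * v' x) \<and>
      (AE x in lborel. x \<in> K --> (\<forall>m. \<bar>g m x\<bar> <= H x \<and> \<bar>dd b (g m) x\<bar> <= H x))"
      using 1 2 hi smooth_on_mult[OF locally_convex_UNIV f(1) g(1)]
      by (intro exI[of _ "\<lambda>m x. f m x * g m x"] exI[of _ "\<lambda>x. 2 * (C * D) * h x"] conjI allI) auto
  qed
qed

text \<open>Both terms of the Leibniz rule have degree i + j + 1; keeping track of the degree is
  what closes the induction.\<close>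

lemma graded_Sobolev_mult:
  assumes S: "model_domain n S"
  shows "graded_Sobolev Q S l i u ==> graded_Sobolev Q S l j v ==> real (i + j + l) <= Q ==>
     graded_Sobolev Q S l (i + j) (\<lambda>x. u x * v x)"
proof (induction l arbitrary: i j u v)
  case 0
  then show ?case by (auto intro: level_mult)
next
  case (Suc l)
  have "\<exists>g. weak_deriv_on S b (\<lambda>x. u x * v x) g \<and> graded_Sobolev Q S l (Suc (i + j)) g" if b: "b \<in> Basis" for b
  proof -
    obtain u' where u': "weak_deriv_on S b u u'" "graded_Sobolev Q S l (Suc i) u'" using Suc.prems(1) b by auto
    obtain v' where v': "weak_deriv_on S b v v'" "graded_Sobolev Q S l (Suc j) v'" using Suc.prems(2) b by auto
    have "weak_deriv_on S b (\<lambda>x. u x * v x) (\<lambda>x. u' x * v x + u x * v' x)"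
      using Suc.prems(3) by (intro weak_deriv_mult[OF S u'(1) v'(1) graded_Sobolev_level[OF Suc.prems(1)]
          graded_Sobolev_level[OF u'(2)] graded_Sobolev_level[OF Suc.prems(2)] graded_Sobolev_level[OF v'(2)]]) simp
    moreover have "graded_Sobolev Q S l (Suc (i + j)) (\<lambda>x. u' x * v x + u x * v' x)"
      using Suc.IH[OF u'(2) graded_Sobolev_decr[OF Suc.prems(2)]] Suc.IH[OF graded_Sobolev_decr[OF Suc.prems(1)] v'(2)] Suc.prems(3)
      by (intro graded_Sobolev_add) auto
    ultimately show ?thesis by blast
  qed
  moreover have "level Q S (i + j) (\<lambda>x. u x * v x)"
    using graded_Sobolev_level[OF Suc.prems(1)] graded_Sobolev_level[OF Suc.prems(2)] Suc.prems(3)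
    by (intro level_mult) auto
  ultimately show ?case by simp
qed

text \<open>Approximations of u may vanish although u does not. They are therefore composed with a
  smooth function on the whole line that agrees with the reciprocal on the values taken by u on
  K.\<close>

lemma weak_deriv_inverse:
  fixes u u' :: "'a::euclidean_space => real"
  assumes S: "model_domain n S" and wu: "weak_deriv_on S b u u'"
    and u: "level Q S 0 u" "level Q S (Suc 0) u'" and Q1: "real (Suc 0) <= Q" and nz: "\<And>x. x \<in> S ==> u x \<noteq> 0"
  shows "weak_deriv_on S b (\<lambda>x. inverse (u x)) (\<lambda>x. (-1) * (inverse (u x) * (inverse (u x) * u' x)))"
proof (cases "n = 0")
  case True
  then have "S \<subseteq> {0}" using S by (rule_tac model_domain_cases[OF S]) auto
  then show ?thesis by (rule weak_deriv_on_point)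
next
  case n0: False
  have Q: "Q > 0" using Q1 by simp
  have uc: "continuous_on S u" using u(1) by (simp add: level_def)
  have li: "level Q S 0 (\<lambda>x. inverse (u x))" unfolding level_def using uc nz by (auto intro!: continuous_intros)
  show ?thesis
  proof (rule weak_deriv_limit)
    show "locally_Lp_on 1 S (\<lambda>x. inverse (u x))" by (rule level_imp_L1[OF li]) (use Q in auto)
    have "level Q S (0 + (0 + Suc 0)) (\<lambda>x. inverse (u x) * (inverse (u x) * u' x))"
      using Q1 by (intro level_mult li u(2)) auto
    then show "locally_Lp_on 1 S (\<lambda>x. (-1) * (inverse (u x) * (inverse (u x) * u' x)))"
      using Q1 by (intro level_imp_L1[OF level_cmult]) auto
  next
    fix K assume K: "compact K" "K \<subseteq> interior S"
    have KS: "K \<subseteq> S" using K(2) interior_subset by blast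
    obtain f C H where f: "\<And>m. smooth (f m)" "0 <= C" "integrable lborel H" "\<And>x. 0 <= H x"
      "AE x in lborel. x \<in> K --> (\<lambda>m::nat. f m x) \<longlonglongrightarrow> u x \<and> (\<lambda>m. dd b (f m) x) \<longlonglongrightarrow> u' x"
      "AE x in lborel. x \<in> K --> (\<forall>m. \<bar>f m x\<bar> <= C * H x powr (real 0 / Q) \<and> \<bar>dd b (f m) x\<bar> <= C * H x powr (real (Suc 0) / Q))"
      by (rule weak_deriv_mollify[OF S n0 K(1) KS wu u Q1]) blast
    have "continuous_on K (\<lambda>x. inverse (u x))" using uc nz KS
      by (intro continuous_on_inverse continuous_on_subset[OF uc]) auto
    then have "bounded ((\<lambda>x. inverse (u x)) ` K)" using K(1) by (intro compact_imp_bounded compact_continuous_image)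
    then obtain E where E: "E > 0" "\<And>x. x \<in> K ==> \<bar>inverse (u x)\<bar> <= E" by (auto simp: bounded_pos)
    \<comment> \<open>Since \<open>\<bar>u\<bar>\<close> is at least 1 / E on K, half of this is a
      strict lower bound.\<close>
    define e where "e = 1 / (2 * E)"
    have e: "e > 0" using E(1) by (simp add: e_def)
    have uE: "\<bar>u x\<bar> > e" if "x \<in> K" for x
    proof -
      have "u x \<noteq> 0" using nz that KS by blast
      then have "1 / E <= \<bar>u x\<bar>" using le_imp_inverse_le[OF E(2)[OF that]] by (simp add: inverse_eq_divide)
      then show ?thesis using E(1) by (simp add: e_def field_simps)
    qed
    define phi where "phi t = t * inverse (t * t + bump 0 e t)" for t :: real
    have pos: "t * t + bump 0 e t > 0" for t :: real
    proof (cases "t = 0")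
      case True
      then show ?thesis using bump_pos_iff[OF e, of 0 t] e by simp
    next
      case False
      then have "t * t > 0" by (simp add: zero_less_mult_iff linorder_neq_iff[symmetric])
      then show ?thesis using bump_nonneg[of 0 e t] by linarith
    qed
    have phis: "smooth phi" unfolding phi_def[abs_def] using pos smooth_on_bounded_linear[OF bounded_linear_ident]
      by (intro smooth_on_mult smooth_on_inverse smooth_on_add locally_convex_UNIV smooth_bump) (auto simp: less_imp_neq[symmetric])
    have phie: "phi t = inverse t" if "e < \<bar>t\<bar>" for t
    proof -
      have "bump 0 e t = 0" using that e by (simp add: bump_eq_0_iff dist_norm)
      then show ?thesis using that e by (auto simp: phi_def)
    qed
    have phi': "dd 1 phi t = - (inverse t * inverse t)" if t: "e < \<bar>t\<bar>" for t
    proof (rule dd_eq[where f' = "\<lambda>v. - (inverse t * v * inverse t)" and v = 1, simplified])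
      have "((\<lambda>t. inverse t) has_derivative (\<lambda>v. - (inverse t * v * inverse t))) (at t)"
        using t e by (intro Deriv.has_derivative_inverse has_derivative_ident) auto
      moreover have "open {t :: real. e < \<bar>t\<bar>}" by (intro open_Collect_less continuous_intros)
      ultimately show "(phi has_derivative (\<lambda>v. - (inverse t * v * inverse t))) (at t)"
        by (rule has_derivative_transform_within_open) (use t phie in simp_all)
    qed
    have cont: "continuous_on UNIV phi" "continuous_on UNIV (dd 1 phi)"
      by (intro smooth_on_imp_continuous smooth_dd phis)+
    \<comment> \<open>At degree 0 the approximations take values in [-C, C] almost everywhere on K,
      so bounds for phi and its derivative on this interval suffice for domination.\<close>
    have "bounded ((\<lambda>t. (phi t, dd 1 phi t)) ` {- C..C})"
      by (intro compact_imp_bounded compact_continuous_image continuous_on_Pair) (auto intro: continuous_on_subset cont)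
    then obtain B where B: "B > 0" "\<And>t. \<bar>t\<bar> <= C ==> norm (phi t, dd 1 phi t) <= B" by (force simp: bounded_pos)
    have B': "\<bar>phi t\<bar> <= B" "\<bar>dd 1 phi t\<bar> <= B" if "\<bar>t\<bar> <= C" for t
      using B(2)[OF that] norm_fst_le[of "phi t" "dd 1 phi t"] norm_snd_le[of "dd 1 phi t" "phi t"] by simp_all
    define g where "g m x = phi (f m x)" for m x
    have gs: "smooth (g m)" for m
      using smooth_on_compose[OF locally_convex_UNIV _ locally_convex_UNIV f(1) phis] by (simp add: g_def[abs_def] comp_def)
    have dg: "dd b (g m) x = dd b (f m) x * dd 1 phi (f m x)" for m x
    proof (rule dd_eq)
      have "(g m has_derivative (\<lambda>v. dd (dd v (f m) x) phi (f m x))) (at x)"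
        unfolding g_def[abs_def] by (rule has_derivative_compose[OF smooth_has_derivative[OF f(1)] smooth_has_derivative[OF phis]])
      moreover have "c * dd 1 phi t = dd c phi t" for c t
        using linear_scale[OF dd_linear[OF phis], of c 1 t] by simp
      ultimately show "(g m has_derivative (\<lambda>v. dd v (f m) x * dd 1 phi (f m x))) (at x)" by (simp only:)
    qed
    define h where "h x = H x + indicator K x" for x
    have "integrable lborel (indicator K :: 'a => real)"
      using K emeasure_compact_finite[of K] by (intro integrable_real_indicator) (auto simp: borel_compact)
    then have hi: "integrable lborel (\<lambda>x. ((1 + C) * B) * h x)" unfolding h_def[abs_def] using f(3) by simp
    have 1: "AE x in lborel. x \<in> K --> (\<lambda>m. g m x) \<longlonglongrightarrow> inverse (u x) \<and>
        (\<lambda>m. dd b (g m) x) \<longlonglongrightarrow> (-1) * (inverse (u x) * (inverse (u x) * u' x))" using f(5)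
    proof eventually_elim
      case (elim x)
      show ?case
      proof
        assume x: "x \<in> K"
        then have l: "(\<lambda>m. f m x) \<longlonglongrightarrow> u x" "(\<lambda>m. dd b (f m) x) \<longlonglongrightarrow> u' x" using elim by blast+
        have "(\<lambda>m. phi (f m x)) \<longlonglongrightarrow> phi (u x)" "(\<lambda>m. dd 1 phi (f m x)) \<longlonglongrightarrow> dd 1 phi (u x)"
          by (rule continuous_on_tendsto_compose[OF cont(1) l(1)] continuous_on_tendsto_compose[OF cont(2) l(1)]; simp)+
        then show "(\<lambda>m. g m x) \<longlonglongrightarrow> inverse (u x) \<and>
            (\<lambda>m. dd b (g m) x) \<longlonglongrightarrow> (-1) * (inverse (u x) * (inverse (u x) * u' x))"
          using tendsto_mult[OF l(2)] unfolding dg g_def phie[OF uE[OF x]] phi'[OF uE[OF x]] by (fastforce simp: mult_ac)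
      qed
    qed
    have 2: "AE x in lborel. x \<in> K --> (\<forall>m. \<bar>g m x\<bar> <= ((1 + C) * B) * h x \<and> \<bar>dd b (g m) x\<bar> <= ((1 + C) * B) * h x)"
      using f(6)
    proof eventually_elim
      case (elim x)
      show ?case
      proof (intro impI allI)
        fix m assume x: "x \<in> K"
        have h1: "1 <= h x" "H x <= h x" using f(4)[of x] x by (simp_all add: h_def)
        have "C * H x powr (real 0 / Q) <= C" using f(2) by (auto simp: mult_left_le)
        then have fC: "\<bar>f m x\<bar> <= C" using elim x by (blast intro: order_trans)
        have "H x powr (real (Suc 0) / Q) <= h x powr (real (Suc 0) / Q)" using f(4) h1 Q by (intro powr_mono2) auto
        also have "... <= h x powr 1" using h1 Q Q1 by (intro powr_mono) auto
        finally have "C * H x powr (real (Suc 0) / Q) <= C * h x" using f(2) h1(1) by (intro mult_left_mono) auto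
        then have "\<bar>dd b (f m) x\<bar> <= C * h x" using elim x by (blast intro: order_trans)
        then have "\<bar>dd b (g m) x\<bar> <= (C * h x) * B"
          unfolding dg abs_mult using B'(2)[OF fC] f(2) h1(1) by (intro mult_mono) auto
        moreover have "\<bar>g m x\<bar> <= B * h x" using mult_mono[OF B'(1)[OF fC] h1(1)] B(1) by (simp add: g_def)
        moreover have "0 <= B * h x" "0 <= C * h x * B" using B(1) h1(1) f(2) by simp_all
        ultimately show "\<bar>g m x\<bar> <= ((1 + C) * B) * h x \<and> \<bar>dd b (g m) x\<bar> <= ((1 + C) * B) * h x"
          by (simp add: algebra_simps)
      qed
    qed
    show "\<exists>g H. (\<forall>m::nat. smooth (g m)) \<and> integrable lborel H \<and>
      (AE x in lborel. x \<in> K --> (\<lambda>m. g m x) \<longlonglongrightarrow> inverse (u x) \<and>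
         (\<lambda>m. dd b (g m) x) \<longlonglongrightarrow> (-1) * (inverse (u x) * (inverse (u x) * u' x))) \<and>
      (AE x in lborel. x \<in> K --> (\<forall>m. \<bar>g m x\<bar> <= H x \<and> \<bar>dd b (g m) x\<bar> <= H x))" using gs hi 1 2 by blast
  qed
qed

lemma graded_Sobolev_decr_le: "graded_Sobolev Q S k i u ==> j <= k ==> graded_Sobolev Q S j i u"
proof (induction k)
  case (Suc k)
  then show ?case using graded_Sobolev_decr[of Q S k i u] by (cases "j = Suc k") auto
qed simp

text \<open>The derivative of 1/u is -u' / u^2, so j derivatives of it use 1/u with j derivatives
  only: the induction gains one order per step.\<close>

lemma graded_Sobolev_inverse:
  assumes S: "model_domain n S" and u: "graded_Sobolev Q S k 0 u" and kQ: "real k <= Q"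
    and nz: "\<And>x. x \<in> S ==> u x \<noteq> 0" shows "j <= k ==> graded_Sobolev Q S j 0 (\<lambda>x. inverse (u x))"
proof (induction j)
  case 0
  have "continuous_on S u" using graded_Sobolev_level[OF u] by (simp add: level_def)
  then show ?case using nz by (auto simp: level_def intro!: continuous_intros)
next
  case (Suc j)
  then have IH: "graded_Sobolev Q S j 0 (\<lambda>x. inverse (u x))" by simp
  obtain k' where k': "k = Suc k'" using Suc.prems by (cases k) auto
  have "\<exists>g. weak_deriv_on S b (\<lambda>x. inverse (u x)) g \<and> graded_Sobolev Q S j (Suc 0) g" if b: "b \<in> Basis" for b
  proof -
    obtain u' where u': "weak_deriv_on S b u u'" "graded_Sobolev Q S k' (Suc 0) u'" using u b unfolding k' by auto
    have "weak_deriv_on S b (\<lambda>x. inverse (u x)) (\<lambda>x. (-1) * (inverse (u x) * (inverse (u x) * u' x)))"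
      using kQ k' by (intro weak_deriv_inverse[OF S u'(1) graded_Sobolev_level[OF u] graded_Sobolev_level[OF u'(2)] _ nz]) auto
    moreover have "graded_Sobolev Q S j (0 + (0 + Suc 0)) (\<lambda>x. inverse (u x) * (inverse (u x) * u' x))"
      using Suc.prems kQ k' by (intro graded_Sobolev_mult[OF S] IH graded_Sobolev_decr_le[OF u'(2)]) auto
    then have "graded_Sobolev Q S j (Suc 0) (\<lambda>x. (-1) * (inverse (u x) * (inverse (u x) * u' x)))"
      using Suc.prems kQ by (intro graded_Sobolev_cmult) auto
    ultimately show ?thesis by blast
  qed
  moreover have "level Q S 0 (\<lambda>x. inverse (u x))" by (rule graded_Sobolev_level[OF IH])
  ultimately show ?case by simp
qed

theorem Sobolev_on_divide:
  fixes u v :: "'a::euclidean_space => real"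
  assumes S: "model_domain n S" and p: "p >= 1" and u: "Sobolev_on k p S u" and v: "Sobolev_on k p S v"
    and nz: "\<And>x. x \<in> S ==> v x \<noteq> 0" shows "Sobolev_on k p S (\<lambda>x. u x / v x)"
proof -
  have kQ: "real k <= real k * p" using p by (simp add: mult_le_cancel_left1)
  have "graded_Sobolev (real k * p) S k (0 + 0) (\<lambda>x. u x * inverse (v x))"
    using kQ by (intro graded_Sobolev_mult[OF S] weakly_deriv_on_imp_graded[OF S p u]
        graded_Sobolev_inverse[OF S weakly_deriv_on_imp_graded[OF S p v] kQ nz]) auto
  then have "weakly_deriv_on p S k (\<lambda>x. u x / v x)"
    using graded_imp_weakly_deriv_on[OF p, of k S k 0] by (simp add: divide_inverse)
  moreover have "continuous_on S (\<lambda>x. u x / v x)"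
    using u v nz by (auto simp: Sobolev_on_def intro!: continuous_intros)
  ultimately show ?thesis by (simp add: Sobolev_on_def)
qed

section \<open>Locality of the Sobolev condition\<close>

lemma locally_Lp_on_local:
  fixes f :: "'a::euclidean_space => 'b::euclidean_space"
  assumes loc: "\<And>x. x \<in> S ==> \<exists>r>0. locally_Lp_on p (S \<inter> ball x r) f" shows "locally_Lp_on p S f"
  unfolding locally_Lp_on_def
proof (intro allI impI)
  fix K assume K: "compact K \<and> K \<subseteq> S"
  from loc obtain r where r: "\<And>x. x \<in> S ==> r x > 0 \<and> locally_Lp_on p (S \<inter> ball x (r x)) f" by metis
  have "K \<subseteq> (\<Union>x\<in>K. ball x (r x / 2))" using K r by force
  then obtain D where D: "D \<subseteq> K" "finite D" "K \<subseteq> (\<Union>x\<in>D. ball x (r x / 2))"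
    using compactE_image[of K K "\<lambda>x. ball x (r x / 2)"] K by auto
  \<comment> \<open>Closed balls of half the radius cut K into finitely many compact pieces, each
    inside one of the given neighbourhoods.\<close>
  define C where "C x = K \<inter> cball x (r x / 2)" for x
  have C: "compact (C x) \<and> C x \<subseteq> S \<inter> ball x (r x)" if "x \<in> D" for x using K r[of x] that D(1) by (auto simp: C_def)
  have KC: "K = (\<Union>x\<in>D. C x)"
  proof
    show "K \<subseteq> (\<Union>x\<in>D. C x)"
    proof
      fix y assume "y \<in> K"
      then obtain x where "x \<in> D" "y \<in> ball x (r x / 2)" using D(3) by blast
      then show "y \<in> (\<Union>x\<in>D. C x)" using \<open>y \<in> K\<close> by (intro UN_I[of x]) (auto simp: C_def)
    qed
  qed (auto simp: C_def)
  have m: "set_borel_measurable lborel (C x) f" and i: "set_integrable lborel (C x) (\<lambda>x. norm (f x) powr p)" if "x \<in> D" for x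
    using r[of x] C[OF that] that D(1) K unfolding locally_Lp_on_def by blast+
  have Cs: "C x \<in> sets lborel" if "x \<in> D" for x using C[OF that] by (simp add: borel_compact)
  have "set_integrable lborel (\<Union>x\<in>D. C x) (\<lambda>x. norm (f x) powr p)"
    by (rule set_integrable_UN[OF D(2)]) (use i Cs in auto)
  moreover have "set_borel_measurable lborel (\<Union>x\<in>D. C x) f" using D(2) m Cs
  proof (induction D)
    case empty
    then show ?case by (simp add: set_borel_measurable_def)
  next
    case (insert x D)
    define U where "U = (\<Union>x\<in>D. C x)"
    have [measurable]: "C x \<in> sets borel" "(\<lambda>y. indicator (C x) y *\<^sub>R f y) \<in> borel_measurable borel"
      "(\<lambda>y. indicator U y *\<^sub>R f y) \<in> borel_measurable borel"
      using insert by (auto simp: set_borel_measurable_def U_def)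
    have eq: "(\<lambda>y. indicator (C x \<union> U) y *\<^sub>R f y) =
        (\<lambda>y. if y \<in> C x then indicator (C x) y *\<^sub>R f y else indicator U y *\<^sub>R f y)" by (auto simp: indicator_def)
    have "(\<lambda>y. indicator (C x \<union> U) y *\<^sub>R f y) \<in> borel_measurable borel" unfolding eq by measurable
    then show ?case by (simp add: set_borel_measurable_def U_def)
  qed
  ultimately show "set_borel_measurable lborel K f \<and> set_integrable lborel K (\<lambda>x. norm (f x) powr p)"
    using KC by simp
qed

lemma locally_Lp_on_smooth_scaleR:
  fixes u :: "'a::euclidean_space => 'b::euclidean_space"
  assumes c: "continuous_on UNIV theta" and u: "locally_Lp_on p S u" and p: "p >= 1"
  shows "locally_Lp_on p S (\<lambda>x. theta x *\<^sub>R u x)" unfolding locally_Lp_on_def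
proof (intro allI impI)
  fix K assume K: "compact K \<and> K \<subseteq> S"
  have "bounded (theta ` K)" using K c by (intro compact_imp_bounded compact_continuous_image continuous_on_subset[OF c]) auto
  then obtain M where M: "M > 0" "\<And>x. x \<in> K ==> \<bar>theta x\<bar> <= M" by (auto simp: bounded_pos)
  have [measurable]: "theta \<in> borel_measurable borel" by (rule borel_measurable_continuous_onI[OF c])
  have "locally_Lp_on p K (\<lambda>x. theta x *\<^sub>R u x)"
  proof (rule locally_Lp_on_bound[where f = u and C = M])
    fix C assume C: "compact C" "C \<subseteq> K"
    have [measurable]: "(\<lambda>x. indicator C x *\<^sub>R u x) \<in> borel_measurable borel"
      using locally_Lp_on_borel[OF u C(1)] C(2) K by blast
    have eq: "(\<lambda>x. indicator C x *\<^sub>R theta x *\<^sub>R u x) = (\<lambda>x. theta x *\<^sub>R indicator C x *\<^sub>R u x)" by (simp add: mult.commute)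
    show "(\<lambda>x. indicator C x *\<^sub>R theta x *\<^sub>R u x) \<in> borel_measurable borel" unfolding eq by measurable
  qed (use M p K locally_Lp_on_subset[OF u] in \<open>auto intro: mult_right_mono\<close>)
  then show "set_borel_measurable lborel K (\<lambda>x. theta x *\<^sub>R u x) \<and> set_integrable lborel K (\<lambda>x. norm (theta x *\<^sub>R u x) powr p)"
    using K by (auto simp: locally_Lp_on_def)
qed

lemma test_function_mult:
  assumes psi: "test_function U psi" and theta: "smooth theta" shows "test_function U (\<lambda>x. theta x * psi x)"
proof -
  obtain K where K: "compact K" "K \<subseteq> U" "\<And>x. x \<notin> K ==> psi x = 0" using psi by (auto simp: test_function_def)
  then show ?thesis unfolding test_function_def
    using test_function_smooth[OF psi] theta by (intro conjI smooth_on_mult locally_convex_UNIV exI[of _ K]) auto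
qed

lemma weakly_deriv_on_decr: "weakly_deriv_on p S (Suc k) u ==> weakly_deriv_on p S k u"
proof (induction k arbitrary: u)
  case (Suc k)
  have "\<exists>g. weak_deriv_on S b u g \<and> weakly_deriv_on p S k g" if b: "b \<in> Basis" for b
  proof -
    obtain g where "weak_deriv_on S b u g" "weakly_deriv_on p S (Suc k) g"
      using Suc.prems b weakly_deriv_on.simps(2)[of p S "Suc k" u] by blast
    then show ?thesis using Suc.IH by blast
  qed
  then show ?case using weakly_deriv_on_Lp[OF Suc.prems] by simp
qed simp

text \<open>A smooth factor times a test function is again a test function, which turns the
  definition of the weak derivative of u into the product rule. Gluing by a partition of unity
  depends on it.\<close>

lemma weakly_deriv_on_smooth_scaleR:
  fixes u :: "'a::euclidean_space => 'b::euclidean_space"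
  assumes p: "p >= 1"
  shows "weakly_deriv_on p S k u ==> smooth theta ==> weakly_deriv_on p S k (\<lambda>x. theta x *\<^sub>R u x)"
proof (induction k arbitrary: u theta)
  case 0
  then show ?case using locally_Lp_on_smooth_scaleR[OF smooth_on_imp_continuous] p by simp
next
  case (Suc k)
  have Lu: "locally_Lp_on p S u" by (rule weakly_deriv_on_Lp[OF Suc.prems(1)])
  have wk: "weakly_deriv_on p S k u" by (rule weakly_deriv_on_decr[OF Suc.prems(1)])
  have "\<exists>g. weak_deriv_on S b (\<lambda>x. theta x *\<^sub>R u x) g \<and> weakly_deriv_on p S k g" if b: "b \<in> Basis" for b
  proof -
    obtain u' where u': "weak_deriv_on S b u u'" "weakly_deriv_on p S k u'" using Suc.prems(1) b by auto
    have "weak_deriv_on S b (\<lambda>x. theta x *\<^sub>R u x) (\<lambda>x. theta x *\<^sub>R u' x + dd b theta x *\<^sub>R u x)"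
      unfolding weak_deriv_on_alt
    proof (intro allI impI)
      fix psi assume psi: "test_function (interior S) psi"
      note sm = test_function_smooth[OF psi]
      have t1: "test_function (interior S) (\<lambda>x. theta x * psi x)" by (rule test_function_mult[OF psi Suc.prems(2)])
      have t2: "test_function (interior S) (\<lambda>x. theta x * dd b psi x)"
        by (rule test_function_mult[OF test_function_dd[OF psi] Suc.prems(2)])
      have t3: "test_function (interior S) (\<lambda>x. dd b theta x * psi x)" by (rule test_function_mult[OF psi smooth_dd[OF Suc.prems(2)]])
      note i1 = test_function_mult_integrable[OF t1 weakly_deriv_on_Lp[OF u'(2)] p]
      note i2 = test_function_mult_integrable[OF t2 Lu p]
      note i3 = test_function_mult_integrable[OF t3 Lu p]
      have "(LINT x|lborel. (theta x * dd b psi x) *\<^sub>R u x) + (LINT x|lborel. (dd b theta x * psi x) *\<^sub>R u x) = - (LINT x|lborel. (theta x * psi x) *\<^sub>R u' x)"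
        using weak_deriv_onD[OF u'(1) t1] i2 i3 by (simp add: dd_mult[OF Suc.prems(2) sm] scaleR_add_left)
      then have "(LINT x|lborel. (theta x * dd b psi x) *\<^sub>R u x) = - ((LINT x|lborel. (theta x * psi x) *\<^sub>R u' x) + (LINT x|lborel. (dd b theta x * psi x) *\<^sub>R u x))"
        by (simp add: algebra_simps eq_neg_iff_add_eq_0)
      also have "... = - (LINT x|lborel. (theta x * psi x) *\<^sub>R u' x + (dd b theta x * psi x) *\<^sub>R u x)"
        using i1 i3 by simp
      finally show "(LINT x|lborel. dd b psi x *\<^sub>R theta x *\<^sub>R u x) = - (LINT x|lborel. psi x *\<^sub>R (theta x *\<^sub>R u' x + dd b theta x *\<^sub>R u x))"
        by (simp add: scaleR_add_right mult.commute)
    qed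
    moreover have "weakly_deriv_on p S k (\<lambda>x. theta x *\<^sub>R u' x + dd b theta x *\<^sub>R u x)"
      using Suc.prems(2) by (intro weakly_deriv_on_add[OF p] Suc.IH u' wk smooth_dd)
    ultimately show ?thesis by blast
  qed
  then show ?case using locally_Lp_on_smooth_scaleR[OF smooth_on_imp_continuous[OF Suc.prems(2)] Lu p] by simp
qed

text \<open>The quotient a / (a + c), where a is positive exactly inside radius 3r/4 and c exactly
  outside radius r/2, so that the denominator never vanishes.\<close>

lemma smooth_plateau:
  assumes r: "r > 0"
  obtains eta :: "'a::euclidean_space => real" where "smooth eta"
    "\<And>x. dist z x <= r / 2 ==> eta x = 1" "\<And>x. 3 / 4 * r <= dist z x ==> eta x = 0"
proof -
  define a where "a = bump z (3 / 4 * r)"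
  define c where "c x = exp_flat 0 ((x - z) \<bullet> (x - z) - (r / 2)\<^sup>2)" for x
  have e: "exp_flat 0 t > 0 \<longleftrightarrow> t > 0" "exp_flat 0 t >= 0" for t by (auto simp: exp_flat_def)
  have "smooth (\<lambda>x. (\<Sum>b\<in>Basis. ((x \<bullet> b) + - (z \<bullet> b)) * ((x \<bullet> b) + - (z \<bullet> b))) + - ((r / 2)\<^sup>2))"
    by (intro smooth_on_add smooth_on_const smooth_on_sum smooth_on_mult locally_convex_UNIV smooth_on_bounded_linear
        bounded_linear_inner_left) auto
  then have "smooth (\<lambda>x. (x - z) \<bullet> (x - z) - (r / 2)\<^sup>2)"
    by (rule smooth_on_cong) (subst euclidean_inner, simp add: inner_diff_left)
  then have "smooth (exp_flat 0 \<circ> (\<lambda>x. (x - z) \<bullet> (x - z) - (r / 2)\<^sup>2))"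
    by (intro smooth_on_compose[where S' = UNIV] locally_convex_UNIV smooth_exp_flat) auto
  then have cs: "smooth c" by (rule smooth_on_cong) (simp add: c_def)
  have c0: "c x >= 0" and a0: "a x >= 0" for x by (auto simp: c_def e a_def bump_nonneg)
  have cpos: "c x > 0 \<longleftrightarrow> r / 2 < dist z x" for x
  proof -
    have "(r / 2)\<^sup>2 < (norm (x - z))\<^sup>2 \<longleftrightarrow> r / 2 < norm (x - z)"
      using r by (meson less_imp_le norm_ge_zero power2_less_imp_less power_strict_mono zero_less_numeral half_gt_zero)
    then show ?thesis by (simp add: c_def e dist_norm norm_minus_commute[of z] power2_norm_eq_inner)
  qed
  have apos: "a x > 0 \<longleftrightarrow> dist z x < 3 / 4 * r" for x using r by (simp add: a_def bump_pos_iff)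
  have ac: "a x + c x > 0" for x
  proof (cases "a x > 0")
    case False
    then show ?thesis using apos[of x] cpos[of x] a0[of x] r by linarith
  qed (use c0[of x] in linarith)
  have "smooth (\<lambda>x. a x * inverse (a x + c x))"
    using ac by (intro smooth_on_mult smooth_on_inverse smooth_on_add cs locally_convex_UNIV) (auto simp: a_def smooth_bump less_imp_neq[symmetric] intro!: smooth_bump)
  moreover have "a x * inverse (a x + c x) = 1" if "dist z x <= r / 2" for x
    using cpos[of x] c0[of x] ac[of x] that by simp
  moreover have "a x * inverse (a x + c x) = 0" if "3 / 4 * r <= dist z x" for x
    using apos[of x] a0[of x] that by simp
  ultimately show ?thesis using that[of "\<lambda>x. a x * inverse (a x + c x)"] by blast
qed

lemma weakly_deriv_on_sum:
  fixes g :: "nat => 'a::euclidean_space => 'b::euclidean_space"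
  assumes p: "p >= 1"
  shows "(\<And>n. n <= j ==> weakly_deriv_on p S k (g n)) ==> weakly_deriv_on p S k (\<lambda>x. \<Sum>n\<le>j. g n x)"
  by (induction j) (auto intro: weakly_deriv_on_add[OF p])

lemma smooth_prod:
  fixes h :: "nat => 'a::euclidean_space => real"
  shows "(\<And>n. smooth (h n)) ==> smooth (\<lambda>x. \<Prod>n<N. h n x)"
  by (induction N) (auto intro: smooth_on_const smooth_on_mult locally_convex_UNIV)

text \<open>The weak derivatives found locally are glued by a partition of unity; no almost-everywhere
uniqueness of weak derivatives is needed.\<close>

lemma weakly_deriv_on_local:
  fixes f :: "'a::euclidean_space => 'b::euclidean_space"
  assumes p: "p >= 1" shows "(\<And>x. x \<in> S ==> \<exists>r>0. weakly_deriv_on p (S \<inter> ball x r) k f) ==> weakly_deriv_on p S k f"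
proof (induction k arbitrary: f)
  case 0
  then show ?case using locally_Lp_on_local[of S p f] by simp
next
  case (Suc k)
  have Lf: "locally_Lp_on p S f" using locally_Lp_on_local[of S p f] Suc.prems by auto
  have "\<exists>g. weak_deriv_on S b f g \<and> weakly_deriv_on p S k g" if b: "b \<in> Basis" for b
  proof (cases "S = {}")
    case True
    then have "test_function (interior S) psi ==> psi = (\<lambda>x. 0)" for psi by (auto simp: test_function_def)
    moreover have "dd b (\<lambda>x. 0) x = 0" for x by (rule dd_eq[where f' = "\<lambda>v. 0"]) simp
    ultimately have "weak_deriv_on S b f f" by (fastforce simp: weak_deriv_on_alt)
    moreover have "weakly_deriv_on p S k f" by (rule Suc.IH) (simp add: True)
    ultimately show ?thesis by blast
  next
    case ne: False
    have "\<forall>x\<in>S. \<exists>r g. r > 0 \<and> weak_deriv_on (S \<inter> ball x r) b f g \<and> weakly_deriv_on p (S \<inter> ball x r) k g"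
      using Suc.prems b by fastforce
    then obtain R G where RG: "\<And>x. x \<in> S ==> R x > 0" "\<And>x. x \<in> S ==> weak_deriv_on (S \<inter> ball x (R x)) b f (G x)"
      "\<And>x. x \<in> S ==> weakly_deriv_on p (S \<inter> ball x (R x)) k (G x)" by metis
    \<comment> \<open>A countable subcover allows the cut-off functions to be enumerated.\<close>
    obtain \<F> where F: "\<F> \<subseteq> (\<lambda>x. ball x (R x / 2)) ` S" "countable \<F>" "\<Union>\<F> = (\<Union>x\<in>S. ball x (R x / 2))"
      using Lindelof[of "(\<lambda>x. ball x (R x / 2)) ` S"] by auto
    from countable_subset_image[of \<F> "\<lambda>x. ball x (R x / 2)" S] F(1,2)
    obtain D where D: "countable D" "D \<subseteq> S" "\<F> = (\<lambda>x. ball x (R x / 2)) ` D" by auto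
    have SD: "S \<subseteq> (\<Union>x\<in>D. ball x (R x / 2))"
    proof
      fix y assume "y \<in> S"
      then have "y \<in> (\<Union>x\<in>S. ball x (R x / 2))" using RG(1) by force
      then show "y \<in> (\<Union>x\<in>D. ball x (R x / 2))" using F(3) D(3) by simp
    qed
    then have Dne: "D \<noteq> {}" using ne by auto
    define z where "z n = from_nat_into D n" for n
    define r where "r n = R (z n)" for n
    define B where "B n = ball (z n) (r n / 2)" for n
    have zS: "z n \<in> S" for n using from_nat_into[OF Dne] D(2) by (auto simp: z_def)
    have rpos: "r n > 0" for n using RG(1)[OF zS] by (simp add: r_def)
    have SB: "\<exists>n. y \<in> B n" if yS: "y \<in> S" for y
    proof -
      obtain x where "x \<in> D" "y \<in> ball x (R x / 2)" using SD yS by blast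
      moreover obtain n where "z n = x" using from_nat_into_surj[OF D(1) \<open>x \<in> D\<close>] by (auto simp: z_def)
      ultimately show ?thesis unfolding B_def r_def by blast
    qed
    define g where "g n = G (z n)" for n
    have g: "weak_deriv_on (S \<inter> ball (z n) (r n)) b f (g n)" "weakly_deriv_on p (S \<inter> ball (z n) (r n)) k (g n)" for n
      using RG(2,3)[OF zS] by (simp_all add: r_def g_def)
    have "\<forall>n. \<exists>eta. smooth eta \<and> (\<forall>x. dist (z n) x <= r n / 2 --> eta x = (1::real)) \<and> (\<forall>x. 3 / 4 * r n <= dist (z n) x --> eta x = 0)"
      using smooth_plateau[OF rpos] by metis
    then obtain h where h: "\<And>n. smooth (h n)" "\<And>n x. dist (z n) x <= r n / 2 ==> h n x = (1::real)"
      "\<And>n x. 3 / 4 * r n <= dist (z n) x ==> h n x = 0" by metis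
    \<comment> \<open>The products telescope: the sum up to j is 1 minus the product of all 1 - h i
      with i at most j. On B i, where h i is 1, the functions with index above i vanish and the
      partial sums from i on are 1.\<close>
    define theta where "theta n x = h n x * (\<Prod>i<n. 1 + - h i x)" for n x
    have thetas: "smooth (theta n)" for n unfolding theta_def[abs_def]
      by (intro smooth_on_mult smooth_prod smooth_on_add smooth_on_const locally_convex_UNIV h
          smooth_on_linear[OF bounded_linear_minus[OF bounded_linear_ident]])
    have thetasum: "(\<Sum>n\<le>j. theta n x) = 1 - (\<Prod>i\<le>j. 1 + - h i x)" for j x
      by (induction j) (auto simp: theta_def algebra_simps lessThan_Suc_atMost)
    have hB: "h i x = 1" if "x \<in> B i" for i x using that h(2)[of i x] by (simp add: B_def)
    have theta1: "(\<Sum>n\<le>j. theta n x) = 1" if "x \<in> B i" "i <= j" for i j x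
    proof -
      have "(\<Prod>i\<le>j. 1 + - h i x) = 0" using hB[OF that(1)] that(2) by (intro prod_zero) auto
      then show ?thesis by (simp add: thetasum)
    qed
    have theta0: "theta n x = 0" if "x \<in> B i" "i < n" for i n x
    proof -
      have "(\<Prod>i<n. 1 + - h i x) = 0" using hB[OF that(1)] that(2) by (intro prod_zero) auto
      then show ?thesis by (simp add: theta_def)
    qed
    \<comment> \<open>The first ball containing x, beyond which all terms vanish at x; this makes
      the infinite sum of the glued derivatives a finite one.\<close>
    define N where "N x = (LEAST n. x \<in> B n)" for x
    define q where "q x = (\<Sum>n\<le>N x. theta n x *\<^sub>R g n x)" for x
    have q: "q x = (\<Sum>n\<le>j. theta n x *\<^sub>R g n x)" if "x \<in> B i" "i <= j" for x i j
    proof -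
      have "x \<in> B (N x)" unfolding N_def by (rule LeastI[of "\<lambda>n. x \<in> B n", OF that(1)])
      moreover have "N x <= j" unfolding N_def using Least_le[of "\<lambda>n. x \<in> B n", OF that(1)] that(2) by linarith
      ultimately show ?thesis unfolding q_def by (intro sum.mono_neutral_left) (auto simp: theta0)
    qed
    have "weak_deriv_on S b f q" unfolding weak_deriv_on_alt
    proof (intro allI impI)
      fix psi assume psi: "test_function (interior S) psi"
      note sm = test_function_smooth[OF psi]
      obtain K where K: "compact K" "K \<subseteq> interior S" "\<And>x. x \<notin> K ==> psi x = 0"
        using psi by (auto simp: test_function_def)
      have cov: "K \<subseteq> (\<Union>n\<in>UNIV. B n)" using subset_trans[OF K(2) interior_subset] SB by auto
      obtain A where A: "finite A" "K \<subseteq> (\<Union>n\<in>A. B n)" by (rule compactE_image[OF K(1) _ cov]) (auto simp: B_def)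
      define J where "J = Max (insert 0 A)"
      have KJ: "\<exists>i\<le>J. x \<in> B i" if xK: "x \<in> K" for x
      proof -
        obtain i where "i \<in> A" "x \<in> B i" using xK A(2) by blast
        then show ?thesis using A(1) by (intro exI[of _ i]) (simp add: J_def)
      qed
      \<comment> \<open>\<open>theta n\<close> vanishes beyond three quarters of the radius, so the
        product has compact support inside the n-th piece, where \<open>g n\<close> is a weak
        derivative.\<close>
      have t: "test_function (interior (S \<inter> ball (z n) (r n))) (\<lambda>x. theta n x * psi x)" for n
        unfolding test_function_def
      proof (intro conjI exI[of _ "K \<inter> cball (z n) (3 / 4 * r n)"] allI impI)
        show "smooth (\<lambda>x. theta n x * psi x)" by (intro smooth_on_mult locally_convex_UNIV thetas sm)
        show "compact (K \<inter> cball (z n) (3 / 4 * r n))" using K(1) by (simp add: compact_Int)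
        show "K \<inter> cball (z n) (3 / 4 * r n) \<subseteq> interior (S \<inter> ball (z n) (r n))" using K(2) rpos[of n] by auto
        fix x assume "x \<notin> K \<inter> cball (z n) (3 / 4 * r n)"
        then show "theta n x * psi x = 0" using K(3)[of x] h(3)[of n x] by (auto simp: theta_def)
      qed
      have i1: "integrable lborel (\<lambda>x. dd b (\<lambda>x. theta n x * psi x) x *\<^sub>R f x)" for n
        by (rule test_function_mult_integrable[OF test_function_dd[OF t] locally_Lp_on_subset[OF Lf] p]) auto
      have i2: "integrable lborel (\<lambda>x. (theta n x * psi x) *\<^sub>R g n x)" for n
        by (rule test_function_mult_integrable[OF t weakly_deriv_on_Lp[OF g(2)] p])
      have psieq: "psi = (\<lambda>x. \<Sum>n\<le>J. theta n x * psi x)"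
      proof
        fix x show "psi x = (\<Sum>n\<le>J. theta n x * psi x)"
        proof (cases "x \<in> K")
          case True
          then show ?thesis using KJ[OF True] theta1[of x] by (auto simp flip: sum_distrib_right)
        qed (simp add: K(3))
      qed
      have "dd b psi x = (\<Sum>n\<le>J. dd b (\<lambda>x. theta n x * psi x) x)" for x
      proof -
        have "dd b (\<lambda>x. \<Sum>n\<le>J. theta n x * psi x) x = (\<Sum>n\<le>J. dd b (\<lambda>x. theta n x * psi x) x)"
          by (rule dd_eq[where f' = "\<lambda>v. \<Sum>n\<le>J. dd v (\<lambda>x. theta n x * psi x) x"])
            (intro has_derivative_sum smooth_has_derivative test_function_smooth[OF t])
        then show ?thesis using psieq by simp
      qed
      then have "(LINT x|lborel. dd b psi x *\<^sub>R f x) = (LINT x|lborel. (\<Sum>n\<le>J. dd b (\<lambda>x. theta n x * psi x) x *\<^sub>R f x))"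
        by (simp add: scaleR_sum_left)
      also have "... = (\<Sum>n\<le>J. LINT x|lborel. dd b (\<lambda>x. theta n x * psi x) x *\<^sub>R f x)"
        by (rule Bochner_Integration.integral_sum) (rule i1)
      also have "... = (\<Sum>n\<le>J. - (LINT x|lborel. (theta n x * psi x) *\<^sub>R g n x))"
        by (intro sum.cong refl weak_deriv_onD[OF g(1) t])
      also have "... = - (LINT x|lborel. (\<Sum>n\<le>J. (theta n x * psi x) *\<^sub>R g n x))"
        using i2 by (simp add: sum_negf Bochner_Integration.integral_sum)
      also have "(\<lambda>x. \<Sum>n\<le>J. (theta n x * psi x) *\<^sub>R g n x) = (\<lambda>x. psi x *\<^sub>R q x)"
      proof
        fix x show "(\<Sum>n\<le>J. (theta n x * psi x) *\<^sub>R g n x) = psi x *\<^sub>R q x"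
        proof (cases "x \<in> K")
          case True
          then obtain i where "i <= J" "x \<in> B i" using KJ by blast
          then show ?thesis by (simp add: q scaleR_sum_right mult.commute)
        qed (simp add: K(3))
      qed
      finally show "(LINT x|lborel. dd b psi x *\<^sub>R f x) = - (LINT x|lborel. psi x *\<^sub>R q x)" .
    qed
    moreover have "weakly_deriv_on p S k q"
    proof (rule Suc.IH)
      fix y assume y: "y \<in> S"
      obtain j where j: "y \<in> B j" using SB[OF y] by blast
      \<comment> \<open>Either y lies in the n-th ball, where \<open>g n\<close> is controlled, or
        \<open>theta n\<close> vanishes near y.\<close>
      have "\<exists>rho>0. weakly_deriv_on p (S \<inter> ball y rho) k (\<lambda>x. theta n x *\<^sub>R g n x)" for n
      proof (cases "dist (z n) y < r n")
        case True
        then obtain rho where rho: "rho > 0" "ball y rho \<subseteq> ball (z n) (r n)"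
          using openE[OF open_ball[of "z n" "r n"], of y] by auto
        then have "weakly_deriv_on p (S \<inter> ball y rho) k (g n)" by (intro weakly_deriv_on_subset[OF g(2)[of n]]) auto
        then show ?thesis using rho(1) weakly_deriv_on_smooth_scaleR[OF p _ thetas] by blast
      next
        case False
        then have "y \<in> - cball (z n) (3 / 4 * r n)" using rpos[of n] by simp
        then obtain rho where rho: "rho > 0" "ball y rho \<subseteq> - cball (z n) (3 / 4 * r n)"
          using openE[OF open_Compl[OF closed_cball]] by blast
        have "weakly_deriv_on p (S \<inter> ball y rho) k (\<lambda>x. 0 *\<^sub>R f x)" for k
        proof (induction k)
          case 0
          then show ?case by (simp add: locally_Lp_on_def set_borel_measurable_def set_integrable_def)
        next
          case (Suc k)
          have "weak_deriv_on (S \<inter> ball y rho) b (\<lambda>x. 0 *\<^sub>R f x) (\<lambda>x. 0 *\<^sub>R f x)" for b by (simp add: weak_deriv_on_alt)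
          then show ?case using Suc weakly_deriv_on_Lp by auto
        qed
        then have w0: "weakly_deriv_on p (S \<inter> ball y rho) k (\<lambda>x. 0 *\<^sub>R f x)" .
        have "0 *\<^sub>R f x = theta n x *\<^sub>R g n x" if "x \<in> S \<inter> ball y rho" for x
        proof -
          have "3 / 4 * r n <= dist (z n) x" using rho(2) that by fastforce
          then show ?thesis using h(3)[of n x] by (simp add: theta_def)
        qed
        then show ?thesis using rho(1) weakly_deriv_on_cong[OF w0] by (intro exI[of _ rho]) simp
      qed
      then obtain rho where rho: "\<And>n. rho n > 0" "\<And>n. weakly_deriv_on p (S \<inter> ball y (rho n)) k (\<lambda>x. theta n x *\<^sub>R g n x)" by metis
      obtain e where e: "e > 0" "ball y e \<subseteq> B j" using openE[OF open_ball, of y "z j" "r j / 2"] j by (auto simp: B_def)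
      define d where "d = Min (insert e (rho ` {..j}))"
      have d: "d > 0" "d <= e" "\<And>n. n <= j ==> d <= rho n" unfolding d_def using e(1) rho(1) by (auto intro: min.coboundedI2)
      have w1: "weakly_deriv_on p (S \<inter> ball y d) k (\<lambda>x. \<Sum>n\<le>j. theta n x *\<^sub>R g n x)"
        by (rule weakly_deriv_on_sum[OF p], rule weakly_deriv_on_subset[OF rho(2)]) (use d(3) in force)
      have "(\<Sum>n\<le>j. theta n x *\<^sub>R g n x) = q x" if "x \<in> S \<inter> ball y d" for x
      proof -
        have "x \<in> B j" using e(2) d(2) that by (auto simp: subset_iff)
        from q[OF this order_refl] show ?thesis by simp
      qed
      then have "weakly_deriv_on p (S \<inter> ball y d) k q" by (rule weakly_deriv_on_cong[OF w1])
      then show "\<exists>r>0. weakly_deriv_on p (S \<inter> ball y r) k q" using d(1) by blast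
    qed
    ultimately show ?thesis by blast
  qed
  then show ?case using Lf by simp
qed

section \<open>Common properties of the smoothness classes\<close>

lemma class_on_continuous: "class_on F S f ==> continuous_on S f"
  by (cases F) (auto simp: C_on_iff_Holder_on zero_enat_def[symmetric] Sobolev_on_def
      intro: Holder_on_imp_continuous dest: spec[of _ "0::nat"])

lemma class_on_subset: "class_on F S f ==> T \<subseteq> S ==> class_on F T f"
  by (cases F) (auto simp: C_on_iff_Holder_on Sobolev_on_def
      intro: Holder_on_subset weakly_deriv_on_subset continuous_on_subset)

lemma class_on_cong: "class_on F S f ==> (\<And>x. x \<in> S ==> f x = g x) ==> class_on F S g"
  by (cases F) (auto simp: C_on_iff_Holder_on Sobolev_on_def cong: continuous_on_cong
      intro: Holder_on_cong weakly_deriv_on_cong)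

lemma smooth_imp_class_on:
  assumes "admissible n F" "model_domain n S" "C_on \<infinity> S f" shows "class_on F S f" using assms
  by (cases F) (auto simp: C_on_iff_Holder_on[of _ S f] intro: C_on_infinity_imp_Sobolev_on
      C_on_infinity_imp_Holder_on[OF model_domain_locally_convex])

lemma class_on_add:
  "admissible n F ==> class_on F S f ==> class_on F S g ==> class_on F S (\<lambda>x. f x + g x)"
  by (cases F) (auto simp: C_on_iff_Holder_on Sobolev_on_def intro: Holder_on_add weakly_deriv_on_add continuous_on_add)

lemma class_on_linear:
  "admissible n F ==> bounded_linear L ==> class_on F S f ==> class_on F S (\<lambda>x. L (f x))"
  by (cases F) (auto simp: C_on_iff_Holder_on Sobolev_on_def
      intro: Holder_on_linear weakly_deriv_on_linear bounded_linear.continuous_on)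

lemma class_on_divide:
  fixes f g :: "'a::euclidean_space => real"
  assumes adm: "admissible n F" and S: "model_domain n S" and f: "class_on F S f" and g: "class_on F S g"
    and nz: "\<And>x. x \<in> S ==> g x \<noteq> 0" shows "class_on F S (\<lambda>x. f x / g x)"
proof (cases F)
  case (C_class k)
  then show ?thesis using f g nz
    by (auto simp: C_on_iff_Holder_on divide_inverse intro!: Holder_on_mult Holder_on_inverse model_domain_locally_convex[OF S])
next
  case (Holder_class k alpha)
  then show ?thesis using f g nz adm
    by (auto simp: divide_inverse intro!: Holder_on_mult Holder_on_inverse model_domain_locally_convex[OF S])
next
  case (Sobolev_class k p)
  then show ?thesis using f g nz adm Sobolev_on_divide[OF S] by auto
qed

lemma class_on_local:
  assumes adm: "admissible n F" and S: "model_domain n S"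
    and loc: "\<And>x. x \<in> S ==> \<exists>T. open T \<and> x \<in> T \<and> class_on F (S \<inter> T) f" shows "class_on F S f"
proof (cases F)
  case (C_class k)
  have "Holder_on j 0 S f" if "enat j <= k" for j
    by (rule Holder_on_local[OF S]) (use loc that C_class in \<open>fastforce simp: C_on_iff_Holder_on\<close>)
  then show ?thesis by (simp add: C_class C_on_iff_Holder_on)
next
  case (Holder_class k alpha)
  show ?thesis unfolding Holder_class class_on.simps by (rule Holder_on_local[OF S]) (use loc Holder_class in simp)
next
  case (Sobolev_class k p)
  have "continuous (at x within S) f" if x: "x \<in> S" for x
  proof -
    obtain T where T: "open T" "x \<in> T" "class_on F (S \<inter> T) f" using loc[OF x] by blast
    then have "continuous (at x within (S \<inter> T)) f"
      using class_on_continuous[OF T(3)] x by (simp add: continuous_on_eq_continuous_within)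
    moreover have "at x within (S \<inter> T) = at x within S" by (rule at_within_nhd[OF T(2,1)]) auto
    ultimately show ?thesis by simp
  qed
  then have "continuous_on S f" by (simp add: continuous_on_eq_continuous_within)
  moreover have "weakly_deriv_on p S k f"
  proof (rule weakly_deriv_on_local)
    fix x assume "x \<in> S"
    then obtain T where T: "open T" "x \<in> T" "weakly_deriv_on p (S \<inter> T) k f"
      using loc Sobolev_class by (force simp: Sobolev_on_def)
    then obtain r where "r > 0" "ball x r \<subseteq> T" using openE by blast
    then show "\<exists>r>0. weakly_deriv_on p (S \<inter> ball x r) k f" using weakly_deriv_on_subset[OF T(3)] by blast
  qed (use adm Sobolev_class in auto)
  ultimately show ?thesis by (simp add: Sobolev_class Sobolev_on_def)
qed

lemma class_on_componentwise:
  fixes f :: "'a::euclidean_space => 'b::euclidean_space"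
  assumes adm: "admissible n F" and S: "model_domain n S" and c: "\<And>b. b \<in> Basis ==> class_on F S (\<lambda>x. f x \<bullet> b)"
  shows "class_on F S f"
proof -
  have "class_on F S (\<lambda>x. \<Sum>b\<in>B. (f x \<bullet> b) *\<^sub>R b)" if "finite B" "B \<subseteq> Basis" for B using that
  proof (induction B)
    case empty
    show ?case using smooth_imp_class_on[OF adm S smooth_on_const[of S 0]] by simp
  next
    case (insert b B)
    then show ?case using class_on_add[OF adm class_on_linear[OF adm bounded_linear_scaleR_left c, of b b]] by simp
  qed
  from this[of Basis] show ?thesis by (simp add: euclidean_representation)
qed

section \<open>Functions on manifolds\<close>

lemma chart_exists:
  assumes "smooth_manifold n M" "v \<in> topspace (mtop M)"
  obtains U c where "(U, c) \<in> charts M" "v \<in> U"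
proof -
  have "v \<in> (\<Union>(U, c)\<in>charts M. U)" using assms by (simp add: smooth_manifold_def)
  then show ?thesis using that by blast
qed

lemma chart_openin: "smooth_manifold n M ==> (U, c) \<in> charts M ==> openin (mtop M) U"
  by (auto simp: smooth_manifold_def manifold_chart_def)

lemma chart_homeomorphic:
  "smooth_manifold n M ==> (U, c) \<in> charts M ==> homeomorphic_map (subtopology (mtop M) U) (top_of_set (c ` U)) c"
  by (auto simp: smooth_manifold_def manifold_chart_def)

lemma chart_topspace: "smooth_manifold n M ==> (U, c) \<in> charts M ==> topspace (subtopology (mtop M) U) = U"
  using chart_openin[of n M U c] openin_subset[of "mtop M" U] by auto

lemma chart_inj: "smooth_manifold n M ==> (U, c) \<in> charts M ==> inj_on c U"
  using homeomorphic_imp_injective_map[OF chart_homeomorphic, of n M U c] chart_topspace[of n M U c] by simp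

lemma chart_inv: "smooth_manifold n M ==> (U, c) \<in> charts M ==> v \<in> U ==> inv_into U c (c v) = v"
  using chart_inj inv_into_f_f by metis

lemma chart_continuous:
  "smooth_manifold n M ==> (U, c) \<in> charts M ==> continuous_map (subtopology (mtop M) U) euclidean c"
  using homeomorphic_imp_continuous_map[OF chart_homeomorphic, of n M U c]
  by (simp add: continuous_map_in_subtopology)

lemma chart_inv_continuous:
  assumes M: "smooth_manifold n M" "(U, c) \<in> charts M"
  shows "continuous_map (top_of_set (c ` U)) (mtop M) (inv_into U c)"
proof -
  obtain g where g: "homeomorphic_maps (subtopology (mtop M) U) (top_of_set (c ` U)) c g"
    using chart_homeomorphic[OF M] by (auto simp: homeomorphic_map_maps)
  then have "continuous_map (top_of_set (c ` U)) (mtop M) g" and gc: "\<And>v. v \<in> U ==> g (c v) = v"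
    using chart_topspace[OF M] by (auto simp: homeomorphic_maps_def continuous_map_in_subtopology)
  then show ?thesis by (rule_tac continuous_map_eq[where f = g]) (auto simp: chart_inv[OF M])
qed

lemma chart_open_image:
  assumes M: "smooth_manifold n M" "(U, c) \<in> charts M" and O: "openin (mtop M) Q"
  shows "openin (top_of_set (c ` U)) (c ` (U \<inter> Q))"
proof -
  have "openin (subtopology (mtop M) U) (U \<inter> Q)"
    using openin_subtopology_Int2[OF O, of U] by (simp add: Int_commute)
  then show ?thesis using homeomorphic_imp_open_map[OF chart_homeomorphic[OF M]] by (auto simp: open_map_def)
qed

lemma chart_open_imageE:
  assumes M: "smooth_manifold n M" "(U, c) \<in> charts M" and O: "openin (mtop M) Q"
  obtains T where "open T" "\<And>R. c ` (U \<inter> (R \<inter> Q)) = c ` (U \<inter> R) \<inter> T"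
proof -
  obtain T where T: "open T" "c ` (U \<inter> Q) = c ` U \<inter> T" using chart_open_image[OF M O] by (auto simp: openin_open)
  have "c ` (U \<inter> (R \<inter> Q)) = c ` (U \<inter> R) \<inter> T" for R
  proof -
    have "c ` (U \<inter> (R \<inter> Q)) = c ` (U \<inter> R) \<inter> c ` (U \<inter> Q)" using chart_inj[OF M] by (auto simp: inj_on_def)
    then show ?thesis using T(2) by auto
  qed
  then show ?thesis using that T(1) by blast
qed

lemma chart_model_domain:
  assumes M: "smooth_manifold n M" "(U, c) \<in> charts M" and O: "openin (mtop M) Q"
  shows "model_domain n (c ` (U \<inter> Q))"
proof -
  obtain H where "H \<in> model_spaces n" "openin (top_of_set H) (c ` U)"
    using M by (auto simp: smooth_manifold_def manifold_chart_def)
  then show ?thesis using openin_trans[OF chart_open_image[OF M O]] by (auto simp: model_domain_def)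
qed

abbreviation smooth_fun :: "('v, 'm::euclidean_space) manifold => 'v set => ('v => 'b::euclidean_space) => bool" where
  "smooth_fun \<equiv> class_fun (C_class \<infinity>)"

lemma class_funD: "class_fun F M Q g ==> (U, c) \<in> charts M ==> class_on F (c ` (U \<inter> Q)) (g \<circ> inv_into U c)"
  by (auto simp: class_fun_def)

lemma class_funI:
  assumes "smooth_manifold n M" "openin (mtop M) Q"
    and "\<And>U c. (U, c) \<in> charts M ==> model_domain n (c ` (U \<inter> Q)) ==> class_on F (c ` (U \<inter> Q)) (g \<circ> inv_into U c)"
  shows "class_fun F M Q g" using assms chart_model_domain unfolding class_fun_def by blast

lemma class_fun_cong:
  assumes M: "smooth_manifold n M" and f: "class_fun F M Q f" and fg: "\<And>v. v \<in> Q ==> f v = g v"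
  shows "class_fun F M Q g" unfolding class_fun_def
proof clarify
  fix U c assume c: "(U, c) \<in> charts M"
  show "class_on F (c ` (U \<inter> Q)) (g \<circ> inv_into U c)"
    by (rule class_on_cong[OF class_funD[OF f c]]) (use fg chart_inv[OF M c] in auto)
qed

lemma class_fun_subset: "class_fun F M Q f ==> R \<subseteq> Q ==> class_fun F M R f"
  unfolding class_fun_def by (auto intro: class_on_subset image_mono)

lemma class_fun_local:
  assumes M: "smooth_manifold n M" and adm: "admissible n F" and Q: "openin (mtop M) Q"
    and loc: "\<And>v. v \<in> Q ==> \<exists>R. openin (mtop M) R \<and> v \<in> R \<and> class_fun F M (Q \<inter> R) f" shows "class_fun F M Q f"
proof (rule class_funI[OF M Q])
  fix U c assume c: "(U, c) \<in> charts M" and D: "model_domain n (c ` (U \<inter> Q))"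
  show "class_on F (c ` (U \<inter> Q)) (f \<circ> inv_into U c)"
  proof (rule class_on_local[OF adm D])
    fix x assume "x \<in> c ` (U \<inter> Q)"
    then obtain v where v: "v \<in> U" "v \<in> Q" "x = c v" by auto
    then obtain R where R: "openin (mtop M) R" "v \<in> R" "class_fun F M (Q \<inter> R) f" using loc by blast
    obtain T where T: "open T" "\<And>Q. c ` (U \<inter> (Q \<inter> R)) = c ` (U \<inter> Q) \<inter> T"
      by (rule chart_open_imageE[OF M c R(1)]) blast
    have "x \<in> c ` (U \<inter> (Q \<inter> R))" using v R(2) by blast
    then show "\<exists>T. open T \<and> x \<in> T \<and> class_on F (c ` (U \<inter> Q) \<inter> T) (f \<circ> inv_into U c)"
      using class_funD[OF R(3) c] T by auto
  qed
qed

lemma class_fun_continuous: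
  assumes M: "smooth_manifold n M" and Q: "openin (mtop M) Q" and f: "class_fun F M Q f"
  shows "continuous_map (subtopology (mtop M) Q) euclidean f"
proof -
  have QM: "Q \<subseteq> topspace (mtop M)" by (rule openin_subset[OF Q])
  have "continuous_map (subtopology (mtop M) (Q \<inter> U)) euclidean f" if c: "(U, c) \<in> charts M" for U c
  proof -
    have "continuous_map (subtopology (mtop M) (Q \<inter> U)) (top_of_set (c ` (U \<inter> Q))) c"
      using continuous_map_from_subtopology[OF chart_continuous[OF M c], of Q]
      by (auto simp: continuous_map_in_subtopology subtopology_subtopology Int_commute)
    moreover have "continuous_map (top_of_set (c ` (U \<inter> Q))) euclidean (f \<circ> inv_into U c)"
      using class_on_continuous[OF class_funD[OF f c]] by simp
    ultimately have "continuous_map (subtopology (mtop M) (Q \<inter> U)) euclidean ((f \<circ> inv_into U c) \<circ> c)"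
      by (rule continuous_map_compose)
    then show ?thesis by (rule continuous_map_eq) (auto simp: chart_inv[OF M c])
  qed
  then have l: "continuous_map (subtopology (subtopology (mtop M) Q) (fst i)) euclidean f" if "i \<in> charts M" for i
    using that by (cases i) (simp add: subtopology_subtopology)
  have o: "openin (subtopology (mtop M) Q) (Q \<inter> fst i)" if "i \<in> charts M" for i
    using that chart_openin[OF M] by (cases i) (auto intro: openin_subtopology_Int2)
  have e: "\<exists>i. i \<in> charts M \<and> x \<in> Q \<inter> fst i" if "x \<in> Q" for x
  proof -
    obtain U c where "(U, c) \<in> charts M" "x \<in> U" using chart_exists[OF M] \<open>x \<in> Q\<close> QM by blast
    then show ?thesis using that by force
  qed
  have r: "subtopology (subtopology (mtop M) Q) (Q \<inter> R) = subtopology (subtopology (mtop M) Q) R" for R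
    by (simp add: subtopology_subtopology Int_assoc[symmetric])
  show ?thesis by (rule pasting_lemma[where I = "charts M" and T = "\<lambda>i. Q \<inter> fst i" and f = "\<lambda>_. f"])
      (use o l e QM in \<open>simp_all add: r\<close>)
qed

lemma class_fun_linear:
  "admissible n F ==> bounded_linear L ==> class_fun F M Q f ==> class_fun F M Q (\<lambda>v. L (f v))"
  unfolding class_fun_def by (fastforce dest: class_on_linear simp: comp_def)

lemma class_fun_add:
  assumes adm: "admissible n F" and f: "class_fun F M Q f" and g: "class_fun F M Q g"
  shows "class_fun F M Q (\<lambda>v. f v + g v)" unfolding class_fun_def
proof clarify
  fix U c assume c: "(U, c) \<in> charts M"
  show "class_on F (c ` (U \<inter> Q)) ((\<lambda>v. f v + g v) \<circ> inv_into U c)"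
    using class_on_add[OF adm class_funD[OF f c] class_funD[OF g c]] by (simp add: comp_def)
qed

lemma class_fun_divide:
  fixes f g :: "'v => real"
  assumes M: "smooth_manifold n M" and adm: "admissible n F" and Q: "openin (mtop M) Q"
    and f: "class_fun F M Q f" and g: "class_fun F M Q g" and nz: "\<And>v. v \<in> Q ==> g v \<noteq> 0"
  shows "class_fun F M Q (\<lambda>v. f v / g v)"
proof (rule class_funI[OF M Q])
  fix U c assume c: "(U, c) \<in> charts M" and D: "model_domain n (c ` (U \<inter> Q))"
  have "class_on F (c ` (U \<inter> Q)) (\<lambda>x. (f \<circ> inv_into U c) x / (g \<circ> inv_into U c) x)"
    by (rule class_on_divide[OF adm D class_funD[OF f c] class_funD[OF g c]]) (use nz chart_inv[OF M c] in auto)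
  then show "class_on F (c ` (U \<inter> Q)) ((\<lambda>v. f v / g v) \<circ> inv_into U c)" by (simp add: comp_def)
qed

lemma class_fun_componentwise:
  fixes f :: "'v => 'b::euclidean_space"
  assumes M: "smooth_manifold n M" and adm: "admissible n F" and Q: "openin (mtop M) Q"
    and f: "\<And>b. b \<in> Basis ==> class_fun F M Q (\<lambda>v. f v \<bullet> b)" shows "class_fun F M Q f"
proof (rule class_funI[OF M Q])
  fix U c assume c: "(U, c) \<in> charts M" and D: "model_domain n (c ` (U \<inter> Q))"
  show "class_on F (c ` (U \<inter> Q)) (f \<circ> inv_into U c)"
    by (rule class_on_componentwise[OF adm D]) (use class_funD[OF f c] in \<open>simp add: comp_def\<close>)
qed

lemma smooth_imp_class_fun:
  assumes M: "smooth_manifold n M" and adm: "admissible n F" and Q: "openin (mtop M) Q" and f: "smooth_fun M Q f"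
  shows "class_fun F M Q f"
  by (rule class_funI[OF M Q], rule smooth_imp_class_on[OF adm]) (use class_funD[OF f] in auto)

lemma smooth_fun_scaleR:
  fixes h :: "'v => real"
  assumes M: "smooth_manifold n M" and Q: "openin (mtop M) Q" and h: "smooth_fun M Q h" and f: "smooth_fun M Q f"
  shows "smooth_fun M Q (\<lambda>v. h v *\<^sub>R f v)"
proof (rule class_funI[OF M Q])
  fix U c assume c: "(U, c) \<in> charts M" and D: "model_domain n (c ` (U \<inter> Q))"
  have "C_on \<infinity> (c ` (U \<inter> Q)) (\<lambda>x. (h \<circ> inv_into U c) x *\<^sub>R (f \<circ> inv_into U c) x)"
    by (rule smooth_on_scaleR[OF model_domain_locally_convex[OF D]])
      (use class_funD[OF h c] class_funD[OF f c] in \<open>simp_all add: comp_def\<close>)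
  then show "class_on (C_class \<infinity>) (c ` (U \<inter> Q)) ((\<lambda>v. h v *\<^sub>R f v) \<circ> inv_into U c)" by (simp add: comp_def)
qed

lemma smooth_fun_const: "smooth_fun M Q (\<lambda>v. a)" by (auto simp: class_fun_def comp_def intro: smooth_on_const)

lemma smooth_fun_chart:
  assumes M: "smooth_manifold n M" and c: "(U, c) \<in> charts M" and h: "smooth h" shows "smooth_fun M U (\<lambda>v. h (c v))"
  unfolding class_fun_def
proof clarify
  fix U' c' assume c': "(U', c') \<in> charts M"
  have t: "C_on \<infinity> (c' ` (U' \<inter> U)) (c \<circ> inv_into U' c')" using M c c' unfolding smooth_manifold_def by fast
  have "C_on \<infinity> (c' ` (U' \<inter> U)) (h \<circ> (c \<circ> inv_into U' c'))"
    by (rule smooth_on_compose[OF model_domain_locally_convex[OF chart_model_domain[OF M c' chart_openin[OF M c]]] _ locally_convex_UNIV t h]) auto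
  then show "class_on (C_class \<infinity>) (c' ` (U' \<inter> U)) ((\<lambda>v. h (c v)) \<circ> inv_into U' c')" by (simp add: comp_def)
qed

text \<open>K is closed because the manifold is Hausdorff; hence every point outside U has a
  neighbourhood on which f is zero, and regularity is checked locally.\<close>

lemma class_fun_extend_zero:
  fixes f :: "'v => 'b::euclidean_space"
  assumes M: "smooth_manifold n M" and adm: "admissible n F" and U: "openin (mtop M) U" and Q: "openin (mtop M) Q"
    and f: "class_fun F M (Q \<inter> U) f" and K: "compactin (mtop M) K" and f0: "\<And>v. v \<in> Q - K ==> f v = 0"
    and KU: "K \<subseteq> U" shows "class_fun F M Q f"
proof (rule class_fun_local[OF M adm Q])
  have clK: "closedin (mtop M) K" using M K by (auto simp: smooth_manifold_def intro: compactin_imp_closedin)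
  fix v assume v: "v \<in> Q"
  show "\<exists>R. openin (mtop M) R \<and> v \<in> R \<and> class_fun F M (Q \<inter> R) f"
  proof (cases "v \<in> U")
    case False
    let ?R = "topspace (mtop M) - K"
    have "class_fun F M (Q \<inter> ?R) (\<lambda>v. 0::'b)"
      using Q clK by (intro smooth_imp_class_fun[OF M adm] smooth_fun_const) auto
    then have "class_fun F M (Q \<inter> ?R) f" by (rule class_fun_cong[OF M]) (use f0 in auto)
    then show ?thesis using False KU clK v openin_subset[OF Q] by (intro exI[of _ ?R]) auto
  qed (use U f in blast)
qed

text \<open>A small closed ball meets the closed model space in a compact subset of the chart image,
  also at boundary points. The bump of the ball, read in the chart, extends by zero.\<close>

lemma smooth_fun_bump:
  assumes M: "smooth_manifold n M" and Q: "openin (mtop M) Q" and v: "v \<in> Q"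
  obtains b :: "'v => real" and K where "smooth_fun M (topspace (mtop M)) b"
    "\<And>u. b u >= 0" "b v > 0" "compactin (mtop M) K" "K \<subseteq> Q" "\<And>u. u \<notin> K ==> b u = 0"
proof -
  obtain U c where c: "(U, c) \<in> charts M" and vU: "v \<in> U" using chart_exists[OF M] v openin_subset[OF Q] by blast
  obtain H where H: "H \<in> model_spaces n" "openin (top_of_set H) (c ` U)"
    using M c by (auto simp: smooth_manifold_def manifold_chart_def)
  have clH: "closed H" using H(1) closed_halfspace_ge by (auto simp: model_spaces_def split: if_splits)
  have "openin (top_of_set H) (c ` (U \<inter> Q))" by (rule openin_trans[OF chart_open_image[OF M c Q] H(2)])
  then obtain r where r: "r > 0" "cball (c v) r \<inter> H \<subseteq> c ` (U \<inter> Q)"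
    using vU v unfolding openin_contains_cball by blast
  define K where "K = inv_into U c ` (cball (c v) r \<inter> H)"
  have "compactin (top_of_set (c ` U)) (cball (c v) r \<inter> H)"
    using r(2) clH by (auto simp: compactin_subtopology compact_Int_closed)
  then have K: "compactin (mtop M) K" unfolding K_def by (rule image_compactin[OF _ chart_inv_continuous[OF M c]])
  have KQ: "K \<subseteq> U \<inter> Q" using r(2) chart_inv[OF M c] by (fastforce simp: K_def)
  define b where "b u = (if u \<in> U then bump (c v) r (c u) else 0)" for u
  have b0: "b u = 0" if "u \<notin> K" for u
  proof (cases "u \<in> U")
    case True
    have "c u \<in> H" using True openin_imp_subset[OF H(2)] by blast
    then have "c u \<notin> cball (c v) r" using that True chart_inv[OF M c True] unfolding K_def by force
    then show ?thesis using r(1) by (simp add: b_def bump_eq_0_iff)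
  qed (simp add: b_def)
  have bU: "smooth_fun M (topspace (mtop M) \<inter> U) b"
  proof (rule class_fun_cong[OF M])
    show "smooth_fun M (topspace (mtop M) \<inter> U) (\<lambda>u. bump (c v) r (c u))"
      by (rule class_fun_subset[OF smooth_fun_chart[OF M c smooth_bump]]) auto
  qed (simp add: b_def)
  have "smooth_fun M (topspace (mtop M)) b"
    by (rule class_fun_extend_zero[OF M _ chart_openin[OF M c] openin_topspace bU K]) (use b0 KQ in auto)
  moreover have "b v > 0" using vU r(1) by (simp add: b_def bump_pos_iff)
  moreover have "b u >= 0" for u by (simp add: b_def bump_nonneg)
  ultimately show ?thesis using that K KQ b0 by blast
qed

section \<open>Sections of vector bundles\<close>

lemma triv_openin: "trivialization X E U \<psi> ==> openin X U" by (simp add: trivialization_def)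

lemma triv_bij: "trivialization X E U \<psi> ==> v \<in> U ==> bij_betw \<psi> (fiber E v) UNIV" by (simp add: trivialization_def)

lemma triv_inj: "trivialization X E U \<psi> ==> v \<in> U ==> e \<in> fiber E v ==> e' \<in> fiber E v ==> \<psi> e = \<psi> e' ==> e = e'"
  using triv_bij by (metis bij_betw_imp_inj_on inj_onD)

lemma triv_inv:
  assumes "trivialization X E U \<psi>" "v \<in> U"
  shows "inv_into (fiber E v) \<psi> a \<in> fiber E v" "\<psi> (inv_into (fiber E v) \<psi> a) = a"
    "e \<in> fiber E v ==> inv_into (fiber E v) \<psi> (\<psi> e) = e"
  using triv_bij[OF assms] unfolding bij_betw_def by (auto intro: inv_into_into f_inv_into_f)

lemma triv_zero:
  assumes "trivialization X E U \<psi>" "v \<in> U"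
  shows "fzero E v \<in> fiber E v" "\<psi> (fzero E v) = 0" "e \<in> fiber E v ==> \<psi> e = 0 \<longleftrightarrow> e = fzero E v"
proof -
  show 1: "fzero E v \<in> fiber E v" "\<psi> (fzero E v) = 0" using assms by (auto simp: trivialization_def)
  show "e \<in> fiber E v ==> \<psi> e = 0 \<longleftrightarrow> e = fzero E v" using triv_inj[OF assms _ 1(1)] 1(2) by auto
qed

lemma triv_add:
  assumes "trivialization X E U \<psi>" "v \<in> U" "e \<in> fiber E v" "e' \<in> fiber E v"
  shows "fadd E e e' \<in> fiber E v" "\<psi> (fadd E e e') = \<psi> e + \<psi> e'" using assms by (auto simp: trivialization_def)

lemma triv_scale:
  assumes "trivialization X E U \<psi>" "v \<in> U" "e \<in> fiber E v"
  shows "fscale E a e \<in> fiber E v" "\<psi> (fscale E a e) = a *\<^sub>R \<psi> e" using assms by (auto simp: trivialization_def)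

lemma triv_inv_linear:
  assumes t: "trivialization X E U \<psi>" "v \<in> U"
  shows "inv_into (fiber E v) \<psi> (a + b) = fadd E (inv_into (fiber E v) \<psi> a) (inv_into (fiber E v) \<psi> b)"
    "inv_into (fiber E v) \<psi> (s *\<^sub>R a) = fscale E s (inv_into (fiber E v) \<psi> a)"
  using triv_inv[OF t] triv_add[OF t] triv_scale[OF t] by (auto intro!: triv_inj[OF t])

lemma transition_linear:
  assumes "trivialization X E U \<psi>" "v \<in> U" "trivialization X E U' \<psi>'" "v \<in> U'"
  shows "linear (\<psi>' \<circ> inv_into (fiber E v) \<psi>)"
  using triv_inv[OF assms(1,2)] triv_add[OF assms(3,4)] triv_scale[OF assms(3,4)]
  by (intro linearI) (auto simp: triv_inv_linear[OF assms(1,2)])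

text \<open>Triviality near the support provides a trivialization that need not be listed in
  \<open>trivs E\<close>. Requiring both transition directions lets sections be built from it and
  components be read in it.\<close>

definition compatible_triv ::
  "('v, 'm::euclidean_space) manifold => ('v, 'e, 'r::finite) vbundle => 'v set => ('e => real ^ 'r) => bool" where
  "compatible_triv M E U \<psi> \<longleftrightarrow> trivialization (mtop M) E U \<psi> \<and>
     (\<forall>(U', \<psi>')\<in>trivs E. smooth_fun M (U \<inter> U') (transition E \<psi> \<psi>') \<and> smooth_fun M (U' \<inter> U) (transition E \<psi>' \<psi>))"

lemma bundle_triv: "vector_bundle F M E ==> (U, \<psi>) \<in> trivs E ==> trivialization (mtop M) E U \<psi>"
  by (auto simp: vector_bundle_def)

lemma bundle_triv_compatible: "smooth_vector_bundle M E ==> (U, \<psi>) \<in> trivs E ==> compatible_triv M E U \<psi>"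
  unfolding compatible_triv_def vector_bundle_def by blast

lemma bundle_triv_exists:
  assumes "vector_bundle F M E" "v \<in> topspace (mtop M)"
  obtains U \<psi> where "(U, \<psi>) \<in> trivs E" "v \<in> U"
proof -
  have "v \<in> (\<Union>(U, \<psi>)\<in>trivs E. U)" using assms by (simp add: vector_bundle_def)
  then show ?thesis using that by blast
qed

lemma trivial_bundle_on_triv: "smooth_vector_bundle M E ==> (U, \<psi>) \<in> trivs E ==> trivial_bundle_on M E U"
  unfolding trivial_bundle_on_def by (intro exI[of _ \<psi>]) (simp add: insert_absorb)

lemma trivial_bundle_on_compatible:
  assumes "trivial_bundle_on M E U"
  obtains \<psi> where "compatible_triv M E U \<psi>"
proof -
  obtain \<psi> where \<psi>: "smooth_vector_bundle M (E\<lparr>trivs := insert (U, \<psi>) (trivs E)\<rparr>)"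
    using assms by (auto simp: trivial_bundle_on_def)
  let ?E = "E\<lparr>trivs := insert (U, \<psi>) (trivs E)\<rparr>"
  have f: "fiber ?E = fiber E" by (simp add: fiber_def fun_eq_iff)
  have "trivialization (mtop M) ?E = trivialization (mtop M) E" "transition ?E = transition E"
    by (simp_all add: trivialization_def transition_def f fun_eq_iff)
  moreover have "compatible_triv M (E\<lparr>trivs := insert (U, \<psi>) (trivs E)\<rparr>) U \<psi>"
    by (rule bundle_triv_compatible[OF \<psi>]) simp
  ultimately have "compatible_triv M E U \<psi>" by (simp add: compatible_triv_def)
  then show ?thesis by (rule that)
qed

lemma bounded_linear_matrix_vector: "bounded_linear (\<lambda>A::real ^ 'n ^ 'm. A *v a)"
  unfolding linear_conv_bounded_linear[symmetric]
  by (rule linearI) (simp_all add: matrix_vector_mult_add_rdistrib scaleR_matrix_vector_assoc[symmetric])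

text \<open>The section k*a of the informal argument: constant direction a in the trivialization,
  with a scalar coefficient h that is meant to vanish off a compact subset of U.\<close>

definition frame_section ::
  "('v, 'm) manifold => ('v, 'e, 'r::finite) vbundle => 'v set => ('e => real ^ 'r) => ('v => real) => real ^ 'r => 'v => 'e"
where
  "frame_section M E U \<psi> h a =
     (\<lambda>v\<in>topspace (mtop M). if v \<in> U then inv_into (fiber E v) \<psi> (h v *\<^sub>R a) else fzero E v)"

lemma frame_section_apply:
  assumes "trivialization (mtop M) E U \<psi>" "v \<in> U"
  shows "frame_section M E U \<psi> h a v = inv_into (fiber E v) \<psi> (h v *\<^sub>R a)"
    "\<psi> (frame_section M E U \<psi> h a v) = h v *\<^sub>R a"
  using assms triv_inv[OF assms] openin_subset[OF triv_openin[OF assms(1)]] by (auto simp: frame_section_def)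

lemma compact_closed:
  "smooth_manifold n M ==> compactin (mtop M) K ==> closedin (mtop M) K"
  by (auto simp: smooth_manifold_def intro: compactin_imp_closedin)

text \<open>In another trivialization the components are h times the transition matrix applied to a,
  hence smooth on the overlap; they extend by zero because h vanishes off K.\<close>

lemma frame_section_compact:
  fixes E :: "('v, 'e, 'r::finite) vbundle" and M :: "('v, 'm::euclidean_space) manifold"
  assumes M: "smooth_manifold n M" and adm: "admissible n F" and E: "smooth_vector_bundle M E"
    and t: "compatible_triv M E U \<psi>" and h: "smooth_fun M (topspace (mtop M)) h"
    and K: "compactin (mtop M) K" "K \<subseteq> U" "\<And>v. v \<notin> K ==> h v = 0"
  shows "frame_section M E U \<psi> h a \<in> compact_sections F M E"
    "section_support M E (frame_section M E U \<psi> h a) \<subseteq> K"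
    "\<And>v. v \<in> topspace (mtop M) - K ==> frame_section M E U \<psi> h a v = fzero E v"
proof -
  let ?s = "frame_section M E U \<psi> h a"
  have T: "trivialization (mtop M) E U \<psi>" using t by (simp add: compatible_triv_def)
  have KM: "K \<subseteq> topspace (mtop M)" by (rule compactin_subset_topspace[OF K(1)])
  have clK: "closedin (mtop M) K" by (rule compact_closed[OF M K(1)])
  have z: "?s v = fzero E v" if "v \<in> topspace (mtop M)" "v \<notin> K" for v
  proof (cases "v \<in> U")
    case True
    have "inv_into (fiber E v) \<psi> 0 = fzero E v"
      using triv_inv(3)[OF T True triv_zero(1)[OF T True]] triv_zero(2)[OF T True] by simp
    then show ?thesis using that True K(3) by (simp add: frame_section_def)
  qed (use that in \<open>simp add: frame_section_def\<close>)
  then show "\<And>v. v \<in> topspace (mtop M) - K ==> ?s v = fzero E v" by auto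
  have "{v \<in> topspace (mtop M). ?s v \<noteq> fzero E v} \<subseteq> K" using z by auto
  then show sup: "section_support M E ?s \<subseteq> K" unfolding section_support_def by (rule closure_of_minimal[OF _ clK])
  have "?s \<in> sections F M E" unfolding sections_def
  proof (clarsimp, intro conjI ballI)
    show "?s \<in> (\<Pi>\<^sub>E v\<in>topspace (mtop M). fiber E v)"
    proof (rule PiE_I)
      fix v assume v: "v \<in> topspace (mtop M)"
      show "?s v \<in> fiber E v"
      proof (cases "v \<in> U")
        case False
        obtain U' \<psi>' where "(U', \<psi>') \<in> trivs E" "v \<in> U'" using bundle_triv_exists[OF E v] .
        then show ?thesis using triv_zero(1)[OF bundle_triv[OF E]] v False by (simp add: frame_section_def)
      qed (use v triv_inv(1)[OF T] in \<open>simp add: frame_section_def\<close>)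
    qed (simp add: frame_section_def)
    fix i assume "i \<in> trivs E"
    then obtain U' \<psi>' where i: "i = (U', \<psi>')" "(U', \<psi>') \<in> trivs E" by (cases i) auto
    note T' = bundle_triv[OF E i(2)]
    have U': "openin (mtop M) U'" by (rule triv_openin[OF T'])
    have "class_fun F M U' (\<psi>' \<circ> ?s)"
    proof (rule class_fun_extend_zero[OF M adm triv_openin[OF T] U' _ K(1) _ K(2)])
      have UU: "openin (mtop M) (U' \<inter> U)" using U' triv_openin[OF T] by auto
      have "smooth_fun M (U' \<inter> U) (transition E \<psi> \<psi>')" using t i(2) by (auto simp: compatible_triv_def Int_commute)
      then have "smooth_fun M (U' \<inter> U) (\<lambda>v. transition E \<psi> \<psi>' v *v a)"
        by (rule class_fun_linear[of 0, OF _ bounded_linear_matrix_vector, rotated]) simp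
      then have "smooth_fun M (U' \<inter> U) (\<lambda>v. h v *\<^sub>R (transition E \<psi> \<psi>' v *v a))"
        using openin_subset[OF UU] by (intro smooth_fun_scaleR[OF M UU] class_fun_subset[OF h]) auto
      then have "class_fun F M (U' \<inter> U) (\<lambda>v. h v *\<^sub>R (transition E \<psi> \<psi>' v *v a))"
        by (rule smooth_imp_class_fun[OF M adm UU])
      then show "class_fun F M (U' \<inter> U) (\<psi>' \<circ> ?s)"
      proof (rule class_fun_cong[OF M])
        fix v assume v: "v \<in> U' \<inter> U"
        then have l: "linear (\<psi>' \<circ> inv_into (fiber E v) \<psi>)" using transition_linear[OF T _ T'] by blast
        have "transition E \<psi> \<psi>' v *v a = \<psi>' (inv_into (fiber E v) \<psi> a)"
          using matrix_vector_mul(2)[OF l, THEN fun_cong, of a] by (simp add: transition_def)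
        then show "h v *\<^sub>R (transition E \<psi> \<psi>' v *v a) = (\<psi>' \<circ> ?s) v"
          using linear_cmul[OF l, of "h v" a] v by (simp add: frame_section_apply[OF T])
      qed
      show "(\<psi>' \<circ> ?s) v = 0" if "v \<in> U' - K" for v
        using that z[of v] openin_subset[OF U'] triv_zero(2)[OF T'] by auto
    qed
    then show "case i of (U, \<psi>) => class_fun F M U (\<psi> \<circ> ?s)" using i(1) by simp
  qed
  moreover have "compactin (mtop M) (section_support M E ?s)"
    using closed_compactin[OF K(1) sup] by (simp add: section_support_def)
  ultimately show "?s \<in> compact_sections F M E" by (simp add: compact_sections_def)
qed

lemma sectionD: "x \<in> sections F M E ==> v \<in> topspace (mtop M) ==> x v \<in> fiber E v" by (auto simp: sections_def)

lemma compact_section_fiber: "x \<in> compact_sections F M E ==> v \<in> topspace (mtop M) ==> x v \<in> fiber E v"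
  by (auto simp: compact_sections_def intro: sectionD)

lemma section_class: "x \<in> sections F M E ==> (U, \<psi>) \<in> trivs E ==> class_fun F M U (\<lambda>v. \<psi> (x v))"
  by (fastforce simp: sections_def comp_def)

lemma compact_section_class:
  "x \<in> compact_sections F M E ==> (U, \<psi>) \<in> trivs E ==> class_fun F M U (\<lambda>v. \<psi> (x v))"
  by (auto simp: compact_sections_def intro: section_class)

lemma section_continuous:
  assumes M: "smooth_manifold n M" and E: "smooth_vector_bundle M E" and x: "x \<in> sections F M E" and t: "(U, \<psi>) \<in> trivs E"
  shows "continuous_map (subtopology (mtop M) U) euclidean (\<lambda>v. \<psi> (x v))"
  by (rule class_fun_continuous[OF M triv_openin[OF bundle_triv[OF E t]] section_class[OF x t]])

lemma closedin_section_support: "closedin (mtop M) (section_support M E x)" by (simp add: section_support_def)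

lemma compact_section_support: "x \<in> compact_sections F M E ==> compactin (mtop M) (section_support M E x)"
  by (simp add: compact_sections_def)

lemma compact_sections_add:
  assumes M: "smooth_manifold n M" and adm: "admissible n F" and E: "smooth_vector_bundle M E"
    and x: "x \<in> compact_sections F M E" and y: "y \<in> compact_sections F M E"
  shows "section_add M E x y \<in> compact_sections F M E"
proof -
  have T: "\<exists>U \<psi>. trivialization (mtop M) E U \<psi> \<and> v \<in> U" if "v \<in> topspace (mtop M)" for v
    using bundle_triv_exists[OF E that] bundle_triv[OF E] by metis
  have fx: "x v \<in> fiber E v" "y v \<in> fiber E v" if "v \<in> topspace (mtop M)" for v
    by (rule compact_section_fiber[OF x that], rule compact_section_fiber[OF y that])
  have "class_fun F M U (\<psi> \<circ> section_add M E x y)" if t: "(U, \<psi>) \<in> trivs E" for U \<psi>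
  proof -
    have "class_fun F M U (\<lambda>v. \<psi> (x v) + \<psi> (y v))"
      by (intro class_fun_add[OF adm] compact_section_class[OF _ t] x y)
    then show ?thesis by (rule class_fun_cong[OF M])
        (use triv_add(2)[OF bundle_triv[OF E t]] openin_subset[OF triv_openin[OF bundle_triv[OF E t]]] fx in \<open>auto simp: section_add_def subset_iff\<close>)
  qed
  moreover have "section_add M E x y \<in> (\<Pi>\<^sub>E v\<in>topspace (mtop M). fiber E v)"
    using T triv_add(1) fx by (fastforce simp: section_add_def)
  moreover have "section_support M E (section_add M E x y) \<subseteq> section_support M E x \<union> section_support M E y"
  proof -
    have "{v \<in> topspace (mtop M). section_add M E x y v \<noteq> fzero E v} \<subseteq>
        {v \<in> topspace (mtop M). x v \<noteq> fzero E v} \<union> {v \<in> topspace (mtop M). y v \<noteq> fzero E v}"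
    proof clarify
      fix v assume v: "v \<in> topspace (mtop M)" "section_add M E x y v \<noteq> fzero E v" "y v = fzero E v" "x v = fzero E v"
      obtain U \<psi> where t: "trivialization (mtop M) E U \<psi>" "v \<in> U" using T v(1) by blast
      have "\<psi> (section_add M E x y v) = 0"
        using v triv_add(2)[OF t triv_zero(1)[OF t] triv_zero(1)[OF t]] triv_zero(2)[OF t] by (simp add: section_add_def)
      moreover have "section_add M E x y v \<in> fiber E v"
        using v triv_add(1)[OF t triv_zero(1)[OF t] triv_zero(1)[OF t]] by (simp add: section_add_def)
      ultimately show False using triv_zero(3)[OF t] v(2) by blast
    qed
    then show ?thesis unfolding section_support_def closure_of_Un[symmetric] by (rule closure_of_mono)
  qed
  then have "compactin (mtop M) (section_support M E (section_add M E x y))"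
    by (rule closed_compactin[OF compactin_Un[OF compact_section_support[OF x] compact_section_support[OF y]] _ closedin_section_support])
  ultimately show ?thesis by (auto simp: compact_sections_def sections_def)
qed

lemma compact_sections_scale:
  assumes M: "smooth_manifold n M" and adm: "admissible n F" and E: "smooth_vector_bundle M E"
    and x: "x \<in> compact_sections F M E" shows "section_scale M E a x \<in> compact_sections F M E"
proof -
  have T: "\<exists>U \<psi>. trivialization (mtop M) E U \<psi> \<and> v \<in> U" if "v \<in> topspace (mtop M)" for v
    using bundle_triv_exists[OF E that] bundle_triv[OF E] by metis
  have fx: "x v \<in> fiber E v" if "v \<in> topspace (mtop M)" for v by (rule compact_section_fiber[OF x that])
  have "class_fun F M U (\<psi> \<circ> section_scale M E a x)" if t: "(U, \<psi>) \<in> trivs E" for U \<psi>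
  proof -
    have "class_fun F M U (\<lambda>v. a *\<^sub>R \<psi> (x v))"
      by (rule class_fun_linear[OF adm bounded_linear_scaleR_right compact_section_class[OF x t]])
    then show ?thesis by (rule class_fun_cong[OF M])
        (use triv_scale(2)[OF bundle_triv[OF E t]] openin_subset[OF triv_openin[OF bundle_triv[OF E t]]] fx in \<open>auto simp: section_scale_def subset_iff\<close>)
  qed
  moreover have "section_scale M E a x \<in> (\<Pi>\<^sub>E v\<in>topspace (mtop M). fiber E v)"
    using T triv_scale(1) fx by (fastforce simp: section_scale_def)
  moreover have "section_support M E (section_scale M E a x) \<subseteq> section_support M E x"
  proof -
    have "{v \<in> topspace (mtop M). section_scale M E a x v \<noteq> fzero E v} \<subseteq> {v \<in> topspace (mtop M). x v \<noteq> fzero E v}"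
    proof clarify
      fix v assume v: "v \<in> topspace (mtop M)" "section_scale M E a x v \<noteq> fzero E v" "x v = fzero E v"
      obtain U \<psi> where t: "trivialization (mtop M) E U \<psi>" "v \<in> U" using T v(1) by blast
      have "\<psi> (section_scale M E a x v) = 0"
        using v triv_scale(2)[OF t triv_zero(1)[OF t]] triv_zero(2)[OF t] by (simp add: section_scale_def)
      moreover have "section_scale M E a x v \<in> fiber E v"
        using v triv_scale(1)[OF t triv_zero(1)[OF t]] by (simp add: section_scale_def)
      ultimately show False using triv_zero(3)[OF t] v(2) by blast
    qed
    then show ?thesis unfolding section_support_def by (rule closure_of_mono)
  qed
  then have "compactin (mtop M) (section_support M E (section_scale M E a x))"
    by (rule closed_compactin[OF compact_section_support[OF x] _ closedin_section_support])
  ultimately show ?thesis by (auto simp: compact_sections_def sections_def)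
qed

lemma fiber_zero:
  assumes "vector_bundle F M E" "v \<in> topspace (mtop M)"
  shows "fzero E v \<in> fiber E v" "fadd E (fzero E v) (fzero E v) = fzero E v" "fscale E a (fzero E v) = fzero E v"
    "e \<in> fiber E v ==> fscale E 0 e = fzero E v"
proof -
  obtain U \<psi> where t: "(U, \<psi>) \<in> trivs E" and v: "v \<in> U" using bundle_triv_exists[OF assms] .
  note t = bundle_triv[OF assms(1) t]
  note z = triv_zero[OF t v]
  show "fzero E v \<in> fiber E v" by (rule z(1))
  have "\<psi> (fadd E (fzero E v) (fzero E v)) = 0" "\<psi> (fscale E a (fzero E v)) = 0"
    using triv_add(2)[OF t v z(1) z(1)] triv_scale(2)[OF t v z(1)] z(2) by simp_all
  then show "fadd E (fzero E v) (fzero E v) = fzero E v" "fscale E a (fzero E v) = fzero E v"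
    using z(3)[OF triv_add(1)[OF t v z(1) z(1)]] z(3)[OF triv_scale(1)[OF t v z(1)]] by simp_all
  show "e \<in> fiber E v ==> fscale E 0 e = fzero E v" using z triv_scale[OF t v, of e 0] by auto
qed

lemma frame_section_scale:
  assumes E: "vector_bundle F M E" and T: "trivialization (mtop M) E U \<psi>" and v: "v \<in> topspace (mtop M)"
    and h: "h' v *\<^sub>R a' = t *\<^sub>R h v *\<^sub>R a"
  shows "frame_section M E U \<psi> h' a' v = fscale E t (frame_section M E U \<psi> h a v)"
proof (cases "v \<in> U")
  case True
  then show ?thesis using triv_inv_linear(2)[OF T True, of t "h v *\<^sub>R a"] h by (simp add: frame_section_apply(1)[OF T True])
next
  case False
  then show ?thesis using v fiber_zero(3)[OF E v] by (simp add: frame_section_def)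
qed

lemma frame_section_add:
  assumes E: "vector_bundle F M E" and T: "trivialization (mtop M) E U \<psi>" and v: "v \<in> topspace (mtop M)"
  shows "frame_section M E U \<psi> h (a + a') v = fadd E (frame_section M E U \<psi> h a v) (frame_section M E U \<psi> h a' v)"
proof (cases "v \<in> U")
  case True
  then show ?thesis using triv_inv_linear(1)[OF T True, of "h v *\<^sub>R a" "h v *\<^sub>R a'"]
    by (simp add: frame_section_apply(1)[OF T True] scaleR_add_right)
next
  case False
  then show ?thesis using v fiber_zero(2)[OF E v] by (simp add: frame_section_def)
qed

lemma continuous_map_matrix_vector:
  fixes A :: "'v => real ^ 'n ^ 'm"
  assumes "continuous_map X euclidean A" "continuous_map X euclidean b"
  shows "continuous_map X euclidean (\<lambda>v. A v *v b v)"
proof -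
  have "continuous_map X (prod_topology euclidean euclidean) (\<lambda>v. (A v, b v))"
    by (rule continuous_map_pairedI[OF assms])
  moreover have "continuous_map (prod_topology euclidean euclidean) euclidean (\<lambda>p :: (real ^ 'n ^ 'm) \<times> (real ^ 'n). fst p *v snd p)"
    unfolding prod_topology_euclidean continuous_map_iff_continuous2 matrix_vector_mult_def
    by (intro continuous_intros)
  ultimately have "continuous_map X euclidean ((\<lambda>p :: (real ^ 'n ^ 'm) \<times> (real ^ 'n). fst p *v snd p) \<circ> (\<lambda>v. (A v, b v)))"
    by (rule continuous_map_compose)
  then show ?thesis by (simp add: comp_def)
qed

text \<open>Components in the additional trivialization are computed from those in the atlas by
  transition matrices, on the overlaps, and then pasted.\<close>

lemma compatible_triv_continuous:
  assumes M: "smooth_manifold n M" and E: "smooth_vector_bundle M E" and t: "compatible_triv M E U \<psi>"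
    and x: "x \<in> sections F M E" shows "continuous_map (subtopology (mtop M) U) euclidean (\<lambda>v. \<psi> (x v))"
proof -
  have T: "trivialization (mtop M) E U \<psi>" using t by (simp add: compatible_triv_def)
  have UM: "U \<subseteq> topspace (mtop M)" by (rule openin_subset[OF triv_openin[OF T]])
  have l: "continuous_map (subtopology (mtop M) (U \<inter> fst i)) euclidean (\<lambda>v. \<psi> (x v))" if i: "i \<in> trivs E" for i
  proof -
    obtain U' \<psi>' where i': "i = (U', \<psi>')" "(U', \<psi>') \<in> trivs E" using i by (cases i) auto
    note T' = bundle_triv[OF E i'(2)]
    have UU: "openin (mtop M) (U' \<inter> U)" using triv_openin[OF T] triv_openin[OF T'] by auto
    have "smooth_fun M (U' \<inter> U) (transition E \<psi>' \<psi>)" using t i'(2) by (auto simp: compatible_triv_def)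
    then have c1: "continuous_map (subtopology (mtop M) (U' \<inter> U)) euclidean (transition E \<psi>' \<psi>)"
      by (rule class_fun_continuous[OF M UU])
    have c2: "continuous_map (subtopology (mtop M) (U' \<inter> U)) euclidean (\<lambda>v. \<psi>' (x v))"
      by (rule class_fun_continuous[OF M UU class_fun_subset[OF section_class[OF x i'(2)]]]) auto
    have "continuous_map (subtopology (mtop M) (U' \<inter> U)) euclidean (\<lambda>v. \<psi> (x v))"
    proof (rule continuous_map_eq[OF continuous_map_matrix_vector[OF c1 c2]])
      fix v assume "v \<in> topspace (subtopology (mtop M) (U' \<inter> U))"
      then have v: "v \<in> topspace (mtop M)" "v \<in> U'" "v \<in> U" by auto
      show "transition E \<psi>' \<psi> v *v \<psi>' (x v) = \<psi> (x v)"
        using matrix_vector_mul(2)[OF transition_linear[OF T' v(2) T v(3)], THEN fun_cong, of "\<psi>' (x v)"]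
          triv_inv(3)[OF T' v(2) sectionD[OF x v(1)]] by (simp add: transition_def)
    qed
    then show ?thesis by (simp add: i'(1) Int_commute)
  qed
  have e: "\<exists>i. i \<in> trivs E \<and> v \<in> U \<inter> fst i" if v: "v \<in> U" for v
  proof -
    obtain U' \<psi>' where "(U', \<psi>') \<in> trivs E" "v \<in> U'" using bundle_triv_exists[OF E] UM v by blast
    then show ?thesis using v by force
  qed
  have o: "openin (subtopology (mtop M) U) (U \<inter> fst i)" if "i \<in> trivs E" for i
    using that triv_openin[OF bundle_triv[OF E]] by (cases i) (auto intro: openin_subtopology_Int2)
  have r: "subtopology (subtopology (mtop M) U) (U \<inter> R) = subtopology (mtop M) (U \<inter> R)" for R
    by (simp add: subtopology_subtopology)
  show ?thesis by (rule pasting_lemma[where I = "trivs E" and T = "\<lambda>i. U \<inter> fst i" and f = "\<lambda>_ v. \<psi> (x v)"])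
      (use o l e UM in \<open>simp_all add: r\<close>)
qed

section \<open>Locating the support\<close>

text \<open>Sum finitely many members whose positivity sets cover S; S being nonempty, there is at
  least one summand, so closure under addition keeps the sum in B. It is applied to all nonnegative
  coefficients and to those annihilated by a functional.\<close>

lemma compact_positive_sum:
  fixes B :: "('v => real) set"
  assumes S: "compactin X S" "S \<noteq> {}" and add: "\<And>b b'. b \<in> B ==> b' \<in> B ==> (\<lambda>v. b v + b' v) \<in> B"
    and nonneg: "\<And>b v. b \<in> B ==> 0 <= b v"
    and cont: "\<And>b. b \<in> B ==> continuous_map (subtopology X S) euclideanreal b"
    and pos: "\<And>v. v \<in> S ==> \<exists>b\<in>B. b v > 0" shows "\<exists>b\<in>B. \<forall>v\<in>S. b v > 0"
proof -
  obtain b where b: "\<And>v. v \<in> S ==> b v \<in> B" "\<And>v. v \<in> S ==> b v v > 0" using pos by metis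
  have SX: "S \<subseteq> topspace X" by (rule compactin_subset_topspace[OF S(1)])
  have op: "openin (subtopology X S) {u \<in> S. b v u \<in> {0<..}}" if "v \<in> S" for v
    using openin_continuous_map_preimage[OF cont[OF b(1)[OF that]], of "{0<..}"] SX by (simp add: Int_absorb1)
  have "compact_space (subtopology X S)" using S(1) by (simp add: compactin_subspace)
  then have comp: "compactin (subtopology X S) S" using SX by (simp add: compact_space_def Int_absorb1)
  obtain \<F> where F: "finite \<F>" "\<F> \<subseteq> (\<lambda>v. {u \<in> S. b v u \<in> {0<..}}) ` S" "S \<subseteq> \<Union>\<F>"
  proof -
    have "\<exists>\<F>. finite \<F> \<and> \<F> \<subseteq> (\<lambda>v. {u \<in> S. b v u \<in> {0<..}}) ` S \<and> S \<subseteq> \<Union>\<F>"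
      by (rule compactinD[OF comp]) (use op b(2) in auto)
    then show thesis using that by blast
  qed
  obtain D where D: "finite D" "D \<subseteq> S" "\<F> = (\<lambda>v. {u \<in> S. b v u \<in> {0<..}}) ` D"
    using finite_subset_image[OF F(1,2)] by blast
  have SD: "\<exists>v\<in>D. b v u > 0" if "u \<in> S" for u using that F(3) D(3) by auto
  have Dne: "D \<noteq> {}" using SD S(2) by auto
  have "\<exists>c\<in>B. \<forall>v\<in>D. \<forall>u. b v u <= c u" using D(1) Dne D(2)
  proof (induction D rule: finite_ne_induct)
    case (singleton v)
    then show ?case using b(1) by auto
  next
    case (insert v D)
    then obtain c where c: "c \<in> B" "\<forall>v\<in>D. \<forall>u. b v u <= c u" by auto
    have bv: "b v \<in> B" using insert.prems b(1) by simp
    show ?case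
    proof (rule bexI[OF _ add[OF bv c(1)]], clarify)
      fix v' u assume "v' \<in> insert v D"
      then show "b v' u <= b v u + c u"
        using c(2) nonneg[OF bv, of u] nonneg[OF c(1), of u] by (auto intro: add_increasing)
    qed
  qed
  then show ?thesis using SD by (meson less_le_trans)
qed

text \<open>Isolates the linear algebra from bundles. \<open>y x\<close> gives the components of x
  along S, \<open>s b a\<close> stands for the section b times a, \<open>\<kappa>\<close> is a
  coefficient positive on S, and \<open>van\<close> expresses that x minus \<open>\<kappa>\<close>
  times \<open>L x\<close> has a zero on S. In rank one S is a point and \<open>van\<close> is
  already the claim.\<close>

lemma support_point_core:
  fixes X :: "'v topology" and C :: "'x set" and y :: "'x => 'v => real ^ 'r" and L :: "'x => real ^ 'r"
    and B :: "('v => real) set" and s :: "('v => real) => real ^ 'r => 'x"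
  assumes S: "compactin X S" "S \<noteq> {}" and card: "CARD('r) = 1 ==> \<exists>v. S = {v}"
    and add: "\<And>x x'. x \<in> C ==> x' \<in> C ==> add x x' \<in> C" "\<And>x x' v. x \<in> C ==> x' \<in> C ==> v \<in> S ==> y (add x x') v = y x v + y x' v"
      "\<And>x x'. x \<in> C ==> x' \<in> C ==> L (add x x') = L x + L x'"
    and scl: "\<And>x t. x \<in> C ==> scl t x \<in> C" "\<And>x t v. x \<in> C ==> v \<in> S ==> y (scl t x) v = t *\<^sub>R y x v"
      "\<And>x t. x \<in> C ==> L (scl t x) = t *\<^sub>R L x"
    and s: "\<And>b a. b \<in> B ==> s b a \<in> C" "\<And>b a v. b \<in> B ==> v \<in> S ==> y (s b a) v = b v *\<^sub>R a"
    and Badd: "\<And>b b'. b \<in> B ==> b' \<in> B ==> (\<lambda>v. b v + b' v) \<in> B"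
    and Bcont: "\<And>b. b \<in> B ==> continuous_map (subtopology X S) euclideanreal b"
    and bump: "\<And>v N. v \<in> S ==> openin X N ==> v \<in> N ==> \<exists>b\<in>B. (\<forall>u. b u >= 0) \<and> b v > 0 \<and> (\<forall>u\<in>S - N. b u = 0)"
    and ycont: "\<And>x. x \<in> C ==> continuous_map (subtopology X S) euclidean (y x)"
    and \<kappa>: "\<kappa> \<in> B" "\<And>v. v \<in> S ==> \<kappa> v > 0" and van: "\<And>x. x \<in> C ==> \<exists>v\<in>S. y x v = \<kappa> v *\<^sub>R L x"
  shows "\<exists>v\<in>S. \<forall>x\<in>C. y x v = \<kappa> v *\<^sub>R L x"
proof (cases "CARD('r) = 1")
  case True
  then obtain v where "S = {v}" using card by blast
  then show ?thesis using van by auto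
next
  case card2: False
  have SX: "S \<subseteq> topspace X" by (rule compactin_subset_topspace[OF S(1)])
  \<comment> \<open>If x and x' agree on S, the components of the difference vanish there, and
    \<open>van\<close> forces L of the difference to be 0.\<close>
  have det: "L x = L x'" if x: "x \<in> C" "x' \<in> C" "\<And>v. v \<in> S ==> y x v = y x' v" for x x'
  proof -
    obtain v where "v \<in> S" "y (add x (scl (-1) x')) v = \<kappa> v *\<^sub>R L (add x (scl (-1) x'))"
      using van[OF add(1)[OF x(1) scl(1)[OF x(2)]]] by blast
    then show ?thesis using \<kappa>(2)[of v] x by (simp add: add scl)
  qed
  \<comment> \<open>Every vector a is an eigenvector of a |-> L(b*a), and the eigenvalue is a value
    of b / \<open>\<kappa>\<close> on S.\<close>
  have eig: "\<exists>v\<in>S. L (s b a) = (b v / \<kappa> v) *\<^sub>R a" if b: "b \<in> B" for b a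
  proof -
    obtain v where v: "v \<in> S" "b v *\<^sub>R a = \<kappa> v *\<^sub>R L (s b a)" using van[OF s(1)[OF b, of a]] s(2)[OF b] by auto
    have "(b v / \<kappa> v) *\<^sub>R a = inverse (\<kappa> v) *\<^sub>R (b v *\<^sub>R a)" by (simp add: divide_inverse mult.commute)
    also have "... = L (s b a)" using \<kappa>(2)[OF v(1)] by (simp add: v(2))
    finally show ?thesis using v(1) by metis
  qed
  have sadd: "L (s b (a + a')) = L (s b a) + L (s b a')" if "b \<in> B" for b a a'
    using det[OF s(1)[OF that, of "a + a'"] add(1)[OF s(1)[OF that, of a] s(1)[OF that, of a']]] that
    by (simp add: s add scaleR_add_right)
  have badd: "L (s (\<lambda>v. b v + b' v) a) = L (s b a) + L (s b' a)" if "b \<in> B" "b' \<in> B" for b b' a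
    using det[OF s(1)[OF Badd[OF that], of a] add(1)[OF s(1)[OF that(1), of a] s(1)[OF that(2), of a]]] that
    by (simp add: s add Badd scaleR_add_left)
  obtain i0 :: 'r where True by blast
  define l where "l b = L (s b (axis i0 1)) $ i0" for b
  have ax: "axis i 1 $ j = (if i = j then 1 else (0::real))" for i j :: 'r by (simp add: axis_def)
  \<comment> \<open>Comparing the eigenvalues on two basis vectors and on their sum shows that they
    coincide.\<close>
  have l: "L (s b (axis i 1)) = l b *\<^sub>R axis i 1" if b: "b \<in> B" for b i
  proof -
    obtain t t' u where t: "L (s b (axis i 1)) = t *\<^sub>R axis i 1" "L (s b (axis i0 1)) = t' *\<^sub>R axis i0 1"
      "L (s b (axis i 1 + axis i0 1)) = u *\<^sub>R (axis i 1 + axis i0 1)"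
      using eig[OF b, of "axis i 1"] eig[OF b, of "axis i0 1"] eig[OF b, of "axis i 1 + axis i0 1"] by metis
    have e: "u *\<^sub>R (axis i 1 + axis i0 1) = t *\<^sub>R axis i 1 + t' *\<^sub>R (axis i0 1 :: real ^ 'r)"
      using sadd[OF b, of "axis i 1" "axis i0 1"] t by simp
    have "t = t'"
    proof (cases "i = i0")
      case True
      then have "t *\<^sub>R axis i 1 = t' *\<^sub>R (axis i 1 :: real ^ 'r)" using t by simp
      then have "(t *\<^sub>R axis i 1) $ i = (t' *\<^sub>R (axis i 1 :: real ^ 'r)) $ i" by simp
      then show ?thesis by (simp add: ax)
    next
      case False
      have "(u *\<^sub>R (axis i 1 + axis i0 1)) $ i = (t *\<^sub>R axis i 1 + t' *\<^sub>R (axis i0 1 :: real ^ 'r)) $ i"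
        "(u *\<^sub>R (axis i 1 + axis i0 1)) $ i0 = (t *\<^sub>R axis i 1 + t' *\<^sub>R (axis i0 1 :: real ^ 'r)) $ i0"
        using e by simp_all
      then show ?thesis using False by (simp add: ax)
    qed
    then show ?thesis using t by (simp add: l_def ax)
  qed
  have lnn: "l b >= 0" if b: "b \<in> B" "\<And>v. b v >= 0" for b
  proof -
    obtain v where "v \<in> S" "L (s b (axis i0 1)) = (b v / \<kappa> v) *\<^sub>R axis i0 1" using eig[OF b(1)] by blast
    then show ?thesis using b(2)[of v] \<kappa>(2)[of v] by (simp add: l_def ax)
  qed
  have ladd: "l (\<lambda>v. b v + b' v) = l b + l b'" if "b \<in> B" "b' \<in> B" for b b' using badd[OF that] by (simp add: l_def)
  \<comment> \<open>Otherwise each point of S has a nonnegative b, positive there, with l b = 0. A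
    sum of such b is positive on all of S and still has l b = 0, whereas l b is a value of b /
    \<open>\<kappa>\<close> on S.\<close>
  have "\<exists>v0\<in>S. \<forall>b\<in>B. (\<forall>u. b u >= 0) \<and> b v0 > 0 --> l b > 0"
  proof (rule ccontr)
    assume neg: "\<not> ?thesis"
    define B' where "B' = {b \<in> B. (\<forall>u. b u >= 0) \<and> l b = 0}"
    have "\<exists>b\<in>B'. b v > 0" if v: "v \<in> S" for v
    proof -
      obtain b where "b \<in> B" "\<forall>u. b u >= 0" "b v > 0" "\<not> l b > 0" using neg v by blast
      then show ?thesis using lnn[of b] by (auto simp: B'_def)
    qed
    then have "\<exists>b\<in>B'. \<forall>v\<in>S. b v > 0" by (intro compact_positive_sum[OF S]) (auto simp: B'_def Badd Bcont ladd)
    then obtain b where b: "b \<in> B" "l b = 0" "\<And>v. v \<in> S ==> b v > 0" by (auto simp: B'_def)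
    obtain v where v: "v \<in> S" "L (s b (axis i0 1)) = (b v / \<kappa> v) *\<^sub>R axis i0 1" using eig[OF b(1)] by blast
    then have "l b = b v / \<kappa> v" by (simp add: l_def ax)
    then show False using b(2) b(3)[OF v(1)] \<kappa>(2)[OF v(1)] by simp
  qed
  then obtain v0 where v0: "v0 \<in> S" "\<And>b. b \<in> B ==> (\<And>u. b u >= 0) ==> b v0 > 0 ==> l b > 0" by blast
  have "y x v0 = \<kappa> v0 *\<^sub>R L x" if x: "x \<in> C" for x
  proof -
    \<comment> \<open>Subtracting \<open>\<kappa>\<close> times \<open>L x\<close> reduces the claim
      to: if L z = 0, then z vanishes at v0.\<close>
    define z where "z = add x (scl (-1) (s \<kappa> (L x)))"
    have zC: "z \<in> C" unfolding z_def using x \<kappa>(1) by (intro add scl s)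
    have yz: "y z v = y x v - \<kappa> v *\<^sub>R L x" if "v \<in> S" for v
      unfolding z_def using x \<kappa>(1) that by (simp add: add scl s)
    have "L (s \<kappa> (L x)) = L x" using eig[OF \<kappa>(1), of "L x"] \<kappa>(2) by fastforce
    then have Lz: "L z = 0" unfolding z_def using x \<kappa>(1) by (simp add: add scl s)
    have "y z v0 = 0"
    proof (rule ccontr)
      assume "y z v0 \<noteq> 0"
      then obtain i where i: "y z v0 $ i \<noteq> 0" by (auto simp: vec_eq_iff)
      have "\<exists>j. j \<noteq> i"
      proof (rule ccontr)
        assume "\<nexists>j. j \<noteq> i"
        then have "(UNIV :: 'r set) = {i}" by auto
        then have "card (UNIV :: 'r set) = card {i}" by (rule arg_cong)
        then show False using card2 by simp
      qed
      then obtain j where j: "j \<noteq> i" by blast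
      have ci: "continuous_map (subtopology X S) euclideanreal (\<lambda>v. y z v $ k)" for k
        using continuous_map_compose[OF ycont[OF zC], of euclideanreal "\<lambda>a. a $ k"]
        by (simp add: comp_def continuous_on_component)
      have "openin (subtopology X S) {v \<in> S. y z v $ i \<in> - {0}}"
        using openin_continuous_map_preimage[OF ci[of i], of "- {0}"] SX by (simp add: Int_absorb1 open_Compl)
      then obtain N where N: "openin X N" "{v \<in> S. y z v $ i \<in> - {0}} = N \<inter> S" by (auto simp: openin_subtopology)
      then have "v0 \<in> N" using i v0(1) by auto
      then obtain b where b: "b \<in> B" "\<And>u. b u >= 0" "b v0 > 0" "\<And>u. u \<in> S - N ==> b u = 0"
        using bump[OF v0(1) N(1)] by blast
      have lb: "l b > 0" using v0(2) b by blast
      have kc: "continuous_map (subtopology X S) euclideanreal \<kappa>" by (rule Bcont[OF \<kappa>(1)])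
      have "continuous_map (subtopology X S) euclideanreal (\<lambda>v. y z v $ j / \<kappa> v)"
        using ci kc \<kappa>(2) SX by (intro continuous_map_real_divide) fastforce+
      then have "compactin euclideanreal ((\<lambda>v. y z v $ j / \<kappa> v) ` S)"
        using S(1) by (intro image_compactin[where X = "subtopology X S"]) (auto simp: compactin_subtopology)
      then have "bounded ((\<lambda>v. y z v $ j / \<kappa> v) ` S)" by (simp add: compact_imp_bounded)
      then obtain M where M: "\<And>v. v \<in> S ==> \<bar>y z v $ j / \<kappa> v\<bar> <= M" by (auto simp: bounded_iff)
      \<comment> \<open>Large enough that adding n times b*e_j to z contradicts \<open>van\<close>.
        At the point supplied by \<open>van\<close> the i-th component of z must be 0, so that point
        is outside N and b vanishes there; then the j-th component of z over \<open>\<kappa>\<close>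
        equals n times l b, which exceeds its bound M.\<close>
      obtain n :: nat where n: "M / l b < real n" using reals_Archimedean2 by blast
      define w where "w = add z (scl (real n) (s b (axis j 1)))"
      have wC: "w \<in> C" unfolding w_def using zC b(1) by (intro add scl s)
      have Lw: "L w = (real n * l b) *\<^sub>R axis j 1" unfolding w_def using zC b(1) by (simp add: add scl s Lz l)
      obtain v where v: "v \<in> S" "y w v = \<kappa> v *\<^sub>R L w" using van[OF wC] by blast
      have e: "y z v + (real n * b v) *\<^sub>R axis j 1 = (\<kappa> v * (real n * l b)) *\<^sub>R axis j 1"
        using v zC b(1) unfolding Lw by (simp add: w_def add scl s)
      then have "(y z v + (real n * b v) *\<^sub>R axis j 1) $ i = ((\<kappa> v * (real n * l b)) *\<^sub>R (axis j 1 :: real ^ 'r)) $ i" by simp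
      then have "y z v $ i = 0" using j by (simp add: ax)
      then have "v \<in> S - N" using v(1) N(2) by auto
      then have "b v = 0" by (rule b(4))
      then have "y z v $ j = \<kappa> v * (real n * l b)" using arg_cong[OF e, of "\<lambda>a. a $ j"] by (simp add: ax)
      then have "y z v $ j / \<kappa> v = real n * l b" using \<kappa>(2)[OF v(1)] by simp
      then have "real n * l b <= M" using M[OF v(1)] lb by simp
      then show False using n lb by (simp add: divide_less_eq)
    qed
    then show ?thesis using yz[OF v0(1)] by simp
  qed
  then show ?thesis using v0(1) by blast
qed

section \<open>A map of sections evaluated at one point\<close>

lemma section_map_value:
  assumes "linear_section_map F V E1 G W E2 f" "x \<in> compact_sections F V E1" "w \<in> topspace (mtop W)"
  shows "f x \<in> sections G W E2" "f x w \<in> fiber E2 w"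
  using assms by (auto simp: linear_section_map_def intro: sectionD)

lemma section_map_add:
  assumes "linear_section_map F V E1 G W E2 f" "x \<in> compact_sections F V E1" "y \<in> compact_sections F V E1" "w \<in> topspace (mtop W)"
  shows "f (section_add V E1 x y) w = fadd E2 (f x w) (f y w)"
  using assms by (auto simp: linear_section_map_def section_add_def)

lemma section_map_scale:
  assumes "linear_section_map F V E1 G W E2 f" "x \<in> compact_sections F V E1" "w \<in> topspace (mtop W)"
  shows "f (section_scale V E1 a x) w = fscale E2 a (f x w)"
  using assms by (auto simp: linear_section_map_def section_scale_def)

definition fiber_isomorphism ::
  "('v, 'e, 'r::finite) vbundle => 'v => ('w, 'e', 's::finite) vbundle => 'w => ('e => 'e') => bool" where
  "fiber_isomorphism E v E' w A \<longleftrightarrow> bij_betw A (fiber E v) (fiber E' w) \<and>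
     (\<forall>e\<in>fiber E v. \<forall>e'\<in>fiber E v. A (fadd E e e') = fadd E' (A e) (A e')) \<and>
     (\<forall>a. \<forall>e\<in>fiber E v. A (fscale E a e) = fscale E' a (A e))"

text \<open>Comparison with the sections \<open>\<kappa>\<close> times a identifies the fiber at w
  with the standard fiber; it is an isomorphism because the nonvanishing hypothesis makes it
  injective and the ranks agree.\<close>

lemma pointwise_form:
  fixes V :: "('v, 'm::euclidean_space) manifold" and W :: "('w, 'n::euclidean_space) manifold"
    and E1 :: "('v, 'e1, 'r::finite) vbundle" and E2 :: "('w, 'e2, 'r) vbundle"
  assumes V: "smooth_manifold dV V" and F: "admissible dV F"
    and E1: "smooth_vector_bundle V E1" and E2: "smooth_vector_bundle W E2"
    and f: "linear_section_map F V E1 G W E2 f" and w: "w \<in> topspace (mtop W)"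
    and S: "compactin (mtop V) S" "S \<noteq> {}" and U: "S \<subseteq> U" "trivial_bundle_on V E1 U"
    and nv: "\<And>x. x \<in> compact_sections F V E1 ==> (\<And>v. v \<in> S ==> x v \<noteq> fzero E1 v) ==> f x w \<noteq> fzero E2 w"
    and card: "CARD('r) = 1 ==> \<exists>v. S = {v}"
  obtains v A where "v \<in> topspace (mtop V)" "fiber_isomorphism E1 v E2 w A"
    "\<And>x. x \<in> compact_sections F V E1 ==> f x w = A (x v)"
proof -
  obtain \<psi> where \<psi>: "compatible_triv V E1 U \<psi>" using trivial_bundle_on_compatible[OF U(2)] .
  have T1: "trivialization (mtop V) E1 U \<psi>" using \<psi> by (simp add: compatible_triv_def)
  have Uo: "openin (mtop V) U" by (rule triv_openin[OF T1])
  have SV: "S \<subseteq> topspace (mtop V)" by (rule compactin_subset_topspace[OF S(1)])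
  obtain U2 \<psi>2 where t2: "(U2, \<psi>2) \<in> trivs E2" "w \<in> U2" using bundle_triv_exists[OF E2 w] .
  note T2 = bundle_triv[OF E2 t2(1)]
  let ?C = "compact_sections F V E1"
  define T where "T x = \<psi>2 (f x w)" for x
  have Tadd: "T (section_add V E1 x y) = T x + T y" if "x \<in> ?C" "y \<in> ?C" for x y
    unfolding T_def section_map_add[OF f that w] by (rule triv_add(2)[OF T2 t2(2) section_map_value(2)[OF f that(1) w] section_map_value(2)[OF f that(2) w]])
  have Tscl: "T (section_scale V E1 a x) = a *\<^sub>R T x" if "x \<in> ?C" for x a
    unfolding T_def section_map_scale[OF f that w] by (rule triv_scale(2)[OF T2 t2(2) section_map_value(2)[OF f that w]])
  have T0: "\<exists>v\<in>S. x v = fzero E1 v" if "x \<in> ?C" "T x = 0" for x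
    using nv[OF that(1)] that(2) triv_zero(3)[OF T2 t2(2) section_map_value(2)[OF f that(1) w]] unfolding T_def by blast
  note Cadd = compact_sections_add[OF V F E1] and Cscl = compact_sections_scale[OF V F E1]
  \<comment> \<open>Coefficients b for which b times a constant vector, in the trivialization over
    U, extends by zero to a compactly supported section.\<close>
  define B where "B = {b. smooth_fun V (topspace (mtop V)) b \<and>
      (\<exists>K. compactin (mtop V) K \<and> K \<subseteq> U \<and> (\<forall>v. v \<notin> K --> b v = (0::real)))}"
  define s where "s = frame_section V E1 U \<psi>"
  have sC: "s b a \<in> ?C" if "b \<in> B" for b a
    using that frame_section_compact(1)[OF V F E1 \<psi>] unfolding B_def s_def by blast
  have sv: "\<psi> (s b a v) = b v *\<^sub>R a" if "v \<in> S" for b a v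
    unfolding s_def by (rule frame_section_apply(2)[OF T1]) (use that U(1) in auto)
  have Badd: "(\<lambda>v. b v + b' v) \<in> B" if b: "b \<in> B" "b' \<in> B" for b b'
  proof -
    obtain K K' where K: "compactin (mtop V) K" "K \<subseteq> U" "\<And>v. v \<notin> K ==> b v = 0"
      "compactin (mtop V) K'" "K' \<subseteq> U" "\<And>v. v \<notin> K' ==> b' v = 0" using b unfolding B_def by blast
    have "smooth_fun V (topspace (mtop V)) (\<lambda>v. b v + b' v)"
      using b by (intro class_fun_add[of 0]) (auto simp: B_def)
    then show ?thesis unfolding B_def using K
      by (intro CollectI conjI exI[of _ "K \<union> K'"]) (auto intro: compactin_Un)
  qed
  have Bcont: "continuous_map (subtopology (mtop V) S) euclideanreal b" if b: "b \<in> B" for b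
  proof -
    have "smooth_fun V (topspace (mtop V)) b" using b by (simp add: B_def)
    from continuous_map_from_subtopology[OF class_fun_continuous[OF V openin_topspace this]] show ?thesis by simp
  qed
  have bump: "\<exists>b\<in>B. (\<forall>u. b u >= 0) \<and> b v > 0 \<and> (\<forall>u\<in>S - N. b u = 0)" if v: "v \<in> S" "openin (mtop V) N" "v \<in> N" for v N
  proof -
    have UN: "openin (mtop V) (U \<inter> N)" "v \<in> U \<inter> N" using Uo v U(1) by auto
    obtain b :: "'v => real" and K where b: "smooth_fun V (topspace (mtop V)) b" "\<And>u. b u >= 0" "b v > 0"
      "compactin (mtop V) K" "K \<subseteq> U \<inter> N" "\<And>u. u \<notin> K ==> b u = 0" by (rule smooth_fun_bump[OF V UN]) blast
    then have "b \<in> B" unfolding B_def by blast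
    then show ?thesis using b by blast
  qed
  have "\<exists>b\<in>{b \<in> B. \<forall>u. b u >= 0}. \<forall>v\<in>S. b v > 0"
  proof (rule compact_positive_sum[OF S])
    fix v assume "v \<in> S"
    then show "\<exists>b\<in>{b \<in> B. \<forall>u. b u >= 0}. b v > 0" using bump[OF _ openin_topspace] SV by blast
  qed (use Badd Bcont in auto)
  then obtain \<kappa> where \<kappa>: "\<kappa> \<in> B" "\<And>v. v \<in> S ==> \<kappa> v > 0" by blast
  \<comment> \<open>The comparison map from the standard fiber to itself, read in a trivialization
    of the target at w.\<close>
  define g where "g a = T (s \<kappa> a)" for a
  have "linear g"
  proof (rule linearI)
    fix a a'
    have "s \<kappa> (a + a') = section_add V E1 (s \<kappa> a) (s \<kappa> a')"
    proof
      fix v show "s \<kappa> (a + a') v = section_add V E1 (s \<kappa> a) (s \<kappa> a') v"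
        using frame_section_add[OF E1 T1, of v \<kappa> a a'] by (cases "v \<in> topspace (mtop V)") (simp_all add: s_def section_add_def frame_section_def)
    qed
    then show "g (a + a') = g a + g a'" unfolding g_def using Tadd[OF sC[OF \<kappa>(1)] sC[OF \<kappa>(1)]] by simp
  next
    fix t a
    have "s \<kappa> (t *\<^sub>R a) = section_scale V E1 t (s \<kappa> a)"
    proof
      fix v show "s \<kappa> (t *\<^sub>R a) v = section_scale V E1 t (s \<kappa> a) v"
        using frame_section_scale[OF E1 T1, of v \<kappa> "t *\<^sub>R a" t \<kappa> a] by (cases "v \<in> topspace (mtop V)") (simp_all add: s_def section_scale_def frame_section_def)
    qed
    then show "g (t *\<^sub>R a) = t *\<^sub>R g a" unfolding g_def using Tscl[OF sC[OF \<kappa>(1)]] by simp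
  qed
  \<comment> \<open>If the section \<open>\<kappa>\<close> times a is sent to 0 at w, it vanishes
    somewhere on S, where \<open>\<kappa>\<close> is positive.\<close>
  have "a = 0" if ga: "g a = 0" for a
  proof -
    obtain v where v: "v \<in> S" "s \<kappa> a v = fzero E1 v" using T0[OF sC[OF \<kappa>(1)]] ga unfolding g_def by blast
    then have "\<kappa> v *\<^sub>R a = 0" using sv[OF v(1), of \<kappa> a] triv_zero(2)[OF T1, of v] U(1) by auto
    then show ?thesis using \<kappa>(2)[OF v(1)] by simp
  qed
  then have gi: "inj g" using linear_injective_0[OF \<open>linear g\<close>] by blast
  then have gs: "surj g" using linear_injective_imp_surjective[OF \<open>linear g\<close>] by blast
  define L where "L x = inv g (T x)" for x
  have gL: "g (L x) = T x" for x unfolding L_def by (rule surj_f_inv_f[OF gs])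
  have Ladd: "L (section_add V E1 x y) = L x + L y" if "x \<in> ?C" "y \<in> ?C" for x y
    by (rule injD[OF gi]) (simp add: gL linear_add[OF \<open>linear g\<close>] Tadd that)
  have Lscl: "L (section_scale V E1 a x) = a *\<^sub>R L x" if "x \<in> ?C" for x a
    by (rule injD[OF gi]) (simp add: gL linear_cmul[OF \<open>linear g\<close>] Tscl that)
  have xf: "x v \<in> fiber E1 v" if "x \<in> ?C" "v \<in> S" for x v
    using compact_section_fiber[OF that(1)] SV that(2) by blast
  have yadd: "\<psi> (section_add V E1 x y v) = \<psi> (x v) + \<psi> (y v)" if "x \<in> ?C" "y \<in> ?C" "v \<in> S" for x y v
    using that SV U(1) triv_add(2)[OF T1, of v "x v" "y v"] xf by (simp add: section_add_def subset_iff)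
  have yscl: "\<psi> (section_scale V E1 a x v) = a *\<^sub>R \<psi> (x v)" if "x \<in> ?C" "v \<in> S" for x a v
    using that SV U(1) triv_scale(2)[OF T1, of v "x v"] xf by (simp add: section_scale_def subset_iff)
  \<comment> \<open>The section x minus \<open>\<kappa>\<close> times \<open>L x\<close> is sent to
    0 at w, by the choice of L as g inverse applied to T.\<close>
  have van: "\<exists>v\<in>S. \<psi> (x v) = \<kappa> v *\<^sub>R L x" if x: "x \<in> ?C" for x
  proof -
    let ?k = "s \<kappa> (L x)"
    let ?z = "section_add V E1 x (section_scale V E1 (-1) ?k)"
    note kC = sC[OF \<kappa>(1), of "L x"]
    have "T ?z = 0" using Tadd[OF x Cscl[OF kC]] Tscl[OF kC] gL[of x] by (simp add: g_def)
    then obtain v where v: "v \<in> S" "?z v = fzero E1 v" using T0[OF Cadd[OF x Cscl[OF kC]]] by blast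
    then have "\<psi> (?z v) = 0" using triv_zero(2)[OF T1] U(1) by auto
    then show ?thesis using v(1) yadd[OF x Cscl[OF kC] v(1)] yscl[OF kC v(1)] sv[OF v(1)] by auto
  qed
  have ycont: "continuous_map (subtopology (mtop V) S) euclidean (\<lambda>v. \<psi> (x v))" if "x \<in> ?C" for x
    using continuous_map_from_subtopology_mono[OF compatible_triv_continuous[OF V E1 \<psi>] U(1)] that by (auto simp: compact_sections_def)
  have "\<exists>v\<in>S. \<forall>x\<in>?C. \<psi> (x v) = \<kappa> v *\<^sub>R L x"
    by (rule support_point_core[where C = ?C and y = "\<lambda>x v. \<psi> (x v)" and L = L and B = B and s = s and \<kappa> = \<kappa>
        and add = "section_add V E1" and scl = "section_scale V E1",
        OF S card Cadd yadd Ladd Cscl yscl Lscl sC sv Badd Bcont bump ycont \<kappa> van])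
  then obtain v where v: "v \<in> S" "\<And>x. x \<in> ?C ==> \<psi> (x v) = \<kappa> v *\<^sub>R L x" by blast
  have vU: "v \<in> U" and vV: "v \<in> topspace (mtop V)" using v(1) U(1) SV by auto
  have kv: "\<kappa> v > 0" by (rule \<kappa>(2)[OF v(1)])
  \<comment> \<open>Dividing the components of x at v by \<open>\<kappa> v\<close> recovers
    \<open>L x\<close>; then g and the trivialization at w return the value of f x.\<close>
  define A where "A e = inv_into (fiber E2 w) \<psi>2 (g ((1 / \<kappa> v) *\<^sub>R \<psi> e))" for e
  have "f x w = A (x v)" if x: "x \<in> ?C" for x
  proof -
    have "(1 / \<kappa> v) *\<^sub>R \<psi> (x v) = L x" using v(2)[OF x] kv by simp
    then have "A (x v) = inv_into (fiber E2 w) \<psi>2 (\<psi>2 (f x w))" by (simp add: A_def gL) (simp add: T_def)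
    then show ?thesis using triv_inv(3)[OF T2 t2(2) section_map_value(2)[OF f x w]] by simp
  qed
  moreover have "fiber_isomorphism E1 v E2 w A" unfolding fiber_isomorphism_def
  proof (intro conjI ballI allI)
    have "bij_betw (\<lambda>a. (1 / \<kappa> v) *\<^sub>R a) UNIV (UNIV :: (real ^ 'r) set)"
      using kv by (intro bij_betwI[where g = "\<lambda>a. \<kappa> v *\<^sub>R a"]) auto
    moreover have "bij_betw g UNIV UNIV" using gi gs by (simp add: bij_betw_def)
    ultimately have "bij_betw (inv_into (fiber E2 w) \<psi>2 \<circ> (g \<circ> ((\<lambda>a. (1 / \<kappa> v) *\<^sub>R a) \<circ> \<psi>))) (fiber E1 v) (fiber E2 w)"
      using triv_bij[OF T1 vU] bij_betw_inv_into[OF triv_bij[OF T2 t2(2)]] by (blast intro: bij_betw_trans)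
    then show "bij_betw A (fiber E1 v) (fiber E2 w)" by (simp add: A_def[abs_def] comp_def)
    show "A (fadd E1 e e') = fadd E2 (A e) (A e')" if "e \<in> fiber E1 v" "e' \<in> fiber E1 v" for e e'
      using triv_add(2)[OF T1 vU that] by (simp add: A_def scaleR_add_right linear_add[OF \<open>linear g\<close>] triv_inv_linear(1)[OF T2 t2(2)])
    show "A (fscale E1 a e) = fscale E2 a (A e)" if "e \<in> fiber E1 v" for a e
      using triv_scale(2)[OF T1 vU that] linear_cmul[OF \<open>linear g\<close>, of a "(1 / \<kappa> v) *\<^sub>R \<psi> e"]
      by (simp add: A_def triv_inv_linear(2)[OF T2 t2(2), symmetric] mult.commute)
  qed
  ultimately show ?thesis using that vV by blast
qed

section \<open>Regularity of the representation\<close>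

lemma fiber_isomorphism_zero:
  assumes E: "vector_bundle F M E" "v \<in> topspace (mtop M)" and E': "vector_bundle F' M' E'" "w \<in> topspace (mtop M')"
    and A: "fiber_isomorphism E v E' w A" and e: "e \<in> fiber E v" shows "A e = fzero E' w \<longleftrightarrow> e = fzero E v"
proof -
  note z = fiber_zero[OF E]
  have inj: "inj_on A (fiber E v)" and Af: "A (fzero E v) \<in> fiber E' w"
    using A z(1) by (auto simp: fiber_isomorphism_def bij_betw_def)
  have "A (fscale E 0 (fzero E v)) = fscale E' 0 (A (fzero E v))" using A z(1) by (simp add: fiber_isomorphism_def)
  then have "A (fzero E v) = fzero E' w" using z(3)[of 0] fiber_zero(4)[OF E' Af] by simp
  then show ?thesis using inj_onD[OF inj _ e z(1)] by auto
qed

lemma pullback_fiber: "w \<in> topspace X ==> fiber (pullback_bundle X \<phi> E) w = Pair w ` fiber E (\<phi> w)"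
  by (auto simp: fiber_def pullback_bundle_def)

lemma fiber_isomorphism_pullback:
  assumes "w \<in> topspace X" shows "bij_betw \<gamma> (fiber (pullback_bundle X \<phi> E) w) (fiber E' w) \<and>
     (\<forall>e\<in>fiber (pullback_bundle X \<phi> E) w. \<forall>e'\<in>fiber (pullback_bundle X \<phi> E) w.
        \<gamma> (fadd (pullback_bundle X \<phi> E) e e') = fadd E' (\<gamma> e) (\<gamma> e')) \<and>
     (\<forall>a. \<forall>e\<in>fiber (pullback_bundle X \<phi> E) w. \<gamma> (fscale (pullback_bundle X \<phi> E) a e) = fscale E' a (\<gamma> e)) \<longleftrightarrow>
     fiber_isomorphism E (\<phi> w) E' w (\<lambda>e. \<gamma> (w, e))"
proof -
  have "bij_betw \<gamma> (Pair w ` fiber E (\<phi> w)) (fiber E' w) \<longleftrightarrow> bij_betw (\<lambda>e. \<gamma> (w, e)) (fiber E (\<phi> w)) (fiber E' w)"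
    using bij_betw_comp_iff[of "Pair w" "fiber E (\<phi> w)" "Pair w ` fiber E (\<phi> w)" \<gamma> "fiber E' w"]
    by (simp add: comp_def inj_on_imp_bij_betw[of "Pair w"] inj_on_def)
  then show ?thesis unfolding fiber_isomorphism_def pullback_fiber[OF assms] by (simp add: pullback_bundle_def)
qed

text \<open>Continuity of \<open>\<phi>\<close> is established first, since the class conditions
  live on its preimages. Next, smooth functions composed with \<open>\<phi>\<close> are shown to be
  of class G, which gives the chart components of \<open>\<phi>\<close> and the denominators for the
  matrix entries of the isomorphism.\<close>

lemma pointwise_form_imp_bundle_map:
  fixes V :: "('v, 'm::euclidean_space) manifold" and W :: "('w, 'n::euclidean_space) manifold"
    and E1 :: "('v, 'e1, 'r::finite) vbundle" and E2 :: "('w, 'e2, 'r) vbundle"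
  assumes V: "smooth_manifold dV V" and W: "smooth_manifold dW W" and F: "admissible dV F" and G: "admissible dW G"
    and E1: "smooth_vector_bundle V E1" and E2: "smooth_vector_bundle W E2"
    and f: "linear_section_map F V E1 G W E2 f" and \<phi>V: "\<And>w. w \<in> topspace (mtop W) ==> \<phi> w \<in> topspace (mtop V)"
    and A: "\<And>w. w \<in> topspace (mtop W) ==> fiber_isomorphism E1 (\<phi> w) E2 w (A w)"
    and fA: "\<And>w x. w \<in> topspace (mtop W) ==> x \<in> compact_sections F V E1 ==> f x w = A w (x (\<phi> w))"
  shows "class_map G W V \<phi>"
    "bundle_isomorphism G W (pullback_bundle (mtop W) \<phi> E1) E2 (\<lambda>(w, e). A w e)"
proof -
  let ?W = "topspace (mtop W)"
  let ?V = "topspace (mtop V)"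
  have bumpE: thesis
    if "w \<in> ?W" "openin (mtop V) D" "\<phi> w \<in> D" "(U, \<psi>) \<in> trivs E1" "\<phi> w \<in> U"
      and *: "\<And>b K. smooth_fun V ?V b ==> b (\<phi> w) > (0::real) ==> compactin (mtop V) K ==> K \<subseteq> D ==>
        K \<subseteq> U ==> (\<And>v. v \<notin> K ==> b v = 0) ==> thesis" for w D U \<psi> thesis
  proof -
    have DU: "openin (mtop V) (D \<inter> U)" "\<phi> w \<in> D \<inter> U" using that triv_openin[OF bundle_triv[OF E1]] by auto
    obtain b :: "'v => real" and K where "smooth_fun V ?V b" "\<And>u. b u >= 0" "b (\<phi> w) > 0"
      "compactin (mtop V) K" "K \<subseteq> D \<inter> U" "\<And>u. u \<notin> K ==> b u = 0" by (rule smooth_fun_bump[OF V DU]) blast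
    then show thesis using *[of b K] by blast
  qed
  have Azero: "A w e = fzero E2 w \<longleftrightarrow> e = fzero E1 (\<phi> w)" if "w \<in> ?W" "e \<in> fiber E1 (\<phi> w)" for w e
    by (rule fiber_isomorphism_zero[OF E1 \<phi>V[OF that(1)] E2 that(1) A[OF that(1)] that(2)])
  have fr0: "frame_section V E1 U \<psi> b a (\<phi> w) \<noteq> fzero E1 (\<phi> w)"
    if "(U, \<psi>) \<in> trivs E1" "\<phi> w \<in> U" "b (\<phi> w) > 0" "a \<noteq> 0" for w U \<psi> b a
    using frame_section_apply(2)[OF bundle_triv[OF E1 that(1)] that(2), of b a] that
      triv_zero(2)[OF bundle_triv[OF E1 that(1)] that(2)] by auto
  \<comment> \<open>For a section x supported in D and nonzero at the image of w, the points where f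
    x is nonzero form an open neighbourhood of w, which \<open>\<phi>\<close> maps into D.\<close>
  have "openin (mtop W) {w \<in> ?W. \<phi> w \<in> D}" if D: "openin (mtop V) D" for D
  proof (rule openin_subopen[THEN iffD2], intro ballI)
    fix w assume "w \<in> {w \<in> ?W. \<phi> w \<in> D}"
    then have w: "w \<in> ?W" "\<phi> w \<in> D" by auto
    obtain U \<psi> where t: "(U, \<psi>) \<in> trivs E1" "\<phi> w \<in> U" using bundle_triv_exists[OF E1 \<phi>V[OF w(1)]] .
    obtain U2 \<psi>2 where t2: "(U2, \<psi>2) \<in> trivs E2" "w \<in> U2" using bundle_triv_exists[OF E2 w(1)] .
    obtain b K where b: "smooth_fun V ?V b" "b (\<phi> w) > (0::real)" "compactin (mtop V) K" "K \<subseteq> D" "K \<subseteq> U"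
      "\<And>v. v \<notin> K ==> b v = 0" by (rule bumpE[OF w(1) D w(2) t]) blast
    define x where "x = frame_section V E1 U \<psi> b (1 :: real ^ 'r)"
    note fs = frame_section_compact[OF V F E1 bundle_triv_compatible[OF E1 t(1)] b(1,3,5,6), where a = 1, folded x_def]
    note T2 = bundle_triv[OF E2 t2(1)]
    have U2W: "U2 \<subseteq> ?W" by (rule openin_subset[OF triv_openin[OF T2]])
    let ?R = "{u \<in> U2. \<psi>2 (f x u) \<in> - {0}}"
    have "openin (subtopology (mtop W) U2) ?R"
      using openin_continuous_map_preimage[OF section_continuous[OF W E2 section_map_value(1)[OF f fs(1) w(1)] t2(1)], of "- {0}"] U2W
      by (simp add: Int_absorb1 open_Compl)
    then have "openin (mtop W) ?R" by (rule openin_trans_full[OF _ triv_openin[OF T2]])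
    moreover have nz: "\<psi>2 (f x u) = 0 \<longleftrightarrow> x (\<phi> u) = fzero E1 (\<phi> u)" if "u \<in> U2" for u
      using triv_zero(3)[OF T2 that section_map_value(2)[OF f fs(1)]] Azero[of u "x (\<phi> u)"] that U2W
        compact_section_fiber[OF fs(1) \<phi>V[of u]] fA[OF _ fs(1)] by auto
    moreover have "w \<in> ?R" using t2(2) nz[OF t2(2)] fr0[where b = b and w = w and a = 1, OF t b(2)] by (simp add: x_def)
    moreover have "?R \<subseteq> {w \<in> ?W. \<phi> w \<in> D}"
    proof
      fix u assume "u \<in> ?R"
      then have u: "u \<in> U2" "\<psi>2 (f x u) \<notin> {0}" by auto
      then have uW: "u \<in> ?W" using U2W by blast
      have "\<phi> u \<in> K" using nz[OF u(1)] u(2) fs(3)[of "\<phi> u"] \<phi>V[OF uW] by auto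
      then show "u \<in> {w \<in> ?W. \<phi> w \<in> D}" using b(4) uW by blast
    qed
    ultimately show "\<exists>T. openin (mtop W) T \<and> w \<in> T \<and> T \<subseteq> {w \<in> ?W. \<phi> w \<in> D}" by blast
  qed
  note open\<phi> = this
  then have cont: "continuous_map (mtop W) (mtop V) \<phi>" using \<phi>V by (auto simp: continuous_map_def)
  \<comment> \<open>Multiplying a section by a multiplies its image under f by a composed with
    \<open>\<phi>\<close>, so this composition is a quotient of components of two sections of class
    G.\<close>
  have ratio: "class_fun G W {w \<in> ?W. \<phi> w \<in> D} (\<lambda>w. a (\<phi> w))"
    if D: "openin (mtop V) D" and a: "smooth_fun V D a" for D and a :: "'v => real"
  proof (rule class_fun_local[OF W G open\<phi>[OF D]])
    fix w assume "w \<in> {w \<in> ?W. \<phi> w \<in> D}"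
    then have w: "w \<in> ?W" "\<phi> w \<in> D" by auto
    obtain U \<psi> where t: "(U, \<psi>) \<in> trivs E1" "\<phi> w \<in> U" using bundle_triv_exists[OF E1 \<phi>V[OF w(1)]] .
    obtain U2 \<psi>2 where t2: "(U2, \<psi>2) \<in> trivs E2" "w \<in> U2" using bundle_triv_exists[OF E2 w(1)] .
    obtain b K where b: "smooth_fun V ?V b" "b (\<phi> w) > (0::real)" "compactin (mtop V) K" "K \<subseteq> D" "K \<subseteq> U"
      "\<And>v. v \<notin> K ==> b v = 0" by (rule bumpE[OF w(1) D w(2) t]) blast
    have DV: "D \<subseteq> ?V" by (rule openin_subset[OF D])
    have ab: "smooth_fun V ?V (\<lambda>v. b v *\<^sub>R a v)"
    proof (rule class_fun_extend_zero[OF V _ D openin_topspace _ b(3) _ b(4)])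
      show "smooth_fun V (?V \<inter> D) (\<lambda>v. b v *\<^sub>R a v)"
        using DV D a by (intro smooth_fun_scaleR[OF V] class_fun_subset[OF b(1)]) (auto simp: Int_absorb1)
    qed (use b(6) in auto)
    define x where "x = frame_section V E1 U \<psi> b (1 :: real ^ 'r)"
    define y where "y = frame_section V E1 U \<psi> (\<lambda>v. b v *\<^sub>R a v) (1 :: real ^ 'r)"
    have xC: "x \<in> compact_sections F V E1"
      unfolding x_def by (rule frame_section_compact(1)[OF V F E1 bundle_triv_compatible[OF E1 t(1)] b(1,3,5,6)])
    have yC: "y \<in> compact_sections F V E1"
      unfolding y_def by (rule frame_section_compact(1)[OF V F E1 bundle_triv_compatible[OF E1 t(1)] ab b(3,5)]) (simp add: b(6))
    note T2 = bundle_triv[OF E2 t2(1)]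
    have U2W: "U2 \<subseteq> ?W" by (rule openin_subset[OF triv_openin[OF T2]])
    have yx: "\<psi>2 (f y u) = a (\<phi> u) *\<^sub>R \<psi>2 (f x u)" if u: "u \<in> U2" for u
    proof -
      have uW: "u \<in> ?W" using u U2W by blast
      have "y (\<phi> u) = fscale E1 (a (\<phi> u)) (x (\<phi> u))"
        unfolding x_def y_def by (rule frame_section_scale[OF E1 bundle_triv[OF E1 t(1)] \<phi>V[OF uW]]) (simp add: mult.commute)
      then have "f y u = fscale E2 (a (\<phi> u)) (f x u)"
        using A[OF uW] compact_section_fiber[OF xC \<phi>V[OF uW]] fA[OF uW] xC yC by (simp add: fiber_isomorphism_def)
      then show ?thesis using triv_scale(2)[OF T2 u section_map_value(2)[OF f xC uW]] by simp
    qed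
    have "\<psi>2 (f x w) \<noteq> 0"
      using triv_zero(3)[OF T2 t2(2) section_map_value(2)[OF f xC w(1)]] Azero[OF w(1) compact_section_fiber[OF xC \<phi>V[OF w(1)]]]
        fA[OF w(1) xC] fr0[where b = b and w = w and a = 1, OF t b(2)] by (simp add: x_def)
    \<comment> \<open>One component of the denominator that is nonzero at w is fixed; the quotient
      is formed on the open set where it stays nonzero.\<close>
    then obtain k where k: "\<psi>2 (f x w) $ k \<noteq> 0" by (auto simp: vec_eq_iff)
    have cf: "class_fun G W U2 (\<lambda>u. \<psi>2 (f z u) $ k)" if "z \<in> compact_sections F V E1" for z
      by (rule class_fun_linear[OF G bounded_linear_vec_nth section_class[OF section_map_value(1)[OF f that w(1)] t2(1)]])
    let ?R = "{u \<in> U2. \<psi>2 (f x u) $ k \<in> - {0}}"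
    have "openin (subtopology (mtop W) U2) ?R"
      using openin_continuous_map_preimage[OF class_fun_continuous[OF W triv_openin[OF T2] cf[OF xC]], of "- {0}"] U2W
      by (simp add: Int_absorb1 open_Compl)
    then have R: "openin (mtop W) ?R" by (rule openin_trans_full[OF _ triv_openin[OF T2]])
    have DR: "openin (mtop W) ({w \<in> ?W. \<phi> w \<in> D} \<inter> ?R)" using open\<phi>[OF D] R by blast
    have "class_fun G W ({w \<in> ?W. \<phi> w \<in> D} \<inter> ?R) (\<lambda>u. \<psi>2 (f y u) $ k / \<psi>2 (f x u) $ k)"
      by (rule class_fun_divide[OF W G DR class_fun_subset[OF cf[OF yC]] class_fun_subset[OF cf[OF xC]]]) auto
    then have "class_fun G W ({w \<in> ?W. \<phi> w \<in> D} \<inter> ?R) (\<lambda>w. a (\<phi> w))" by (rule class_fun_cong[OF W]) (simp add: yx)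
    then show "\<exists>R. openin (mtop W) R \<and> w \<in> R \<and> class_fun G W ({w \<in> ?W. \<phi> w \<in> D} \<inter> R) (\<lambda>w. a (\<phi> w))"
      using R t2(2) k by (intro exI[of _ ?R]) auto
  qed
  show "class_map G W V \<phi>" unfolding class_map_def
  proof (intro conjI cont, clarify)
    fix U c assume c: "(U, c) \<in> charts V"
    note Uo = chart_openin[OF V c]
    show "class_fun G W {w \<in> ?W. \<phi> w \<in> U} (c \<circ> \<phi>)"
    proof (rule class_fun_componentwise[OF W G open\<phi>[OF Uo]])
      fix k :: 'm
      show "class_fun G W {w \<in> ?W. \<phi> w \<in> U} (\<lambda>w. (c \<circ> \<phi>) w \<bullet> k)"
        using ratio[OF Uo smooth_fun_chart[OF V c smooth_on_bounded_linear[OF bounded_linear_inner_left[of k]]]] by simp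
    qed
  qed
  let ?P = "pullback_bundle (mtop W) \<phi> E1"
  let ?\<gamma> = "\<lambda>(w, e). A w e"
  have iso: "fiber_isomorphism E1 (\<phi> w) E2 w (\<lambda>e. ?\<gamma> (w, e))" if "w \<in> ?W" for w using A[OF that] by simp
  \<comment> \<open>Column j of the matrix consists of the components of the image of b*e_j, divided
    by b composed with \<open>\<phi>\<close>; the divisor is of class G by
    \<open>ratio\<close>.\<close>
  have mat: "class_fun G W ({w \<in> ?W. \<phi> w \<in> U} \<inter> U2) (\<lambda>w. matrix (\<psi>2 \<circ> ?\<gamma> \<circ> inv_into (fiber ?P w) (\<psi> \<circ> snd)))"
    if t: "(U, \<psi>) \<in> trivs E1" and t2: "(U2, \<psi>2) \<in> trivs E2" for U \<psi> U2 \<psi>2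
  proof -
    note T1 = bundle_triv[OF E1 t] and T2 = bundle_triv[OF E2 t2]
    let ?Q = "{w \<in> ?W. \<phi> w \<in> U} \<inter> U2"
    have Qo: "openin (mtop W) ?Q" using open\<phi>[OF triv_openin[OF T1]] triv_openin[OF T2] by blast
    have inv: "inv_into (fiber ?P w) (\<psi> \<circ> snd) a = (w, inv_into (fiber E1 (\<phi> w)) \<psi> a)" if "w \<in> ?Q" for w a
    proof (rule inv_into_f_eq)
      have w: "w \<in> ?W" "\<phi> w \<in> U" using that by auto
      show "inj_on (\<psi> \<circ> snd) (fiber ?P w)"
        unfolding pullback_fiber[OF w(1)] using triv_inj[OF T1 w(2)] by (auto simp: inj_on_def)
      show "(w, inv_into (fiber E1 (\<phi> w)) \<psi> a) \<in> fiber ?P w"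
        unfolding pullback_fiber[OF w(1)] using triv_inv(1)[OF T1 w(2)] by blast
      show "(\<psi> \<circ> snd) (w, inv_into (fiber E1 (\<phi> w)) \<psi> a) = a" using triv_inv(2)[OF T1 w(2)] by simp
    qed
    show ?thesis
    proof (rule class_fun_componentwise[OF W G Qo])
      fix B :: "real ^ 'r ^ 'r" assume "B \<in> Basis"
      then obtain i j where B: "B = axis i (axis j 1)" by (auto simp: Basis_vec_def)
      have Bc: "matrix (\<psi>2 \<circ> ?\<gamma> \<circ> inv_into (fiber ?P w) (\<psi> \<circ> snd)) \<bullet> B =
          \<psi>2 (A w (inv_into (fiber E1 (\<phi> w)) \<psi> (axis j 1))) $ i" if "w \<in> ?Q" for w
        by (simp add: B inner_axis matrix_def inv[OF that])
      show "class_fun G W ?Q (\<lambda>w. matrix (\<psi>2 \<circ> ?\<gamma> \<circ> inv_into (fiber ?P w) (\<psi> \<circ> snd)) \<bullet> B)"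
      proof (rule class_fun_local[OF W G Qo])
        fix w assume w: "w \<in> ?Q"
        then have wW: "w \<in> ?W" "\<phi> w \<in> U" by auto
        obtain b K where b: "smooth_fun V ?V b" "b (\<phi> w) > (0::real)" "compactin (mtop V) K" "K \<subseteq> ?V" "K \<subseteq> U"
          "\<And>v. v \<notin> K ==> b v = 0" by (rule bumpE[OF wW(1) openin_topspace \<phi>V[OF wW(1)] t wW(2)]) blast
        define x where "x = frame_section V E1 U \<psi> b (axis j 1)"
        have xC: "x \<in> compact_sections F V E1"
          unfolding x_def by (rule frame_section_compact(1)[OF V F E1 bundle_triv_compatible[OF E1 t] b(1,3,5,6)])
        have bp: "class_fun G W ?W (\<lambda>w. b (\<phi> w))"
          using class_fun_subset[OF ratio[OF openin_topspace b(1)], of ?W] \<phi>V by auto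
        let ?R = "{u \<in> ?W. b (\<phi> u) \<in> - {0}}"
        have R: "openin (mtop W) ?R"
          using openin_continuous_map_preimage[OF class_fun_continuous[OF W openin_topspace bp], of "- {0}"]
          by (simp add: open_Compl)
        have QR: "openin (mtop W) (?Q \<inter> ?R)" using Qo R by blast
        have "class_fun G W (?Q \<inter> ?R) (\<lambda>u. \<psi>2 (f x u) $ i / b (\<phi> u))"
        proof (rule class_fun_divide[OF W G QR])
          show "class_fun G W (?Q \<inter> ?R) (\<lambda>u. \<psi>2 (f x u) $ i)"
            by (rule class_fun_subset[OF class_fun_linear[OF G bounded_linear_vec_nth section_class[OF section_map_value(1)[OF f xC wW(1)] t2]]]) auto
          show "class_fun G W (?Q \<inter> ?R) (\<lambda>u. b (\<phi> u))" by (rule class_fun_subset[OF bp]) auto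
        qed auto
        then have "class_fun G W (?Q \<inter> ?R) (\<lambda>w. matrix (\<psi>2 \<circ> ?\<gamma> \<circ> inv_into (fiber ?P w) (\<psi> \<circ> snd)) \<bullet> B)"
        proof (rule class_fun_cong[OF W])
          fix u assume u: "u \<in> ?Q \<inter> ?R"
          then have uW: "u \<in> ?W" "\<phi> u \<in> U" "u \<in> U2" "b (\<phi> u) \<noteq> 0" by auto
          let ?e = "inv_into (fiber E1 (\<phi> u)) \<psi> (axis j 1)"
          note e = triv_inv(1)[OF T1 uW(2), of "axis j 1"]
          have Ae: "A u ?e \<in> fiber E2 u" using A[OF uW(1)] e by (auto simp: fiber_isomorphism_def bij_betw_def)
          have "x (\<phi> u) = fscale E1 (b (\<phi> u)) ?e"
            unfolding x_def frame_section_apply(1)[OF T1 uW(2)] by (rule triv_inv_linear(2)[OF T1 uW(2)])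
          then have "f x u = fscale E2 (b (\<phi> u)) (A u ?e)"
            using A[OF uW(1)] e fA[OF uW(1) xC] by (simp add: fiber_isomorphism_def)
          then have "\<psi>2 (f x u) = b (\<phi> u) *\<^sub>R \<psi>2 (A u ?e)" using triv_scale(2)[OF T2 uW(3) Ae] by simp
          moreover have "u \<in> ?Q" using u by blast
          ultimately show "\<psi>2 (f x u) $ i / b (\<phi> u) = matrix (\<psi>2 \<circ> ?\<gamma> \<circ> inv_into (fiber ?P u) (\<psi> \<circ> snd)) \<bullet> B"
            using uW(4) by (simp only: Bc) simp
        qed
        then show "\<exists>R. openin (mtop W) R \<and> w \<in> R \<and> class_fun G W (?Q \<inter> R)
            (\<lambda>w. matrix (\<psi>2 \<circ> ?\<gamma> \<circ> inv_into (fiber ?P w) (\<psi> \<circ> snd)) \<bullet> B)"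
          using R wW(1) b(2) by (intro exI[of _ ?R]) auto
      qed
    qed
  qed
  show "bundle_isomorphism G W ?P E2 ?\<gamma>" unfolding bundle_isomorphism_def bundle_morphism_def
  proof (intro conjI ballI)
    fix w assume w: "w \<in> ?W"
    note P = fiber_isomorphism_pullback[OF w, of ?\<gamma> \<phi> E1 E2, THEN iffD2, OF iso[OF w]]
    show "?\<gamma> ` fiber ?P w \<subseteq> fiber E2 w" using P by (auto simp: bij_betw_def)
    show "bij_betw ?\<gamma> (fiber ?P w) (fiber E2 w)" using P by blast
    show "\<forall>a. \<forall>e\<in>fiber ?P w. ?\<gamma> (fscale ?P a e) = fscale E2 a (?\<gamma> e)" using P by blast
    show "?\<gamma> (fadd ?P e e') = fadd E2 (?\<gamma> e) (?\<gamma> e')" if "e \<in> fiber ?P w" "e' \<in> fiber ?P w" for e e'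
      using P that by blast
  next
    fix i assume "i \<in> trivs ?P"
    then obtain U \<psi> where i: "i = ({w \<in> ?W. \<phi> w \<in> U}, \<psi> \<circ> snd)" "(U, \<psi>) \<in> trivs E1" by (auto simp: pullback_bundle_def)
    show "case i of (U, \<psi>) => \<forall>(U', \<psi>')\<in>trivs E2. class_fun G W (U \<inter> U') (\<lambda>w. matrix (\<psi>' \<circ> ?\<gamma> \<circ> inv_into (fiber ?P w) \<psi>))"
      using mat[OF i(2)] unfolding i(1) by blast
  qed
qed

text \<open>A bump section near v shows that v is a support point; any other point is separated from
  v by disjoint open sets, and a section supported in the one not containing v vanishes at
  v.\<close>

lemma support_points_singleton:
  fixes V :: "('v, 'm::euclidean_space) manifold" and W :: "('w, 'n::euclidean_space) manifold"
    and E1 :: "('v, 'e1, 'r::finite) vbundle" and E2 :: "('w, 'e2, 's::finite) vbundle"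
  assumes V: "smooth_manifold dV V" and F: "admissible dV F"
    and E1: "smooth_vector_bundle V E1" and v: "v \<in> topspace (mtop V)"
    and fv: "\<And>x. x \<in> compact_sections F V E1 ==> f x w = fzero E2 w \<longleftrightarrow> x v = fzero E1 v"
  shows "support_points F V E1 E2 f w = {v}"
proof -
  let ?V = "topspace (mtop V)"
  have "v \<in> support_points F V E1 E2 f w" unfolding support_points_def
  proof (intro CollectI conjI v allI impI, elim conjE)
    fix Q assume Q: "openin (mtop V) Q" "v \<in> Q"
    obtain U \<psi> where t: "(U, \<psi>) \<in> trivs E1" "v \<in> U" using bundle_triv_exists[OF E1 v] .
    note T = bundle_triv[OF E1 t(1)]
    have QU: "openin (mtop V) (Q \<inter> U)" "v \<in> Q \<inter> U" using Q t triv_openin[OF T] by auto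
    obtain b :: "'v => real" and K where b: "smooth_fun V ?V b" "\<And>u. b u >= 0" "b v > 0"
      "compactin (mtop V) K" "K \<subseteq> Q \<inter> U" "\<And>u. u \<notin> K ==> b u = 0" by (rule smooth_fun_bump[OF V QU]) blast
    have KU: "K \<subseteq> U" using b(5) by blast
    note x = frame_section_compact[OF V F E1 bundle_triv_compatible[OF E1 t(1)] b(1,4) KU b(6), where a = 1]
    have "frame_section V E1 U \<psi> b 1 v \<noteq> fzero E1 v"
      using frame_section_apply(2)[OF T t(2), of b 1] triv_zero(2)[OF T t(2)] b(3) by auto
    then show "\<exists>x\<in>compact_sections F V E1. section_support V E1 x \<subseteq> Q \<and> f x w \<noteq> fzero E2 w"
      using x(1,2) b(5) fv[OF x(1)] by blast
  qed
  moreover have "u = v" if u: "u \<in> support_points F V E1 E2 f w" for u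
  proof (rule ccontr)
    assume "u \<noteq> v"
    moreover have "u \<in> ?V" using u by (simp add: support_points_def)
    ultimately obtain Q R where QR: "openin (mtop V) Q" "openin (mtop V) R" "u \<in> Q" "v \<in> R" "disjnt Q R"
      using V v unfolding smooth_manifold_def Hausdorff_space_def by metis
    then obtain x where x: "x \<in> compact_sections F V E1" "section_support V E1 x \<subseteq> Q" "f x w \<noteq> fzero E2 w"
      using u unfolding support_points_def by blast
    have "{u \<in> ?V. x u \<noteq> fzero E1 u} \<subseteq> section_support V E1 x"
      unfolding section_support_def by (rule closure_of_subset) auto
    then have "x v = fzero E1 v" using v x(2) QR(4,5) unfolding disjnt_def by blast
    then show False using fv[OF x(1)] x(3) by blast
  qed
  ultimately show ?thesis by blast
qed

theorem theorem10p2: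
  fixes V :: "('v, 'm::euclidean_space) manifold"
    and W :: "('w, 'n::euclidean_space) manifold"
    and E1 :: "('v, 'e1, 'r::finite) vbundle"
    and E2 :: "('w, 'e2, 'r) vbundle"
    and F G :: smoothness
    and dV dW :: nat
    and f :: "('v \<Rightarrow> 'e1) \<Rightarrow> 'w \<Rightarrow> 'e2"
  assumes "smooth_manifold dV V" and "smooth_manifold dW W"
    and "admissible dV F" and "admissible dW G"
    and "smooth_vector_bundle V E1" and "smooth_vector_bundle W E2"
    and "linear_section_map F V E1 G W E2 f"
  shows
    "(\<forall>w\<in>topspace (mtop W).
        support_points F V E1 E2 f w \<noteq> {} \<and>
        compactin (mtop V) (support_points F V E1 E2 f w) \<and>
        (\<exists>U. openin (mtop V) U \<and> support_points F V E1 E2 f w \<subseteq> U \<and> trivial_bundle_on V E1 U) \<and>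
        (\<forall>x\<in>compact_sections F V E1.
           (\<forall>v\<in>support_points F V E1 E2 f w. x v \<noteq> fzero E1 v) \<longrightarrow> f x w \<noteq> fzero E2 w) \<and>
        (CARD('r) = 1 \<longrightarrow> (\<exists>v. support_points F V E1 E2 f w = {v})))
     \<longleftrightarrow>
     (\<exists>\<phi> \<gamma>.
        class_map G W V \<phi> \<and>
        bundle_isomorphism G W (pullback_bundle (mtop W) \<phi> E1) E2 \<gamma> \<and>
        (\<forall>x\<in>compact_sections F V E1.
           f x = (\<lambda>w\<in>topspace (mtop W). \<gamma> (pullback_section (mtop W) \<phi> x w))))"
    (is "(\<forall>w\<in>_. ?a w) \<longleftrightarrow> (\<exists>\<phi> \<gamma>. ?b \<phi> \<gamma>)")
proof
  note V = assms(1) and W = assms(2) and F = assms(3) and G = assms(4) and E1 = assms(5) and E2 = assms(6) and f = assms(7)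
  assume a: "\<forall>w\<in>topspace (mtop W). ?a w"
  \<comment> \<open>Point and fiber map are paired so that a single choice over w produces
    both.\<close>
  have "\<forall>w\<in>topspace (mtop W). \<exists>p. fst p \<in> topspace (mtop V) \<and> fiber_isomorphism E1 (fst p) E2 w (snd p) \<and>
      (\<forall>x\<in>compact_sections F V E1. f x w = snd p (x (fst p)))"
  proof
    fix w assume w: "w \<in> topspace (mtop W)"
    then have aw: "?a w" using a by blast
    then obtain U where U: "support_points F V E1 E2 f w \<subseteq> U" "trivial_bundle_on V E1 U" by blast
    obtain v A where "v \<in> topspace (mtop V)" "fiber_isomorphism E1 v E2 w A"
      "\<And>x. x \<in> compact_sections F V E1 \<Longrightarrow> f x w = A (x v)"
      by (rule pointwise_form[OF V F E1 E2 f w _ _ U]) (use aw in blast)+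
    then show "\<exists>p. fst p \<in> topspace (mtop V) \<and> fiber_isomorphism E1 (fst p) E2 w (snd p) \<and>
      (\<forall>x\<in>compact_sections F V E1. f x w = snd p (x (fst p)))"
      by (intro exI[of _ "(v, A)"]) simp
  qed
  from bchoice[OF this] obtain p where p: "\<forall>w\<in>topspace (mtop W). fst (p w) \<in> topspace (mtop V) \<and>
      fiber_isomorphism E1 (fst (p w)) E2 w (snd (p w)) \<and> (\<forall>x\<in>compact_sections F V E1. f x w = snd (p w) (x (fst (p w))))" ..
  define \<phi> where "\<phi> w = fst (p w)" for w
  define A where "A w = snd (p w)" for w
  have pA: "\<And>w. w \<in> topspace (mtop W) \<Longrightarrow> \<phi> w \<in> topspace (mtop V)"
    "\<And>w. w \<in> topspace (mtop W) \<Longrightarrow> fiber_isomorphism E1 (\<phi> w) E2 w (A w)"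
    "\<And>w x. w \<in> topspace (mtop W) \<Longrightarrow> x \<in> compact_sections F V E1 \<Longrightarrow> f x w = A w (x (\<phi> w))"
    using p by (auto simp: \<phi>_def A_def)
  \<comment> \<open>Sections are extensional, so outside W both sides are
    \<open>undefined\<close>.\<close>
  have "f x = (\<lambda>w\<in>topspace (mtop W). (\<lambda>(w, e). A w e) (pullback_section (mtop W) \<phi> x w))" if x: "x \<in> compact_sections F V E1" for x
  proof
    fix w
    have "f x \<in> sections G W E2" using f x by (auto simp: linear_section_map_def)
    then have "f x w = undefined" if "w \<notin> topspace (mtop W)" using that by (auto simp: sections_def)
    then show "f x w = (\<lambda>w\<in>topspace (mtop W). (\<lambda>(w, e). A w e) (pullback_section (mtop W) \<phi> x w)) w"
      using pA(3)[OF _ x] by (cases "w \<in> topspace (mtop W)") (simp_all add: pullback_section_def)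
  qed
  then show "\<exists>\<phi> \<gamma>. ?b \<phi> \<gamma>"
    using pointwise_form_imp_bundle_map[OF V W F G E1 E2 f pA] by blast
next
  note V = assms(1) and F = assms(3) and E1 = assms(5) and E2 = assms(6)
  assume "\<exists>\<phi> \<gamma>. ?b \<phi> \<gamma>"
  then obtain \<phi> \<gamma> where b: "class_map G W V \<phi>" "bundle_isomorphism G W (pullback_bundle (mtop W) \<phi> E1) E2 \<gamma>"
    "\<And>x. x \<in> compact_sections F V E1 \<Longrightarrow> f x = (\<lambda>w\<in>topspace (mtop W). \<gamma> (pullback_section (mtop W) \<phi> x w))" by blast
  show "\<forall>w\<in>topspace (mtop W). ?a w"
  proof
    fix w assume w: "w \<in> topspace (mtop W)"
    have v: "\<phi> w \<in> topspace (mtop V)" using b(1) w by (auto simp: class_map_def continuous_map_def)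
    have iso: "fiber_isomorphism E1 (\<phi> w) E2 w (\<lambda>e. \<gamma> (w, e))"
      using b(2) w unfolding fiber_isomorphism_pullback[OF w, symmetric] bundle_isomorphism_def bundle_morphism_def by blast
    have fv: "f x w = fzero E2 w \<longleftrightarrow> x (\<phi> w) = fzero E1 (\<phi> w)" if x: "x \<in> compact_sections F V E1" for x
      using fiber_isomorphism_zero[OF E1 v E2 w iso compact_section_fiber[OF x v]] b(3)[OF x] w
      by (simp add: pullback_section_def)
    have S: "support_points F V E1 E2 f w = {\<phi> w}" by (rule support_points_singleton[where f = f and w = w and ?E2.0 = E2, OF V F E1 v]) (rule fv)
    obtain U \<psi> where t: "(U, \<psi>) \<in> trivs E1" "\<phi> w \<in> U" using bundle_triv_exists[OF E1 v] .
    have "openin (mtop V) U \<and> {\<phi> w} \<subseteq> U \<and> trivial_bundle_on V E1 U"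
      using t trivial_bundle_on_triv[OF E1 t(1)] triv_openin[OF bundle_triv[OF E1 t(1)]] by blast
    then show "?a w" unfolding S using v fv by auto
  qed
qed

end
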